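(* Let $n\ge 1$ be an integer and let $\beta\in\mathbb{C}$, $\beta\ne 0$. Then the assignment $$\bar x^+_{0,r}\mapsto E_{n,1}\otimes\partial^rx,\quad \bar x^-_{0,r}\mapsto E_{1,n}\otimes x^{-1}\partial^r,\quad \bar\xi_{0,r}\mapsto E_{n,n}\otimes\partial^r-E_{1,1}\otimes(\partial+n\beta)^r+\delta_{0,r}c_{\mathfrak D},$$ $$\bar x^+_{i,r}\mapsto E_{i,i+1}\otimes(\partial+(n-i)\beta)^r,\quad \bar x^-_{i,r}\mapsto E_{i+1,i}\otimes(\partial+(n-i)\beta)^r,\quad \bar\xi_{i,r}\mapsto(E_{i,i}-E_{i+1,i+1})\otimes(\partial+(n-i)\beta)^r$$ (with $i\in\{1,\ldots,n-1\}$ and $r\in\mathbb{Z}_{\ge 0}$) provides an isomorphism of Lie algebras $$\vartheta^{(n)}_\beta:\ \ddot y^{(n)}_\beta\ \xrightarrow{\ \sim\ }\ \bar{\mathfrak D}^{(n)}_{n\beta}.$$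
   Context: All Lie algebras are over $\mathbb{C}$; $\mathbb{Z}_+=\mathbb{Z}_{\ge0}$. $[n]=\{0,1,\ldots,n-1\}$ is viewed as the set of residues mod $n$ (indices $i\pm1$ of generators and Kronecker deltas of such indices are taken mod $n$). For $n\ge2$ and $i,j\in[n]$ put $a_{i,j}=2\delta_{i,j}-\delta_{i,j+1}-\delta_{i,j-1}$ and $m_{i,j}=\delta_{i,j+1}-\delta_{i,j-1}$. $\Sigma_s$ is the symmetric group on $s$ letters. $E_{i,j}$ are the matrix units of the algebra $\mathbb{M}_n$ of complex $n\times n$ matrices. **The Lie algebra $\ddot y^{(n)}_\beta$.** It is generated by $\{\bar x^\pm_{i,r},\bar\xi_{i,r}\}_{i\in[n],\,r\in\mathbb{Z}_+}$ with the following defining relations (for all $i,j\in[n]$ and $r,s,r_1,r_2,r_3\in\mathbb{Z}_+$). For all $n$: - $[\bar\xi_{i,r},\bar\xi_{j,s}]=0$; - $[\bar x^+_{i,r},\bar x^-_{j,s}]=\delta_{i,j}\bar\xi_{i,r+s}$. In addition, for $n>2$: - $[\bar x^\pm_{i,r+1},\bar x^\pm_{j,s}]-[\bar x^\pm_{i,r},\bar x^\pm_{j,s+1}]=-m_{i,j}\beta[\bar x^\pm_{i,r},\bar x^\pm_{j,s}]$; - $[\bar\xi_{i,r+1},\bar x^\pm_{j,s}]-[\bar\xi_{i,r},\bar x^\pm_{j,s+1}]=-m_{i,j}\beta[\bar\xi_{i,r},\bar x^\pm_{j,s}]$; - $[\bar\xi_{i,0},\bar x^\pm_{j,s}]=\pm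 a_{i,j}\bar x^\pm_{j,s}$; - $\sum_{\pi\in\Sigma_2}[\bar x^\pm_{i,r_{\pi(1)}},[\bar x^\pm_{i,r_{\pi(2)}},\bar x^\pm_{j,s}]]=0$ for each of $j=i+1$ and $j=i-1$, and $[\bar x^\pm_{i,r},\bar x^\pm_{j,s}]=0$ for $j\ne i,i\pm1$. In addition, for $n=2$: - $[\bar x^\pm_{i,r+1},\bar x^\pm_{i,s}]=[\bar x^\pm_{i,r},\bar x^\pm_{i,s+1}]$, $\ [\bar x^\pm_{i,r+2},\bar x^\pm_{i+1,s}]-2[\bar x^\pm_{i,r+1},\bar x^\pm_{i+1,s+1}]+[\bar x^\pm_{i,r},\bar x^\pm_{i+1,s+2}]=\beta^2[\bar x^\pm_{i,r},\bar x^\pm_{i+1,s}]$; - $[\bar\xi_{i,r+1},\bar x^\pm_{i,s}]=[\bar\xi_{i,r},\bar x^\pm_{i,s+1}]$, $\ [\bar\xi_{i,r+2},\bar x^\pm_{i+1,s}]-2[\bar\xi_{i,r+1},\bar x^\pm_{i+1,s+1}]+[\bar\xi_{i,r},\bar x^\pm_{i+1,s+2}]=\beta^2[\bar\xi_{i,r},\bar x^\pm_{i+1,s}]$; - $[\bar\xi_{i,0},\bar x^\pm_{j,s}]=\pm a_{i,j}\bar x^\pm_{j,s}$, $\ [\bar\xi_{i,1},\bar x^\pm_{i+1,s}]=\mp2\bar x^\pm_{i+1,s+1}$; - $\sum_{\pi\in\Sigma_3}[\bar x^\pm_{i,r_{\pi(1)}},[\bar x^\pm_{i,r_{\pi(2)}},[\bar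 x^\pm_{i,r_{\pi(3)}},\bar x^\pm_{i+1,s}]]]=0$. In addition, for $n=1$: - $[\bar x^\pm_{0,r+3},\bar x^\pm_{0,s}]-3[\bar x^\pm_{0,r+2},\bar x^\pm_{0,s+1}]+3[\bar x^\pm_{0,r+1},\bar x^\pm_{0,s+2}]-[\bar x^\pm_{0,r},\bar x^\pm_{0,s+3}]=\beta^2([\bar x^\pm_{0,r+1},\bar x^\pm_{0,s}]-[\bar x^\pm_{0,r},\bar x^\pm_{0,s+1}])$; - $[\bar\xi_{0,r+3},\bar x^\pm_{0,s}]-3[\bar\xi_{0,r+2},\bar x^\pm_{0,s+1}]+3[\bar\xi_{0,r+1},\bar x^\pm_{0,s+2}]-[\bar\xi_{0,r},\bar x^\pm_{0,s+3}]=\beta^2([\bar\xi_{0,r+1},\bar x^\pm_{0,s}]-[\bar\xi_{0,r},\bar x^\pm_{0,s+1}])$; - $[\bar\xi_{0,0},\bar x^\pm_{0,s}]=0$, $\ [\bar\xi_{0,1},\bar x^\pm_{0,s}]=0$, $\ [\bar\xi_{0,2},\bar x^\pm_{0,s}]=\mp2\beta^2\bar x^\pm_{0,s}$; - $\sum_{\pi\in\Sigma_3}[\bar x^\pm_{0,r_{\pi(1)}},[\bar x^\pm_{0,r_{\pi(2)}},\bar x^\pm_{0,r_{\pi(3)}+1}]]=0$. **The Lie algebra $\bar{\mathfrak D}^{(n)}_s$.** For $s\in\mathbb{C}$, $\mathfrak D_s$ is the unital associative $\mathbb{C}$-algebra generated by $\partial,x^{\pm1}$ with relations $x^{\pm1}x^{\mp1}=1$,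 $\partial x=x(\partial+s)$. Put $\mathfrak D^{(n)}_s=\mathbb{M}_n\otimes\mathfrak D_s$, viewed as a Lie algebra under the commutator. A 2-cocycle $\phi$ on it is given by $$\phi(M_1\otimes f_1(\partial)x^{l_1},M_2\otimes f_2(\partial)x^{l_2})=\begin{cases}\mathrm{tr}(M_1M_2)\sum_{a=0}^{l_1-1}f_1(as)f_2((a-l_1)s)&\text{if }l_1=-l_2>0,\\-\mathrm{tr}(M_1M_2)\sum_{a=0}^{-l_1-1}f_2(as)f_1((a+l_1)s)&\text{if }l_1=-l_2<0,\\0&\text{otherwise}\end{cases}$$ for polynomials $f_1,f_2$, $M_1,M_2\in\mathbb{M}_n$, $l_1,l_2\in\mathbb{Z}$. Then $\bar{\mathfrak D}^{(n)}_s=\mathfrak D^{(n)}_s\oplus\mathbb{C}c_{\mathfrak D}$ is the Lie algebra with bracket $[X+\lambda c_{\mathfrak D},Y+\mu c_{\mathfrak D}]=XY-YX+\phi(X,Y)c_{\mathfrak D}$ for $X,Y\in\mathfrak D^{(n)}_s$, $\lambda,\mu\in\mathbb{C}$. In the claim $s=n\beta$. *)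

theory Defs
  imports
    Complex_Main
    "HOL-Number_Theory.Cong"
    "HOL-Computational_Algebra.Polynomial"
    "HOL-Algebra.Module"
begin

section \<open>Lie algebras over the complex numbers\<close>

definition complex_ring :: "complex ring" where
  "complex_ring = \<lparr> carrier = UNIV, monoid.mult = (*), one = 1, zero = 0, add = (+) \<rparr>"

lemma cring_complex_ring: "cring complex_ring"
proof (rule cringI)
  show "abelian_group complex_ring"
    by (rule abelian_groupI) (auto simp: complex_ring_def intro: exI[of _ "- x" for x])
  show "comm_monoid complex_ring"
    by (rule comm_monoidI) (auto simp: complex_ring_def)
qed (auto simp: complex_ring_def algebra_simps)

text \<open>A Lie algebra is carried by a record of type \<^typ>\<open>(complex, 'a) module\<close> whose
  product is the Lie bracket; its unit component plays no role.\<close>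

locale lie_algebra = module complex_ring L for L (structure) +
  assumes bracket_closed:
      "\<lbrakk>x \<in> carrier L; y \<in> carrier L\<rbrakk> \<Longrightarrow> x \<otimes> y \<in> carrier L"
    and bracket_add_left:
      "\<lbrakk>x \<in> carrier L; y \<in> carrier L; z \<in> carrier L\<rbrakk> \<Longrightarrow> (x \<oplus> y) \<otimes> z = (x \<otimes> z) \<oplus> (y \<otimes> z)"
    and bracket_add_right:
      "\<lbrakk>x \<in> carrier L; y \<in> carrier L; z \<in> carrier L\<rbrakk> \<Longrightarrow> x \<otimes> (y \<oplus> z) = (x \<otimes> y) \<oplus> (x \<otimes> z)"
    and bracket_smult_left:
      "\<lbrakk>x \<in> carrier L; y \<in> carrier L\<rbrakk> \<Longrightarrow> (c \<odot> x) \<otimes> y = c \<odot> (x \<otimes> y)"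
    and bracket_smult_right:
      "\<lbrakk>x \<in> carrier L; y \<in> carrier L\<rbrakk> \<Longrightarrow> x \<otimes> (c \<odot> y) = c \<odot> (x \<otimes> y)"
    and bracket_alternating:
      "x \<in> carrier L \<Longrightarrow> x \<otimes> x = \<zero>"
    and jacobi:
      "\<lbrakk>x \<in> carrier L; y \<in> carrier L; z \<in> carrier L\<rbrakk> \<Longrightarrow>
        (x \<otimes> (y \<otimes> z)) \<oplus> (y \<otimes> (z \<otimes> x)) \<oplus> (z \<otimes> (x \<otimes> y)) = \<zero>"

locale lie_hom = source: lie_algebra K + target: lie_algebra L
  for K (structure) and L (structure) +
  fixes \<theta>
  assumes hom_closed: "x \<in> carrier K \<Longrightarrow> \<theta> x \<in> carrier L"
    and hom_add: "\<lbrakk>x \<in> carrier K; y \<in> carrier K\<rbrakk> \<Longrightarrow> \<theta> (x \<oplus>\<^bsub>K\<^esub> y) = \<theta> x \<oplus>\<^bsub>L\<^esub> \<theta> y"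
    and hom_smult: "x \<in> carrier K \<Longrightarrow> \<theta> (c \<odot>\<^bsub>K\<^esub> x) = c \<odot>\<^bsub>L\<^esub> \<theta> x"
    and hom_bracket: "\<lbrakk>x \<in> carrier K; y \<in> carrier K\<rbrakk> \<Longrightarrow> \<theta> (x \<otimes>\<^bsub>K\<^esub> y) = \<theta> x \<otimes>\<^bsub>L\<^esub> \<theta> y"

locale lie_iso = lie_hom +
  assumes bij: "bij_betw \<theta> (carrier K) (carrier L)"


section \<open>Lie algebras given by generators and relations\<close>

datatype (lie_gens: 'g) lie_term =
    LGen 'g
  | LZero
  | LAdd "'g lie_term" "'g lie_term"  (infixl "\<oplus>\<^sub>L" 65)
  | LScale complex "'g lie_term"  (infixr "\<cdot>\<^sub>L" 75)
  | LBr "'g lie_term" "'g lie_term"  ("\<langle>_, _\<rangle>")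

abbreviation LDiff :: "'g lie_term \<Rightarrow> 'g lie_term \<Rightarrow> 'g lie_term"  (infixl "\<ominus>\<^sub>L" 65) where
  "u \<ominus>\<^sub>L v \<equiv> u \<oplus>\<^sub>L (-1) \<cdot>\<^sub>L v"

definition lie_terms :: "'g set \<Rightarrow> 'g lie_term set" where
  "lie_terms G = {t. lie_gens t \<subseteq> G}"

text \<open>Two terms over the generators \<open>G\<close> are identified iff their equality follows from the
  axioms of a complex Lie algebra and the relations \<open>R\<close>; a pair \<open>(u, v)\<close> in \<open>R\<close> stands for the
  relation \<open>u = v\<close>.\<close>

inductive lie_cong ::
    "'g set \<Rightarrow> ('g lie_term \<times> 'g lie_term) set \<Rightarrow> 'g lie_term \<Rightarrow> 'g lie_term \<Rightarrow> bool"
  for G R where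
  relation: "\<lbrakk>(u, v) \<in> R; u \<in> lie_terms G; v \<in> lie_terms G\<rbrakk> \<Longrightarrow> lie_cong G R u v"
| refl: "u \<in> lie_terms G \<Longrightarrow> lie_cong G R u u"
| sym: "lie_cong G R u v \<Longrightarrow> lie_cong G R v u"
| trans: "\<lbrakk>lie_cong G R u v; lie_cong G R v w\<rbrakk> \<Longrightarrow> lie_cong G R u w"
| cong_add: "\<lbrakk>lie_cong G R u u'; lie_cong G R v v'\<rbrakk> \<Longrightarrow> lie_cong G R (u \<oplus>\<^sub>L v) (u' \<oplus>\<^sub>L v')"
| cong_scale: "lie_cong G R u u' \<Longrightarrow> lie_cong G R (c \<cdot>\<^sub>L u) (c \<cdot>\<^sub>L u')"
| cong_br: "\<lbrakk>lie_cong G R u u'; lie_cong G R v v'\<rbrakk> \<Longrightarrow> lie_cong G R \<langle>u, v\<rangle> \<langle>u', v'\<rangle>"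
| add_assoc: "\<lbrakk>u \<in> lie_terms G; v \<in> lie_terms G; w \<in> lie_terms G\<rbrakk> \<Longrightarrow>
    lie_cong G R (u \<oplus>\<^sub>L v \<oplus>\<^sub>L w) (u \<oplus>\<^sub>L (v \<oplus>\<^sub>L w))"
| add_comm: "\<lbrakk>u \<in> lie_terms G; v \<in> lie_terms G\<rbrakk> \<Longrightarrow> lie_cong G R (u \<oplus>\<^sub>L v) (v \<oplus>\<^sub>L u)"
| add_zero: "u \<in> lie_terms G \<Longrightarrow> lie_cong G R (LZero \<oplus>\<^sub>L u) u"
| add_neg: "u \<in> lie_terms G \<Longrightarrow> lie_cong G R (u \<ominus>\<^sub>L u) LZero"
| scale_add_left: "u \<in> lie_terms G \<Longrightarrow> lie_cong G R ((c + d) \<cdot>\<^sub>L u) (c \<cdot>\<^sub>L u \<oplus>\<^sub>L d \<cdot>\<^sub>L u)"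
| scale_add_right: "\<lbrakk>u \<in> lie_terms G; v \<in> lie_terms G\<rbrakk> \<Longrightarrow>
    lie_cong G R (c \<cdot>\<^sub>L (u \<oplus>\<^sub>L v)) (c \<cdot>\<^sub>L u \<oplus>\<^sub>L c \<cdot>\<^sub>L v)"
| scale_scale: "u \<in> lie_terms G \<Longrightarrow> lie_cong G R ((c * d) \<cdot>\<^sub>L u) (c \<cdot>\<^sub>L d \<cdot>\<^sub>L u)"
| scale_one: "u \<in> lie_terms G \<Longrightarrow> lie_cong G R (1 \<cdot>\<^sub>L u) u"
| br_add_left: "\<lbrakk>u \<in> lie_terms G; v \<in> lie_terms G; w \<in> lie_terms G\<rbrakk> \<Longrightarrow>
    lie_cong G R \<langle>u \<oplus>\<^sub>L v, w\<rangle> (\<langle>u, w\<rangle> \<oplus>\<^sub>L \<langle>v, w\<rangle>)"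
| br_add_right: "\<lbrakk>u \<in> lie_terms G; v \<in> lie_terms G; w \<in> lie_terms G\<rbrakk> \<Longrightarrow>
    lie_cong G R \<langle>u, v \<oplus>\<^sub>L w\<rangle> (\<langle>u, v\<rangle> \<oplus>\<^sub>L \<langle>u, w\<rangle>)"
| br_scale_left: "\<lbrakk>u \<in> lie_terms G; v \<in> lie_terms G\<rbrakk> \<Longrightarrow>
    lie_cong G R \<langle>c \<cdot>\<^sub>L u, v\<rangle> (c \<cdot>\<^sub>L \<langle>u, v\<rangle>)"
| br_scale_right: "\<lbrakk>u \<in> lie_terms G; v \<in> lie_terms G\<rbrakk> \<Longrightarrow>
    lie_cong G R \<langle>u, c \<cdot>\<^sub>L v\<rangle> (c \<cdot>\<^sub>L \<langle>u, v\<rangle>)"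
| br_alternating: "u \<in> lie_terms G \<Longrightarrow> lie_cong G R \<langle>u, u\<rangle> LZero"
| br_jacobi: "\<lbrakk>u \<in> lie_terms G; v \<in> lie_terms G; w \<in> lie_terms G\<rbrakk> \<Longrightarrow>
    lie_cong G R (\<langle>u, \<langle>v, w\<rangle>\<rangle> \<oplus>\<^sub>L \<langle>v, \<langle>w, u\<rangle>\<rangle> \<oplus>\<^sub>L \<langle>w, \<langle>u, v\<rangle>\<rangle>) LZero"

definition lie_class ::
    "'g set \<Rightarrow> ('g lie_term \<times> 'g lie_term) set \<Rightarrow> 'g lie_term \<Rightarrow> 'g lie_term set" where
  "lie_class G R t = {u. lie_cong G R t u}"

definition presented_lie_algebra ::
    "'g set \<Rightarrow> ('g lie_term \<times> 'g lie_term) set \<Rightarrow> (complex, 'g lie_term set) module" where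
  "presented_lie_algebra G R =
    \<lparr> carrier = lie_class G R ` lie_terms G,
      monoid.mult = (\<lambda>U V. \<Union>u\<in>U. \<Union>v\<in>V. lie_class G R \<langle>u, v\<rangle>),
      one = undefined,
      zero = lie_class G R LZero,
      add = (\<lambda>U V. \<Union>u\<in>U. \<Union>v\<in>V. lie_class G R (u \<oplus>\<^sub>L v)),
      module.smult = (\<lambda>c U. \<Union>u\<in>U. lie_class G R (c \<cdot>\<^sub>L u)) \<rparr>"

lemma UN_const1: "\<lbrakk>a \<in> A; \<And>x. x \<in> A \<Longrightarrow> f x = c\<rbrakk> \<Longrightarrow> (\<Union>x\<in>A. f x) = c"
  by auto

lemma UN_const2:
  "\<lbrakk>a \<in> A; b \<in> B; \<And>x y. \<lbrakk>x \<in> A; y \<in> B\<rbrakk> \<Longrightarrow> f x y = c\<rbrakk> \<Longrightarrow> (\<Union>x\<in>A. \<Union>y\<in>B. f x y) = c"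
  by (rule UN_const1, assumption, rule UN_const1) auto

lemma lie_cong_terms: "lie_cong G R u v \<Longrightarrow> u \<in> lie_terms G \<and> v \<in> lie_terms G"
  by (induction rule: lie_cong.induct) (auto simp: lie_terms_def)

lemma lie_class_eqI: "lie_cong G R u v \<Longrightarrow> lie_class G R u = lie_class G R v"
  unfolding lie_class_def by (blast intro: lie_cong.sym lie_cong.trans)

lemma presented_lie_algebra_carrier:
  "carrier (presented_lie_algebra G R) = lie_class G R ` lie_terms G"
  by (simp add: presented_lie_algebra_def)

lemma presented_lie_algebra_zero:
  "\<zero>\<^bsub>presented_lie_algebra G R\<^esub> = lie_class G R LZero"
  by (simp add: presented_lie_algebra_def)

lemma lie_class_refl: "u \<in> lie_terms G \<Longrightarrow> u \<in> lie_class G R u"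
  by (simp add: lie_class_def lie_cong.refl)

lemma lie_class_cong: "u' \<in> lie_class G R u \<Longrightarrow> lie_cong G R u' u"
  by (simp add: lie_class_def lie_cong.sym)

lemma presented_lie_algebra_add:
  assumes "u \<in> lie_terms G" "v \<in> lie_terms G"
  shows "lie_class G R u \<oplus>\<^bsub>presented_lie_algebra G R\<^esub> lie_class G R v = lie_class G R (u \<oplus>\<^sub>L v)"
  unfolding presented_lie_algebra_def
  by (simp, rule UN_const2[OF lie_class_refl[OF assms(1)] lie_class_refl[OF assms(2)]], rule lie_class_eqI, rule lie_cong.cong_add)
    (auto intro: lie_class_cong)

lemma presented_lie_algebra_bracket:
  assumes "u \<in> lie_terms G" "v \<in> lie_terms G"
  shows "lie_class G R u \<otimes>\<^bsub>presented_lie_algebra G R\<^esub> lie_class G R v = lie_class G R (\<langle>u, v\<rangle>)"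
  unfolding presented_lie_algebra_def
  by (simp, rule UN_const2[OF lie_class_refl[OF assms(1)] lie_class_refl[OF assms(2)]], rule lie_class_eqI, rule lie_cong.cong_br)
    (auto intro: lie_class_cong)

lemma presented_lie_algebra_smult:
  assumes "u \<in> lie_terms G"
  shows "c \<odot>\<^bsub>presented_lie_algebra G R\<^esub> lie_class G R u = lie_class G R (c \<cdot>\<^sub>L u)"
  unfolding presented_lie_algebra_def
  by (simp, rule UN_const1[OF lie_class_refl[OF assms]], rule lie_class_eqI, rule lie_cong.cong_scale)
    (auto intro: lie_class_cong)

lemma lie_terms_simps [simp]:
  "LGen g \<in> lie_terms G \<longleftrightarrow> g \<in> G"
  "LZero \<in> lie_terms G"
  "u \<oplus>\<^sub>L v \<in> lie_terms G \<longleftrightarrow> u \<in> lie_terms G \<and> v \<in> lie_terms G"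
  "c \<cdot>\<^sub>L u \<in> lie_terms G \<longleftrightarrow> u \<in> lie_terms G"
  "\<langle>u, v\<rangle> \<in> lie_terms G \<longleftrightarrow> u \<in> lie_terms G \<and> v \<in> lie_terms G"
  by (auto simp: lie_terms_def)

lemmas presented_lie_algebra_simps =
  presented_lie_algebra_carrier presented_lie_algebra_zero presented_lie_algebra_add
  presented_lie_algebra_bracket presented_lie_algebra_smult

lemmas lie_cong_axioms =
  lie_cong.add_assoc lie_cong.add_comm lie_cong.add_zero lie_cong.scale_add_left
  lie_cong.scale_add_right lie_cong.scale_scale lie_cong.scale_one lie_cong.br_add_left
  lie_cong.br_add_right lie_cong.br_scale_left lie_cong.br_scale_right
  lie_cong.br_alternating lie_cong.br_jacobi

lemma lie_algebra_presented: "lie_algebra (presented_lie_algebra G R)"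
proof -
  have "abelian_group (presented_lie_algebra G R)"
  proof (rule abelian_groupI)
    fix x assume "x \<in> carrier (presented_lie_algebra G R)"
    then obtain u where u: "u \<in> lie_terms G" "x = lie_class G R u"
      by (auto simp: presented_lie_algebra_simps)
    have "lie_cong G R ((-1) \<cdot>\<^sub>L u \<oplus>\<^sub>L u) LZero"
      using u by (intro lie_cong.trans[OF lie_cong.add_comm lie_cong.add_neg]) auto
    then show "\<exists>y\<in>carrier (presented_lie_algebra G R).
        y \<oplus>\<^bsub>presented_lie_algebra G R\<^esub> x = \<zero>\<^bsub>presented_lie_algebra G R\<^esub>"
      using u by (intro bexI[of _ "lie_class G R ((-1) \<cdot>\<^sub>L u)"])
        (auto simp: presented_lie_algebra_simps intro!: lie_class_eqI del: equalityI)
  qed (auto simp: presented_lie_algebra_simps intro!: lie_class_eqI lie_cong_axioms del: equalityI)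
  moreover note cring_complex_ring
  ultimately have "module complex_ring (presented_lie_algebra G R)"
    by (intro moduleI)
      (auto simp: presented_lie_algebra_simps complex_ring_def
        intro!: lie_class_eqI lie_cong_axioms del: equalityI)
  then show ?thesis
    by (intro lie_algebra.intro lie_algebra_axioms.intro)
      (auto simp: presented_lie_algebra_simps intro!: lie_class_eqI lie_cong_axioms del: equalityI)
qed


section \<open>The Lie algebra \<open>y\<close>\<close>

datatype pm = Plus | Minus

fun sgn_pm :: "pm \<Rightarrow> complex" where
  "sgn_pm Plus = 1"
| "sgn_pm Minus = -1"

datatype y_gen = YX pm nat nat | YXi nat nat

definition y_gens :: "nat \<Rightarrow> y_gen set" where
  "y_gens n = {YX e i r | e i r. i < n} \<union> {YXi i r | i r. i < n}"

text \<open>Kronecker delta of residues modulo \<open>n\<close>, and the matrices \<open>a\<^sub>i\<^sub>j\<close> and \<open>m\<^sub>i\<^sub>j\<close>.\<close>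

definition kdelta :: "nat \<Rightarrow> int \<Rightarrow> int \<Rightarrow> complex" where
  "kdelta n p q = of_bool [p = q] (mod int n)"

definition a_mat :: "nat \<Rightarrow> nat \<Rightarrow> nat \<Rightarrow> complex" where
  "a_mat n i j = 2 * kdelta n (int i) (int j)
    - kdelta n (int i) (int j + 1) - kdelta n (int i) (int j - 1)"

definition m_mat :: "nat \<Rightarrow> nat \<Rightarrow> nat \<Rightarrow> complex" where
  "m_mat n i j = kdelta n (int i) (int j + 1) - kdelta n (int i) (int j - 1)"

abbreviation X :: "pm \<Rightarrow> nat \<Rightarrow> nat \<Rightarrow> y_gen lie_term" where
  "X e i r \<equiv> LGen (YX e i r)"

abbreviation Xi :: "nat \<Rightarrow> nat \<Rightarrow> y_gen lie_term"  ("\<Xi>") where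
  "\<Xi> i r \<equiv> LGen (YXi i r)"

text \<open>Sums over the symmetric groups on two and three letters.\<close>

definition sym2 :: "(nat \<Rightarrow> nat \<Rightarrow> 'g lie_term) \<Rightarrow> nat \<Rightarrow> nat \<Rightarrow> 'g lie_term" where
  "sym2 f p q = f p q \<oplus>\<^sub>L f q p"

definition sym3 ::
    "(nat \<Rightarrow> nat \<Rightarrow> nat \<Rightarrow> 'g lie_term) \<Rightarrow> nat \<Rightarrow> nat \<Rightarrow> nat \<Rightarrow> 'g lie_term" where
  "sym3 f p q r =
    f p q r \<oplus>\<^sub>L f p r q \<oplus>\<^sub>L f q p r \<oplus>\<^sub>L f q r p \<oplus>\<^sub>L f r p q \<oplus>\<^sub>L f r q p"

inductive_set y_rels :: "nat \<Rightarrow> complex \<Rightarrow> (y_gen lie_term \<times> y_gen lie_term) set"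
  for n \<beta> where
  xi_xi: "\<lbrakk>i < n; j < n\<rbrakk> \<Longrightarrow> (\<langle>\<Xi> i r, \<Xi> j s\<rangle>, LZero) \<in> y_rels n \<beta>"
| x_plus_minus: "\<lbrakk>i < n; j < n\<rbrakk> \<Longrightarrow>
    (\<langle>X Plus i r, X Minus j s\<rangle>, of_bool (i = j) \<cdot>\<^sub>L \<Xi> i (r + s)) \<in> y_rels n \<beta>"
  \<comment> \<open>\<open>n > 2\<close>\<close>
| x_x: "\<lbrakk>n > 2; i < n; j < n\<rbrakk> \<Longrightarrow>
    (\<langle>X e i (r + 1), X e j s\<rangle> \<ominus>\<^sub>L \<langle>X e i r, X e j (s + 1)\<rangle>,
     (- m_mat n i j * \<beta>) \<cdot>\<^sub>L \<langle>X e i r, X e j s\<rangle>) \<in> y_rels n \<beta>"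
| xi_x: "\<lbrakk>n > 2; i < n; j < n\<rbrakk> \<Longrightarrow>
    (\<langle>\<Xi> i (r + 1), X e j s\<rangle> \<ominus>\<^sub>L \<langle>\<Xi> i r, X e j (s + 1)\<rangle>,
     (- m_mat n i j * \<beta>) \<cdot>\<^sub>L \<langle>\<Xi> i r, X e j s\<rangle>) \<in> y_rels n \<beta>"
| xi0_x: "\<lbrakk>n > 2; i < n; j < n\<rbrakk> \<Longrightarrow>
    (\<langle>\<Xi> i 0, X e j s\<rangle>, (sgn_pm e * a_mat n i j) \<cdot>\<^sub>L X e j s) \<in> y_rels n \<beta>"
| serre_adjacent: "\<lbrakk>n > 2; i < n; j < n;
     [int j = int i + 1] (mod int n) \<or> [int j = int i - 1] (mod int n)\<rbrakk> \<Longrightarrow>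
    (sym2 (\<lambda>p q. \<langle>X e i p, \<langle>X e i q, X e j s\<rangle>\<rangle>) r1 r2, LZero) \<in> y_rels n \<beta>"
| serre_distant: "\<lbrakk>n > 2; i < n; j < n; j \<noteq> i;
     \<not> [int j = int i + 1] (mod int n); \<not> [int j = int i - 1] (mod int n)\<rbrakk> \<Longrightarrow>
    (\<langle>X e i r, X e j s\<rangle>, LZero) \<in> y_rels n \<beta>"
  \<comment> \<open>\<open>n = 2\<close>\<close>
| x_x_same_2: "\<lbrakk>n = 2; i < n\<rbrakk> \<Longrightarrow>
    (\<langle>X e i (r + 1), X e i s\<rangle>, \<langle>X e i r, X e i (s + 1)\<rangle>) \<in> y_rels n \<beta>"
| x_x_2: "\<lbrakk>n = 2; i < n; j = (i + 1) mod n\<rbrakk> \<Longrightarrow>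
    (\<langle>X e i (r + 2), X e j s\<rangle> \<ominus>\<^sub>L 2 \<cdot>\<^sub>L \<langle>X e i (r + 1), X e j (s + 1)\<rangle> \<oplus>\<^sub>L \<langle>X e i r, X e j (s + 2)\<rangle>,
     \<beta>\<^sup>2 \<cdot>\<^sub>L \<langle>X e i r, X e j s\<rangle>) \<in> y_rels n \<beta>"
| xi_x_same_2: "\<lbrakk>n = 2; i < n\<rbrakk> \<Longrightarrow>
    (\<langle>\<Xi> i (r + 1), X e i s\<rangle>, \<langle>\<Xi> i r, X e i (s + 1)\<rangle>) \<in> y_rels n \<beta>"
| xi_x_2: "\<lbrakk>n = 2; i < n; j = (i + 1) mod n\<rbrakk> \<Longrightarrow>
    (\<langle>\<Xi> i (r + 2), X e j s\<rangle> \<ominus>\<^sub>L 2 \<cdot>\<^sub>L \<langle>\<Xi> i (r + 1), X e j (s + 1)\<rangle> \<oplus>\<^sub>L \<langle>\<Xi> i r, X e j (s + 2)\<rangle>,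
     \<beta>\<^sup>2 \<cdot>\<^sub>L \<langle>\<Xi> i r, X e j s\<rangle>) \<in> y_rels n \<beta>"
| xi0_x_2: "\<lbrakk>n = 2; i < n; j < n\<rbrakk> \<Longrightarrow>
    (\<langle>\<Xi> i 0, X e j s\<rangle>, (sgn_pm e * a_mat n i j) \<cdot>\<^sub>L X e j s) \<in> y_rels n \<beta>"
| xi1_x_2: "\<lbrakk>n = 2; i < n; j = (i + 1) mod n\<rbrakk> \<Longrightarrow>
    (\<langle>\<Xi> i 1, X e j s\<rangle>, (- sgn_pm e * 2) \<cdot>\<^sub>L X e j (s + 1)) \<in> y_rels n \<beta>"
| serre_2: "\<lbrakk>n = 2; i < n; j = (i + 1) mod n\<rbrakk> \<Longrightarrow>
    (sym3 (\<lambda>p q t. \<langle>X e i p, \<langle>X e i q, \<langle>X e i t, X e j s\<rangle>\<rangle>\<rangle>) r1 r2 r3, LZero) \<in> y_rels n \<beta>"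
  \<comment> \<open>\<open>n = 1\<close>\<close>
| x_x_1: "n = 1 \<Longrightarrow>
    (\<langle>X e 0 (r + 3), X e 0 s\<rangle> \<ominus>\<^sub>L 3 \<cdot>\<^sub>L \<langle>X e 0 (r + 2), X e 0 (s + 1)\<rangle>
       \<oplus>\<^sub>L 3 \<cdot>\<^sub>L \<langle>X e 0 (r + 1), X e 0 (s + 2)\<rangle> \<ominus>\<^sub>L \<langle>X e 0 r, X e 0 (s + 3)\<rangle>,
     \<beta>\<^sup>2 \<cdot>\<^sub>L (\<langle>X e 0 (r + 1), X e 0 s\<rangle> \<ominus>\<^sub>L \<langle>X e 0 r, X e 0 (s + 1)\<rangle>)) \<in> y_rels n \<beta>"
| xi_x_1: "n = 1 \<Longrightarrow>
    (\<langle>\<Xi> 0 (r + 3), X e 0 s\<rangle> \<ominus>\<^sub>L 3 \<cdot>\<^sub>L \<langle>\<Xi> 0 (r + 2), X e 0 (s + 1)\<rangle>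
       \<oplus>\<^sub>L 3 \<cdot>\<^sub>L \<langle>\<Xi> 0 (r + 1), X e 0 (s + 2)\<rangle> \<ominus>\<^sub>L \<langle>\<Xi> 0 r, X e 0 (s + 3)\<rangle>,
     \<beta>\<^sup>2 \<cdot>\<^sub>L (\<langle>\<Xi> 0 (r + 1), X e 0 s\<rangle> \<ominus>\<^sub>L \<langle>\<Xi> 0 r, X e 0 (s + 1)\<rangle>)) \<in> y_rels n \<beta>"
| xi0_x_1: "n = 1 \<Longrightarrow> (\<langle>\<Xi> 0 0, X e 0 s\<rangle>, LZero) \<in> y_rels n \<beta>"
| xi1_x_1: "n = 1 \<Longrightarrow> (\<langle>\<Xi> 0 1, X e 0 s\<rangle>, LZero) \<in> y_rels n \<beta>"
| xi2_x_1: "n = 1 \<Longrightarrow>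
    (\<langle>\<Xi> 0 2, X e 0 s\<rangle>, (- sgn_pm e * 2 * \<beta>\<^sup>2) \<cdot>\<^sub>L X e 0 s) \<in> y_rels n \<beta>"
| serre_1: "n = 1 \<Longrightarrow>
    (sym3 (\<lambda>p q t. \<langle>X e 0 p, \<langle>X e 0 q, X e 0 (t + 1)\<rangle>\<rangle>) r1 r2 r3, LZero) \<in> y_rels n \<beta>"

definition y_algebra :: "nat \<Rightarrow> complex \<Rightarrow> (complex, y_gen lie_term set) module" where
  "y_algebra n \<beta> = presented_lie_algebra (y_gens n) (y_rels n \<beta>)"

definition y_elem :: "nat \<Rightarrow> complex \<Rightarrow> y_gen \<Rightarrow> y_gen lie_term set" where
  "y_elem n \<beta> g = lie_class (y_gens n) (y_rels n \<beta>) (LGen g)"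


section \<open>Unital associative algebras given by generators and relations\<close>

datatype 'g alg_term =
    AGen 'g
  | AZero
  | AOne
  | AAdd "'g alg_term" "'g alg_term"  (infixl "\<oplus>\<^sub>A" 65)
  | AScale complex "'g alg_term"  (infixr "\<cdot>\<^sub>A" 75)
  | AMult "'g alg_term" "'g alg_term"  (infixl "\<otimes>\<^sub>A" 70)

inductive alg_cong ::
    "('g alg_term \<times> 'g alg_term) set \<Rightarrow> 'g alg_term \<Rightarrow> 'g alg_term \<Rightarrow> bool"
  for R where
  relation: "(u, v) \<in> R \<Longrightarrow> alg_cong R u v"
| refl: "alg_cong R u u"
| sym: "alg_cong R u v \<Longrightarrow> alg_cong R v u"
| trans: "\<lbrakk>alg_cong R u v; alg_cong R v w\<rbrakk> \<Longrightarrow> alg_cong R u w"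
| cong_add: "\<lbrakk>alg_cong R u u'; alg_cong R v v'\<rbrakk> \<Longrightarrow> alg_cong R (u \<oplus>\<^sub>A v) (u' \<oplus>\<^sub>A v')"
| cong_scale: "alg_cong R u u' \<Longrightarrow> alg_cong R (c \<cdot>\<^sub>A u) (c \<cdot>\<^sub>A u')"
| cong_mult: "\<lbrakk>alg_cong R u u'; alg_cong R v v'\<rbrakk> \<Longrightarrow> alg_cong R (u \<otimes>\<^sub>A v) (u' \<otimes>\<^sub>A v')"
| add_assoc: "alg_cong R (u \<oplus>\<^sub>A v \<oplus>\<^sub>A w) (u \<oplus>\<^sub>A (v \<oplus>\<^sub>A w))"
| add_comm: "alg_cong R (u \<oplus>\<^sub>A v) (v \<oplus>\<^sub>A u)"
| add_zero: "alg_cong R (AZero \<oplus>\<^sub>A u) u"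
| add_neg: "alg_cong R (u \<oplus>\<^sub>A (-1) \<cdot>\<^sub>A u) AZero"
| scale_add_left: "alg_cong R ((c + d) \<cdot>\<^sub>A u) (c \<cdot>\<^sub>A u \<oplus>\<^sub>A d \<cdot>\<^sub>A u)"
| scale_add_right: "alg_cong R (c \<cdot>\<^sub>A (u \<oplus>\<^sub>A v)) (c \<cdot>\<^sub>A u \<oplus>\<^sub>A c \<cdot>\<^sub>A v)"
| scale_scale: "alg_cong R ((c * d) \<cdot>\<^sub>A u) (c \<cdot>\<^sub>A d \<cdot>\<^sub>A u)"
| scale_one: "alg_cong R (1 \<cdot>\<^sub>A u) u"
| mult_assoc: "alg_cong R (u \<otimes>\<^sub>A v \<otimes>\<^sub>A w) (u \<otimes>\<^sub>A (v \<otimes>\<^sub>A w))"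
| mult_one_left: "alg_cong R (AOne \<otimes>\<^sub>A u) u"
| mult_one_right: "alg_cong R (u \<otimes>\<^sub>A AOne) u"
| mult_add_left: "alg_cong R ((u \<oplus>\<^sub>A v) \<otimes>\<^sub>A w) (u \<otimes>\<^sub>A w \<oplus>\<^sub>A v \<otimes>\<^sub>A w)"
| mult_add_right: "alg_cong R (u \<otimes>\<^sub>A (v \<oplus>\<^sub>A w)) (u \<otimes>\<^sub>A v \<oplus>\<^sub>A u \<otimes>\<^sub>A w)"
| mult_scale_left: "alg_cong R ((c \<cdot>\<^sub>A u) \<otimes>\<^sub>A v) (c \<cdot>\<^sub>A (u \<otimes>\<^sub>A v))"
| mult_scale_right: "alg_cong R (u \<otimes>\<^sub>A (c \<cdot>\<^sub>A v)) (c \<cdot>\<^sub>A (u \<otimes>\<^sub>A v))"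

definition alg_class ::
    "('g alg_term \<times> 'g alg_term) set \<Rightarrow> 'g alg_term \<Rightarrow> 'g alg_term set" where
  "alg_class R t = {u. alg_cong R t u}"

definition presented_algebra ::
    "('g alg_term \<times> 'g alg_term) set \<Rightarrow> (complex, 'g alg_term set) module" where
  "presented_algebra R =
    \<lparr> carrier = range (alg_class R),
      monoid.mult = (\<lambda>U V. \<Union>u\<in>U. \<Union>v\<in>V. alg_class R (u \<otimes>\<^sub>A v)),
      one = alg_class R AOne,
      zero = alg_class R AZero,
      add = (\<lambda>U V. \<Union>u\<in>U. \<Union>v\<in>V. alg_class R (u \<oplus>\<^sub>A v)),
      module.smult = (\<lambda>c U. \<Union>u\<in>U. alg_class R (c \<cdot>\<^sub>A u)) \<rparr>"

lemma alg_class_eqI: "alg_cong R u v \<Longrightarrow> alg_class R u = alg_class R v"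
  unfolding alg_class_def by (blast intro: alg_cong.sym alg_cong.trans)

lemma alg_class_eq_iff: "alg_class R u = alg_class R v \<longleftrightarrow> alg_cong R u v"
  by (metis alg_class_def alg_class_eqI alg_cong.refl mem_Collect_eq)

lemma presented_algebra_simps:
  "carrier (presented_algebra R) = range (alg_class R)"
  "\<one>\<^bsub>presented_algebra R\<^esub> = alg_class R AOne"
  "\<zero>\<^bsub>presented_algebra R\<^esub> = alg_class R AZero"
  "alg_class R u \<otimes>\<^bsub>presented_algebra R\<^esub> alg_class R v = alg_class R (u \<otimes>\<^sub>A v)"
  "alg_class R u \<oplus>\<^bsub>presented_algebra R\<^esub> alg_class R v = alg_class R (u \<oplus>\<^sub>A v)"
  "c \<odot>\<^bsub>presented_algebra R\<^esub> alg_class R u = alg_class R (c \<cdot>\<^sub>A u)"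
proof -
  have refl: "t \<in> alg_class R t" for t
    by (simp add: alg_class_def alg_cong.refl)
  have mem: "alg_cong R t' t" if "t' \<in> alg_class R t" for t t'
    using that by (auto simp: alg_class_def intro: alg_cong.sym)
  show "alg_class R u \<otimes>\<^bsub>presented_algebra R\<^esub> alg_class R v = alg_class R (u \<otimes>\<^sub>A v)"
    unfolding presented_algebra_def
    by (simp, rule UN_const2[OF refl refl], rule alg_class_eqI, rule alg_cong.cong_mult)
      (auto intro: mem)
  show "alg_class R u \<oplus>\<^bsub>presented_algebra R\<^esub> alg_class R v = alg_class R (u \<oplus>\<^sub>A v)"
    unfolding presented_algebra_def
    by (simp, rule UN_const2[OF refl refl], rule alg_class_eqI, rule alg_cong.cong_add)
      (auto intro: mem)
  show "c \<odot>\<^bsub>presented_algebra R\<^esub> alg_class R u = alg_class R (c \<cdot>\<^sub>A u)"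
    unfolding presented_algebra_def
    by (simp, rule UN_const1[OF refl], rule alg_class_eqI, rule alg_cong.cong_scale)
      (auto intro: mem)
qed (simp_all add: presented_algebra_def)

lemmas alg_cong_axioms =
  alg_cong.add_assoc alg_cong.add_comm alg_cong.add_zero alg_cong.scale_add_left
  alg_cong.scale_add_right alg_cong.scale_scale alg_cong.scale_one alg_cong.mult_assoc
  alg_cong.mult_one_left alg_cong.mult_one_right alg_cong.mult_add_left
  alg_cong.mult_add_right

lemma ring_presented_algebra: "ring (presented_algebra R)"
proof (rule ringI)
  show "abelian_group (presented_algebra R)"
  proof (rule abelian_groupI)
    fix x assume "x \<in> carrier (presented_algebra R)"
    then obtain u where u: "x = alg_class R u"
      by (auto simp: presented_algebra_simps)
    have "alg_cong R ((-1) \<cdot>\<^sub>A u \<oplus>\<^sub>A u) AZero"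
      by (rule alg_cong.trans[OF alg_cong.add_comm alg_cong.add_neg])
    then show "\<exists>y\<in>carrier (presented_algebra R).
        y \<oplus>\<^bsub>presented_algebra R\<^esub> x = \<zero>\<^bsub>presented_algebra R\<^esub>"
      using u by (intro bexI[of _ "alg_class R ((-1) \<cdot>\<^sub>A u)"])
        (auto simp: presented_algebra_simps intro!: alg_class_eqI del: equalityI)
  qed (auto simp: presented_algebra_simps intro!: alg_class_eqI alg_cong_axioms del: equalityI)
  show "monoid (presented_algebra R)"
    by (rule monoidI) (auto simp: presented_algebra_simps intro!: alg_class_eqI alg_cong_axioms del: equalityI)
qed (auto simp: presented_algebra_simps intro!: alg_class_eqI alg_cong_axioms del: equalityI)

lemma module_presented_algebra: "module complex_ring (presented_algebra R)"
  by (intro moduleI cring_complex_ring ring.is_abelian_group ring_presented_algebra)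
    (auto simp: presented_algebra_simps complex_ring_def intro!: alg_class_eqI alg_cong_axioms del: equalityI)


section \<open>The Lie algebra \<open>D\<close>\<close>

datatype d_gen = GPartial | GX | GXinv

definition d_rels :: "complex \<Rightarrow> (d_gen alg_term \<times> d_gen alg_term) set" where
  "d_rels s =
    {(AGen GX \<otimes>\<^sub>A AGen GXinv, AOne),
     (AGen GXinv \<otimes>\<^sub>A AGen GX, AOne),
     (AGen GPartial \<otimes>\<^sub>A AGen GX, AGen GX \<otimes>\<^sub>A (AGen GPartial \<oplus>\<^sub>A s \<cdot>\<^sub>A AOne))}"

definition D :: "complex \<Rightarrow> (complex, d_gen alg_term set) module" where
  "D s = presented_algebra (d_rels s)"

definition d_partial :: "complex \<Rightarrow> d_gen alg_term set"  ("\<partial>") where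
  "\<partial> s = alg_class (d_rels s) (AGen GPartial)"

definition d_x :: "complex \<Rightarrow> d_gen alg_term set" where
  "d_x s = alg_class (d_rels s) (AGen GX)"

definition d_xinv :: "complex \<Rightarrow> d_gen alg_term set" where
  "d_xinv s = alg_class (d_rels s) (AGen GXinv)"

definition d_xpow :: "complex \<Rightarrow> int \<Rightarrow> d_gen alg_term set" where
  "d_xpow s l = (if l \<ge> 0 then d_x s [^]\<^bsub>D s\<^esub> nat l else d_xinv s [^]\<^bsub>D s\<^esub> nat (- l))"

text \<open>\<open>d_poly s f\<close> is \<open>f(\<partial>)\<close>.\<close>

definition d_poly :: "complex \<Rightarrow> complex poly \<Rightarrow> d_gen alg_term set" where
  "d_poly s f = (\<Oplus>\<^bsub>D s\<^esub>k\<in>{..degree f}. poly.coeff f k \<odot>\<^bsub>D s\<^esub> (\<partial> s [^]\<^bsub>D s\<^esub> k))"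

text \<open>The tensor product of the \<open>n \<times> n\<close> matrices with an algebra \<open>A\<close> is realised as the
  algebra of \<open>n \<times> n\<close> matrices over \<open>A\<close>. Rows and columns are numbered from \<open>1\<close>; the entries
  of a complex matrix outside of this range are ignored.\<close>

definition mat_algebra ::
    "nat \<Rightarrow> (complex, 'a) module \<Rightarrow> (complex, nat \<times> nat \<Rightarrow> 'a) module" where
  "mat_algebra n A =
    \<lparr> carrier = {1..n} \<times> {1..n} \<rightarrow>\<^sub>E carrier A,
      monoid.mult = (\<lambda>M N. \<lambda>(i, j)\<in>{1..n} \<times> {1..n}. \<Oplus>\<^bsub>A\<^esub>k\<in>{1..n}. M (i, k) \<otimes>\<^bsub>A\<^esub> N (k, j)),
      one = (\<lambda>(i, j)\<in>{1..n} \<times> {1..n}. if i = j then \<one>\<^bsub>A\<^esub> else \<zero>\<^bsub>A\<^esub>),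
      zero = (\<lambda>(i, j)\<in>{1..n} \<times> {1..n}. \<zero>\<^bsub>A\<^esub>),
      add = (\<lambda>M N. \<lambda>(i, j)\<in>{1..n} \<times> {1..n}. M (i, j) \<oplus>\<^bsub>A\<^esub> N (i, j)),
      module.smult = (\<lambda>c M. \<lambda>(i, j)\<in>{1..n} \<times> {1..n}. c \<odot>\<^bsub>A\<^esub> M (i, j)) \<rparr>"

type_synonym cmat = "nat \<Rightarrow> nat \<Rightarrow> complex"

definition tensor :: "nat \<Rightarrow> (complex, 'a) module \<Rightarrow> cmat \<Rightarrow> 'a \<Rightarrow> nat \<times> nat \<Rightarrow> 'a" where
  "tensor n A M d = (\<lambda>(i, j)\<in>{1..n} \<times> {1..n}. M i j \<odot>\<^bsub>A\<^esub> d)"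

definition unit_mat :: "nat \<Rightarrow> nat \<Rightarrow> cmat"  ("E") where
  "E i j = (\<lambda>a b. of_bool (a = i \<and> b = j))"

definition trace_mult :: "nat \<Rightarrow> cmat \<Rightarrow> cmat \<Rightarrow> complex" where
  "trace_mult n M N = (\<Sum>i = 1..n. \<Sum>k = 1..n. M i k * N k i)"

type_synonym d_elem = "nat \<times> nat \<Rightarrow> d_gen alg_term set"

definition Dmat :: "nat \<Rightarrow> complex \<Rightarrow> (complex, d_elem) module" where
  "Dmat n s = mat_algebra n (D s)"

definition cocycle_value ::
    "nat \<Rightarrow> complex \<Rightarrow> cmat \<Rightarrow> complex poly \<Rightarrow> int \<Rightarrow> cmat \<Rightarrow> complex poly \<Rightarrow> int \<Rightarrow> complex" where
  "cocycle_value n s M1 f1 l1 M2 f2 l2 =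
    (if l1 = - l2 \<and> l1 > 0 then
       trace_mult n M1 M2 *
         (\<Sum>a = 0..l1 - 1. poly f1 (of_int a * s) * poly f2 (of_int (a - l1) * s))
     else if l1 = - l2 \<and> l1 < 0 then
       - trace_mult n M1 M2 *
         (\<Sum>a = 0..- l1 - 1. poly f2 (of_int a * s) * poly f1 (of_int (a + l1) * s))
     else 0)"

text \<open>The elements \<open>M \<otimes> f(\<partial>) x\<^sup>l\<close> span \<open>Dmat n s\<close>, so that a bilinear form with the prescribed
  values on them is unique on the carrier; extensionality makes it unique as a function.\<close>

definition is_cocycle :: "nat \<Rightarrow> complex \<Rightarrow> (d_elem \<Rightarrow> d_elem \<Rightarrow> complex) \<Rightarrow> bool" where
  "is_cocycle n s \<phi> \<longleftrightarrow>
    \<phi> \<in> carrier (Dmat n s) \<rightarrow>\<^sub>E (carrier (Dmat n s) \<rightarrow>\<^sub>E UNIV) \<and>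
    (\<forall>u\<in>carrier (Dmat n s). \<forall>v\<in>carrier (Dmat n s). \<forall>w\<in>carrier (Dmat n s).
      \<phi> (u \<oplus>\<^bsub>Dmat n s\<^esub> v) w = \<phi> u w + \<phi> v w \<and>
      \<phi> w (u \<oplus>\<^bsub>Dmat n s\<^esub> v) = \<phi> w u + \<phi> w v) \<and>
    (\<forall>c. \<forall>u\<in>carrier (Dmat n s). \<forall>v\<in>carrier (Dmat n s).
      \<phi> (c \<odot>\<^bsub>Dmat n s\<^esub> u) v = c * \<phi> u v \<and>
      \<phi> u (c \<odot>\<^bsub>Dmat n s\<^esub> v) = c * \<phi> u v) \<and>
    (\<forall>M1 f1 l1 M2 f2 l2.
      \<phi> (tensor n (D s) M1 (d_poly s f1 \<otimes>\<^bsub>D s\<^esub> d_xpow s l1))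
        (tensor n (D s) M2 (d_poly s f2 \<otimes>\<^bsub>D s\<^esub> d_xpow s l2)) =
      cocycle_value n s M1 f1 l1 M2 f2 l2)"

definition cocycle :: "nat \<Rightarrow> complex \<Rightarrow> d_elem \<Rightarrow> d_elem \<Rightarrow> complex" where
  "cocycle n s = (THE \<phi>. is_cocycle n s \<phi>)"

text \<open>The pair \<open>(u, \<lambda>)\<close> stands for \<open>u + \<lambda> c\<close>, where \<open>c\<close> is the central element.\<close>

definition Dbar :: "nat \<Rightarrow> complex \<Rightarrow> (complex, d_elem \<times> complex) module" where
  "Dbar n s =
    \<lparr> carrier = carrier (Dmat n s) \<times> UNIV,
      monoid.mult = (\<lambda>(u, a) (v, b).
        (u \<otimes>\<^bsub>Dmat n s\<^esub> v \<ominus>\<^bsub>Dmat n s\<^esub> v \<otimes>\<^bsub>Dmat n s\<^esub> u, cocycle n s u v)),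
      one = undefined,
      zero = (\<zero>\<^bsub>Dmat n s\<^esub>, 0),
      add = (\<lambda>(u, a) (v, b). (u \<oplus>\<^bsub>Dmat n s\<^esub> v, a + b)),
      module.smult = (\<lambda>c (u, a). (c \<odot>\<^bsub>Dmat n s\<^esub> u, c * a)) \<rparr>"


section \<open>The assignment on generators\<close>

text \<open>\<open>shift_pow s c r\<close> is \<open>(\<partial> + c)\<^sup>r\<close>.\<close>

definition shift_pow :: "complex \<Rightarrow> complex \<Rightarrow> nat \<Rightarrow> d_gen alg_term set" where
  "shift_pow s c r = (\<partial> s \<oplus>\<^bsub>D s\<^esub> c \<odot>\<^bsub>D s\<^esub> \<one>\<^bsub>D s\<^esub>) [^]\<^bsub>D s\<^esub> r"

fun theta_gen :: "nat \<Rightarrow> complex \<Rightarrow> y_gen \<Rightarrow> d_elem \<times> complex" where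
  "theta_gen n \<beta> (YX Plus i r) =
    (let s = of_nat n * \<beta> in
      if i = 0 then (tensor n (D s) (E n 1) (\<partial> s [^]\<^bsub>D s\<^esub> r \<otimes>\<^bsub>D s\<^esub> d_x s), 0)
      else (tensor n (D s) (E i (i + 1)) (shift_pow s ((of_nat n - of_nat i) * \<beta>) r), 0))"
| "theta_gen n \<beta> (YX Minus i r) =
    (let s = of_nat n * \<beta> in
      if i = 0 then (tensor n (D s) (E 1 n) (d_xinv s \<otimes>\<^bsub>D s\<^esub> \<partial> s [^]\<^bsub>D s\<^esub> r), 0)
      else (tensor n (D s) (E (i + 1) i) (shift_pow s ((of_nat n - of_nat i) * \<beta>) r), 0))"
| "theta_gen n \<beta> (YXi i r) =
    (let s = of_nat n * \<beta> in
      if i = 0 then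
        (tensor n (D s) (E n n) (\<partial> s [^]\<^bsub>D s\<^esub> r) \<ominus>\<^bsub>Dmat n s\<^esub>
           tensor n (D s) (E 1 1) (shift_pow s (of_nat n * \<beta>) r),
         of_bool (r = 0))
      else
        (tensor n (D s) (\<lambda>a b. E i i a b - E (i + 1) (i + 1) a b)
           (shift_pow s ((of_nat n - of_nat i) * \<beta>) r),
         0))"

end

theory Submission
  imports Defs
begin

text \<open>Write an integer \<open>N\<close> as \<open>k n + (n - i)\<close> with \<open>1 \<le> i \<le> n\<close>. Functions of \<open>N\<close> are then columns of
  \<open>n\<close> functions of \<open>k\<close>, and \<open>D\<close> acts on functions of \<open>k\<close>: \<open>\<partial>\<close> multiplies by \<open>k s\<close> and \<open>x\<close> shifts.
  For \<open>s = n \<beta>\<close> the matrices over \<open>D\<close> become the operators \<open>\<Sum> F\<^sub>d \<tau>\<^sup>d\<close> on functions of \<open>N\<close>, where \<open>\<tau>\<close> is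
  the shift by one and each \<open>F\<^sub>d\<close> is a quasi-polynomial: a polynomial in \<open>N\<close> on every class modulo
  \<open>n\<close>. The given cocycle becomes the standard one of matrices concentrated near the diagonal,
  \<open>\<alpha>(A, B) - \<alpha>(B, A)\<close> with \<open>\<alpha>(A, B) = \<Sum> A\<^sub>N\<^sub>M B\<^sub>M\<^sub>N\<close> over \<open>N \<ge> 0 > M\<close>. The assignment of the theorem sends
  \<open>x\<^sup>+\<close> with indices \<open>i, r\<close> to the matrix with the entries \<open>(N \<beta>)\<^sup>r\<close> in the positions \<open>(N, N - 1)\<close>,
  \<open>N \<equiv> - i\<close>, and \<open>x\<^sup>-\<close> to the transposed matrix. So the claim is that the relations of \<open>y\<close> present the
  central extension of the algebra of all these operators.

  The relations hold in this model by direct computation. Surjectivity: brackets of \<open>x\<^sup>+\<close> produce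
  every \<open>F \<tau>\<^sup>d\<close> with \<open>d > 0\<close>, brackets of \<open>x\<^sup>-\<close> those with \<open>d < 0\<close>, and the \<open>\<xi>\<close> produce
  \<open>F N - F (N + 1)\<close> with central part \<open>F 0\<close>; since quasi-polynomials have antidifferences, this is
  everything of degree \<open>0\<close>, and constant \<open>F\<close> give the centre.

  The substance is injectivity: the relations must suffice to bring every element into the form
  of an element of the model. Rescaling the generators by \<open>\<beta>\<^sup>-\<^sup>r\<close> reduces to \<open>\<beta> = 1\<close>. Let \<open>e(F)\<close> be the
  generating function of the \<open>x\<^sup>+\<close>. For every \<open>d\<close> there is a candidate \<open>e\<^sub>d(H)\<close> for \<open>H \<tau>\<^sup>d\<close>, and one
  shows by induction on \<open>d\<close> that
  \<open>[e(F), e\<^sub>d(G)] = e\<^sub>d\<^sub>+\<^sub>1(N \<mapsto> F(N) G(N - 1) - G(N) F(N - d))\<close> (\<open>mult_ok_all\<close>). The left side is a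
  linear functional \<open>\<Phi>\<^sub>d\<close> of the function \<open>F(z) G(w)\<close> of two variables; it has to vanish on every \<open>R(z, w)\<close>
  with \<open>R(N, N - 1) = R(N - d, N)\<close>. The quadratic relations give this for \<open>d = 1\<close>. For larger \<open>d\<close>
  the Jacobi identity says that every function \<open>P\<close> of three variables with
  \<open>P(N, N - 1, u) = P(N - 1, N, u)\<close> yields a function on which \<open>\<Phi>\<^sub>d\<close> vanishes (\<open>jacobi_ext_zero\<close>), and
  suitable \<open>P\<close> show step by step that only the two lines \<open>z = w + 1\<close> and \<open>z = w - d\<close> matter and
  that values may be moved from one to the other. For \<open>d = 2\<close> this leaves the lines \<open>z = w\<close> and
  \<open>z = w - 1\<close>; they are removed by the Serre relations, with a separate argument for each of \<open>n = 1\<close>,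
  \<open>n = 2\<close>, \<open>n > 2\<close>. For \<open>d = 3\<close> the line \<open>z = w - 1\<close> survives the generic argument and is removed by
  the antisymmetry of \<open>[e\<^sub>2(F), e\<^sub>2(G)]\<close>.

  Consequently the span of the \<open>\<xi>\<close>, of all \<open>e\<^sub>d\<close> and of their counterparts for \<open>x\<^sup>-\<close> is stable under
  the generators, hence is the whole algebra (\<open>sub_U\<close>). On it the map to the model is injective:
  different degrees lie on different diagonals, and in degree \<open>0\<close> the central part \<open>F 0\<close> determines
  the constant that \<open>F N - F (N + 1)\<close> loses (\<open>sub_\<Theta>_zero\<close>).\<close>


section \<open>Complex Lie algebras carried by whole types\<close>

text \<open>Lie algebras as types, so that the group arithmetic of the type is available in the long computations.
  Algebras given by a carrier are related to such types by evaluation maps further below.\<close>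

class clie = ab_group_add +
  fixes csc :: "complex \<Rightarrow> 'a \<Rightarrow> 'a"  (infixr "*\<^sub>C" 75)
    and br :: "'a \<Rightarrow> 'a \<Rightarrow> 'a"
  assumes csc_add_right: "c *\<^sub>C (u + v) = c *\<^sub>C u + c *\<^sub>C v"
    and csc_add_left: "(c + d) *\<^sub>C u = c *\<^sub>C u + d *\<^sub>C u"
    and csc_csc: "c *\<^sub>C d *\<^sub>C u = (c * d) *\<^sub>C u"
    and csc_one: "1 *\<^sub>C u = u"
    and br_add_left: "br (u + v) w = br u w + br v w"
    and br_add_right: "br w (u + v) = br w u + br w v"
    and br_csc_left: "br (c *\<^sub>C u) v = c *\<^sub>C br u v"
    and br_csc_right: "br u (c *\<^sub>C v) = c *\<^sub>C br u v"
    and br_self: "br u u = 0"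
    and br_cyclic: "br u (br v w) + br v (br w u) + br w (br u v) = 0"

global_interpretation clie: vector_space "csc :: complex \<Rightarrow> 'a \<Rightarrow> 'a::clie"
  by unfold_locales (simp_all add: csc_add_right csc_add_left csc_csc csc_one)

lemmas csc_simps [simp] = clie.scale_zero_left clie.scale_zero_right csc_one csc_csc

global_interpretation br_left: additive "\<lambda>u. br u (v::'a::clie)"
  by unfold_locales (rule br_add_left)

global_interpretation br_right: additive "\<lambda>v. br (u::'a::clie) v"
  by unfold_locales (rule br_add_right)

lemmas br_zero [simp] = br_left.zero br_right.zero
lemmas br_minus = br_left.minus br_right.minus
lemmas br_diff = br_left.diff br_right.diff
lemmas br_sum = br_left.sum br_right.sum
lemmas br_linear = br_add_left br_add_right br_csc_left br_csc_right br_minus br_diff br_sum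
lemmas csc_linear = csc_add_right clie.scale_right_diff_distrib clie.scale_minus_right
  clie.scale_sum_right

lemma br_anti: "br u v = - br v (u::'a::clie)"
proof -
  have "br (u + v) (u + v) = br u u + br v u + (br u v + br v v)"
    by (simp only: br_add_left br_add_right)
  then have "br u v + br v u = 0"
    by (simp add: br_self add.commute)
  then show ?thesis by (simp add: eq_neg_iff_add_eq_0)
qed

lemma jacobi_left: "br (br u v) w = br u (br v w) - br v (br u (w::'a::clie))"
proof -
  have "br u (br v w) + br v (br w u) + br w (br u v) = 0" by (rule br_cyclic)
  moreover have "br w (br u v) = - br (br u v) w" by (rule br_anti)
  moreover have "br v (br w u) = - br v (br u w)"
    by (subst br_anti[of w u]) (simp only: br_right.minus)
  ultimately show ?thesis by (simp add: algebra_simps)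
qed

lemma jacobi_right: "br u (br v w) = br (br u v) w + br v (br u (w::'a::clie))"
  by (simp add: jacobi_left)

definition lin_on :: "(int \<Rightarrow> complex) set \<Rightarrow> ((int \<Rightarrow> complex) \<Rightarrow> 'a::clie) \<Rightarrow> bool" where
  "lin_on A f \<longleftrightarrow> (\<forall>F\<in>A. \<forall>G\<in>A. f (\<lambda>N. F N + G N) = f F + f G) \<and> (\<forall>c. \<forall>F\<in>A. f (\<lambda>N. c * F N) = c *\<^sub>C f F)"

definition clie_hom :: "('a::clie \<Rightarrow> 'b::clie) \<Rightarrow> bool" where
  "clie_hom f \<longleftrightarrow> (\<forall>u v. f (u + v) = f u + f v) \<and> (\<forall>c u. f (c *\<^sub>C u) = c *\<^sub>C f u)
    \<and> (\<forall>u v. f (br u v) = br (f u) (f v))"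

lemma clie_homD:
  assumes "clie_hom f"
  shows "f (u + v) = f u + f v" "f (c *\<^sub>C u) = c *\<^sub>C f u" "f (br u v) = br (f u) (f v)"
    "f 0 = 0" "f (- u) = - f u" "f (u - v) = f u - f v"
proof -
  have a: "\<And>u v. f (u + v) = f u + f v" and s: "\<And>c u. f (c *\<^sub>C u) = c *\<^sub>C f u"
    and b: "f (br u v) = br (f u) (f v)"
    using assms unfolding clie_hom_def by auto
  interpret additive f by unfold_locales (rule a)
  show "f (u + v) = f u + f v" "f (c *\<^sub>C u) = c *\<^sub>C f u" "f (br u v) = br (f u) (f v)"
    "f 0 = 0" "f (- u) = - f u" "f (u - v) = f u - f v"
    by (fact a s b zero minus diff)+
qed


section \<open>Local linear operators on functions of an integer\<close>

definition local_op :: "int \<Rightarrow> ((int \<Rightarrow> complex) \<Rightarrow> int \<Rightarrow> complex) \<Rightarrow> bool" where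
  "local_op b A \<longleftrightarrow> (\<forall>u v k. (\<forall>j\<in>{k - b..k + b}. u j = v j) \<longrightarrow> A u k = A v k)"

text \<open>Matrices indexed by the integers and concentrated near the diagonal, as operators on all functions:
  the value at \<open>k\<close> depends only on the values of the argument within a fixed distance of \<open>k\<close>.\<close>

typedef lop = "{A :: (int \<Rightarrow> complex) \<Rightarrow> int \<Rightarrow> complex.
    (\<forall>u v. A (\<lambda>k. u k + v k) = (\<lambda>k. A u k + A v k)) \<and> (\<forall>c u. A (\<lambda>k. c * u k) = (\<lambda>k. c * A u k)) \<and>
    (\<exists>b. local_op b A)}"
  morphisms app Lop
proof
  have "local_op 0 (\<lambda>u k. 0 :: complex)"
    by (simp add: local_op_def)
  then show "(\<lambda>u k. 0) \<in> {A :: (int \<Rightarrow> complex) \<Rightarrow> int \<Rightarrow> complex.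
    (\<forall>u v. A (\<lambda>k. u k + v k) = (\<lambda>k. A u k + A v k)) \<and> (\<forall>c u. A (\<lambda>k. c * u k) = (\<lambda>k. c * A u k)) \<and>
    (\<exists>b. local_op b A)}"
    by auto
qed

setup_lifting type_definition_lop

lemma local_op_mono: "local_op b A \<Longrightarrow> b \<le> b' \<Longrightarrow> local_op b' A"
  unfolding local_op_def by (meson atLeastatMost_subset_iff add_left_mono diff_left_mono subsetD)

lemma local_op_comp:
  assumes "local_op b A" "local_op c B" shows "local_op (\<bar>b\<bar> + \<bar>c\<bar>) (\<lambda>u. A (B u))"
  unfolding local_op_def
proof (intro allI impI)
  fix u v :: "int \<Rightarrow> complex" and k
  assume eq: "\<forall>j\<in>{k - (\<bar>b\<bar> + \<bar>c\<bar>)..k + (\<bar>b\<bar> + \<bar>c\<bar>)}. u j = v j"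
  have "B u j = B v j" if "j \<in> {k - b..k + b}" for j
  proof -
    have "\<forall>i\<in>{j - c..j + c}. u i = v i" using eq that by auto
    then show ?thesis using assms(2) unfolding local_op_def by blast
  qed
  then show "A (B u) k = A (B v) k" using assms(1) unfolding local_op_def by blast
qed

instantiation lop :: ring_1
begin
lift_definition zero_lop :: lop is "\<lambda>u k. 0" by (auto simp: local_op_def)
lift_definition one_lop :: lop is "\<lambda>u. u" by (auto simp: local_op_def intro!: exI[of _ 0])
lift_definition plus_lop :: "lop \<Rightarrow> lop \<Rightarrow> lop" is "\<lambda>A B u k. A u k + B u k"
proof (clarsimp simp: algebra_simps, goal_cases)
  case (1 A B b c)
  then have "local_op (max b c) A" "local_op (max b c) B"
    using local_op_mono[of b _ "max b c"] local_op_mono[of c _ "max b c"] by auto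
  then have "local_op (max b c) (\<lambda>u k. A u k + B u k)"
    unfolding local_op_def by metis
  then show ?case by blast
qed
lift_definition minus_lop :: "lop \<Rightarrow> lop \<Rightarrow> lop" is "\<lambda>A B u k. A u k - B u k"
proof (clarsimp simp: algebra_simps, goal_cases)
  case (1 A B b c)
  then have "local_op (max b c) A" "local_op (max b c) B"
    using local_op_mono[of b _ "max b c"] local_op_mono[of c _ "max b c"] by auto
  then have "local_op (max b c) (\<lambda>u k. A u k - B u k)"
    unfolding local_op_def by metis
  then show ?case by blast
qed
lift_definition uminus_lop :: "lop \<Rightarrow> lop" is "\<lambda>A u k. - A u k"
  by (auto simp: local_op_def)
lift_definition times_lop :: "lop \<Rightarrow> lop \<Rightarrow> lop" is "\<lambda>A B u. A (B u)"
proof (clarsimp, goal_cases)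
  case (1 A B b c)
  then show ?case using local_op_comp by blast
qed
instance
proof
  show "(0::lop) \<noteq> 1"
    by transfer (metis zero_neq_one)
qed (transfer; auto simp: algebra_simps)+
end

lift_definition scl :: "complex \<Rightarrow> lop \<Rightarrow> lop" is "\<lambda>c A u k. c * A u k"
proof -
  fix c :: complex and A :: "(int \<Rightarrow> complex) \<Rightarrow> int \<Rightarrow> complex"
  assume A: "(\<forall>u v. A (\<lambda>k. u k + v k) = (\<lambda>k. A u k + A v k)) \<and> (\<forall>c u. A (\<lambda>k. c * u k) = (\<lambda>k. c * A u k)) \<and>
    (\<exists>b. local_op b A)"
  then obtain b where "local_op b A" by blast
  then have "local_op b (\<lambda>u k. c * A u k)" unfolding local_op_def by metis
  with A show "(\<forall>u v. (\<lambda>k. c * A (\<lambda>k. u k + v k) k) = (\<lambda>k. c * A u k + c * A v k)) \<and>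
    (\<forall>d u. (\<lambda>k. c * A (\<lambda>k. d * u k) k) = (\<lambda>k. d * (c * A u k))) \<and> (\<exists>b. local_op b (\<lambda>u k. c * A u k))"
    by (auto simp: algebra_simps)
qed

text \<open>The operator \<open>F \<tau>\<^sup>d\<close> with \<open>\<tau>\<close> the shift by one; its matrix has the entries \<open>F N\<close> in the positions
  \<open>(N, N - d)\<close>.\<close>

lift_definition FT :: "(int \<Rightarrow> complex) \<Rightarrow> int \<Rightarrow> lop" is "\<lambda>F d u k. F k * u (k - d)"
proof -
  fix F d
  have "local_op \<bar>d\<bar> (\<lambda>u k. F k * u (k - d))"
    unfolding local_op_def
  proof (intro allI impI)
    fix u v :: "int \<Rightarrow> complex" and k assume "\<forall>j\<in>{k - \<bar>d\<bar>..k + \<bar>d\<bar>}. u j = v j"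
    moreover have "k - d \<in> {k - \<bar>d\<bar>..k + \<bar>d\<bar>}" by auto
    ultimately show "F k * u (k - d) = F k * v (k - d)" by metis
  qed
  then show "(\<forall>u v. (\<lambda>k. F k * (u (k - d) + v (k - d))) = (\<lambda>k. F k * u (k - d) + F k * v (k - d))) \<and>
          (\<forall>c u. (\<lambda>k. F k * (c * u (k - d))) = (\<lambda>k. c * (F k * u (k - d)))) \<and> (\<exists>b. local_op b (\<lambda>u k. F k * u (k - d)))"
    by (auto simp: algebra_simps)
qed

lemma scl_simps:
  "scl c (A + B) = scl c A + scl c B" "scl (c + d) A = scl c A + scl d A"
  "scl c (scl d A) = scl (c * d) A" "scl 1 A = A" "scl c A * B = scl c (A * B)"
  "A * scl c B = scl c (A * B)" "scl c (A - B) = scl c A - scl c B" "scl c 0 = 0" "scl 0 A = 0"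
  "scl c (- A) = - scl c A"
  by (transfer; auto simp: algebra_simps)+

lemma lop_eqI: "(\<And>u k. app A u k = app B u k) \<Longrightarrow> A = B"
  by (simp add: app_inject[symmetric] ext)

lemma app_simps [simp]:
  "app (A + B) u k = app A u k + app B u k" "app (A - B) u k = app A u k - app B u k"
  "app (- A) u k = - app A u k" "app (A * B) u = app A (app B u)" "app 0 u k = 0" "app 1 u = u"
  "app (scl c A) u k = c * app A u k" "app (FT F d) u k = F k * u (k - d)"
  by (transfer; simp)+

lemma app_linear: "app A (\<lambda>k. u k + v k) = (\<lambda>k. app A u k + app A v k)" "app A (\<lambda>k. c * u k) = (\<lambda>k. c * app A u k)"
  using app[of A] by auto

lemma app_zero: "app A (\<lambda>k. 0) = (\<lambda>k. 0)"
  using app_linear(2)[of A 0 "\<lambda>k. 0"] by simp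

lemma app_sum: "app A (\<lambda>k. \<Sum>i\<in>I. f i k) = (\<lambda>k. \<Sum>i\<in>I. app A (f i) k)"
  by (induction I rule: infinite_finite_induct) (simp_all add: app_zero app_linear)

lemma app_local: obtains b where "b \<ge> 0" "local_op b (app A)"
proof -
  obtain b where "local_op b (app A)" using app[of A] by auto
  then have "local_op \<bar>b\<bar> (app A)" by (rule local_op_mono) simp
  then show ?thesis using that[of "\<bar>b\<bar>"] by simp
qed

definition ent :: "lop \<Rightarrow> int \<Rightarrow> int \<Rightarrow> complex" where
  "ent A N M = app A (\<lambda>k. of_bool (k = M)) N"

lemma app_eq_ent:
  assumes "local_op b (app A)" "finite W" "{N - b..N + b} \<subseteq> W"
  shows "app A v N = (\<Sum>K\<in>W. ent A N K * v K)"
proof -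
  have "app A v N = app A (\<lambda>k. \<Sum>K\<in>W. v K * of_bool (k = K)) N"
  proof -
    have "\<forall>j\<in>{N - b..N + b}. v j = (\<Sum>K\<in>W. v K * of_bool (j = K))"
    proof
      fix j assume "j \<in> {N - b..N + b}"
      then have "j \<in> W" using assms(3) by blast
      then show "v j = (\<Sum>K\<in>W. v K * of_bool (j = K))"
        using assms(2) by (simp add: of_bool_def sum.delta' if_distrib cong: if_cong)
    qed
    with assms(1)[unfolded local_op_def, rule_format, of N v "\<lambda>k. \<Sum>K\<in>W. v K * of_bool (k = K)"] show ?thesis by simp
  qed
  also have "\<dots> = (\<Sum>K\<in>W. v K * ent A N K)"
    by (simp only: app_sum app_linear(2) ent_def)
  finally show ?thesis by (simp add: mult.commute)
qed

lemma ent_outside: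
  assumes "local_op b (app A)" "\<bar>N - M\<bar> > b"
  shows "ent A N M = 0"
proof -
  have "app A (\<lambda>k. of_bool (k = M)) N = app A (\<lambda>k. 0) N"
    using assms(2) by (intro assms(1)[unfolded local_op_def, rule_format]) auto
  then show ?thesis by (simp add: ent_def app_zero)
qed

lemma ent_eqI: assumes "\<And>N M. ent A N M = ent B N M" shows "A = B"
proof (rule lop_eqI)
  fix u k
  obtain a where a: "a \<ge> 0" "local_op a (app A)" by (rule app_local)
  obtain b where b: "b \<ge> 0" "local_op b (app B)" by (rule app_local)
  let ?W = "{k - (a + b)..k + (a + b)}"
  show "app A u k = app B u k"
    using app_eq_ent[OF a(2), of ?W k u] app_eq_ent[OF b(2), of ?W k u] a(1) b(1) assms by simp
qed

lemma ent_simps [simp]: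
  "ent (A + B) N M = ent A N M + ent B N M" "ent (A - B) N M = ent A N M - ent B N M"
  "ent (- A) N M = - ent A N M" "ent 0 N M = 0" "ent (scl c A) N M = c * ent A N M"
  "ent (FT F d) N M = F N * of_bool (M = N - d)"
  by (auto simp: ent_def)

lemma ent_times:
  assumes "local_op b (app A)" "finite W" "{N - b..N + b} \<subseteq> W"
  shows "ent (A * B) N M = (\<Sum>K\<in>W. ent A N K * ent B K M)"
  using app_eq_ent[OF assms, of "app B (\<lambda>k. of_bool (k = M))"] by (simp add: ent_def)

lemma FT_times: "FT F d * FT G e = FT (\<lambda>N. F N * G (N - d)) (d + e)"
  by (rule lop_eqI) (simp add: algebra_simps)

lemma FT_linear: "FT (\<lambda>N. F N + G N) d = FT F d + FT G d" "FT (\<lambda>N. c * F N) d = scl c (FT F d)"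
   "FT (\<lambda>N. F N - G N) d = FT F d - FT G d"  "FT (\<lambda>N. - F N) d = - FT F d" "FT (\<lambda>N. 0) d = 0"
  by (rule lop_eqI; simp add: algebra_simps)+


section \<open>The cocycle of the algebra of local operators\<close>

text \<open>The pairing of the entries of \<open>A\<close> that lead across the cut between \<open>-1\<close> and \<open>0\<close> with the entries of \<open>B\<close>
  that lead back. Restricting the summation to nonzero entries makes the index set finite.\<close>

definition alpha :: "lop \<Rightarrow> lop \<Rightarrow> complex" where
  "alpha A B = (\<Sum>(N, M) \<in> {(N, M). N \<ge> 0 \<and> M < 0 \<and> ent A N M \<noteq> 0 \<and> ent B M N \<noteq> 0}. ent A N M * ent B M N)"

definition phi :: "lop \<Rightarrow> lop \<Rightarrow> complex" where
  "phi A B = alpha A B - alpha B A"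

text \<open>Locality of one factor confines the sum to a box, whose size does not depend on the other factor;
  this makes bilinearity evident.\<close>

lemma alpha_eq:
  assumes "local_op b (app A) \<or> local_op b (app B)" "b \<le> L"
  shows "alpha A B = (\<Sum>N\<in>{0..L}. \<Sum>M\<in>{- L..-1}. ent A N M * ent B M N)"
proof -
  have "alpha A B = (\<Sum>(N, M) \<in> {0..L} \<times> {- L..-1}. ent A N M * ent B M N)"
    unfolding alpha_def
  proof (rule sum.mono_neutral_left)
    show "{(N, M). N \<ge> 0 \<and> M < 0 \<and> ent A N M \<noteq> 0 \<and> ent B M N \<noteq> 0} \<subseteq> {0..L} \<times> {- L..-1}"
    proof (clarsimp)
      fix N M :: int assume h: "0 \<le> N" "M < 0" "ent A N M \<noteq> 0" "ent B M N \<noteq> 0"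
      have "\<not> \<bar>N - M\<bar> > b" using assms(1) ent_outside[of b A N M] ent_outside[of b B M N] h
        by (auto simp: abs_minus_commute)
      then show "N \<le> L \<and> - L \<le> M" using h assms(2) by linarith
    qed
  qed auto
  then show ?thesis by (simp add: sum.cartesian_product)
qed

lemma alpha_add_left: "alpha (A + B) C = alpha A C + alpha B C"
  and alpha_add_right: "alpha C (A + B) = alpha C A + alpha C B"
  and alpha_scl: "alpha (scl c A) C = c * alpha A C" "alpha C (scl c A) = c * alpha C A"
proof -
  obtain a where a: "a \<ge> 0" "local_op a (app C)" by (rule app_local)
  note e = alpha_eq[OF disjI1[OF a(2)] order.refl] alpha_eq[OF disjI2[OF a(2)] order.refl]
  show "alpha (A + B) C = alpha A C + alpha B C" "alpha C (A + B) = alpha C A + alpha C B"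
    "alpha (scl c A) C = c * alpha A C" "alpha C (scl c A) = c * alpha C A"
    by (simp_all add: e algebra_simps sum.distrib sum_distrib_left)
qed

lemma phi_bilinear:
  "phi (A + B) C = phi A C + phi B C" "phi C (A + B) = phi C A + phi C B"
  "phi (scl c A) C = c * phi A C" "phi C (scl c A) = c * phi C A"
  by (simp_all add: phi_def alpha_add_left alpha_add_right alpha_scl algebra_simps)

lemma phi_minus: "phi (A - B) C = phi A C - phi B C" "phi C (A - B) = phi C A - phi C B"
  using phi_bilinear(1)[of "A - B" B C] phi_bilinear(2)[of C "A - B" B] by simp_all

lemma phi_anti: "phi A B = - phi B A"
  by (simp add: phi_def)

definition box :: "lop \<Rightarrow> lop \<Rightarrow> lop \<Rightarrow> int set \<Rightarrow> int set \<Rightarrow> int set \<Rightarrow> complex" where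
  "box A B C I J K = (\<Sum>i\<in>I. \<Sum>j\<in>J. \<Sum>k\<in>K. ent A i j * ent B j k * ent C k i)"

lemma box_rotate: "box B C A I J K = box A B C K I J"
proof -
  have "box A B C K I J = (\<Sum>k\<in>K. \<Sum>i\<in>I. \<Sum>j\<in>J. ent A k i * ent B i j * ent C j k)" by (simp add: box_def)
  also have "\<dots> = (\<Sum>i\<in>I. \<Sum>k\<in>K. \<Sum>j\<in>J. ent A k i * ent B i j * ent C j k)" by (rule sum.swap)
  also have "\<dots> = (\<Sum>i\<in>I. \<Sum>j\<in>J. \<Sum>k\<in>K. ent A k i * ent B i j * ent C j k)"
    by (rule sum.cong[OF HOL.refl], rule sum.swap)
  finally show ?thesis by (simp add: box_def mult_ac)
qed

text \<open>The intermediate index of the product \<open>A B\<close> lies on one of the two sides of the cut. Each term is a sum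
  over cyclic paths with prescribed sides.\<close>

lemma phi_times_eq_box:
  assumes loc: "b \<ge> 0" "local_op b (app A)" "local_op b (app B)" "local_op b (app C)"
    and P: "P = {0..2 * b}" and Q: "Q = {- (2 * b)..-1}"
  shows "phi (A * B) C = box A B C P P Q + box A B C P Q Q - box A B C Q P P - box A B C Q Q P"
proof -
  have PQ: "finite P" "finite Q" "P \<inter> Q = {}" by (auto simp: P Q)
  have W: "P \<union> Q = {- (2 * b)..2 * b}" using loc(1) by (auto simp: P Q)
  have times: "ent (A * B) N M * ent C M N = (\<Sum>K\<in>P \<union> Q. ent A N K * ent B K M * ent C M N)"
    if "(N \<in> P \<and> M \<in> Q) \<or> (N \<in> Q \<and> M \<in> P)" for N M
  proof (cases "\<bar>M - N\<bar> > b")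
    case True
    then show ?thesis using ent_outside[OF loc(4) True] by simp
  next
    case False
    then have "{N - b..N + b} \<subseteq> {- (2 * b)..2 * b}" using that loc(1) by (auto simp: P Q)
    then show ?thesis using ent_times[OF loc(2), of "P \<union> Q" N B M] W
      by (simp add: sum_distrib_right)
  qed
  have 1: "alpha (A * B) C = box A B C P P Q + box A B C P Q Q"
  proof -
    have "alpha (A * B) C = (\<Sum>N\<in>P. \<Sum>M\<in>Q. ent (A * B) N M * ent C M N)"
      unfolding P Q using loc by (intro alpha_eq[of b]) auto
    also have "\<dots> = (\<Sum>N\<in>P. \<Sum>M\<in>Q. \<Sum>K\<in>P \<union> Q. ent A N K * ent B K M * ent C M N)"
      using times by (intro sum.cong) auto
    also have "\<dots> = (\<Sum>N\<in>P. \<Sum>K\<in>P \<union> Q. \<Sum>M\<in>Q. ent A N K * ent B K M * ent C M N)"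
      by (rule sum.cong[OF HOL.refl], rule sum.swap)
    finally show ?thesis using PQ by (simp add: box_def sum.union_disjoint sum.distrib)
  qed
  have 2: "alpha C (A * B) = box A B C Q P P + box A B C Q Q P"
  proof -
    have "alpha C (A * B) = (\<Sum>N\<in>P. \<Sum>M\<in>Q. ent C N M * ent (A * B) M N)"
      unfolding P Q using loc by (intro alpha_eq[of b]) auto
    also have "\<dots> = (\<Sum>N\<in>P. \<Sum>M\<in>Q. \<Sum>K\<in>P \<union> Q. ent A M K * ent B K N * ent C N M)"
      using times by (intro sum.cong HOL.refl) (auto simp: mult.commute)
    also have "\<dots> = (\<Sum>M\<in>Q. \<Sum>N\<in>P. \<Sum>K\<in>P \<union> Q. ent A M K * ent B K N * ent C N M)"
      by (rule sum.swap)
    also have "\<dots> = (\<Sum>M\<in>Q. \<Sum>K\<in>P \<union> Q. \<Sum>N\<in>P. ent A M K * ent B K N * ent C N M)"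
      by (rule sum.cong[OF HOL.refl], rule sum.swap)
    finally show ?thesis using PQ by (simp add: box_def sum.union_disjoint sum.distrib)
  qed
  show ?thesis by (simp add: phi_def 1 2)
qed

text \<open>Rotating the cyclic paths matches the positive terms of one summand with the negative terms of
  another.\<close>

lemma phi_cyclic: "phi (A * B) C + phi (B * C) A + phi (C * A) B = 0"
proof -
  obtain a where a: "a \<ge> 0" "local_op a (app A)" by (rule app_local)
  obtain b where b: "b \<ge> 0" "local_op b (app B)" by (rule app_local)
  obtain c where c: "c \<ge> 0" "local_op c (app C)" by (rule app_local)
  define l where "l = a + b + c"
  have l: "l \<ge> 0" "local_op l (app A)" "local_op l (app B)" "local_op l (app C)"
    using local_op_mono[OF a(2), of l] local_op_mono[OF b(2), of l] local_op_mono[OF c(2), of l] a b c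
    by (auto simp: l_def)
  define P where "P = {0..2 * l}"
  define Q where "Q = {- (2 * l)..-1}"
  note e = phi_times_eq_box[OF l P_def Q_def] phi_times_eq_box[OF l(1,3,4,2) P_def Q_def]
    phi_times_eq_box[OF l(1,4,2,3) P_def Q_def]
  show ?thesis unfolding e
    by (simp add: box_rotate[of B C A] box_rotate[of C A B])
qed

text \<open>The central extension of the commutator algebra by this cocycle.\<close>

datatype clop = Ext (op: lop) (ctr: complex)

instantiation clop :: clie
begin
definition "zero_clop = Ext 0 0"
definition "plus_clop u v = Ext (op u + op v) (ctr u + ctr v)"
definition "minus_clop u v = Ext (op u - op v) (ctr u - ctr v)"
definition "uminus_clop u = Ext (- op u) (- ctr u)"
definition "csc_clop c u = Ext (scl c (op u)) (c * ctr u)"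
definition "br_clop u v = Ext (op u * op v - op v * op u) (phi (op u) (op v))"
instance
proof
  fix u v w :: clop
  have "phi (op u) (op v * op w - op w * op v) = phi (op w * op v) (op u) - phi (op v * op w) (op u)" for u v w
    by (subst phi_anti) (simp add: phi_minus)
  note e = this[of u v w] this[of v w u] this[of w u v]
  have "phi (op u) (op v * op w - op w * op v) + phi (op v) (op w * op u - op u * op w) + phi (op w) (op u * op v - op v * op u)
    = (phi (op w * op v) (op u) + phi (op v * op u) (op w) + phi (op u * op w) (op v))
      - (phi (op u * op v) (op w) + phi (op v * op w) (op u) + phi (op w * op u) (op v))"
    unfolding e by simp
  also have "\<dots> = 0"
    by (simp only: phi_cyclic) simp
  finally have "phi (op u) (op v * op w - op w * op v) + phi (op v) (op w * op u - op u * op w) + phi (op w) (op u * op v - op v * op u) = 0" .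
  then show "br u (br v w) + br v (br w u) + br w (br u v) = 0"
    by (simp add: br_clop_def plus_clop_def zero_clop_def algebra_simps)
qed (simp_all add: zero_clop_def plus_clop_def minus_clop_def uminus_clop_def csc_clop_def br_clop_def
    scl_simps phi_bilinear algebra_simps clop.expand, simp add: phi_def)
end

lemma clop_simps [simp]:
  "op (u + v) = op u + op v" "op (u - v) = op u - op v" "op (- u) = - op u" "op 0 = 0" "op (c *\<^sub>C u) = scl c (op u)"
  "op (br u v) = op u * op v - op v * op u"
  "ctr (u + v) = ctr u + ctr v" "ctr (u - v) = ctr u - ctr v" "ctr (- u) = - ctr u" "ctr 0 = 0" "ctr (c *\<^sub>C u) = c * ctr u"
  "ctr (br u v) = phi (op u) (op v)"
  by (simp_all add: zero_clop_def plus_clop_def minus_clop_def uminus_clop_def csc_clop_def br_clop_def)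


section \<open>Quasi-polynomials\<close>

text \<open>Quasi-polynomials: a polynomial in \<open>N\<close> on each class modulo \<open>n\<close>.\<close>

definition qp :: "nat \<Rightarrow> (int \<Rightarrow> complex) set" where
  "qp n = {F. \<exists>p :: int \<Rightarrow> complex poly. \<forall>N. F N = poly (p (N mod int n)) (of_int N)}"

text \<open>The class \<open>N \<equiv> - i\<close>, on which the generators with index \<open>i\<close> live.\<close>

definition ch :: "nat \<Rightarrow> nat \<Rightarrow> int \<Rightarrow> complex" where
  "ch n i N = of_bool ((N + int i) mod int n = 0)"

named_theorems qpI
named_theorems qps

lemma qp_const [qpI]: "(\<lambda>N. c) \<in> qp n"
  unfolding qp_def by (intro CollectI exI[of _ "\<lambda>_. [:c:]"]) simp

lemma qp_id [qpI]: "of_int \<in> qp n"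
  unfolding qp_def by (intro CollectI exI[of _ "\<lambda>_. [:0, 1:]"]) simp

lemma qp_ch [qpI]: "ch n i \<in> qp n"
  unfolding qp_def ch_def
  by (intro CollectI exI[of _ "\<lambda>r. [:of_bool ((r + int i) mod int n = 0):]"]) (simp add: mod_add_left_eq)

lemma qp_add [qpI]: assumes "F \<in> qp n" "G \<in> qp n" shows "(\<lambda>N. F N + G N) \<in> qp n"
proof -
  obtain p q where "\<And>N. F N = poly (p (N mod int n)) (of_int N)" "\<And>N. G N = poly (q (N mod int n)) (of_int N)"
    using assms unfolding qp_def by auto
  then show ?thesis unfolding qp_def by (intro CollectI exI[of _ "\<lambda>r. p r + q r"]) simp
qed

lemma qp_mult [qpI]: assumes "F \<in> qp n" "G \<in> qp n" shows "(\<lambda>N. F N * G N) \<in> qp n"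
proof -
  obtain p q where "\<And>N. F N = poly (p (N mod int n)) (of_int N)" "\<And>N. G N = poly (q (N mod int n)) (of_int N)"
    using assms unfolding qp_def by auto
  then show ?thesis unfolding qp_def by (intro CollectI exI[of _ "\<lambda>r. p r * q r"]) simp
qed

lemma qp_shift [qps]: assumes "F \<in> qp n" shows "(\<lambda>N. F (N + a)) \<in> qp n"
proof -
  obtain p where "\<And>N. F N = poly (p (N mod int n)) (of_int N)"
    using assms unfolding qp_def by auto
  then show ?thesis unfolding qp_def
    by (intro CollectI exI[of _ "\<lambda>r. pcompose (p ((r + a) mod int n)) [:of_int a, 1:]"])
      (simp add: poly_pcompose mod_add_left_eq mod_add_right_eq add.commute)
qed

lemma qp_shift' [qps]: "F \<in> qp n \<Longrightarrow> (\<lambda>N. F (N - a)) \<in> qp n"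
  using qp_shift[of F n "- a"] by simp

lemma qp_uminus [qpI]: "F \<in> qp n \<Longrightarrow> (\<lambda>N. - F N) \<in> qp n"
  using qp_mult[OF qp_const[of "-1"], of F n] by simp

lemma qp_diff [qpI]: "F \<in> qp n \<Longrightarrow> G \<in> qp n \<Longrightarrow> (\<lambda>N. F N - G N) \<in> qp n"
  using qp_add[OF _ qp_uminus, of F n G] by simp

lemma qp_divide [qpI]: "F \<in> qp n \<Longrightarrow> (\<lambda>N. F N / c) \<in> qp n"
  using qp_mult[OF qp_const[of "inverse c"], of F n] by (simp add: field_simps)

lemma qp_power [qpI]: "F \<in> qp n \<Longrightarrow> (\<lambda>N. F N ^ k) \<in> qp n"
  by (induction k) (auto intro: qp_const qp_mult)

lemma qp_poly [qpI]: "(\<lambda>N. poly p (of_int N)) \<in> qp n"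
  unfolding qp_def by (intro CollectI exI[of _ "\<lambda>_. p"]) simp

text \<open>The tensor square and the tensor cube of the space of quasi-polynomials, realised as functions of two and of three variables.\<close>

inductive_set qp2 :: "nat \<Rightarrow> (int \<Rightarrow> int \<Rightarrow> complex) set" for n where
  qp2_zero: "(\<lambda>z w. 0) \<in> qp2 n"
| qp2_step: "\<lbrakk>R \<in> qp2 n; F \<in> qp n; G \<in> qp n\<rbrakk> \<Longrightarrow> (\<lambda>z w. R z w + F z * G w) \<in> qp2 n"

inductive_set qp3 :: "nat \<Rightarrow> (int \<Rightarrow> int \<Rightarrow> int \<Rightarrow> complex) set" for n where
  qp3_zero: "(\<lambda>x y z. 0) \<in> qp3 n"
| qp3_step: "\<lbrakk>P \<in> qp3 n; F \<in> qp n; G \<in> qp n; H \<in> qp n\<rbrakk> \<Longrightarrow> (\<lambda>x y z. P x y z + F x * G y * H z) \<in> qp3 n"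

lemma qp2_pure: "F \<in> qp n \<Longrightarrow> G \<in> qp n \<Longrightarrow> (\<lambda>z w. F z * G w) \<in> qp2 n"
  using qp2_step[OF qp2_zero] by simp

lemma qp3_pure: "F \<in> qp n \<Longrightarrow> G \<in> qp n \<Longrightarrow> H \<in> qp n \<Longrightarrow> (\<lambda>x y z. F x * G y * H z) \<in> qp3 n"
  using qp3_step[OF qp3_zero] by simp

lemma qp2_add [qpI]: assumes "R \<in> qp2 n" "S \<in> qp2 n" shows "(\<lambda>z w. R z w + S z w) \<in> qp2 n"
  using assms(2)
proof (induction S rule: qp2.induct)
  case (qp2_step S F G)
  then show ?case using qp2.qp2_step[of "\<lambda>z w. R z w + S z w" n F G] by (simp add: add.assoc)
qed (simp add: assms)

lemma qp3_add [qpI]: assumes "P \<in> qp3 n" "S \<in> qp3 n" shows "(\<lambda>x y z. P x y z + S x y z) \<in> qp3 n"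
  using assms(2)
proof (induction S rule: qp3.induct)
  case (qp3_step S F G H)
  then show ?case using qp3.qp3_step[of "\<lambda>x y z. P x y z + S x y z" n F G H] by (simp add: add.assoc)
qed (simp add: assms)

lemma qp2_mult [qpI]: assumes "R \<in> qp2 n" "S \<in> qp2 n" shows "(\<lambda>z w. R z w * S z w) \<in> qp2 n"
  using assms(2)
proof (induction S rule: qp2.induct)
  case qp2_zero
  then show ?case using qp2.qp2_zero by simp
next
  case (qp2_step S F G)
  have "(\<lambda>z w. R z w * (F z * G w)) \<in> qp2 n" using assms(1)
  proof (induction R rule: qp2.induct)
    case qp2_zero
    then show ?case using qp2.qp2_zero by simp
  next
    case (qp2_step R F' G')
    have "(\<lambda>z w. R z w * (F z * G w) + (F' z * F z) * (G' w * G w)) \<in> qp2 n"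
      by (intro qp2_add qp2_step.IH qp2_pure qp_mult qp2_step \<open>F \<in> qp n\<close> \<open>G \<in> qp n\<close>)
    then show ?case by (simp add: algebra_simps)
  qed
  with qp2_step.IH have "(\<lambda>z w. R z w * S z w + R z w * (F z * G w)) \<in> qp2 n" by (rule qp2_add)
  then show ?case by (simp add: distrib_left)
qed

lemma qp3_mult [qpI]: assumes "R \<in> qp3 n" "S \<in> qp3 n" shows "(\<lambda>x y z. R x y z * S x y z) \<in> qp3 n"
  using assms(2)
proof (induction S rule: qp3.induct)
  case qp3_zero
  then show ?case using qp3.qp3_zero by simp
next
  case (qp3_step S F G H)
  have "(\<lambda>x y z. R x y z * (F x * G y * H z)) \<in> qp3 n" using assms(1)
  proof (induction R rule: qp3.induct)
    case qp3_zero
    then show ?case using qp3.qp3_zero by simp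
  next
    case (qp3_step R F' G' H')
    have "(\<lambda>x y z. R x y z * (F x * G y * H z) + (F' x * F x) * (G' y * G y) * (H' z * H z)) \<in> qp3 n"
      by (intro qp3_add qp3_step.IH qp3_pure qp_mult qp3_step \<open>F \<in> qp n\<close> \<open>G \<in> qp n\<close> \<open>H \<in> qp n\<close>)
    then show ?case by (simp add: algebra_simps)
  qed
  with qp3_step.IH have "(\<lambda>x y z. R x y z * S x y z + R x y z * (F x * G y * H z)) \<in> qp3 n" by (rule qp3_add)
  then show ?case by (simp add: distrib_left)
qed

lemma qp2_fst [qpI]: "F \<in> qp n \<Longrightarrow> (\<lambda>z w. F z) \<in> qp2 n"
  using qp2_pure[OF _ qp_const[of 1]] by simp

lemma qp2_snd [qpI]: "F \<in> qp n \<Longrightarrow> (\<lambda>z w. F w) \<in> qp2 n"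
  using qp2_pure[OF qp_const[of 1]] by simp

lemma qp3_1 [qpI]: "F \<in> qp n \<Longrightarrow> (\<lambda>x y z. F x) \<in> qp3 n"
  using qp3_pure[OF _ qp_const[of 1] qp_const[of 1]] by simp

lemma qp3_2 [qpI]: "F \<in> qp n \<Longrightarrow> (\<lambda>x y z. F y) \<in> qp3 n"
  using qp3_pure[OF qp_const[of 1] _ qp_const[of 1]] by simp

lemma qp3_3 [qpI]: "F \<in> qp n \<Longrightarrow> (\<lambda>x y z. F z) \<in> qp3 n"
  using qp3_pure[OF qp_const[of 1] qp_const[of 1]] by simp

lemma qp2_const [qpI]: "(\<lambda>z w. c) \<in> qp2 n" by (rule qp2_fst, rule qp_const)
lemma qp3_const [qpI]: "(\<lambda>x y z. c) \<in> qp3 n" by (rule qp3_1, rule qp_const)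

lemma qp2_uminus [qpI]: "R \<in> qp2 n \<Longrightarrow> (\<lambda>z w. - R z w) \<in> qp2 n"
  using qp2_mult[OF qp2_const[of "-1"], of R n] by simp
lemma qp3_uminus [qpI]: "R \<in> qp3 n \<Longrightarrow> (\<lambda>x y z. - R x y z) \<in> qp3 n"
  using qp3_mult[OF qp3_const[of "-1"], of R n] by simp
lemma qp2_diff [qpI]: "R \<in> qp2 n \<Longrightarrow> S \<in> qp2 n \<Longrightarrow> (\<lambda>z w. R z w - S z w) \<in> qp2 n"
  using qp2_add[OF _ qp2_uminus, of R n S] by simp
lemma qp3_diff [qpI]: "R \<in> qp3 n \<Longrightarrow> S \<in> qp3 n \<Longrightarrow> (\<lambda>x y z. R x y z - S x y z) \<in> qp3 n"
  using qp3_add[OF _ qp3_uminus, of R n S] by simp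
lemma qp2_divide [qpI]: "R \<in> qp2 n \<Longrightarrow> (\<lambda>z w. R z w / c) \<in> qp2 n"
  using qp2_mult[OF qp2_const[of "inverse c"], of R n] by (simp add: field_simps)
lemma qp3_divide [qpI]: "R \<in> qp3 n \<Longrightarrow> (\<lambda>x y z. R x y z / c) \<in> qp3 n"
  using qp3_mult[OF qp3_const[of "inverse c"], of R n] by (simp add: field_simps)
lemma qp2_power [qpI]: "R \<in> qp2 n \<Longrightarrow> (\<lambda>z w. R z w ^ k) \<in> qp2 n"
  by (induction k) (auto intro: qp2_const qp2_mult)
lemma qp3_power [qpI]: "R \<in> qp3 n \<Longrightarrow> (\<lambda>x y z. R x y z ^ k) \<in> qp3 n"
  by (induction k) (auto intro: qp3_const qp3_mult)

lemma qp2_subst: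
  assumes "R \<in> qp2 n" "\<And>F. F \<in> qp n \<Longrightarrow> (\<lambda>z w. F (f z w)) \<in> qp2 n" "\<And>F. F \<in> qp n \<Longrightarrow> (\<lambda>z w. F (g z w)) \<in> qp2 n"
  shows "(\<lambda>z w. R (f z w) (g z w)) \<in> qp2 n"
  using assms(1) by induction (intro qp2_zero qp2_add qp2_mult assms; assumption)+

lemma qp2_subst_qp:
  assumes "R \<in> qp2 n" "\<And>F. F \<in> qp n \<Longrightarrow> (\<lambda>z. F (f z)) \<in> qp n" "\<And>F. F \<in> qp n \<Longrightarrow> (\<lambda>z. F (g z)) \<in> qp n"
  shows "(\<lambda>z. R (f z) (g z)) \<in> qp n"
  using assms(1) by induction (intro qp_const qp_add qp_mult assms; assumption)+

lemma qp2_subst_qp3: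
  assumes "R \<in> qp2 n" "\<And>F. F \<in> qp n \<Longrightarrow> (\<lambda>x y z. F (f x y z)) \<in> qp3 n" "\<And>F. F \<in> qp n \<Longrightarrow> (\<lambda>x y z. F (g x y z)) \<in> qp3 n"
  shows "(\<lambda>x y z. R (f x y z) (g x y z)) \<in> qp3 n"
  using assms(1) by induction (intro qp3_zero qp3_add qp3_mult assms; assumption)+

lemma qp3_subst_qp2:
  assumes "P \<in> qp3 n" "\<And>F. F \<in> qp n \<Longrightarrow> (\<lambda>z w. F (f z w)) \<in> qp2 n" "\<And>F. F \<in> qp n \<Longrightarrow> (\<lambda>z w. F (g z w)) \<in> qp2 n"
    "\<And>F. F \<in> qp n \<Longrightarrow> (\<lambda>z w. F (h z w)) \<in> qp2 n"
  shows "(\<lambda>z w. P (f z w) (g z w) (h z w)) \<in> qp2 n"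
  using assms(1) by induction (intro qp2_zero qp2_add qp2_mult assms; assumption)+

text \<open>The coordinates, shifted by constants, are admissible substitutions.\<close>

lemma shift_fst2 [qps]: "F \<in> qp n \<Longrightarrow> (\<lambda>z w. F (z + a)) \<in> qp2 n" "F \<in> qp n \<Longrightarrow> (\<lambda>z w. F (z - a)) \<in> qp2 n"
  "F \<in> qp n \<Longrightarrow> (\<lambda>z w. F (z - a + b)) \<in> qp2 n" "F \<in> qp n \<Longrightarrow> (\<lambda>z w. F (z + a - b)) \<in> qp2 n" "F \<in> qp n \<Longrightarrow> (\<lambda>z w. F z) \<in> qp2 n"
  using qp2_fst[OF qp_shift[of F n "b - a"]] qp2_fst[OF qp_shift[of F n "a - b"]]
  by (auto intro: qp2_fst[of "\<lambda>z. F (z + a)"] qp2_fst[of "\<lambda>z. F (z - a)"] qp2_fst qp_shift qp_shift' simp: algebra_simps)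

lemma shift_snd2 [qps]: "F \<in> qp n \<Longrightarrow> (\<lambda>z w. F (w + a)) \<in> qp2 n" "F \<in> qp n \<Longrightarrow> (\<lambda>z w. F (w - a)) \<in> qp2 n"
  "F \<in> qp n \<Longrightarrow> (\<lambda>z w. F (w - a + b)) \<in> qp2 n" "F \<in> qp n \<Longrightarrow> (\<lambda>z w. F (w + a - b)) \<in> qp2 n" "F \<in> qp n \<Longrightarrow> (\<lambda>z w. F w) \<in> qp2 n"
  using qp2_snd[OF qp_shift[of F n "b - a"]] qp2_snd[OF qp_shift[of F n "a - b"]]
  by (auto intro: qp2_snd[of "\<lambda>z. F (z + a)"] qp2_snd[of "\<lambda>z. F (z - a)"] qp2_snd qp_shift qp_shift' simp: algebra_simps)

lemma shift_3 [qps]: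
  assumes "F \<in> qp n"
  shows "(\<lambda>x y z. F (x + a)) \<in> qp3 n" "(\<lambda>x y z. F (y + a)) \<in> qp3 n" "(\<lambda>x y z. F (z + a)) \<in> qp3 n"
    "(\<lambda>x y z. F x) \<in> qp3 n" "(\<lambda>x y z. F y) \<in> qp3 n" "(\<lambda>x y z. F z) \<in> qp3 n"
    "(\<lambda>x y z. F (x + a - b)) \<in> qp3 n"
  using qp3_1[OF qp_shift[OF assms, of a]] qp3_2[OF qp_shift[OF assms, of a]] qp3_3[OF qp_shift[OF assms, of a]]
    qp3_1[OF assms] qp3_2[OF assms] qp3_3[OF assms] qp3_1[OF qp_shift[OF assms, of "a - b"]]
  by (simp_all add: algebra_simps)

lemma qp2_swap: "R \<in> qp2 n \<Longrightarrow> (\<lambda>z w. R w z) \<in> qp2 n"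
  by (rule qp2_subst) (auto intro: qp2_fst qp2_snd)

lemma qp2_diag: "R \<in> qp2 n \<Longrightarrow> (\<lambda>N. R (N + a) (N + b)) \<in> qp n"
  by (rule qp2_subst_qp) (auto intro: qps)


section \<open>Linear extension of bilinear maps to functions of two variables\<close>

definition bilin :: "nat \<Rightarrow> ((int \<Rightarrow> complex) \<Rightarrow> (int \<Rightarrow> complex) \<Rightarrow> 'a::clie) \<Rightarrow> bool" where
  "bilin n B \<longleftrightarrow> (\<forall>G\<in>qp n. lin_on (qp n) (\<lambda>F. B F G)) \<and> (\<forall>F\<in>qp n. lin_on (qp n) (B F))"

lemma lin_onD:
  assumes "lin_on A f"
  shows "\<lbrakk>F \<in> A; G \<in> A\<rbrakk> \<Longrightarrow> f (\<lambda>N. F N + G N) = f F + f G" "F \<in> A \<Longrightarrow> f (\<lambda>N. c * F N) = c *\<^sub>C f F"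
    "F \<in> A \<Longrightarrow> f (\<lambda>N. 0) = 0"
proof -
  show "\<lbrakk>F \<in> A; G \<in> A\<rbrakk> \<Longrightarrow> f (\<lambda>N. F N + G N) = f F + f G" "F \<in> A \<Longrightarrow> f (\<lambda>N. c * F N) = c *\<^sub>C f F" for c
    using assms by (auto simp: lin_on_def)
  from this(2)[of 0] show "F \<in> A \<Longrightarrow> f (\<lambda>N. 0) = 0" by simp
qed

lemma lin_on_sum_list:
  assumes "lin_on (qp n) f" "\<And>G. G \<in> set L \<Longrightarrow> g G \<in> qp n"
  shows "f (\<lambda>N. \<Sum>G\<leftarrow>L. c G * g G N) = (\<Sum>G\<leftarrow>L. c G *\<^sub>C f (g G)) \<and> (\<lambda>N. \<Sum>G\<leftarrow>L. c G * g G N) \<in> qp n"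
  using assms(2)
proof (induction L)
  case Nil
  then show ?case using lin_onD(3)[OF assms(1) qp_const] by (simp add: qp_const)
next
  case (Cons G L)
  then have "(\<lambda>N. c G * g G N) \<in> qp n" "f (\<lambda>N. c G * g G N) = c G *\<^sub>C f (g G)"
    by (auto intro!: qpI lin_onD(2)[OF assms(1)])
  then show ?case using Cons lin_onD(1)[OF assms(1)] by (auto intro!: qp_add)
qed

definition tens_ok :: "nat \<Rightarrow> ((int \<Rightarrow> complex) \<times> (int \<Rightarrow> complex)) list \<Rightarrow> bool" where
  "tens_ok n L \<longleftrightarrow> (\<forall>p\<in>set L. fst p \<in> qp n \<and> snd p \<in> qp n)"

definition tens_fun :: "((int \<Rightarrow> complex) \<times> (int \<Rightarrow> complex)) list \<Rightarrow> int \<Rightarrow> int \<Rightarrow> complex" where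
  "tens_fun L = (\<lambda>z w. \<Sum>p\<leftarrow>L. fst p z * snd p w)"

definition tens_val :: "((int \<Rightarrow> complex) \<Rightarrow> (int \<Rightarrow> complex) \<Rightarrow> 'a::clie) \<Rightarrow> ((int \<Rightarrow> complex) \<times> (int \<Rightarrow> complex)) list \<Rightarrow> 'a" where
  "tens_val B L = (\<Sum>p\<leftarrow>L. B (fst p) (snd p))"

text \<open>The extension is well defined because a representation of the zero function can be shortened: where
  the first factor \<open>F\<close> of its head is nonzero, the second factor \<open>G\<close> is a combination of the other second
  factors, and substituting it merges the head into the tail.\<close>

lemma tens_val_zero:
  assumes B: "bilin n B"
  shows "tens_ok n L \<Longrightarrow> tens_fun L = (\<lambda>z w. 0) \<Longrightarrow> tens_val B L = 0"
proof (induction L rule: measure_induct_rule[of length])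
  case (less L)
  show ?case
  proof (cases L)
    case Nil
    then show ?thesis by (simp add: tens_val_def)
  next
    case (Cons p L')
    obtain F G where p: "p = (F, G)" by force
    have FG: "F \<in> qp n" "G \<in> qp n" and ok: "tens_ok n L'" using less.prems(1) Cons p by (auto simp: tens_ok_def)
    have z: "F z * G w + tens_fun L' z w = 0" for z w
      using fun_cong[OF fun_cong[OF less.prems(2), of z], of w] by (simp add: Cons p tens_fun_def)
    have lG: "lin_on (qp n) (\<lambda>F. B F G)" if "G \<in> qp n" for G using B that by (simp add: bilin_def)
    have lF: "lin_on (qp n) (B F)" using B FG by (simp add: bilin_def)
    show ?thesis
    proof (cases "\<exists>z. F z \<noteq> 0")
      case False
      then have "F = (\<lambda>N. 0)" by auto
      then have "B F G = 0" "tens_fun L' = (\<lambda>z w. 0)" using lin_onD(3)[OF lG[OF FG(2)] FG(1)] z by auto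
      with less.IH[of L'] ok show ?thesis by (simp add: Cons p tens_val_def)
    next
      case True
      then obtain z0 where z0: "F z0 \<noteq> 0" by blast
      define c where "c q = fst q z0 / F z0" for q :: "(int \<Rightarrow> complex) \<times> (int \<Rightarrow> complex)"
      define M where "M = map (\<lambda>q. (\<lambda>z. fst q z + (- c q) * F z, snd q)) L'"
      have GL: "G = (\<lambda>w. \<Sum>q\<leftarrow>L'. (- c q) * snd q w)"
      proof
        fix w
        have "F z0 * G w = - tens_fun L' z0 w" using z[of z0 w] by (simp add: eq_neg_iff_add_eq_0)
        then have "G w = (- inverse (F z0)) * tens_fun L' z0 w" using z0 by (simp add: field_simps)
        also have "\<dots> = (\<Sum>q\<leftarrow>L'. (- c q) * snd q w)"
          unfolding tens_fun_def sum_list_const_mult[symmetric]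
          by (intro arg_cong[where f = sum_list] map_cong) (auto simp: c_def field_simps)
        finally show "G w = (\<Sum>q\<leftarrow>L'. (- c q) * snd q w)" .
      qed
      have okM: "tens_ok n M" using ok FG unfolding tens_ok_def M_def by (auto intro!: qpI)
      have "tens_fun M z w = 0" for z w
      proof -
        have "tens_fun M z w = (\<Sum>q\<leftarrow>L'. fst q z * snd q w + F z * ((- c q) * snd q w))"
          unfolding tens_fun_def M_def by (simp add: o_def algebra_simps)
        also have "\<dots> = tens_fun L' z w + F z * (\<Sum>q\<leftarrow>L'. (- c q) * snd q w)"
          unfolding tens_fun_def by (simp only: sum_list_addf sum_list_const_mult)
        also have "\<dots> = tens_fun L' z w + F z * G w" using fun_cong[OF GL, of w] by simp
        finally show ?thesis using z[of z w] by (simp add: add.commute)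
      qed
      then have "tens_val B M = 0" using less.IH[of M] okM by (auto simp: M_def Cons)
      moreover have "tens_val B M = (\<Sum>q\<leftarrow>L'. B (fst q) (snd q) + (- c q) *\<^sub>C B F (snd q))"
        unfolding tens_val_def M_def map_map o_def fst_conv snd_conv
      proof (intro arg_cong[where f = sum_list] map_cong HOL.refl)
        fix q assume "q \<in> set L'"
        then have q: "fst q \<in> qp n" "snd q \<in> qp n" using ok by (auto simp: tens_ok_def)
        show "B (\<lambda>z. fst q z + - c q * F z) (snd q) = B (fst q) (snd q) + (- c q) *\<^sub>C B F (snd q)"
          using lin_onD(1)[OF lG[OF q(2)] q(1), of "\<lambda>z. - c q * F z"] lin_onD(2)[OF lG[OF q(2)] FG(1), of "- c q"]
          by (simp only: qp_mult qp_const FG)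
      qed
      moreover have "B F G = (\<Sum>q\<leftarrow>L'. (- c q) *\<^sub>C B F (snd q))"
        using lin_on_sum_list[OF lF, of L' snd "\<lambda>q. - c q"] ok GL by (auto simp: tens_ok_def)
      ultimately show ?thesis by (simp add: Cons p tens_val_def sum_list_addf sum_list_subtractf uminus_sum_list_map[symmetric, unfolded o_def])
    qed
  qed
qed

text \<open>By the preceding lemma a finite sum of products \<open>F z * G w\<close> may be handled as a function of two variables;
  this is what allows polynomial identities in \<open>z\<close> and \<open>w\<close> to act on brackets.\<close>

definition ext :: "nat \<Rightarrow> ((int \<Rightarrow> complex) \<Rightarrow> (int \<Rightarrow> complex) \<Rightarrow> 'a::clie) \<Rightarrow> (int \<Rightarrow> int \<Rightarrow> complex) \<Rightarrow> 'a" where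
  "ext n B R = (THE v. \<exists>L. tens_ok n L \<and> R = tens_fun L \<and> v = tens_val B L)"

definition tens_scale where
  "tens_scale c L = map (\<lambda>p. (\<lambda>z. c * fst p z, snd p)) (L :: ((int \<Rightarrow> complex) \<times> (int \<Rightarrow> complex)) list)"

lemma tens_scale:
  "tens_ok n L \<Longrightarrow> tens_ok n (tens_scale c L)" "tens_fun (tens_scale c L) = (\<lambda>z w. c * tens_fun L z w)"
  "bilin n B \<Longrightarrow> tens_ok n L \<Longrightarrow> tens_val B (tens_scale c L) = c *\<^sub>C tens_val B L"
proof -
  show "tens_ok n L \<Longrightarrow> tens_ok n (tens_scale c L)"
    by (auto simp: tens_scale_def tens_ok_def intro!: qpI)
  show "tens_fun (tens_scale c L) = (\<lambda>z w. c * tens_fun L z w)"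
    by (simp add: tens_scale_def tens_fun_def sum_list_const_mult[symmetric] o_def mult.assoc)
  show "bilin n B \<Longrightarrow> tens_ok n L \<Longrightarrow> tens_val B (tens_scale c L) = c *\<^sub>C tens_val B L"
  proof (induction L)
    case (Cons p L)
    then have "B (\<lambda>z. c * fst p z) (snd p) = c *\<^sub>C B (fst p) (snd p)"
      using lin_onD(2)[of "qp n" "\<lambda>F. B F (snd p)"] by (simp add: bilin_def tens_ok_def)
    then show ?case using Cons by (simp add: tens_scale_def tens_val_def tens_ok_def csc_linear)
  qed (simp add: tens_scale_def tens_val_def)
qed

lemma tens_append: "tens_ok n (L @ M) \<longleftrightarrow> tens_ok n L \<and> tens_ok n M"
  "tens_fun (L @ M) = (\<lambda>z w. tens_fun L z w + tens_fun M z w)" "tens_val B (L @ M) = tens_val B L + tens_val B M"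
  by (auto simp: tens_ok_def tens_fun_def tens_val_def)

lemma ext_tens:
  assumes "bilin n B" "tens_ok n L" shows "ext n B (tens_fun L) = tens_val B L"
  unfolding ext_def
proof (rule the_equality)
  fix v assume "\<exists>M. tens_ok n M \<and> tens_fun L = tens_fun M \<and> v = tens_val B M"
  then obtain M where M: "tens_ok n M" "tens_fun L = tens_fun M" "v = tens_val B M" by blast
  have "tens_val B (M @ tens_scale (-1) L) = 0"
    by (rule tens_val_zero[OF assms(1)]) (use M assms(2) in \<open>auto simp: tens_append tens_scale\<close>)
  then show "v = tens_val B L" using M assms by (simp add: tens_append tens_scale)
qed (use assms in blast)

lemma qp2_tens: "R \<in> qp2 n \<Longrightarrow> \<exists>L. tens_ok n L \<and> R = tens_fun L"
proof (induction rule: qp2.induct)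
  case qp2_zero
  show ?case by (rule exI[of _ "[]"]) (simp add: tens_ok_def tens_fun_def)
next
  case (qp2_step R F G)
  then obtain L where "tens_ok n L \<and> R = tens_fun L" by blast
  then show ?case using qp2_step
    by (intro exI[of _ "L @ [(F, G)]"]) (auto simp: tens_append, simp_all add: tens_ok_def tens_fun_def)
qed

lemma ext_pure: assumes "bilin n B" "F \<in> qp n" "G \<in> qp n" shows "ext n B (\<lambda>z w. F z * G w) = B F G"
  using ext_tens[OF assms(1), of "[(F, G)]"] assms by (simp add: tens_ok_def tens_fun_def tens_val_def)

lemma ext_add:
  assumes "bilin n B" "R \<in> qp2 n" "S \<in> qp2 n" shows "ext n B (\<lambda>z w. R z w + S z w) = ext n B R + ext n B S"
proof -
  obtain L M where "tens_ok n L" "R = tens_fun L" "tens_ok n M" "S = tens_fun M"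
    using qp2_tens assms by metis
  then show ?thesis using ext_tens[OF assms(1), of "L @ M"] ext_tens[OF assms(1)] by (simp add: tens_append)
qed

lemma ext_scale:
  assumes "bilin n B" "R \<in> qp2 n" shows "ext n B (\<lambda>z w. c * R z w) = c *\<^sub>C ext n B R"
proof -
  obtain L where "tens_ok n L" "R = tens_fun L"
    using qp2_tens assms by metis
  then show ?thesis using ext_tens[OF assms(1), of "tens_scale c L"] ext_tens[OF assms(1)] assms(1) by (simp add: tens_scale)
qed

lemma ext_uminus: "bilin n B \<Longrightarrow> R \<in> qp2 n \<Longrightarrow> ext n B (\<lambda>z w. - R z w) = - ext n B R"
  using ext_scale[of n B R "-1"] by simp

lemma ext_diff:
  assumes "bilin n B" "R \<in> qp2 n" "S \<in> qp2 n" shows "ext n B (\<lambda>z w. R z w - S z w) = ext n B R - ext n B S"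
  using ext_add[OF assms(1,2) qp2_uminus[OF assms(3)]] ext_uminus[OF assms(1,3)] by simp

lemma ext_zero: "bilin n B \<Longrightarrow> ext n B (\<lambda>z w. 0) = 0"
  using ext_scale[of n B "\<lambda>z w. 0" 0] qp2_zero by simp

lemma ext_step:
  assumes "bilin n B" "R \<in> qp2 n" "F \<in> qp n" "G \<in> qp n"
  shows "ext n B (\<lambda>z w. R z w + F z * G w) = ext n B R + B F G"
  using ext_add[OF assms(1,2) qp2_pure[OF assms(3,4)]] ext_pure[OF assms(1,3,4)] by simp


section \<open>Generating functions\<close>

text \<open>A quasi-polynomial is a combination of the functions \<open>ch n i N * N ^ k\<close>. The map \<open>gen n x\<close> sends these to
  \<open>x i k\<close> and thereby collects all generators of one kind in one linear map; \<open>px x i\<close> is its part on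
  the class \<open>i\<close>, and \<open>cpoly n F i\<close> is the polynomial that agrees with \<open>F\<close> on that class.\<close>

definition px :: "(nat \<Rightarrow> nat \<Rightarrow> 'a::clie) \<Rightarrow> nat \<Rightarrow> complex poly \<Rightarrow> 'a" where
  "px x i p = (\<Sum>k\<le>degree p. poly.coeff p k *\<^sub>C x i k)"

definition cpoly :: "nat \<Rightarrow> (int \<Rightarrow> complex) \<Rightarrow> nat \<Rightarrow> complex poly" where
  "cpoly n F i = (THE p. \<forall>N. (N + int i) mod int n = 0 \<longrightarrow> F N = poly p (of_int N))"

definition gen :: "nat \<Rightarrow> (nat \<Rightarrow> nat \<Rightarrow> 'a::clie) \<Rightarrow> (int \<Rightarrow> complex) \<Rightarrow> 'a" where
  "gen n x F = (\<Sum>i<n. px x i (cpoly n F i))"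

lemma px_bound: assumes "degree p \<le> m" shows "px x i p = (\<Sum>k\<le>m. poly.coeff p k *\<^sub>C x i k)"
  unfolding px_def by (rule sum.mono_neutral_left) (use assms in \<open>auto simp: coeff_eq_0\<close>)

lemma px_add: "px x i (p + q) = px x i p + px x i q"
proof -
  let ?m = "max (degree p) (degree q)"
  have "degree (p + q) \<le> ?m" by (rule degree_add_le) auto
  then show ?thesis by (simp add: px_bound[of _ ?m] csc_add_left sum.distrib)
qed

lemma px_smult: "px x i (Polynomial.smult c p) = c *\<^sub>C px x i p"
  using px_bound[of "Polynomial.smult c p" "degree p" x i] by (simp add: px_def csc_linear degree_smult_le)

lemma px_zero [simp]: "px x i 0 = 0" by (simp add: px_def)

lemma px_monom: "px x i (monom c k) = c *\<^sub>C x i k"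
  using px_bound[OF degree_monom_le[of c k], of x i] by (simp add: if_distrib[of "\<lambda>c. c *\<^sub>C _"] sum.delta' cong: if_cong)

lemma px_monom_mult: "px x i (monom 1 a * p) = (\<Sum>k\<le>degree p. poly.coeff p k *\<^sub>C x i (k + a))"
proof -
  have "degree (monom 1 a * p) \<le> a + degree p"
    using degree_mult_le[of "monom (1::complex) a" p] degree_monom_le[of "1::complex" a] by linarith
  then have "px x i (monom 1 a * p) = (\<Sum>k\<le>a + degree p. poly.coeff (monom 1 a * p) k *\<^sub>C x i k)"
    by (rule px_bound)
  also have "\<dots> = (\<Sum>k\<in>{a..a + degree p}. poly.coeff (monom 1 a * p) k *\<^sub>C x i k)"
    by (rule sum.mono_neutral_right) (auto simp: coeff_monom_mult)
  also have "\<dots> = (\<Sum>k\<in>{0..degree p}. poly.coeff (monom 1 a * p) (k + a) *\<^sub>C x i (k + a))"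
    using sum.shift_bounds_cl_nat_ivl[of "\<lambda>k. poly.coeff (monom 1 a * p) k *\<^sub>C x i k" 0 a "degree p"] by (simp add: add.commute)
  finally show ?thesis by (simp add: coeff_monom_mult atLeast0AtMost)
qed

lemma class_infinite: assumes "n \<ge> 1" shows "infinite {N. (N + int i) mod int n = 0}"
proof
  assume "finite {N. (N + int i) mod int n = 0}"
  moreover have "(\<lambda>k::int. k * int n - int i) ` UNIV \<subseteq> {N. (N + int i) mod int n = 0}" by auto
  moreover have "inj (\<lambda>k::int. k * int n - int i)" using assms by (auto simp: inj_on_def)
  ultimately show False using finite_subset finite_imageD infinite_UNIV_int by metis
qed

text \<open>A class is infinite, so the polynomial of a quasi-polynomial on it is unique.\<close>

lemma poly_eq_on_class:
  assumes "n \<ge> 1" "\<And>N. (N + int i) mod int n = 0 \<Longrightarrow> poly p (of_int N) = poly q (of_int N :: complex)"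
  shows "p = q"
proof (rule ccontr)
  assume "p \<noteq> q"
  then have "finite {z. poly (p - q) z = 0}" by (intro poly_roots_finite) simp
  moreover have "of_int ` {N. (N + int i) mod int n = 0} \<subseteq> {z. poly (p - q) z = 0}" using assms(2) by auto
  ultimately have "finite (of_int ` {N. (N + int i) mod int n = 0} :: complex set)" by (rule rev_finite_subset)
  then have "finite {N. (N + int i) mod int n = 0}" by (rule finite_imageD) (auto simp: inj_on_def)
  then show False using class_infinite[OF assms(1)] by simp
qed

lemma cpoly_unique:
  assumes "n \<ge> 1" "\<And>N. (N + int i) mod int n = 0 \<Longrightarrow> F N = poly p (of_int N)"
  shows "cpoly n F i = p"
  unfolding cpoly_def
proof (rule the_equality)
  fix q assume q: "\<forall>N. (N + int i) mod int n = 0 \<longrightarrow> F N = poly q (of_int N)"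
  show "q = p" by (rule poly_eq_on_class[OF assms(1), of i]) (use q assms(2) in force)
qed (use assms(2) in blast)

lemma cpoly_eq:
  assumes "n \<ge> 1" "F \<in> qp n" "(N + int i) mod int n = 0"
  shows "F N = poly (cpoly n F i) (of_int N)"
proof -
  obtain p where p: "\<And>N. F N = poly (p (N mod int n)) (of_int N)" using assms(2) unfolding qp_def by auto
  have "N mod int n = (- int i) mod int n" if "(N + int i) mod int n = 0" for N
    using that by (metis add.commute add_diff_cancel_left' mod_diff_left_eq diff_0 minus_add_cancel)
  then have "cpoly n F i = p ((- int i) mod int n)" using p by (intro cpoly_unique assms(1)) metis
  then show ?thesis using p assms(3) \<open>\<And>N. (N + int i) mod int n = 0 \<Longrightarrow> N mod int n = (- int i) mod int n\<close> by metis
qed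

lemma ch_ch: assumes "i < n" "j < n" "i \<noteq> j" shows "ch n i N * ch n j N = 0"
proof -
  have "\<not> ((N + int i) mod int n = 0 \<and> (N + int j) mod int n = 0)"
  proof
    assume "(N + int i) mod int n = 0 \<and> (N + int j) mod int n = 0"
    then have "(int i - int j) mod int n = 0" by (metis add_diff_cancel_left mod_diff_eq diff_self mod_0)
    then have "int i mod int n = int j mod int n" by (metis mod_eq_dvd_iff mod_0_imp_dvd)
    then show False using assms by simp
  qed
  then show ?thesis by (auto simp: ch_def)
qed

lemma sum_ch: assumes "n \<ge> 1" shows "(\<Sum>i<n. ch n i N) = 1"
proof -
  define k where "k = nat ((- N) mod int n)"
  have k: "k < n" "(N + int k) mod int n = 0" using assms by (auto simp: k_def nat_less_iff mod_add_right_eq)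
  have "ch n i N = (if i = k then 1 else 0)" if "i < n" for i
    using ch_ch[OF that k(1), of N] k(2) by (auto simp: ch_def)
  then show ?thesis using k(1) by simp
qed

lemma gen_lin: assumes "n \<ge> 1" shows "lin_on (qp n) (gen n x)"
  unfolding lin_on_def
proof (intro conjI ballI allI)
  fix F G assume FG: "F \<in> qp n" "G \<in> qp n"
  have "cpoly n (\<lambda>N. F N + G N) i = cpoly n F i + cpoly n G i" for i
    by (rule cpoly_unique[OF assms]) (simp add: cpoly_eq[OF assms FG(1)] cpoly_eq[OF assms FG(2)])
  then show "gen n x (\<lambda>N. F N + G N) = gen n x F + gen n x G"
    by (simp add: gen_def px_add sum.distrib)
next
  fix c F assume F: "F \<in> qp n"
  have "cpoly n (\<lambda>N. c * F N) i = Polynomial.smult c (cpoly n F i)" for i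
    by (rule cpoly_unique[OF assms]) (simp add: cpoly_eq[OF assms F])
  then show "gen n x (\<lambda>N. c * F N) = c *\<^sub>C gen n x F"
    by (simp add: gen_def px_smult csc_linear)
qed

lemma gen_ch_poly: assumes "n \<ge> 1" "i < n" shows "gen n x (\<lambda>N. ch n i N * poly p (of_int N)) = px x i p"
proof -
  have "cpoly n (\<lambda>N. ch n i N * poly p (of_int N)) j = (if j = i then p else 0)" if "j < n" for j
  proof (rule cpoly_unique[OF assms(1)])
    fix N assume N: "(N + int j) mod int n = 0"
    then show "ch n i N * poly p (of_int N) = poly (if j = i then p else 0) (of_int N)"
      using ch_ch[OF assms(2) that, of N] by (auto simp: ch_def)
  qed
  then have "gen n x (\<lambda>N. ch n i N * poly p (of_int N)) = (\<Sum>j<n. if j = i then px x i p else 0)"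
    unfolding gen_def by (intro sum.cong) auto
  then show ?thesis using assms(2) by simp
qed

lemma ch_cpoly: assumes "n \<ge> 1" "F \<in> qp n" shows "ch n i N * F N = ch n i N * poly (cpoly n F i) (of_int N)"
  using cpoly_eq[OF assms] by (auto simp: ch_def)

lemma gen_ch: assumes "n \<ge> 1" "i < n" "F \<in> qp n"
  shows "gen n x (\<lambda>N. ch n i N * (of_int N ^ a * F N)) = px x i (monom 1 a * cpoly n F i)"
proof -
  have "(\<lambda>N. ch n i N * (of_int N ^ a * F N)) = (\<lambda>N. ch n i N * poly (monom 1 a * cpoly n F i) (of_int N))"
  proof
    fix N
    have "ch n i N * (of_int N ^ a * F N) = of_int N ^ a * (ch n i N * F N)" by simp
    also have "\<dots> = of_int N ^ a * (ch n i N * poly (cpoly n F i) (of_int N))" by (simp only: ch_cpoly[OF assms(1,3)])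
    finally show "ch n i N * (of_int N ^ a * F N) = ch n i N * poly (monom 1 a * cpoly n F i) (of_int N)"
      by (simp add: poly_monom)
  qed
  then show ?thesis by (simp only: gen_ch_poly[OF assms(1,2)])
qed

lemma ext_by_classes:
  assumes "n \<ge> 1" "bilin n B" "R \<in> qp2 n"
    and "\<And>i j. i < n \<Longrightarrow> j < n \<Longrightarrow> ext n B (\<lambda>z w. ch n i z * ch n j w * R z w) = 0"
  shows "ext n B R = 0"
proof -
  have chR: "(\<lambda>z w. ch n i z * ch n j w * R z w) \<in> qp2 n" for i j
    by (intro qpI assms)
  have sum0: "(\<lambda>z w. \<Sum>j<m. f j z w) \<in> qp2 n \<and> ext n B (\<lambda>z w. \<Sum>j<m. f j z w) = 0"
    if "\<And>j. j < m \<Longrightarrow> f j \<in> qp2 n \<and> ext n B (f j) = 0" for f :: "nat \<Rightarrow> int \<Rightarrow> int \<Rightarrow> complex" and m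
    using that
  proof (induction m)
    case 0
    show ?case using ext_zero[OF assms(2)] qp2_zero by simp
  next
    case (Suc m)
    then show ?case using ext_add[OF assms(2), of "\<lambda>z w. \<Sum>j<m. f j z w" "f m"]
        qp2_add[of "\<lambda>z w. \<Sum>j<m. f j z w" n "f m"] by simp
  qed
  have "ext n B (\<lambda>z w. \<Sum>i<n. \<Sum>j<n. ch n i z * ch n j w * R z w) = 0"
    using sum0[of n "\<lambda>i z w. \<Sum>j<n. ch n i z * ch n j w * R z w"] sum0[of n] assms(4) chR by simp
  then show ?thesis
    by (simp add: sum_distrib_right[symmetric] sum_distrib_left[symmetric] sum_ch[OF assms(1)])
qed

text \<open>Modulo the multiples of \<open>z - w - c\<close> one may replace \<open>z\<close> by \<open>w + c\<close> in every polynomial; on the two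
  classes every quasi-polynomial is a polynomial, and \<open>ij\<close> makes the substitution respect the classes.
  Hence only the values on the line \<open>z = w + c\<close> matter.\<close>

lemma ext_reduce:
  assumes n: "n \<ge> 1" and B: "bilin n B" and K: "K \<in> qp2 n"
    and kill: "\<And>S. S \<in> qp2 n \<Longrightarrow> ext n B (\<lambda>z w. ch n i z * ch n j w * K z w * (of_int z - of_int w - of_int c) * S z w) = 0"
    and ij: "(int j - int i - c) mod int n = 0" and R: "R \<in> qp2 n" "\<And>w. R (w + c) w = 0"
  shows "ext n B (\<lambda>z w. ch n i z * ch n j w * K z w * R z w) = 0"
proof -
  define \<chi> where "\<chi> = (\<lambda>z w. ch n i z * ch n j w * K z w)"
  have \<chi>: "\<chi> \<in> qp2 n" unfolding \<chi>_def by (intro qpI K)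
  have poly: "ext n B (\<lambda>z w. \<chi> z w * (poly p (of_int z) * G w)) = ext n B (\<lambda>z w. \<chi> z w * (poly p (of_int w + of_int c) * G w))"
    if "G \<in> qp n" for p G using that
  proof (induction p arbitrary: G)
    case 0
    then show ?case by simp
  next
    case (pCons a p)
    have G2: "(\<lambda>z w. G w) \<in> qp2 n" by (intro qpI pCons)
    have pz: "(\<lambda>z w. poly p (of_int z)) \<in> qp2 n" by (rule qp2_fst) (rule qp_poly)
    have "(\<lambda>N. poly p (of_int (N + c))) \<in> qp n" by (rule qp_shift[where F = "\<lambda>N. poly p (of_int N)"]) (rule qp_poly)
    then have pw: "(\<lambda>z w. poly p (of_int w + of_int c)) \<in> qp2 n" by (intro qp2_snd) simp
    have wG: "(\<lambda>w. (of_int w + of_int c) * G w) \<in> qp n" by (intro qpI pCons)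
    have aG: "(\<lambda>z w. a * (\<chi> z w * G w)) \<in> qp2 n" by (intro qpI G2 \<chi>)
    have "ext n B (\<lambda>z w. \<chi> z w * (poly (pCons a p) (of_int z) * G w))
      = ext n B (\<lambda>z w. (a * (\<chi> z w * G w) + \<chi> z w * (poly p (of_int z) * ((of_int w + of_int c) * G w)))
          + \<chi> z w * (of_int z - of_int w - of_int c) * (poly p (of_int z) * G w))"
      by (rule arg_cong[where f = "ext n B"]) (auto simp: algebra_simps)
    also have "\<dots> = ext n B (\<lambda>z w. a * (\<chi> z w * G w) + \<chi> z w * (poly p (of_int z) * ((of_int w + of_int c) * G w)))
        + ext n B (\<lambda>z w. \<chi> z w * (of_int z - of_int w - of_int c) * (poly p (of_int z) * G w))"
      by (intro ext_add B qpI \<chi> G2 pz)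
    also have "ext n B (\<lambda>z w. \<chi> z w * (of_int z - of_int w - of_int c) * (poly p (of_int z) * G w)) = 0"
      unfolding \<chi>_def by (rule kill) (intro qpI pz G2)
    also have "ext n B (\<lambda>z w. a * (\<chi> z w * G w) + \<chi> z w * (poly p (of_int z) * ((of_int w + of_int c) * G w)))
      = ext n B (\<lambda>z w. a * (\<chi> z w * G w)) + ext n B (\<lambda>z w. \<chi> z w * (poly p (of_int z) * ((of_int w + of_int c) * G w)))"
      by (intro ext_add B qpI \<chi> G2 pz)
    also have "ext n B (\<lambda>z w. \<chi> z w * (poly p (of_int z) * ((of_int w + of_int c) * G w)))
      = ext n B (\<lambda>z w. \<chi> z w * (poly p (of_int w + of_int c) * ((of_int w + of_int c) * G w)))"
      by (rule pCons.IH[OF wG])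
    also have "ext n B (\<lambda>z w. a * (\<chi> z w * G w)) + ext n B (\<lambda>z w. \<chi> z w * (poly p (of_int w + of_int c) * ((of_int w + of_int c) * G w)))
      = ext n B (\<lambda>z w. a * (\<chi> z w * G w) + \<chi> z w * (poly p (of_int w + of_int c) * ((of_int w + of_int c) * G w)))"
      by (intro ext_add[symmetric] B qpI \<chi> G2 pw)
    also have "\<dots> = ext n B (\<lambda>z w. \<chi> z w * (poly (pCons a p) (of_int w + of_int c) * G w))"
      by (rule arg_cong[where f = "ext n B"]) (auto simp: algebra_simps)
    finally show ?case by simp
  qed
  have cl: "(w + c + int i) mod int n = 0" if "(w + int j) mod int n = 0" for w
  proof -
    have "(w + int j - (int j - int i - c)) mod int n = 0" using that ij by (metis mod_diff_eq diff_0_right mod_0)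
    then show ?thesis by (simp add: algebra_simps)
  qed
  have main: "(\<lambda>z w. R (w + c) w) \<in> qp2 n \<and> ext n B (\<lambda>z w. \<chi> z w * R z w) = ext n B (\<lambda>z w. \<chi> z w * R (w + c) w)"
    using R(1)
  proof (induction R rule: qp2.induct)
    case qp2_zero
    then show ?case using qp2.qp2_zero by simp
  next
    case (qp2_step R F G)
    have FG: "(\<lambda>z w. F z * G w) \<in> qp2 n" "(\<lambda>z w. F (w + c) * G w) \<in> qp2 n"
      by (intro qp2_mult qp2_fst qp2_snd qp_shift qp2_step)+
    have 1: "(\<lambda>z w. \<chi> z w * (F z * G w)) = (\<lambda>z w. \<chi> z w * (poly (cpoly n F i) (of_int z) * G w))"
    proof (intro HOL.ext)
      fix z w
      have "\<chi> z w * (f * G w) = (ch n i z * f) * (ch n j w * K z w * G w)" for f by (simp add: \<chi>_def)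
      then show "\<chi> z w * (F z * G w) = \<chi> z w * (poly (cpoly n F i) (of_int z) * G w)"
        by (simp only: ch_cpoly[OF n qp2_step(2)])
    qed
    have "ch n j w * F (w + c) = ch n j w * poly (cpoly n F i) (of_int w + of_int c)" for w
      using cpoly_eq[OF n qp2_step(2) cl, of w] by (auto simp: ch_def)
    then have 2: "(\<lambda>z w. \<chi> z w * (F (w + c) * G w)) = (\<lambda>z w. \<chi> z w * (poly (cpoly n F i) (of_int w + of_int c) * G w))"
    proof (intro HOL.ext)
      fix z w
      assume h: "\<And>w. ch n j w * F (w + c) = ch n j w * poly (cpoly n F i) (of_int w + of_int c)"
      have "\<chi> z w * (f * G w) = (ch n j w * f) * (ch n i z * K z w * G w)" for f by (simp add: \<chi>_def)
      then show "\<chi> z w * (F (w + c) * G w) = \<chi> z w * (poly (cpoly n F i) (of_int w + of_int c) * G w)"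
        by (simp only: h)
    qed
    have "ext n B (\<lambda>z w. \<chi> z w * R z w + \<chi> z w * (F z * G w)) = ext n B (\<lambda>z w. \<chi> z w * R z w) + ext n B (\<lambda>z w. \<chi> z w * (F z * G w))"
      by (intro ext_add B qpI \<chi> FG qp2_step)
    moreover have "ext n B (\<lambda>z w. \<chi> z w * R (w + c) w + \<chi> z w * (F (w + c) * G w)) = ext n B (\<lambda>z w. \<chi> z w * R (w + c) w) + ext n B (\<lambda>z w. \<chi> z w * (F (w + c) * G w))"
      by (intro ext_add B qp2_mult \<chi> FG qp2_step.IH[THEN conjunct1])
    ultimately show ?case using qp2_step.IH FG poly[OF qp2_step(3)] 1 2 by (auto simp: distrib_left intro: qp2_add)
  qed
  then show ?thesis using R(2) by (simp add: \<chi>_def ext_zero[OF B])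
qed


section \<open>One half of the algebra\<close>

text \<open>The relations of the generators of one sign at \<open>\<beta> = 1\<close>, together with what is used of the opposite sign \<open>y\<close>
  and of the Cartan elements \<open>h\<close>, and a homomorphism \<open>\<Theta>\<close> to a model in which \<open>t d F\<close> stands for \<open>F \<tau>\<^sup>d\<close>. In
  generating functions, \<open>quad\<close> says that \<open>[e(z), e(w)]\<close> is supported on \<open>z - w = \<plusminus> 1\<close>, and \<open>above\<close> and \<open>below\<close>
  remove one of these lines when it does not meet the classes \<open>i\<close> and \<open>j\<close>.\<close>

locale half =
  fixes n :: nat and x y h :: "nat \<Rightarrow> nat \<Rightarrow> 'v::clie"
    and \<Theta> :: "'v \<Rightarrow> 'w::clie" and t :: "nat \<Rightarrow> (int \<Rightarrow> complex) \<Rightarrow> 'w"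
  assumes n1: "n \<ge> 1"
    and quad: "\<lbrakk>i < n; j < n\<rbrakk> \<Longrightarrow> br (x i (r + 2)) (x j s) - 2 *\<^sub>C br (x i (r + 1)) (x j (s + 1)) + br (x i r) (x j (s + 2)) = br (x i r) (x j s)"
    and above: "\<lbrakk>i < n; j < n; \<not> [int j = int i + 1] (mod int n)\<rbrakk> \<Longrightarrow> br (x i (r + 1)) (x j s) - br (x i r) (x j (s + 1)) + br (x i r) (x j s) = 0"
    and below: "\<lbrakk>i < n; j < n; \<not> [int j = int i - 1] (mod int n)\<rbrakk> \<Longrightarrow> br (x i (r + 1)) (x j s) - br (x i r) (x j (s + 1)) - br (x i r) (x j s) = 0"
    and serre_n: "\<lbrakk>n > 2; i < n; j < n; [int j = int i + 1] (mod int n) \<or> [int j = int i - 1] (mod int n)\<rbrakk> \<Longrightarrow>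
      br (x i p) (br (x i q) (x j s)) = 0"
    and serre2: "\<lbrakk>n = 2; i < n; j < n; i \<noteq> j\<rbrakk> \<Longrightarrow> br (x i p) (br (x i q) (br (x i r) (x j s))) = 0"
    and serre1: "n = 1 \<Longrightarrow>
      br (x 0 p) (br (x 0 q) (x 0 (r + 1))) + br (x 0 p) (br (x 0 r) (x 0 (q + 1)))
      + br (x 0 q) (br (x 0 p) (x 0 (r + 1))) + br (x 0 q) (br (x 0 r) (x 0 (p + 1)))
      + br (x 0 r) (br (x 0 p) (x 0 (q + 1))) + br (x 0 r) (br (x 0 q) (x 0 (p + 1))) = 0"
    and xy: "\<lbrakk>i < n; j < n\<rbrakk> \<Longrightarrow> br (x i r) (y j s) = (if i = j then h i (r + s) else 0)"
    and hx: "\<lbrakk>i < n; j < n\<rbrakk> \<Longrightarrow> \<exists>p. br (h i r) (x j s) = px x j p"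
    and hx2: "\<lbrakk>n = 2; i < n; j < n\<rbrakk> \<Longrightarrow> br (h i 0) (x j s) = (if i = j then 2 else -2) *\<^sub>C x j s"
    and hom: "clie_hom \<Theta>"
    and \<Theta>_x: "i < n \<Longrightarrow> \<Theta> (x i r) = t 1 (\<lambda>N. ch n i N * of_int N ^ r)"
    and t_lin: "lin_on UNIV (t d)"
    and t_inj: "t d F = 0 \<Longrightarrow> F = (\<lambda>N. 0)"
    and t_br: "d \<ge> 1 \<Longrightarrow> br (t 1 F) (t d G) = t (Suc d) (\<lambda>N. F N * G (N - 1) - G N * F (N - int d))"
begin

abbreviation e where "e \<equiv> gen n x"

lemma e_lin: "lin_on (qp n) e" by (rule gen_lin[OF n1])

text \<open>In the model, \<open>((N + d) H, 1)\<close> and \<open>(H, N)\<close> inserted for \<open>(F, G)\<close> in \<open>F N * G (N - 1) - G N * F (N - d)\<close>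
  give two functions whose difference is \<open>(d + 1) H\<close>. This determines what the element of degree \<open>d + 1\<close>
  over \<open>H \<tau>\<^sup>d\<^sup>+\<^sup>1\<close> has to be.\<close>

fun ed :: "nat \<Rightarrow> (int \<Rightarrow> complex) \<Rightarrow> 'v" where
  "ed 0 H = 0"
| "ed (Suc 0) H = e H"
| "ed (Suc (Suc d)) H = (1 / of_nat (d + 2)) *\<^sub>C
    (br (e (\<lambda>N. (of_int N + of_nat (d + 1)) * H N)) (ed (Suc d) (\<lambda>N. 1)) - br (e H) (ed (Suc d) of_int))"

definition be :: "nat \<Rightarrow> (int \<Rightarrow> complex) \<Rightarrow> (int \<Rightarrow> complex) \<Rightarrow> 'v" where
  "be d F G = br (e F) (ed d G)"

abbreviation \<Phi> where "\<Phi> d \<equiv> ext n (be d)"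

lemma ed_lin: "lin_on (qp n) (ed d)"
proof -
  consider (1) "d = 0" | (2) "d = Suc 0" | (3) d' where "d = Suc (Suc d')"
    by (metis not0_implies_Suc)
  then show ?thesis
  proof cases
  case 1
  then show ?thesis by (simp add: lin_on_def)
next
  case 2
  then show ?thesis using e_lin by (simp add: lin_on_def)
next
  case (3 d')
  have q: "F \<in> qp n \<Longrightarrow> (\<lambda>N. (of_int N + of_nat (d' + 1)) * F N) \<in> qp n" for F by (intro qpI)
  have a: "(\<lambda>N. (of_int N + of_nat (d' + 1)) * (F N + G N)) = (\<lambda>N. (of_int N + of_nat (d' + 1)) * F N + (of_int N + of_nat (d' + 1)) * G N)" for F G :: "int \<Rightarrow> complex"
    by (auto simp: algebra_simps)
  have c: "(\<lambda>N. (of_int N + of_nat (d' + 1)) * (c * F N)) = (\<lambda>N. c * ((of_int N + of_nat (d' + 1)) * F N))" for F :: "int \<Rightarrow> complex" and c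
    by (auto simp: algebra_simps)
  show ?thesis unfolding 3 lin_on_def ed.simps a c
    by (auto simp only: lin_onD[OF e_lin] q br_linear csc_linear csc_csc intro!: arg_cong[where f = "csc _"])
       (simp_all add: algebra_simps csc_linear)
  qed
qed

lemma be_bilin: "bilin n (be d)"
  unfolding bilin_def be_def lin_on_def
  by (simp add: lin_onD[OF e_lin] lin_onD[OF ed_lin] br_linear)

lemma bilin_ed: "bilin n (\<lambda>F G. br (ed c F) (ed d G))"
  unfolding bilin_def be_def lin_on_def
  by (simp add: lin_onD[OF ed_lin] br_linear)

text \<open>\<open>mult_ok\<close> is the bracket rule of the model. Its reformulation \<open>string_ok\<close> concerns the pairs
  \<open>(z, w)\<close> for which the matrix units \<open>(z, z - 1)\<close> and \<open>(w, w - d)\<close> can be composed: these are \<open>(N, N - 1)\<close> and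
  \<open>(N - d, N)\<close>, and both products are supported in the position \<open>(N, N - d - 1)\<close>.\<close>

definition mult_ok :: "nat \<Rightarrow> bool" where
  "mult_ok d \<longleftrightarrow> (\<forall>F\<in>qp n. \<forall>G\<in>qp n. br (e F) (ed d G) = ed (Suc d) (\<lambda>N. F N * G (N - 1) - G N * F (N - int d)))"

definition string_ok :: "nat \<Rightarrow> bool" where
  "string_ok d \<longleftrightarrow> (\<forall>R\<in>qp2 n. (\<forall>N. R N (N - 1) = R (N - int d) N) \<longrightarrow> \<Phi> d R = 0)"

lemma of_nat_d2: "of_nat (d + 2) \<noteq> (0::complex)"
  by (simp only: of_nat_eq_0_iff)

text \<open>Subtracting from \<open>F z * G w\<close> the tensor that defines \<open>ed\<close> of the expected result leaves a function \<open>R\<close>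
  to which \<open>string_ok\<close> applies.\<close>

lemma mult_okI: assumes "string_ok (Suc d)" shows "mult_ok (Suc d)"
  unfolding mult_ok_def
proof (intro ballI)
  fix F G assume FG: "F \<in> qp n" "G \<in> qp n"
  define H where "H = (\<lambda>N. F N * G (N - 1) - G N * F (N - int (Suc d)))"
  have H: "H \<in> qp n" unfolding H_def by (intro qp_diff qp_mult FG qp_shift')
  have zH: "(\<lambda>N. (of_int N + of_nat (d + 1)) * H N) \<in> qp n" by (intro qpI H)
  define c :: complex where "c = 1 / of_nat (d + 2)"
  define R where "R = (\<lambda>z w. F z * G w - c * ((of_int z + of_nat (d + 1)) * H z * 1 - H z * of_int w))"
  have pure: "(\<lambda>z w. F z * G w) \<in> qp2 n" "(\<lambda>z w. (of_int z + of_nat (d + 1)) * H z * 1) \<in> qp2 n" "(\<lambda>z w. H z * of_int w) \<in> qp2 n"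
    by (intro qpI FG H)+
  have R: "R \<in> qp2 n" unfolding R_def by (intro qp2_diff qp2_mult qp2_const pure)
  have c: "c * of_nat (d + 2) = 1" unfolding c_def using of_nat_d2[of d] by (simp del: of_nat_add)
  have "R N (N - 1) = R (N - int (Suc d)) N" for N
  proof -
    have "R N (N - 1) = F N * G (N - 1) - (c * of_nat (d + 2)) * H N" by (simp add: R_def algebra_simps)
    also have "\<dots> = G N * F (N - int (Suc d))" unfolding c by (simp add: H_def)
    also have "\<dots> = R (N - int (Suc d)) N" by (simp add: R_def algebra_simps)
    finally show ?thesis .
  qed
  then have "\<Phi> (Suc d) R = 0" using assms R unfolding string_ok_def by blast
  moreover have "\<Phi> (Suc d) R = be (Suc d) F G - c *\<^sub>C (be (Suc d) (\<lambda>N. (of_int N + of_nat (d + 1)) * H N) (\<lambda>N. 1) - be (Suc d) H of_int)"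
    unfolding R_def
    by (simp only: ext_diff[OF be_bilin] ext_scale[OF be_bilin] ext_pure[OF be_bilin] pure qp2_diff qp2_mult qp2_const FG H zH qp_id qp_const)
  ultimately show "br (e F) (ed (Suc d) G) = ed (Suc (Suc d)) (\<lambda>N. F N * G (N - 1) - G N * F (N - int (Suc d)))"
    unfolding H_def[symmetric] by (simp add: be_def c_def)
qed

lemma \<Theta>_lin [simp]: "\<Theta> (u + v) = \<Theta> u + \<Theta> v" "\<Theta> (c *\<^sub>C u) = c *\<^sub>C \<Theta> u" "\<Theta> (br u v) = br (\<Theta> u) (\<Theta> v)"
    "\<Theta> 0 = 0" "\<Theta> (- u) = - \<Theta> u" "\<Theta> (u - v) = \<Theta> u - \<Theta> v"
  by (fact clie_homD[OF hom])+

lemma \<Theta>_sum: "\<Theta> (sum f A) = (\<Sum>a\<in>A. \<Theta> (f a))"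
  by (induction A rule: infinite_finite_induct) auto

lemma t_sum: "t d (\<lambda>N. \<Sum>a\<in>A. c a * F a N) = (\<Sum>a\<in>A. c a *\<^sub>C t d (F a))"
  by (induction A rule: infinite_finite_induct) (auto simp: lin_onD[OF t_lin] lin_onD(3)[OF t_lin, of undefined])

lemma \<Theta>_px: assumes "i < n" shows "\<Theta> (px x i p) = t 1 (\<lambda>N. ch n i N * poly p (of_int N))"
proof -
  have "\<Theta> (px x i p) = (\<Sum>k\<le>degree p. poly.coeff p k *\<^sub>C t 1 (\<lambda>N. ch n i N * of_int N ^ k))"
    by (simp add: px_def \<Theta>_sum \<Theta>_x[OF assms])
  also have "\<dots> = t 1 (\<lambda>N. \<Sum>k\<le>degree p. poly.coeff p k * (ch n i N * of_int N ^ k))"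
    by (simp only: t_sum)
  finally show ?thesis by (simp add: poly_altdef sum_distrib_left mult_ac)
qed

lemma \<Theta>_e: assumes "F \<in> qp n" shows "\<Theta> (e F) = t 1 F"
proof -
  have "\<Theta> (e F) = (\<Sum>i<n. 1 *\<^sub>C t 1 (\<lambda>N. ch n i N * poly (cpoly n F i) (of_int N)))"
    unfolding gen_def \<Theta>_sum by (rule sum.cong) (simp_all add: \<Theta>_px)
  also have "\<dots> = (\<Sum>i<n. 1 *\<^sub>C t 1 (\<lambda>N. ch n i N * F N))"
    by (simp only: ch_cpoly[OF n1 assms, symmetric])
  also have "\<dots> = t 1 (\<lambda>N. \<Sum>i<n. 1 * (ch n i N * F N))"
    by (simp only: t_sum)
  finally show ?thesis by (simp add: sum_distrib_right[symmetric] sum_ch[OF n1])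
qed

lemma t_lin' [simp]: "t d (\<lambda>N. F N + G N) = t d F + t d G" "t d (\<lambda>N. c * F N) = c *\<^sub>C t d F" "t d (\<lambda>N. 0) = 0"
  "t d (\<lambda>N. - F N) = - t d F" "t d (\<lambda>N. F N - G N) = t d F - t d G"
proof -
  show 1: "t d (\<lambda>N. F N + G N) = t d F + t d G" "t d (\<lambda>N. c * F N) = c *\<^sub>C t d F" "t d (\<lambda>N. 0) = 0" for F G c
    using lin_onD[OF t_lin] by auto
  show 2: "t d (\<lambda>N. - F N) = - t d F" for F using 1(2)[of "-1" F] by simp
  show "t d (\<lambda>N. F N - G N) = t d F - t d G" using 1(1)[of F "\<lambda>N. - G N"] 2[of G] by simp
qed

lemma \<Theta>_ed: "F \<in> qp n \<Longrightarrow> \<Theta> (ed (Suc d) F) = t (Suc d) F"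
proof (induction d arbitrary: F)
  case 0
  then show ?case using \<Theta>_e by simp
next
  case (Suc d)
  have q: "(\<lambda>N. (of_int N + of_nat (d + 1)) * F N) \<in> qp n" by (intro qpI Suc)
  have c: "(1 / of_nat (d + 2)) * of_nat (d + 2) = (1::complex)" using of_nat_d2[of d] by (simp del: of_nat_add)
  have tb: "br (t 1 F) (t (Suc d) G) = t (Suc (Suc d)) (\<lambda>N. F N * G (N - 1) - G N * F (N - int (Suc d)))" for F G
    by (rule t_br) simp
  have "\<Theta> (ed (Suc (Suc d)) F) = (1 / of_nat (d + 2)) *\<^sub>C
     (br (t 1 (\<lambda>N. (of_int N + of_nat (d + 1)) * F N)) (t (Suc d) (\<lambda>N. 1)) - br (t 1 F) (t (Suc d) of_int))"
    by (simp only: ed.simps \<Theta>_lin \<Theta>_e[OF q] \<Theta>_e[OF Suc.prems] Suc.IH[OF qp_const] Suc.IH[OF qp_id])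
  also have "\<dots> = t (Suc (Suc d)) (\<lambda>N. (1 / of_nat (d + 2)) * (((of_int N + of_nat (d + 1)) * F N * 1 - 1 * ((of_int (N - int (Suc d)) + of_nat (d + 1)) * F (N - int (Suc d))))
      - (F N * of_int (N - 1) - of_int N * F (N - int (Suc d)))))"
    by (simp only: tb t_lin')
  also have "(\<lambda>N. (1 / of_nat (d + 2)) * (((of_int N + of_nat (d + 1)) * F N * 1 - 1 * ((of_int (N - int (Suc d)) + of_nat (d + 1)) * F (N - int (Suc d))))
      - (F N * of_int (N - 1) - of_int N * F (N - int (Suc d))))) = (\<lambda>N. ((1 / of_nat (d + 2)) * of_nat (d + 2)) * F N)"
  proof (rule HOL.ext)
    have "c * (((of_int N + of_nat (d + 1)) * F N * 1 - 1 * ((of_int (N - int (Suc d)) + of_nat (d + 1)) * F (N - int (Suc d))))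
      - (F N * of_int (N - 1) - of_int N * F (N - int (Suc d)))) = (c * of_nat (d + 2)) * F N" for c :: complex and N
      by (simp add: algebra_simps)
    then show "(1 / of_nat (d + 2)) * (((of_int N + of_nat (d + 1)) * F N * 1 - 1 * ((of_int (N - int (Suc d)) + of_nat (d + 1)) * F (N - int (Suc d))))
      - (F N * of_int (N - 1) - of_int N * F (N - int (Suc d)))) = ((1 / of_nat (d + 2)) * of_nat (d + 2)) * F N" for N
      by blast
  qed
  finally show ?case unfolding c by simp
qed

lemma \<Theta>_ext:
  assumes "R \<in> qp2 n"
  shows "\<Theta> (\<Phi> (Suc d) R) = t (Suc (Suc d)) (\<lambda>N. R N (N - 1) - R (N - int (Suc d)) N)"
  using assms
proof (induction R rule: qp2.induct)
  case qp2_zero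
  then show ?case by (simp add: ext_zero[OF be_bilin])
next
  case (qp2_step R F G)
  have eq: "(\<lambda>N. (R N (N - 1) + F N * G (N - 1)) - (R (N - int (Suc d)) N + F (N - int (Suc d)) * G N))
        = (\<lambda>N. (R N (N - 1) - R (N - int (Suc d)) N) + (F N * G (N - 1) - G N * F (N - int (Suc d))))"
    by (auto simp: algebra_simps)
  show ?case
    unfolding eq ext_step[OF be_bilin qp2_step(1,2,3)] t_lin'(1)
    using qp2_step t_br[of "Suc d" F G] by (simp add: be_def[of "Suc d" F G] \<Theta>_e \<Theta>_ed)
qed

subsection \<open>Degree two\<close>

lemma be1_monom:
  assumes "i < n" "j < n" "F \<in> qp n" "G \<in> qp n"
  shows "be 1 (\<lambda>N. ch n i N * (of_int N ^ a * F N)) (\<lambda>N. ch n j N * (of_int N ^ b * G N))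
    = (\<Sum>k\<le>degree (cpoly n F i). \<Sum>l\<le>degree (cpoly n G j).
        (poly.coeff (cpoly n F i) k * poly.coeff (cpoly n G j) l) *\<^sub>C br (x i (k + a)) (x j (l + b)))"
  by (simp add: be_def gen_ch[OF n1] assms px_monom_mult br_linear csc_linear) (subst sum.swap, simp add: mult.commute)

lemma ch_monom_qp: "F \<in> qp n \<Longrightarrow> (\<lambda>N. ch n i N * (of_int N ^ a * F N)) \<in> qp n"
  by (intro qpI)

lemma ch_monom_qp2:
  assumes "F \<in> qp n" "G \<in> qp n"
  shows "(\<lambda>z w. (ch n i z * (of_int z ^ a * F z)) * (ch n j w * (of_int w ^ b * G w))) \<in> qp2 n"
  by (intro qp2_mult qp2_fst qp2_snd qpI assms)

text \<open>On products of monomials this is the quadratic relation; everything is linear in \<open>S\<close>.\<close>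

lemma quad_ext:
  assumes "i < n" "j < n" "S \<in> qp2 n"
  shows "\<Phi> 1 (\<lambda>z w. ch n i z * ch n j w * ((of_int z - of_int w)\<^sup>2 - 1) * S z w) = 0"
  using assms(3)
proof (induction S rule: qp2.induct)
  case qp2_zero
  then show ?case by (simp add: ext_zero[OF be_bilin])
next
  case (qp2_step S F G)
  define m where "m a b = (\<lambda>z w. (ch n i z * (of_int z ^ a * F z)) * (ch n j w * (of_int w ^ b * G w)))" for a b
  have m: "m a b \<in> qp2 n" for a b unfolding m_def by (rule ch_monom_qp2) (rule qp2_step)+
  have \<Phi>m: "\<Phi> 1 (m a b) = be 1 (\<lambda>N. ch n i N * (of_int N ^ a * F N)) (\<lambda>N. ch n j N * (of_int N ^ b * G N))" for a b
    unfolding m_def by (intro ext_pure be_bilin ch_monom_qp qp2_step)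
  have "(\<lambda>z w. ch n i z * ch n j w * ((of_int z - of_int w)\<^sup>2 - 1) * (S z w + F z * G w))
    = (\<lambda>z w. ch n i z * ch n j w * ((of_int z - of_int w)\<^sup>2 - 1) * S z w + (m 2 0 z w - 2 * m 1 1 z w + m 0 2 z w - m 0 0 z w))"
    by (auto simp: m_def algebra_simps power2_eq_square)
  moreover have "\<Phi> 1 (\<lambda>z w. ch n i z * ch n j w * ((of_int z - of_int w)\<^sup>2 - 1) * S z w + (m 2 0 z w - 2 * m 1 1 z w + m 0 2 z w - m 0 0 z w))
      = \<Phi> 1 (\<lambda>z w. ch n i z * ch n j w * ((of_int z - of_int w)\<^sup>2 - 1) * S z w) + \<Phi> 1 (\<lambda>z w. m 2 0 z w - 2 * m 1 1 z w + m 0 2 z w - m 0 0 z w)"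
    by (intro ext_add[OF be_bilin] qpI m qp2_step)
  moreover have "\<Phi> 1 (\<lambda>z w. m 2 0 z w - 2 * m 1 1 z w + m 0 2 z w - m 0 0 z w) = \<Phi> 1 (m 2 0) - 2 *\<^sub>C \<Phi> 1 (m 1 1) + \<Phi> 1 (m 0 2) - \<Phi> 1 (m 0 0)"
    by (simp only: ext_add[OF be_bilin] ext_diff[OF be_bilin] ext_scale[OF be_bilin] m qp2_add qp2_diff qp2_mult qp2_const)
  moreover have "\<dots> = 0"
  proof -
    have cq: "c *\<^sub>C br (x i (k + 2)) (x j (l + 0)) - 2 *\<^sub>C c *\<^sub>C br (x i (k + 1)) (x j (l + 1))
        + c *\<^sub>C br (x i (k + 0)) (x j (l + 2)) - c *\<^sub>C br (x i (k + 0)) (x j (l + 0)) = 0" for c k l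
    proof -
      have "c *\<^sub>C br (x i (k + 2)) (x j (l + 0)) - 2 *\<^sub>C c *\<^sub>C br (x i (k + 1)) (x j (l + 1))
        + c *\<^sub>C br (x i (k + 0)) (x j (l + 2)) - c *\<^sub>C br (x i (k + 0)) (x j (l + 0))
        = c *\<^sub>C ((br (x i (k + 2)) (x j l) - 2 *\<^sub>C br (x i (k + 1)) (x j (l + 1)) + br (x i k) (x j (l + 2))) - br (x i k) (x j l))"
        by (simp add: csc_linear mult.commute)
      then show ?thesis by (simp only: quad[OF assms(1,2)]) simp
    qed
    show ?thesis unfolding \<Phi>m be1_monom[OF assms(1,2) qp2_step(2,3)] csc_linear
        sum_subtractf[symmetric] sum.distrib[symmetric]
      by (intro sum.neutral ballI) (rule cq)
  qed
  ultimately show ?case using qp2_step.IH by simp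
qed

lemma above_below_ext:
  assumes "i < n" "j < n" "S \<in> qp2 n" "c = 1 \<or> c = -1" "\<not> [int j = int i + c] (mod int n)"
  shows "\<Phi> 1 (\<lambda>z w. ch n i z * ch n j w * (of_int z - of_int w + of_int c) * S z w) = 0"
  using assms(3)
proof (induction S rule: qp2.induct)
  case qp2_zero
  then show ?case by (simp add: ext_zero[OF be_bilin])
next
  case (qp2_step S F G)
  define m where "m a b = (\<lambda>z w. (ch n i z * (of_int z ^ a * F z)) * (ch n j w * (of_int w ^ b * G w)))" for a b
  have m: "m a b \<in> qp2 n" for a b unfolding m_def by (rule ch_monom_qp2) (rule qp2_step)+
  have \<Phi>m: "\<Phi> 1 (m a b) = be 1 (\<lambda>N. ch n i N * (of_int N ^ a * F N)) (\<lambda>N. ch n j N * (of_int N ^ b * G N))" for a b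
    unfolding m_def by (intro ext_pure be_bilin ch_monom_qp qp2_step)
  have "(\<lambda>z w. ch n i z * ch n j w * (of_int z - of_int w + of_int c) * (S z w + F z * G w))
    = (\<lambda>z w. ch n i z * ch n j w * (of_int z - of_int w + of_int c) * S z w + (m 1 0 z w - m 0 1 z w + of_int c * m 0 0 z w))"
    by (auto simp: m_def algebra_simps)
  moreover have "\<Phi> 1 (\<lambda>z w. ch n i z * ch n j w * (of_int z - of_int w + of_int c) * S z w + (m 1 0 z w - m 0 1 z w + of_int c * m 0 0 z w))
      = \<Phi> 1 (\<lambda>z w. ch n i z * ch n j w * (of_int z - of_int w + of_int c) * S z w) + \<Phi> 1 (\<lambda>z w. m 1 0 z w - m 0 1 z w + of_int c * m 0 0 z w)"
    by (intro ext_add[OF be_bilin] qpI m qp2_step)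
  moreover have "\<Phi> 1 (\<lambda>z w. m 1 0 z w - m 0 1 z w + of_int c * m 0 0 z w) = \<Phi> 1 (m 1 0) - \<Phi> 1 (m 0 1) + of_int c *\<^sub>C \<Phi> 1 (m 0 0)"
    by (simp only: ext_add[OF be_bilin] ext_diff[OF be_bilin] ext_scale[OF be_bilin] m qp2_add qp2_diff qp2_mult qp2_const)
  moreover have "\<dots> = 0"
  proof -
    have cq: "b *\<^sub>C br (x i (k + 1)) (x j (l + 0)) - b *\<^sub>C br (x i (k + 0)) (x j (l + 1))
        + of_int c *\<^sub>C b *\<^sub>C br (x i (k + 0)) (x j (l + 0)) = 0" for b k l
    proof -
      have "b *\<^sub>C br (x i (k + 1)) (x j (l + 0)) - b *\<^sub>C br (x i (k + 0)) (x j (l + 1))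
        + of_int c *\<^sub>C b *\<^sub>C br (x i (k + 0)) (x j (l + 0))
        = b *\<^sub>C (br (x i (k + 1)) (x j l) - br (x i k) (x j (l + 1)) + of_int c *\<^sub>C br (x i k) (x j l))"
        by (simp add: csc_linear mult.commute)
      also have "br (x i (k + 1)) (x j l) - br (x i k) (x j (l + 1)) + of_int c *\<^sub>C br (x i k) (x j l) = 0"
        using assms(4,5) above[OF assms(1,2), of k l] below[OF assms(1,2), of k l] by (auto simp: clie.scale_minus_left)
      finally show ?thesis by simp
    qed
    show ?thesis unfolding \<Phi>m be1_monom[OF assms(1,2) qp2_step(2,3)] csc_linear
        sum_subtractf[symmetric] sum.distrib[symmetric]
      by (intro sum.neutral ballI) (rule cq)
  qed
  ultimately show ?case using qp2_step.IH by simp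
qed

text \<open>For each of \<open>c = 1\<close> and \<open>c = -1\<close>, multiplication by \<open>z - w + c\<close> kills functions vanishing on the line
  \<open>z = w + c\<close>: if the line meets the classes \<open>i\<close> and \<open>j\<close>, by reduction modulo the quadratic relation,
  and otherwise by the linear one. The two factors differ by the unit \<open>2\<close>.\<close>

lemma ext_neighbours:
  assumes R: "R \<in> qp2 n" "\<And>w. R (w + 1) w = 0" "\<And>w. R (w - 1) w = 0"
  shows "\<Phi> 1 R = 0"
proof (rule ext_by_classes[OF n1 be_bilin R(1)])
  fix i j assume ij: "i < n" "j < n"
  have key: "\<Phi> 1 (\<lambda>z w. ch n i z * ch n j w * (of_int z - of_int w + of_int c) * R z w) = 0" if c: "c = 1 \<or> c = -1" for c
  proof (cases "[int j = int i + c] (mod int n)")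
    case True
    show ?thesis
    proof (rule ext_reduce[OF n1 be_bilin])
      show "(int j - int i - c) mod int n = 0"
        using True unfolding cong_def by (metis cong_def cong_diff_iff_cong_0 diff_diff_eq mod_0)
      show "R (w + c) w = 0" for w using c R by auto
      fix S assume S: "S \<in> qp2 n"
      have "(\<lambda>z w. ch n i z * ch n j w * (of_int z - of_int w + of_int c) * (of_int z - of_int w - of_int c) * S z w)
         = (\<lambda>z w. ch n i z * ch n j w * ((of_int z - of_int w)\<^sup>2 - 1) * S z w)"
        using c by (auto simp: algebra_simps power2_eq_square)
      then show "\<Phi> 1 (\<lambda>z w. ch n i z * ch n j w * (of_int z - of_int w + of_int c) * (of_int z - of_int w - of_int c) * S z w) = 0"
        using quad_ext[OF ij S] by simp
    qed (intro qpI R)+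
  next
    case False
    then show ?thesis using above_below_ext[OF ij R(1) c] by simp
  qed
  have q: "(\<lambda>z w. ch n i z * ch n j w * (of_int z - of_int w + of_int c) * R z w) \<in> qp2 n" for c :: int
    by (intro qpI R)
  have "(\<lambda>z w. ch n i z * ch n j w * R z w) = (\<lambda>z w. (1/2) * (ch n i z * ch n j w * (of_int z - of_int w + of_int 1) * R z w
      - ch n i z * ch n j w * (of_int z - of_int w + of_int (-1)) * R z w))"
    by (auto simp: field_simps)
  then show "\<Phi> 1 (\<lambda>z w. ch n i z * ch n j w * R z w) = 0"
    using key[of 1] key[of "-1"] by (simp only: ext_scale[OF be_bilin] ext_diff[OF be_bilin] q qp2_diff) simp
qed

lemma ext_be1_swap: "R \<in> qp2 n \<Longrightarrow> \<Phi> 1 (\<lambda>z w. R w z) = - \<Phi> 1 R"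
proof (induction R rule: qp2.induct)
  case qp2_zero
  then show ?case by (simp add: ext_zero[OF be_bilin])
next
  case (qp2_step R F G)
  have "(\<lambda>z w. R w z + F w * G z) = (\<lambda>z w. R w z + G z * F w)" by (simp add: mult.commute)
  then show ?case
    using qp2_step ext_step[OF be_bilin qp2_swap[OF qp2_step(1)] qp2_step(3,2), of 1] ext_step[OF be_bilin qp2_step(1,2,3), of 1]
      br_anti[of "e F" "e G"]
    by (simp add: be_def[of "Suc 0" F G] be_def[of "Suc 0" G F])
qed

text \<open>\<open>R z w - R w z\<close> vanishes at neighbouring points, and \<open>\<Phi> 1\<close> is antisymmetric.\<close>

lemma string_ok_1: "string_ok 1"
  unfolding string_ok_def
proof (intro ballI impI)
  fix R assume R: "R \<in> qp2 n" and eq: "\<forall>N. R N (N - 1) = R (N - int 1) N"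
  have R': "(\<lambda>z w. R w z) \<in> qp2 n" by (rule qp2_swap[OF R])
  have "\<Phi> 1 (\<lambda>z w. R z w - R w z) = 0"
  proof (rule ext_neighbours)
    show "R (w + 1) w - R w (w + 1) = 0" for w using eq[rule_format, of "w + 1"] by simp
    show "R (w - 1) w - R w (w - 1) = 0" for w using eq[rule_format, of w] by simp
  qed (intro qp2_diff R R')
  then have "2 *\<^sub>C \<Phi> 1 R = 0"
    unfolding ext_diff[OF be_bilin R R', of 1] ext_be1_swap[OF R]
    using csc_add_left[of 1 1 "\<Phi> 1 R"] by simp
  then show "\<Phi> 1 R = 0" by (simp add: clie.scale_eq_0_iff)
qed

lemma mult_ok_1: "mult_ok 1"
  using mult_okI[of 0] string_ok_1 by simp

subsection \<open>The Jacobi identity\<close>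

text \<open>The Jacobi identity for \<open>e F\<close>, \<open>e G\<close> and \<open>ed (d - 1) H\<close> is linear in each argument and so is a statement about
  functions \<open>P\<close> of three variables. Evaluating the inner brackets by \<open>mult_ok\<close> turns
  \<open>[e F, [e G, ed H]] - [e G, [e F, ed H]]\<close> into \<open>\<Phi> d\<close> of \<open>jac_left\<close>, and \<open>[[e F, e G], ed H]\<close> into the extension of
  \<open>[ed 2, ed (d - 1)]\<close> to \<open>jac_right\<close>.\<close>

definition jac_left :: "nat \<Rightarrow> (int \<Rightarrow> int \<Rightarrow> int \<Rightarrow> complex) \<Rightarrow> int \<Rightarrow> int \<Rightarrow> complex" where
  "jac_left d P = (\<lambda>z w. P z w (w - 1) - P z (w - int d + 1) w - P w z (w - 1) + P (w - int d + 1) z w)"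

definition jac_right :: "(int \<Rightarrow> int \<Rightarrow> int \<Rightarrow> complex) \<Rightarrow> int \<Rightarrow> int \<Rightarrow> complex" where
  "jac_right P = (\<lambda>N u. P N (N - 1) u - P (N - 1) N u)"

lemma jac_left_qp2: assumes "P \<in> qp3 n" shows "jac_left d P \<in> qp2 n"
  unfolding jac_left_def
  by (intro qp2_add qp2_diff qp3_subst_qp2[OF assms] qps)

lemma jac_right_qp2: assumes "P \<in> qp3 n" shows "jac_right P \<in> qp2 n"
  unfolding jac_right_def
  by (intro qp2_add qp2_diff qp3_subst_qp2[OF assms] qps)

lemma jacobi_ext:
  assumes d: "mult_ok (Suc d)" and P: "P \<in> qp3 n"
  shows "\<Phi> (Suc (Suc d)) (jac_left (Suc (Suc d)) P) = ext n (\<lambda>F G. br (ed 2 F) (ed (Suc d) G)) (jac_right P)"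
  using P
proof (induction P rule: qp3.induct)
  case qp3_zero
  then show ?case by (simp add: jac_left_def jac_right_def ext_zero[OF be_bilin] ext_zero[OF bilin_ed])
next
  case (qp3_step P F G H)
  let ?D = "Suc (Suc d)"
  define A1 where "A1 = (\<lambda>w. G w * H (w - 1) - H w * G (w - int (Suc d)))"
  define A2 where "A2 = (\<lambda>w. F w * H (w - 1) - H w * F (w - int (Suc d)))"
  define C where "C = (\<lambda>N. F N * G (N - 1) - G N * F (N - int 1))"
  have q: "A1 \<in> qp n" "A2 \<in> qp n" "C \<in> qp n"
    unfolding A1_def A2_def C_def by (intro qp_diff qp_mult qp3_step qp_shift')+
  have l: "jac_left ?D (\<lambda>x y z. P x y z + F x * G y * H z) = (\<lambda>z w. (jac_left ?D P z w + F z * A1 w) - G z * A2 w)"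
    by (intro HOL.ext) (simp add: jac_left_def A1_def A2_def algebra_simps)
  have r: "jac_right (\<lambda>x y z. P x y z + F x * G y * H z) = (\<lambda>z w. jac_right P z w + C z * H w)"
    by (intro HOL.ext) (simp add: jac_right_def C_def algebra_simps)
  have e1: "br (e G) (ed (Suc d) H) = ed ?D A1" "br (e F) (ed (Suc d) H) = ed ?D A2" "br (e F) (e G) = ed 2 C"
    using d mult_ok_1 qp3_step unfolding mult_ok_def A1_def A2_def C_def by (simp_all add: numeral_2_eq_2)
  have "\<Phi> ?D (jac_left ?D (\<lambda>x y z. P x y z + F x * G y * H z)) = \<Phi> ?D (jac_left ?D P) + be ?D F A1 - be ?D G A2"
    unfolding l
    using ext_diff[OF be_bilin qp2_step[OF jac_left_qp2[OF qp3_step(1)] qp3_step(2) q(1)] qp2_pure[OF qp3_step(3) q(2)]]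
      ext_step[OF be_bilin jac_left_qp2[OF qp3_step(1)] qp3_step(2) q(1)] ext_pure[OF be_bilin qp3_step(3) q(2)]
    by simp
  moreover have "be ?D F A1 - be ?D G A2 = br (ed 2 C) (ed (Suc d) H)"
    unfolding be_def e1[symmetric] by (simp only: jacobi_left)
  ultimately show ?case
    unfolding r using qp3_step.IH ext_step[OF bilin_ed jac_right_qp2[OF qp3_step(1)] q(3) qp3_step(4)]
    by (simp add: add_diff_eq)
qed

text \<open>This is the source of the vanishing statements in higher degree: it remains to find good \<open>P\<close>.\<close>

lemma jacobi_ext_zero:
  assumes "mult_ok (Suc d)" "P \<in> qp3 n" "\<And>N u. P N (N - 1) u = P (N - 1) N u"
    and "R = (\<lambda>z w. P z w (w - 1) - P z (w - int (Suc d)) w - P w z (w - 1) + P (w - int (Suc d)) z w)"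
  shows "\<Phi> (Suc (Suc d)) R = 0"
proof -
  have "jac_right P = (\<lambda>z w. 0)" using assms(3) by (intro HOL.ext) (simp add: jac_right_def)
  moreover have "R = jac_left (Suc (Suc d)) P" unfolding assms(4) jac_left_def by (simp add: algebra_simps)
  ultimately show ?thesis using jacobi_ext[OF assms(1,2)] by (simp add: ext_zero[OF bilin_ed])
qed

end

context half begin

subsection \<open>Supports in higher degree\<close>

text \<open>In degree \<open>m + 1\<close> the expected support consists of the lines \<open>z = w + 1\<close> and \<open>z = w - m - 1\<close>. Write \<open>t = z - w\<close>.
  Two families of \<open>P\<close> confine the support to \<open>t\<close> among \<open>1, -1, 0, - m - 1\<close>, and two others to \<open>t\<close> among
  \<open>1, - m, 1 - m, - m - 1\<close>; for \<open>m \<ge> 3\<close> both sets have only the expected lines in common.\<close>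

lemma ext_scaled: "R \<in> qp2 n \<Longrightarrow> c \<noteq> 0 \<Longrightarrow> \<Phi> k (\<lambda>z w. c * R z w) = 0 \<Longrightarrow> \<Phi> k R = 0"
  by (simp add: ext_scale[OF be_bilin] clie.scale_eq_0_iff)

context
  fixes d :: nat and m :: int
  assumes prev: "mult_ok (Suc d)" and m: "m = int (Suc d)"
begin

lemma jacobi_vanish:
  assumes "P \<in> qp3 n" "\<And>N u. P N (N - 1) u = P (N - 1) N u"
    and "\<And>z w. R z w = P z w (w - 1) - P z (w - m) w - P w z (w - 1) + P (w - m) z w"
  shows "\<Phi> (Suc (Suc d)) R = 0"
proof -
  have "R = (\<lambda>z w. P z w (w - 1) - P z (w - m) w - P w z (w - 1) + P (w - m) z w)"
    by (intro HOL.ext) (rule assms(3))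
  then show ?thesis using jacobi_ext_zero[OF prev assms(1,2), of R] unfolding m by blast
qed

lemma m_nz: "of_int m \<noteq> (0::complex)" "of_int m + 1 \<noteq> (0::complex)" "of_int m + 2 \<noteq> (0::complex)"
proof -
  have "m \<noteq> 0" "m + 1 \<noteq> 0" "m + 2 \<noteq> 0" using m by auto
  then have "of_int m \<noteq> (0::complex)" "of_int (m + 1) \<noteq> (0::complex)" "of_int (m + 2) \<noteq> (0::complex)"
    by (simp_all only: of_int_eq_0_iff) auto
  then show "of_int m \<noteq> (0::complex)" "of_int m + 1 \<noteq> (0::complex)" "of_int m + 2 \<noteq> (0::complex)" by auto
qed

text \<open>Let \<open>P x y u\<close> be \<open>R y x\<close> times a polynomial that cancels three of the four terms of the Jacobi identity. The
  zeros of \<open>R\<close> make the right side of the identity vanish.\<close>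

lemma support_near_1:
  assumes R: "R \<in> qp2 n" "\<And>w. R (w + 1) w = 0" "\<And>w. R (w - 1) w = 0"
  shows "\<Phi> (Suc (Suc d)) (\<lambda>z w. (of_int z - of_int w) * (of_int z - of_int w + of_int m + 1) * R z w) = 0"
proof (rule ext_scaled)
  show "- (of_int m + 1) \<noteq> (0::complex)" using m_nz(2) unfolding neg_equal_0_iff_equal .
  show "\<Phi> (Suc (Suc d)) (\<lambda>z w. - (of_int m + 1) * ((of_int z - of_int w) * (of_int z - of_int w + of_int m + 1) * R z w)) = 0"
  proof (rule jacobi_vanish[where P = "\<lambda>x y u. R y x * ((of_int y - of_int u - 1) * (of_int y - of_int u + of_int m) * (of_int x - of_int u + of_int m))"])
    show "(\<lambda>x y u. R y x * ((of_int y - of_int u - 1) * (of_int y - of_int u + of_int m) * (of_int x - of_int u + of_int m))) \<in> qp3 n"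
      by (intro qp3_mult qp2_subst_qp3[OF R(1)] qp3_1 qp3_2; (assumption | intro qpI))
    show "R (N - 1) N * ((of_int (N - 1) - of_int u - 1) * (of_int (N - 1) - of_int u + of_int m) * (of_int N - of_int u + of_int m)) =
      R N (N - 1) * ((of_int N - of_int u - 1) * (of_int N - of_int u + of_int m) * (of_int (N - 1) - of_int u + of_int m))" for N u
      using R(2)[of "N - 1"] R(3)[of N] by simp
  qed (simp add: algebra_simps)
qed (intro qpI R)

text \<open>The factor \<open>(x - y)\<^sup>2 - 1\<close> of \<open>P\<close> makes the right side of the Jacobi identity vanish; the zeros of \<open>R\<close> remove
  the two terms in which \<open>P\<close> is evaluated with first argument \<open>z\<close>.\<close>

lemma support_near_2:
  assumes R: "R \<in> qp2 n" "\<And>w. R w w = 0" "\<And>w. R (w - m - 1) w = 0"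
  shows "\<Phi> (Suc (Suc d)) (\<lambda>z w. ((of_int z - of_int w)\<^sup>2 - 1) * R z w) = 0"
proof (rule ext_scaled)
  show "- (of_int m + 1) \<noteq> (0::complex)" using m_nz(2) unfolding neg_equal_0_iff_equal .
  show "\<Phi> (Suc (Suc d)) (\<lambda>z w. - (of_int m + 1) * (((of_int z - of_int w)\<^sup>2 - 1) * R z w)) = 0"
  proof (rule jacobi_vanish[where P = "\<lambda>x y u. R y (u + 1) * (((of_int x - of_int y)\<^sup>2 - 1) * (of_int x - of_int u + of_int m))"])
    show "(\<lambda>x y u. R y (u + 1) * (((of_int x - of_int y)\<^sup>2 - 1) * (of_int x - of_int u + of_int m))) \<in> qp3 n"
      by (intro qp3_mult qp2_subst_qp3[OF R(1)] qp3_2 shift_3; (assumption | intro qpI))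
    show "- (of_int m + 1) * (((of_int z - of_int w)\<^sup>2 - 1) * R z w)
      = R w (w - 1 + 1) * (((of_int z - of_int w)\<^sup>2 - 1) * (of_int z - of_int (w - 1) + of_int m))
      - R (w - m) (w + 1) * (((of_int z - of_int (w - m))\<^sup>2 - 1) * (of_int z - of_int w + of_int m))
      - R z (w - 1 + 1) * (((of_int w - of_int z)\<^sup>2 - 1) * (of_int w - of_int (w - 1) + of_int m))
      + R z (w + 1) * (((of_int (w - m) - of_int z)\<^sup>2 - 1) * (of_int (w - m) - of_int w + of_int m))" for z w
      using R(2)[of w] R(3)[of "w + 1"] by (simp add: algebra_simps power2_eq_square)
  qed simp
qed (intro qpI R)

text \<open>With \<open>D = m + 1\<close>, the polynomials \<open>t (t + D)\<close> and \<open>t\<^sup>2 - 1\<close> that kill are coprime: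
  \<open>1 - D\<^sup>2 = (D\<^sup>2 + D t - 1) (t\<^sup>2 - 1) - (D t - 1) t (t + D)\<close>.\<close>

lemma support_near:
  assumes R: "R \<in> qp2 n" "\<And>w. R (w + 1) w = 0" "\<And>w. R (w - 1) w = 0" "\<And>w. R w w = 0" "\<And>w. R (w - m - 1) w = 0"
  shows "\<Phi> (Suc (Suc d)) R = 0"
proof (rule ext_scaled)
  define D :: complex where "D = of_int m + 1"
  show "1 - (of_int m + 1)\<^sup>2 \<noteq> (0::complex)"
  proof -
    have "1 - (of_int m + 1)\<^sup>2 = - (of_int m * (of_int m + 2) :: complex)" by (simp add: algebra_simps power2_eq_square)
    then show ?thesis using m_nz by simp
  qed
  have 1: "\<Phi> (Suc (Suc d)) (\<lambda>z w. (of_int z - of_int w) * (of_int z - of_int w + of_int m + 1) * ((D * (of_int z - of_int w) - 1) * R z w)) = 0"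
    by (rule support_near_1) (simp_all add: R, intro qpI R)
  have 2: "\<Phi> (Suc (Suc d)) (\<lambda>z w. ((of_int z - of_int w)\<^sup>2 - 1) * ((D\<^sup>2 + D * (of_int z - of_int w) - 1) * R z w)) = 0"
    by (rule support_near_2) (simp_all add: R, intro qpI R)
  have "(\<lambda>z w. (1 - (of_int m + 1)\<^sup>2) * R z w) = (\<lambda>z w. ((of_int z - of_int w)\<^sup>2 - 1) * ((D\<^sup>2 + D * (of_int z - of_int w) - 1) * R z w)
     - (of_int z - of_int w) * (of_int z - of_int w + of_int m + 1) * ((D * (of_int z - of_int w) - 1) * R z w))"
    by (intro HOL.ext) (simp add: D_def algebra_simps power2_eq_square)
  moreover have "\<Phi> (Suc (Suc d)) \<dots> = 0"
    unfolding 1 2 by (subst ext_diff[OF be_bilin]) (simp_all add: 1 2, (intro qpI R)+)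
  ultimately show "\<Phi> (Suc (Suc d)) (\<lambda>z w. (1 - (of_int m + 1)\<^sup>2) * R z w) = 0" by simp
qed (rule R)

text \<open>The counterpart of \<open>support_near_1\<close> under the reflection \<open>t \<mapsto> - m - t\<close>, which exchanges the two expected lines.\<close>

lemma support_far_1:
  assumes R: "R \<in> qp2 n" "\<And>w. R (w + 1 - m) w = 0" "\<And>w. R (w - m - 1) w = 0"
  shows "\<Phi> (Suc (Suc d)) (\<lambda>z w. (of_int z - of_int w - 1) * (of_int z - of_int w + of_int m) * R z w) = 0"
proof (rule ext_scaled)
  show "- (of_int m + 1) \<noteq> (0::complex)" using m_nz(2) unfolding neg_equal_0_iff_equal .
  show "\<Phi> (Suc (Suc d)) (\<lambda>z w. - (of_int m + 1) * ((of_int z - of_int w - 1) * (of_int z - of_int w + of_int m) * R z w)) = 0"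
  proof (rule jacobi_vanish[where P = "\<lambda>x y u. R y (x + m) * ((of_int y - of_int u - 1) * (of_int y - of_int u + of_int m) * (of_int x - of_int u - 1))"])
    show "(\<lambda>x y u. R y (x + m) * ((of_int y - of_int u - 1) * (of_int y - of_int u + of_int m) * (of_int x - of_int u - 1))) \<in> qp3 n"
      by (intro qp3_mult qp2_subst_qp3[OF R(1)] qp3_2 shift_3; (assumption | intro qpI))
    show "R (N - 1) (N + m) * ((of_int (N - 1) - of_int u - 1) * (of_int (N - 1) - of_int u + of_int m) * (of_int N - of_int u - 1)) =
      R N (N - 1 + m) * ((of_int N - of_int u - 1) * (of_int N - of_int u + of_int m) * (of_int (N - 1) - of_int u - 1))" for N u
      using R(2)[of "N - 1 + m"] R(3)[of "N + m"] by simp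
  qed (simp add: algebra_simps)
qed (intro qpI R)

text \<open>The counterpart of \<open>support_near_2\<close> under the same reflection.\<close>

lemma support_far_2:
  assumes R: "R \<in> qp2 n" "\<And>w. R (w + 1) w = 0" "\<And>w. R (w - m) w = 0"
  shows "\<Phi> (Suc (Suc d)) (\<lambda>z w. ((of_int z - of_int w + of_int m)\<^sup>2 - 1) * R z w) = 0"
proof (rule ext_scaled)
  show "- (of_int m + 1) \<noteq> (0::complex)" using m_nz(2) unfolding neg_equal_0_iff_equal .
  show "\<Phi> (Suc (Suc d)) (\<lambda>z w. - (of_int m + 1) * (((of_int z - of_int w + of_int m)\<^sup>2 - 1) * R z w)) = 0"
  proof (rule jacobi_vanish[where P = "\<lambda>x y u. R y u * (((of_int x - of_int y)\<^sup>2 - 1) * (of_int x - of_int u - 1))"])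
    show "(\<lambda>x y u. R y u * (((of_int x - of_int y)\<^sup>2 - 1) * (of_int x - of_int u - 1))) \<in> qp3 n"
      by (intro qp3_mult qp2_subst_qp3[OF R(1)] qp3_2 qp3_3; (assumption | intro qpI))
    show "- (of_int m + 1) * (((of_int z - of_int w + of_int m)\<^sup>2 - 1) * R z w)
      = R w (w - 1) * (((of_int z - of_int w)\<^sup>2 - 1) * (of_int z - of_int (w - 1) - 1))
      - R (w - m) w * (((of_int z - of_int (w - m))\<^sup>2 - 1) * (of_int z - of_int w - 1))
      - R z (w - 1) * (((of_int w - of_int z)\<^sup>2 - 1) * (of_int w - of_int (w - 1) - 1))
      + R z w * (((of_int (w - m) - of_int z)\<^sup>2 - 1) * (of_int (w - m) - of_int w - 1))" for z w
      using R(2)[of "w - 1"] R(3)[of w] by (simp add: algebra_simps power2_eq_square)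
  qed simp
qed (intro qpI R)

lemma support_far:
  assumes R: "R \<in> qp2 n" "\<And>w. R (w + 1) w = 0" "\<And>w. R (w - m) w = 0" "\<And>w. R (w + 1 - m) w = 0" "\<And>w. R (w - m - 1) w = 0"
  shows "\<Phi> (Suc (Suc d)) R = 0"
proof (rule ext_scaled)
  define D :: complex where "D = of_int m + 1"
  show "1 - (of_int m + 1)\<^sup>2 \<noteq> (0::complex)"
  proof -
    have "1 - (of_int m + 1)\<^sup>2 = - (of_int m * (of_int m + 2) :: complex)" by (simp add: algebra_simps power2_eq_square)
    then show ?thesis using m_nz by simp
  qed
  \<comment> \<open>the identity of \<open>support_near\<close> with \<open>t\<close> replaced by \<open>- m - t\<close>\<close>
  have 1: "\<Phi> (Suc (Suc d)) (\<lambda>z w. (of_int z - of_int w - 1) * (of_int z - of_int w + of_int m) * ((D * (- of_int m - (of_int z - of_int w)) - 1) * R z w)) = 0"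
    by (rule support_far_1) (simp_all add: R, intro qpI R)
  have 2: "\<Phi> (Suc (Suc d)) (\<lambda>z w. ((of_int z - of_int w + of_int m)\<^sup>2 - 1) * ((D\<^sup>2 + D * (- of_int m - (of_int z - of_int w)) - 1) * R z w)) = 0"
    by (rule support_far_2) (simp_all add: R, intro qpI R)
  have "(\<lambda>z w. (1 - (of_int m + 1)\<^sup>2) * R z w) = (\<lambda>z w. ((of_int z - of_int w + of_int m)\<^sup>2 - 1) * ((D\<^sup>2 + D * (- of_int m - (of_int z - of_int w)) - 1) * R z w)
     - (of_int z - of_int w - 1) * (of_int z - of_int w + of_int m) * ((D * (- of_int m - (of_int z - of_int w)) - 1) * R z w))"
    by (intro HOL.ext) (simp add: D_def algebra_simps power2_eq_square)
  moreover have "\<Phi> (Suc (Suc d)) \<dots> = 0"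
    by (subst ext_diff[OF be_bilin]) (simp_all add: 1 2, (intro qpI R)+)
  ultimately show "\<Phi> (Suc (Suc d)) (\<lambda>z w. (1 - (of_int m + 1)\<^sup>2) * R z w) = 0" by simp
qed (rule R)

text \<open>The remaining \<open>P\<close> depends on a function \<open>H\<close> of one variable and produces a function \<open>S\<close> with
  \<open>S N (N - 1) = S (N - m - 1) N = c H N\<close>. Subtracting \<open>S\<close> makes \<open>R\<close> vanish on both expected lines. For \<open>m = 2\<close>
  vanishing on the line \<open>t = -1\<close> is preserved as well.\<close>

lemma exchange_ends:
  assumes R: "R \<in> qp2 n" and eq: "\<And>N. R N (N - 1) = R (N - m - 1) N" and mid: "m = 2 \<Longrightarrow> (\<And>w. R (w - 1) w = 0)"
    and ends: "\<And>R. R \<in> qp2 n \<Longrightarrow> (\<And>w. R (w + 1) w = 0) \<Longrightarrow> (\<And>w. R (w - m - 1) w = 0) \<Longrightarrow>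
      (m = 2 \<Longrightarrow> (\<And>w. R (w - 1) w = 0)) \<Longrightarrow> \<Phi> (Suc (Suc d)) R = 0"
  shows "\<Phi> (Suc (Suc d)) R = 0"
proof -
  define c :: complex where "c = of_int m * (of_int m + 1) * (of_int m + 2)"
  have c: "c \<noteq> 0" using m_nz by (simp add: c_def)
  define H where "H N = R N (N - 1) / c" for N
  have H: "H \<in> qp n" unfolding H_def using qp2_diag[OF R, of 0 "-1"] by (intro qp_divide) simp
  have Hc: "H N * c = R N (N - 1)" for N using c by (simp add: H_def)
  define P where "P = (\<lambda>x y u. H y * (((of_int x - of_int y)\<^sup>2 - 1) * (of_int y - of_int u + of_int m)))"
  have P: "P \<in> qp3 n" unfolding P_def by (intro qp3_mult qp3_2 H; (assumption | intro qpI))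
  define S where "S = (\<lambda>z w. P z w (w - 1) - P z (w - m) w - P w z (w - 1) + P (w - m) z w)"
  have S: "S \<in> qp2 n" unfolding S_def by (intro qp2_add qp2_diff qp3_subst_qp2[OF P] qps)
  have "\<Phi> (Suc (Suc d)) S = 0"
    by (rule jacobi_vanish[OF P]) (simp_all add: P_def S_def)
  moreover have "\<Phi> (Suc (Suc d)) (\<lambda>z w. R z w - S z w) = 0"
  proof (rule ends)
    have "S (w + 1) w = H (w + 1) * c" for w
      unfolding S_def P_def c_def by (simp add: algebra_simps power2_eq_square)
    then show "R (w + 1) w - S (w + 1) w = 0" for w using Hc[of "w + 1"] by simp
    have "S (w - m - 1) w = H w * c" for w
      unfolding S_def P_def c_def by (simp add: algebra_simps power2_eq_square)
    then show "R (w - m - 1) w - S (w - m - 1) w = 0" for w using Hc[of w] eq[of w] by simp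
    show "R (w - 1) w - S (w - 1) w = 0" if "m = 2" for w
      using mid[OF that] that by (simp add: S_def P_def)
  qed (intro qp2_diff R S)
  ultimately show ?thesis by (simp add: ext_diff[OF be_bilin R S])
qed

lemma string_ok_far: assumes "d \<ge> 2" shows "string_ok (Suc (Suc d))"
  unfolding string_ok_def
proof (intro ballI impI)
  fix R assume R0: "R \<in> qp2 n" and eq: "\<forall>N. R N (N - 1) = R (N - int (Suc (Suc d))) N"
  have m2: "m \<noteq> 2" using assms m by simp
  show "\<Phi> (Suc (Suc d)) R = 0"
  proof (rule exchange_ends[OF R0])
    show "R N (N - 1) = R (N - m - 1) N" for N using eq by (simp add: m algebra_simps)
    show "R (w - 1) w = 0" if "m = 2" for w using m2 that by simp
    fix R assume R: "R \<in> qp2 n" "\<And>w. R (w + 1) w = 0" "\<And>w. R (w - m - 1) w = 0"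
    define k :: complex where "k = of_int m - 1"
    define t :: "int \<Rightarrow> int \<Rightarrow> complex" where "t = (\<lambda>z w. of_int z - of_int w)"
    have t: "t \<in> qp2 n" unfolding t_def by (intro qpI)
    have "m - 1 \<noteq> 0" "m - 2 \<noteq> 0" using assms m by auto
    then have "of_int (m - 1) \<noteq> (0::complex)" "of_int (m - 2) \<noteq> (0::complex)" by (simp_all only: of_int_eq_0_iff) auto
    moreover have "k * (k\<^sup>2 - 1) = of_int (m - 1) * (of_int (m - 2) * of_int m)"
      by (simp add: k_def power2_eq_square algebra_simps)
    ultimately have k: "k * (k\<^sup>2 - 1) \<noteq> 0"
      using m_nz(1) by (simp only: mult_eq_0_iff) simp
    \<comment> \<open>the factors vanish on the lines on which \<open>R\<close> need not vanish, and the two products differ by the constant \<open>k (k\<^sup>2 - 1)\<close>\<close>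
    have 1: "\<Phi> (Suc (Suc d)) (\<lambda>z w. t z w * (t z w + 1) * (2 * t z w + 3 * k + 1) * R z w) = 0"
      by (rule support_near) (simp_all add: R t_def, intro qpI R)
    have 2: "\<Phi> (Suc (Suc d)) (\<lambda>z w. (t z w + k) * (t z w + of_int m) * (2 * t z w - k + 1) * R z w) = 0"
      by (rule support_far) (simp_all add: R t_def k_def, intro qpI R)
    show "\<Phi> (Suc (Suc d)) R = 0"
    proof (rule ext_scaled[OF R(1) k])
      have "(\<lambda>z w. k * (k\<^sup>2 - 1) * R z w) = (\<lambda>z w. t z w * (t z w + 1) * (2 * t z w + 3 * k + 1) * R z w
          - (t z w + k) * (t z w + of_int m) * (2 * t z w - k + 1) * R z w)"
        by (intro HOL.ext) (simp add: k_def algebra_simps power2_eq_square)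
      moreover have "\<Phi> (Suc (Suc d)) \<dots> = 0"
        by (subst ext_diff[OF be_bilin]) (simp_all add: 1 2, (intro qpI R t)+)
      ultimately show "\<Phi> (Suc (Suc d)) (\<lambda>z w. k * (k\<^sup>2 - 1) * R z w) = 0" by simp
    qed
  qed
qed

end

lemma ext_ed_self:
  assumes "Q \<in> qp2 n" "\<And>N u. Q N u = Q u N" shows "ext n (\<lambda>F G. br (ed c F) (ed c G)) Q = 0"
proof -
  have swap: "ext n (\<lambda>F G. br (ed c F) (ed c G)) (\<lambda>z w. R w z) = - ext n (\<lambda>F G. br (ed c F) (ed c G)) R" if "R \<in> qp2 n" for R
    using that
  proof (induction R rule: qp2.induct)
    case qp2_zero
    then show ?case by (simp add: ext_zero[OF bilin_ed])
  next
    case (qp2_step R F G)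
    have "(\<lambda>z w. R w z + F w * G z) = (\<lambda>z w. R w z + G z * F w)" by (simp add: mult.commute)
    then show ?case
      using qp2_step ext_step[OF bilin_ed qp2_swap[OF qp2_step(1)] qp2_step(3,2), of c c] ext_step[OF bilin_ed qp2_step(1,2,3), of c c]
        br_anti[of "ed c F" "ed c G"] by simp
  qed
  have "(\<lambda>z w. Q w z) = Q" using assms(2) by auto
  then have "ext n (\<lambda>F G. br (ed c F) (ed c G)) Q = - ext n (\<lambda>F G. br (ed c F) (ed c G)) Q" using swap[OF assms(1)] by simp
  then have "2 *\<^sub>C ext n (\<lambda>F G. br (ed c F) (ed c G)) Q = 0"
    using csc_add_left[of 1 1 "ext n (\<lambda>F G. br (ed c F) (ed c G)) Q"] by simp (metis add.left_inverse)
  then show ?thesis by (simp add: clie.scale_eq_0_iff)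
qed

text \<open>For \<open>m = 2\<close> the lines \<open>t = -1\<close> and \<open>t = 1 - m\<close> coincide. A symmetric right side of the Jacobi identity is
  also killed, since \<open>[ed 2, ed 2]\<close> is antisymmetric; \<open>P\<close> is chosen so that \<open>jac_right P\<close> is a symmetric \<open>Q\<close> and
  \<open>jac_left\<close> agrees with \<open>R\<close> on \<open>t = -1\<close>.\<close>

lemma string_ok_3: assumes "mult_ok 2" shows "string_ok 3"
proof -
  have prev: "mult_ok (Suc 1)" using assms by (simp add: numeral_2_eq_2)
  have "string_ok (Suc (Suc 1))"
    unfolding string_ok_def
  proof (intro ballI impI)
    fix R assume R: "R \<in> qp2 n" and eq: "\<forall>N. R N (N - 1) = R (N - int (Suc (Suc 1))) N"
    define H where "H w = R (w - 1) w" for w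
    have H: "H \<in> qp n" unfolding H_def using qp2_diag[OF R, of "-1" 0] by simp
    define Q where "Q = (\<lambda>N u. - (of_int N - of_int u + 1) / 4 * H N - (of_int u - of_int N + 1) / 4 * H u)"
    have Q: "Q \<in> qp2 n" unfolding Q_def by (intro qpI H)
    define P where "P = (\<lambda>x y u. (of_int x - of_int y + 1) / 2 * Q x u)"
    have P: "P \<in> qp3 n" unfolding P_def by (intro qp3_mult qp2_subst_qp3[OF Q] qp3_1 qp3_3; (assumption | intro qpI))
    define S where "S = jac_left (Suc (Suc 1)) P"
    have S: "S \<in> qp2 n" unfolding S_def by (rule jac_left_qp2[OF P])
    have "jac_right P = Q" by (intro HOL.ext) (simp add: jac_right_def P_def)
    moreover have Q_sym: "Q N u = Q u N" for N u by (simp add: Q_def field_simps)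
    ultimately have S0: "\<Phi> (Suc (Suc 1)) S = 0"
      unfolding S_def jacobi_ext[OF prev P] using ext_ed_self[OF Q Q_sym, of "Suc 1"] by (simp only: numeral_2_eq_2 One_nat_def)
    have "\<Phi> (Suc (Suc 1)) (\<lambda>z w. R z w - S z w) = 0"
    proof (rule exchange_ends[OF prev, of 2])
      show "R N (N - 1) - S N (N - 1) = R (N - 2 - 1) N - S (N - 2 - 1) N" for N
        using eq[rule_format, of N] by (simp add: S_def jac_left_def P_def Q_def algebra_simps) (simp add: field_simps)
      show "R (w - 1) w - S (w - 1) w = 0" for w
        by (simp add: S_def jac_left_def P_def Q_def H_def field_simps)
      fix R assume R: "R \<in> qp2 n" "\<And>w. R (w + 1) w = 0" "\<And>w. R (w - 2 - 1) w = 0"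
        "2 = (2::int) \<Longrightarrow> (\<And>w. R (w - 1) w = 0)"
      have R3: "R (w - 3) w = 0" for w using R(3)[of w] by simp
      have 1: "\<Phi> (Suc (Suc 1)) (\<lambda>z w. (of_int z - of_int w) * R z w) = 0"
        by (rule support_near[OF prev, of 2]) (simp_all add: R R3, intro qpI R)
      have 2: "\<Phi> (Suc (Suc 1)) (\<lambda>z w. (of_int z - of_int w + 2) * R z w) = 0"
        by (rule support_far[OF prev, of 2]) (simp_all add: R R3, intro qpI R)
      show "\<Phi> (Suc (Suc 1)) R = 0"
      proof (rule ext_scaled[OF R(1)])
        \<comment> \<open>the remaining unexpected lines are \<open>t = 0\<close> and \<open>t = -2\<close>\<close>
        have "(\<lambda>z w. 2 * R z w) = (\<lambda>z w. (of_int z - of_int w + 2) * R z w - (of_int z - of_int w) * R z w)"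
          by (auto simp: algebra_simps)
        moreover have "\<Phi> (Suc (Suc 1)) \<dots> = 0"
          by (subst ext_diff[OF be_bilin]) (simp_all only: 1 2 diff_self, (intro qpI R)+)
        ultimately show "\<Phi> (Suc (Suc 1)) (\<lambda>z w. 2 * R z w) = 0" by (simp only:)
      qed simp
    qed (simp_all add: qp2_diff[OF R S])
    then show "\<Phi> (Suc (Suc 1)) R = 0" using S0 by (simp add: ext_diff[OF be_bilin R S])
  qed
  then show ?thesis by (simp add: numeral_3_eq_3)
qed

end

context half begin

subsection \<open>Action of the opposite half\<close>

text \<open>Bracketing with \<open>h\<close> preserves the degree and bracketing with \<open>y\<close> lowers it by one, as far as \<open>mult_ok\<close> is known.
  This serves the proof of \<open>mult_ok\<close> for \<open>d = 2\<close>, and later the proof that the homogeneous parts span the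
  whole algebra.\<close>

definition Hs :: "'v set" where "Hs = clie.span {h i r | i r. i < n}"

definition Ed :: "nat \<Rightarrow> 'v set" where "Ed d = ed d ` qp n"

lemma EdI: "F \<in> qp n \<Longrightarrow> ed d F \<in> Ed d" by (simp add: Ed_def)

lemma Ed_subspace: "clie.subspace (Ed d)"
proof (rule clie.subspaceI)
  show "0 \<in> Ed d" using EdI[OF qp_const[of 0]] lin_onD(3)[OF ed_lin qp_const] by metis
  show "u + v \<in> Ed d" if uv: "u \<in> Ed d" "v \<in> Ed d" for u v
  proof -
    obtain F G where FG: "F \<in> qp n" "G \<in> qp n" "u = ed d F" "v = ed d G" using uv by (auto simp: Ed_def)
    then have "u + v = ed d (\<lambda>N. F N + G N)" by (simp add: lin_onD(1)[OF ed_lin])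
    then show ?thesis using EdI[OF qp_add[OF FG(1,2)]] by simp
  qed
  show "c *\<^sub>C u \<in> Ed d" if u: "u \<in> Ed d" for u c
  proof -
    obtain F where F: "F \<in> qp n" "u = ed d F" using u by (auto simp: Ed_def)
    then have "c *\<^sub>C u = ed d (\<lambda>N. c * F N)" by (simp add: lin_onD(2)[OF ed_lin])
    then show ?thesis using EdI[OF qp_mult[OF qp_const F(1)]] by simp
  qed
qed

lemmas Ed_closed = clie.subspace_add[OF Ed_subspace] clie.subspace_scale[OF Ed_subspace]
  clie.subspace_diff[OF Ed_subspace] clie.subspace_neg[OF Ed_subspace] clie.subspace_0[OF Ed_subspace]
lemmas Ed_sum = clie.subspace_sum[OF Ed_subspace]

lemma px_Ed: "i < n \<Longrightarrow> px x i p \<in> Ed (Suc 0)"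
  using EdI[of "\<lambda>N. ch n i N * poly p (of_int N)" "Suc 0"] by (simp add: gen_ch_poly[OF n1, of i x p] qp_mult qp_ch qp_poly)

lemma h_x: "i < n \<Longrightarrow> j < n \<Longrightarrow> br (h i r) (x j s) \<in> Ed (Suc 0)"
  using hx px_Ed by metis

lemma br_span:
  assumes "u \<in> clie.span A" "\<And>a. a \<in> A \<Longrightarrow> br a v \<in> S" "clie.subspace S" shows "br u v \<in> S"
proof (rule clie.span_induct[OF assms(1)])
  show "br a v \<in> S" if "a \<in> A" for a using assms(2) that .
  show "clie.subspace {u. br u v \<in> S}"
    by (rule clie.subspaceI) (auto simp: br_linear clie.subspace_add[OF assms(3)] clie.subspace_scale[OF assms(3)] clie.subspace_0[OF assms(3)])
qed

lemma h_e: "u \<in> Hs \<Longrightarrow> F \<in> qp n \<Longrightarrow> br u (e F) \<in> Ed (Suc 0)"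
  unfolding Hs_def
  by (erule br_span) (auto simp: gen_def px_def br_linear intro!: Ed_sum Ed_closed h_x Ed_subspace)

lemma e_Ed: "mult_ok d \<Longrightarrow> F \<in> qp n \<Longrightarrow> v \<in> Ed d \<Longrightarrow> br (e F) v \<in> Ed (Suc d)"
  unfolding mult_ok_def Ed_def by (auto intro!: imageI qp_diff qp_mult qp_shift')

lemma Ed1_Ed: "mult_ok d \<Longrightarrow> u \<in> Ed (Suc 0) \<Longrightarrow> v \<in> Ed d \<Longrightarrow> br u v \<in> Ed (Suc d)"
  using e_Ed unfolding Ed_def[of "Suc 0"] by auto

lemma h_br: assumes "u \<in> Hs" "mult_ok (Suc d)" "F \<in> qp n" "v \<in> Ed (Suc d)" "br u v \<in> Ed (Suc d)"
  shows "br u (br (e F) v) \<in> Ed (Suc (Suc d))"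
  unfolding jacobi_right[of u "e F"]
  by (intro Ed_closed Ed1_Ed[OF assms(2)] h_e assms e_Ed)

lemma h_Ed: "u \<in> Hs \<Longrightarrow> (\<And>c. c < d \<Longrightarrow> mult_ok (Suc c)) \<Longrightarrow> F \<in> qp n \<Longrightarrow> br u (ed (Suc d) F) \<in> Ed (Suc d)"
proof (induction d arbitrary: F)
  case 0
  then show ?case using h_e by simp
next
  case (Suc d)
  have q: "(\<lambda>N. (of_int N + of_nat (d + 1)) * F N) \<in> qp n" by (intro qpI Suc)
  show ?case unfolding ed.simps br_linear
    by (intro Ed_closed h_br Suc q EdI qp_const qp_id) auto
qed

lemma y_x: "j < n \<Longrightarrow> F \<in> qp n \<Longrightarrow> br (y j s) (e F) \<in> Hs"
proof -
  assume j: "j < n" and F: "F \<in> qp n"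
  have "br (y j s) (x i r) \<in> Hs" if "i < n" for i r
  proof -
    have "br (y j s) (x i r) = - br (x i r) (y j s)" by (rule br_anti)
    then have eq: "br (y j s) (x i r) = (if i = j then - h i (r + s) else 0)" using xy[OF that j] by simp
    have "h i (r + s) \<in> Hs" unfolding Hs_def by (rule clie.span_base) (use that in blast)
    then have "- h i (r + s) \<in> Hs" unfolding Hs_def by (rule clie.span_neg)
    then show ?thesis unfolding eq using clie.span_zero[of "{h i r | i r. i < n}", folded Hs_def] by (cases "i = j") auto
  qed
  then show ?thesis unfolding gen_def px_def br_linear
    by (intro clie.span_sum[of _ _ "{h i r | i r. i < n}", folded Hs_def] clie.span_scale[of _ "{h i r | i r. i < n}", folded Hs_def]) auto
qed

lemma y_br:
  assumes "j < n" "\<And>c. c \<le> d \<Longrightarrow> mult_ok c \<or> c = 0" "F \<in> qp n" "G \<in> qp n"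
    and "d \<noteq> 0 \<Longrightarrow> br (y j s) (ed (Suc d) G) \<in> Ed d"
  shows "br (y j s) (br (e F) (ed (Suc d) G)) \<in> Ed (Suc d)"
  unfolding jacobi_right[of "y j s" "e F"]
proof (intro Ed_closed)
  have m: "mult_ok (Suc c)" if "c < d" for c using assms(2)[of "Suc c"] that by auto
  show "br (br (y j s) (e F)) (ed (Suc d) G) \<in> Ed (Suc d)"
    by (rule h_Ed[OF y_x[OF assms(1,3)] m assms(4)])
  show "br (e F) (br (y j s) (ed (Suc d) G)) \<in> Ed (Suc d)"
  proof (cases "d = 0")
    case True
    have "br (br (y j s) (e G)) (e F) \<in> Ed (Suc 0)" by (rule h_e[OF y_x[OF assms(1,4)] assms(3)])
    then show ?thesis using True br_anti[of "e F" "br (y j s) (e G)"] by (simp add: Ed_closed)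
  next
    case False
    then show ?thesis using assms(2)[of d] assms(5) e_Ed[OF _ assms(3), of d] by auto
  qed
qed

lemma y_Ed: "j < n \<Longrightarrow> (\<And>c. c < d \<Longrightarrow> mult_ok (Suc c)) \<Longrightarrow> F \<in> qp n \<Longrightarrow> br (y j s) (ed (Suc (Suc d)) F) \<in> Ed (Suc d)"
proof (induction d arbitrary: F)
  case 0
  have q: "(\<lambda>N. (of_int N + of_nat (0 + 1)) * F N) \<in> qp n" by (intro qpI 0)
  show ?case unfolding ed.simps(3) br_linear
    by (intro Ed_closed y_br 0 q qp_const qp_id) auto
next
  case (Suc d)
  have q: "(\<lambda>N. (of_int N + of_nat (Suc d + 1)) * F N) \<in> qp n" by (intro qpI Suc)
  have m: "mult_ok c \<or> c = 0" if "c \<le> Suc d" for c using Suc(3)[of "c - 1"] that by (cases c) auto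
  show ?case unfolding ed.simps(3)[of "Suc d"] br_linear
    by (intro Ed_closed y_br Suc q qp_const qp_id m) auto
qed

text \<open>A homogeneous element is \<open>ed (Suc d) F\<close> for some \<open>F\<close>, and its image \<open>t (Suc d) F\<close> determines \<open>F\<close>.\<close>

lemma Ed_\<Theta>_zero: assumes "v \<in> Ed (Suc d)" "\<Theta> v = 0" shows "v = 0"
proof -
  obtain F where F: "F \<in> qp n" "v = ed (Suc d) F" using assms(1) by (auto simp: Ed_def)
  then have "F = (\<lambda>N. 0)" using assms(2) \<Theta>_ed t_inj by auto
  then show ?thesis using F lin_onD(3)[OF ed_lin F(1)] by simp
qed

lemma y_ext:
  assumes "j < n" "\<And>c. c \<le> d \<Longrightarrow> mult_ok c \<or> c = 0" "R \<in> qp2 n"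
  shows "br (y j s) (\<Phi> (Suc d) R) \<in> Ed (Suc d)"
  using assms(3)
proof (induction R rule: qp2.induct)
  case qp2_zero
  then show ?case by (simp add: ext_zero[OF be_bilin] Ed_closed)
next
  case (qp2_step R F G)
  have m: "mult_ok (Suc c)" if "c < d - 1" for c using assms(2)[of "Suc c"] that by auto
  have "br (y j s) (be (Suc d) F G) \<in> Ed (Suc d)"
    unfolding be_def
  proof (intro y_br assms qp2_step)
    assume "d \<noteq> 0"
    then show "br (y j s) (ed (Suc d) G) \<in> Ed d" using y_Ed[OF assms(1), of "d - 1" G s] m qp2_step by auto
  qed
  then show ?case using qp2_step unfolding ext_step[OF be_bilin qp2_step(1-3)] by (simp add: br_linear Ed_closed)
qed

subsection \<open>Degree three: the Serre relations\<close>

text \<open>For \<open>m = 1\<close> the near and the far lines are the same, so that \<open>t = 0\<close> and \<open>t = -1\<close> remain besides the expected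
  lines \<open>t = 1\<close> and \<open>t = -2\<close>.\<close>

text \<open>On one class the relations \<open>above\<close> and \<open>below\<close> both hold, and their difference is twice the bracket.\<close>

lemma same_class: assumes "n \<ge> 2" "i < n" shows "br (x i r) (x i s) = 0"
proof -
  have c: "\<not> [int i = int i + 1] (mod int n)" "\<not> [int i = int i - 1] (mod int n)"
    using assms(1) by (auto simp: cong_iff_dvd_diff dest: zdvd_imp_le)
  have "br (x i (r + 1)) (x i s) - br (x i r) (x i (s + 1)) + br (x i r) (x i s) = 0"
    "br (x i (r + 1)) (x i s) - br (x i r) (x i (s + 1)) - br (x i r) (x i s) = 0"
    using above[OF assms(2,2) c(1)] below[OF assms(2,2) c(2)] by auto
  then have "br (x i r) (x i s) + br (x i r) (x i s) = 0" by (simp add: algebra_simps)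
  then have "2 *\<^sub>C br (x i r) (x i s) = 0" using csc_add_left[of 1 1 "br (x i r) (x i s)"] by simp
  then show ?thesis by (simp add: clie.scale_eq_0_iff)
qed

lemma same_class_px: "n \<ge> 2 \<Longrightarrow> i < n \<Longrightarrow> br (px x i p) (px x i q) = 0"
  by (simp add: px_def br_linear same_class)

lemma gen_ch': "i < n \<Longrightarrow> F \<in> qp n \<Longrightarrow> e (\<lambda>N. ch n i N * F N) = px x i (cpoly n F i)"
  using gen_ch[OF n1, of i F x 0] by simp

lemma ext_pure_sum:
  assumes "R \<in> qp2 n" "clie.subspace S" "\<And>F G. F \<in> qp n \<Longrightarrow> G \<in> qp n \<Longrightarrow> be d (\<lambda>N. f N * F N) (\<lambda>N. g N * G N) \<in> S" "f \<in> qp n" "g \<in> qp n"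
  shows "\<Phi> d (\<lambda>z w. f z * g w * R z w) \<in> S"
  using assms(1)
proof (induction R rule: qp2.induct)
  case qp2_zero
  then show ?case by (simp add: ext_zero[OF be_bilin] clie.subspace_0[OF assms(2)])
next
  case (qp2_step R F G)
  have "(\<lambda>z w. f z * g w * (R z w + F z * G w)) = (\<lambda>z w. f z * g w * R z w + (f z * F z) * (g w * G w))"
    by (simp add: algebra_simps)
  moreover have "(\<lambda>z w. f z * g w * R z w) \<in> qp2 n" by (intro qp2_mult qp2_fst qp2_snd assms qp2_step)
  ultimately show ?case
    using ext_step[OF be_bilin, of "\<lambda>z w. f z * g w * R z w" "\<lambda>N. f N * F N" "\<lambda>N. g N * G N" d] qp2_step assms
    by (simp add: qp_mult clie.subspace_add)
qed

text \<open>On the class \<open>j\<close> the element \<open>ed 2 G\<close> is a bracket of the generators of the classes \<open>j\<close> and \<open>j + 1\<close>. If \<open>i\<close> is one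
  of these two, the Serre relation applies; for all other \<open>i\<close> the lines \<open>t = 0\<close> and \<open>t = -1\<close> do not meet
  the classes \<open>i\<close> and \<open>j\<close>.\<close>

lemma support_three_n:
  assumes "n > 2" "R \<in> qp2 n" "\<And>w. R (w + 1) w = 0" "\<And>w. R (w - 2) w = 0"
  shows "\<Phi> 2 R = 0"
proof (rule ext_by_classes[OF n1 be_bilin assms(2)])
  fix i j assume ij: "i < n" "j < n"
  have Z: "clie.subspace {0::'v}" by (rule clie.subspaceI) auto
  have mod_eq: "i = j" if "[int i = int j] (mod int n)" "i < n" "j < n" for i j
    using that by (simp add: cong_def)
  define j' where "j' = (if j + 1 < n then j + 1 else 0)"
  have j': "j' < n" "[int j' = int j + 1] (mod int n)" using ij assms(1) by (auto simp: j'_def cong_def) (metis mod_self of_nat_Suc Suc_lessI add.commute)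
  have jj: "\<not> [int j = int j' + 1] (mod int n)"
  proof
    assume "[int j = int j' + 1] (mod int n)"
    then have "[int j = int j + 1 + 1] (mod int n)" using j'(2) by (meson cong_add_rcancel cong_sym cong_trans)
    then have "int n dvd 2" by (simp add: cong_iff_dvd_diff)
    then show False using assms(1) by (auto dest: zdvd_imp_le)
  qed
  have ed2: "ed 2 (\<lambda>N. ch n j N * G N) = br (px x j (cpoly n G j)) (px x j' 1)" if G: "G \<in> qp n" for G
  proof -
    have q: "(\<lambda>N. ch n j N * G N) \<in> qp n" by (intro qpI G)
    have "br (e (\<lambda>N. ch n j N * G N)) (ed (Suc 0) (ch n j')) = ed (Suc (Suc 0)) (\<lambda>N. (ch n j N * G N) * ch n j' (N - 1) - ch n j' N * (ch n j (N - int (Suc 0)) * G (N - int (Suc 0))))"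
      using mult_ok_1 q qp_ch unfolding mult_ok_def by auto
    moreover have "(\<lambda>N. (ch n j N * G N) * ch n j' (N - 1) - ch n j' N * (ch n j (N - int (Suc 0)) * G (N - int (Suc 0)))) = (\<lambda>N. ch n j N * G N)"
    proof
      fix N
      have 1: "ch n j' (N - 1) = 1" if "ch n j N \<noteq> 0"
      proof -
        have "[N + int j = 0] (mod int n)" using that by (auto simp: ch_def cong_def)
        moreover have "[N - 1 + int j' = N - 1 + (int j + 1)] (mod int n)" by (rule Cong.cong_add[OF cong_refl j'(2)])
        ultimately have "[N - 1 + int j' = 0] (mod int n)" by (simp add: cong_def)
        then show ?thesis by (simp add: ch_def cong_def)
      qed
      have 2: "ch n j' N * ch n j (N - 1) = 0"
      proof (rule ccontr)
        assume "ch n j' N * ch n j (N - 1) \<noteq> 0"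
        then have "[N + int j' = 0] (mod int n)" "[N - 1 + int j = 0] (mod int n)" by (auto simp: ch_def cong_def split: if_splits)
        then have "[(N - 1 + int j) - (N + int j') = 0 - 0] (mod int n)" by (intro cong_diff)
        then have "[int j = int j' + 1] (mod int n)" by (simp add: cong_iff_dvd_diff algebra_simps)
        then show False using jj by simp
      qed
      show "(ch n j N * G N) * ch n j' (N - 1) - ch n j' N * (ch n j (N - int (Suc 0)) * G (N - int (Suc 0))) = ch n j N * G N"
        using 1 2 by auto
    qed
    moreover have "e (ch n j') = px x j' 1" using gen_ch_poly[OF n1 j'(1), of x 1] by simp
    ultimately show ?thesis using gen_ch'[OF ij(2) G] by (simp only: ed.simps(2) numeral_2_eq_2)
  qed
  have be2: "be 2 (\<lambda>N. ch n i N * F N) (\<lambda>N. ch n j N * G N) = br (px x i (cpoly n F i)) (br (px x j (cpoly n G j)) (px x j' 1))"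
    if "F \<in> qp n" "G \<in> qp n" for F G
    using that by (simp add: be_def gen_ch' ij ed2)
  consider (same) "i = j" | (low) "i = j'" | (far) "i \<noteq> j" "\<not> [int i = int j + 1] (mod int n)"
    using mod_eq[OF _ ij(1) j'(1)] j'(2) by (meson cong_sym cong_trans)
  then show "\<Phi> 2 (\<lambda>z w. ch n i z * ch n j w * R z w) = 0"
  proof cases
    case same
    have "br (px x i p) (br (px x j q) (px x j' r)) = 0" for p q r
      using serre_n[OF assms(1) ij(2) j'(1)] j'(2) by (simp add: same px_def br_linear)
    then show ?thesis using ext_pure_sum[OF assms(2) Z, of 2 "ch n i" "ch n j"] be2 qp_ch by auto
  next
    case low
    have "[int j = int j' - 1] (mod int n)" using cong_diff[OF cong_sym[OF j'(2)] cong_refl[of 1]] by simp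
    then have "br (x j' a) (br (x j' b) (x j c)) = 0" for a b c
      using serre_n[OF assms(1) j'(1) ij(2)] by blast
    moreover have "br (x j b) (x j' c) = - br (x j' c) (x j b)" for b c by (rule br_anti)
    ultimately have "br (x j' a) (br (x j b) (x j' c)) = 0" for a b c
      by (metis br_right.minus neg_equal_0_iff_equal)
    then have "br (px x i p) (br (px x j q) (px x j' r)) = 0" for p q r
      by (simp add: low px_def br_linear)
    then show ?thesis using ext_pure_sum[OF assms(2) Z, of 2 "ch n i" "ch n j"] be2 qp_ch by auto
  next
    case far
    have "\<Phi> (Suc (Suc 0)) (\<lambda>z w. ch n i z * ch n j w * R z w) = 0"
    proof (rule support_near[of 0 1])
      show "mult_ok (Suc 0)" using mult_ok_1 by simp
      show "ch n i w * ch n j w * R w w = 0" for w using ch_ch[OF ij far(1)] by simp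
      show "ch n i (w - 1) * ch n j w * R (w - 1) w = 0" for w
      proof -
        have "ch n i (w - 1) * ch n j w = 0"
        proof (rule ccontr)
          assume "ch n i (w - 1) * ch n j w \<noteq> 0"
          then have "[w - 1 + int i = 0] (mod int n)" "[w + int j = 0] (mod int n)" by (auto simp: ch_def cong_def split: if_splits)
          then have "[(w - 1 + int i) - (w + int j) = 0 - 0] (mod int n)" by (intro cong_diff)
          then have "[int i = int j + 1] (mod int n)" by (simp add: cong_iff_dvd_diff algebra_simps)
          then show False using far by simp
        qed
        then show ?thesis by simp
      qed
    qed (use assms in \<open>simp_all, intro qpI assms\<close>)
    then show ?thesis by (simp add: numeral_2_eq_2)
  qed
qed

text \<open>The element \<open>k\<close> to be shown zero is a combination of brackets \<open>[x i, [x i, x i']]\<close> and so has weight \<open>2\<close> for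
  \<open>h i 0\<close>. Its image in the model is zero; therefore \<open>[y i 0, k]\<close>, which is homogeneous of degree two,
  vanishes, and \<open>[x i 0, k]\<close> vanishes by the Serre relation. Hence \<open>2 k = [h i 0, k] = 0\<close>.\<close>

lemma support_three_2:
  assumes "n = 2" "R \<in> qp2 n" "\<And>w. R (w + 1) w = 0" "\<And>w. R (w - 2) w = 0"
  shows "\<Phi> 2 R = 0"
proof (rule ext_by_classes[OF n1 be_bilin assms(2)])
  fix i j assume ij: "i < n" "j < n"
  define i' where "i' = 1 - i"
  have i': "i' < n" "i \<noteq> i'" using ij assms(1) unfolding i'_def by presburger+
  define W where "W = clie.span {br (x i p) (br (x i q) (x i' s)) | p q s. True}"
  have W: "clie.subspace W" unfolding W_def by (rule clie.subspace_span)
  have Wx: "br (x i p) (br (x i q) (x i' s)) \<in> W" for p q s unfolding W_def by (rule clie.span_base) blast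
  have Wx': "br (x i p) (br (x i' q) (x i s)) \<in> W" for p q s
    using clie.subspace_neg[OF W Wx[of p s q]] br_anti[of "x i' q" "x i s"] by (simp add: br_right.minus)
  note W_closed = clie.subspace_add[OF W] clie.subspace_scale[OF W]
    clie.subspace_diff[OF W] clie.subspace_neg[OF W] clie.subspace_0[OF W] clie.subspace_sum[OF W]
  have Wpx: "br (px x i p) (br (px x i q) (px x i' s)) \<in> W" "br (px x i p) (br (px x i' q) (px x i s)) \<in> W" for p q s
    unfolding px_def br_linear by (intro W_closed Wx Wx')+
  have e2: "e F = px x i (cpoly n F i) + px x i' (cpoly n F i')" for F
  proof -
    have "{..<n} = {i, i'}" using ij i' assms(1) by (auto simp: i'_def)
    then show ?thesis using i' by (simp add: gen_def)
  qed
  have Wed: "br (px x i p) (ed 2 (\<lambda>N. ch n j N * G N)) \<in> W" if G: "G \<in> qp n" for G p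
  proof -
    have chG: "(\<lambda>N. ch n j N * G N) \<in> qp n" by (intro qpI G)
    have *: "br (px x i p) (br (e (\<lambda>N. ch n j N * F N)) (e F')) \<in> W" if F: "F \<in> qp n" "F' \<in> qp n" for F F'
    proof -
      have "j = i \<or> j = i'" using ij assms(1) by (auto simp: i'_def)
      then show ?thesis
      proof
        assume "j = i"
        then show ?thesis unfolding gen_ch'[OF ij(2) F(1)] e2[of F'] br_linear
          using same_class_px[of i] ij assms(1) Wpx by simp
      next
        assume "j = i'"
        then show ?thesis unfolding gen_ch'[OF ij(2) F(1)] e2[of F'] br_linear
          using same_class_px[of i'] i' assms(1) Wpx by simp
      qed
    qed
    have c: "(\<lambda>N. (of_int N + of_nat (0 + 1)) * (ch n j N * G N)) = (\<lambda>N. ch n j N * ((of_int N + of_nat (0 + 1)) * G N))" by auto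
    have q: "(\<lambda>N. (of_int N + of_nat (0 + 1)) * G N) \<in> qp n" by (intro qpI G)
    show ?thesis
      unfolding numeral_2_eq_2 ed.simps br_linear c
      by (intro W_closed * G q qp_const qp_id)
  qed
  have S: "(\<lambda>z w. ch n i z * ch n j w * R z w) \<in> qp2 n" by (intro qpI assms)
  define k where "k = \<Phi> 2 (\<lambda>z w. ch n i z * ch n j w * R z w)"
  have kW: "k \<in> W" unfolding k_def
  proof (rule ext_pure_sum[OF assms(2) W])
    show "be 2 (\<lambda>N. ch n i N * F N) (\<lambda>N. ch n j N * G N) \<in> W" if "F \<in> qp n" "G \<in> qp n" for F G
      unfolding be_def gen_ch'[OF ij(1) that(1)] by (rule Wed[OF that(2)])
  qed (rule qp_ch)+
  have k\<Theta>: "\<Theta> k = 0"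
    using \<Theta>_ext[OF S, of 1] assms(3)[of "_ - 1"] assms(4) by (simp add: k_def numeral_2_eq_2)
  have "br (y i 0) k \<in> Ed (Suc 1)"
    unfolding k_def numeral_2_eq_2[unfolded One_nat_def[symmetric]]
    by (rule y_ext[OF ij(1) _ S]) (use mult_ok_1 in \<open>auto simp: le_Suc_eq\<close>)
  then have yk: "br (y i 0) k = 0"
    by (rule Ed_\<Theta>_zero) (simp add: k\<Theta>)
  have "br (x i 0) k = 0"
  proof -
    have "br k (x i 0) \<in> {0}"
      by (rule br_span[OF kW[unfolded W_def]])
        (use serre2[OF assms(1) ij(1) i'] br_anti in \<open>auto intro!: clie.subspaceI simp: br_anti[of _ "x i 0"]\<close>)
    then show ?thesis using br_anti[of k "x i 0"] by simp
  qed
  then have "br (br (x i 0) (y i 0)) k = 0"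
    by (simp add: jacobi_left yk)
  then have h0: "br (h i 0) k = 0" using xy[OF ij(1) ij(1), of 0 0] by simp
  have "br (h i 0) u = 2 *\<^sub>C u" if "u \<in> W" for u
    using that unfolding W_def
  proof (rule clie.span_induct)
    have a: "br (h i 0) (x i s) = 2 *\<^sub>C x i s" "br (h i 0) (x i' s) = (-2) *\<^sub>C x i' s" for s
      using hx2[OF assms(1) ij(1) ij(1)] hx2[OF assms(1) ij(1) i'(1)] i'(2) by auto
    show "br (h i 0) b = 2 *\<^sub>C b" if bW: "b \<in> {br (x i p) (br (x i q) (x i' s)) | p q s. True}" for b
    proof -
      obtain p q s where b: "b = br (x i p) (br (x i q) (x i' s))" using bW by blast
      have 1: "br (h i 0) (br (x i q) (x i' s)) = 0"
        unfolding jacobi_right[of "h i 0"] a br_linear by (simp add: clie.scale_minus_left)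
      show ?thesis
        unfolding b jacobi_right[of "h i 0" "x i p"] 1 a br_linear by simp
    qed
    show "clie.subspace {b. br (h i 0) b = 2 *\<^sub>C b}"
      by (rule clie.subspaceI) (auto simp: br_linear csc_linear mult.commute)
  qed
  then have "2 *\<^sub>C k = 0" using kW h0 by simp
  then show "\<Phi> 2 (\<lambda>z w. ch n i z * ch n j w * R z w) = 0" by (simp add: k_def clie.scale_eq_0_iff)
qed

definition sym6 :: "(int \<Rightarrow> int \<Rightarrow> int \<Rightarrow> complex) \<Rightarrow> int \<Rightarrow> int \<Rightarrow> int \<Rightarrow> complex" where
  "sym6 f a b c = f a b c + f a c b + f b a c + f b c a + f c a b + f c b a"

lemma lin_on_monomials:
  assumes "n = 1" "lin_on (qp n) f" "\<And>k. f (\<lambda>N. of_int N ^ k) = 0" "F \<in> qp n"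
  shows "f F = 0"
proof -
  have F: "F = (\<lambda>N. poly (cpoly n F 0) (of_int N))"
    using cpoly_eq[OF n1 assms(4), of _ 0] assms(1) by auto
  have "f (\<lambda>N. poly p (of_int N)) = 0" for p
  proof -
    have "f (\<lambda>N. \<Sum>k<m. poly.coeff p k * of_int N ^ k) = 0 \<and> (\<lambda>N. \<Sum>k<m. poly.coeff p k * of_int N ^ k) \<in> qp n" for m
    proof (induction m)
      case 0
      then show ?case using lin_onD(3)[OF assms(2) qp_const] by (simp add: qp_const)
    next
      case (Suc m)
      have "(\<lambda>N. of_int N ^ m) \<in> qp n" by (intro qpI)
      then show ?case using Suc assms(3)[of m]
        by (simp add: lin_onD[OF assms(2)] qp_add qp_mult qp_const)
    qed
    from this[of "Suc (degree p)"] show ?thesis by (simp add: poly_altdef lessThan_Suc_atMost)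
  qed
  then show ?thesis by (subst F)
qed

text \<open>By the bracket rule, \<open>[e F, [e G, e (N H)]]\<close> is \<open>\<Phi> 2\<close> of \<open>F z (G w H (w - 1) (w - 1) - H w G (w - 1) w)\<close>. In the sum over
  the permutations of \<open>F\<close>, \<open>G\<close>, \<open>H\<close>, which the Serre relation kills, the factors \<open>w - 1\<close> and \<open>- w\<close> add up to \<open>-1\<close>.\<close>

lemma serre_sym:
  assumes "n = 1" "f \<in> qp3 n"
  shows "\<Phi> 2 (\<lambda>z w. sym6 f z w (w - 1)) = 0"
proof -
  define e' where "e' F = e (\<lambda>N. of_int N * F N)" for F
  have e'_lin: "lin_on (qp n) e'"
  proof -
    have "(\<lambda>N. of_int N * (F N + G N)) = (\<lambda>N. of_int N * F N + of_int N * G N)"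
      "(\<lambda>N. of_int N * (c * F N)) = (\<lambda>N. c * (of_int N * F N))" for F G :: "int \<Rightarrow> complex" and c
      by (auto simp: algebra_simps)
    then show ?thesis unfolding lin_on_def e'_def by (simp add: lin_onD[OF e_lin] qp_mult qp_id)
  qed
  define T where "T F G H = br (e F) (br (e G) (e' H)) + br (e F) (br (e H) (e' G))
    + br (e G) (br (e F) (e' H)) + br (e G) (br (e H) (e' F)) + br (e H) (br (e F) (e' G)) + br (e H) (br (e G) (e' F))" for F G H
  have ex: "e (\<lambda>N. of_int N ^ k) = x 0 k" "e' (\<lambda>N. of_int N ^ k) = x 0 (k + 1)" for k
  proof -
    have *: "e (\<lambda>N. of_int N ^ k) = x 0 k" for k
      using gen_ch_poly[OF n1, of 0 x "monom 1 k"] assms(1) by (simp add: ch_def poly_monom px_monom)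
    show "e (\<lambda>N. of_int N ^ k) = x 0 k" by (rule *)
    show "e' (\<lambda>N. of_int N ^ k) = x 0 (k + 1)" unfolding e'_def using *[of "k + 1"] by simp
  qed
  have mono: "T (\<lambda>N. of_int N ^ p) (\<lambda>N. of_int N ^ q) (\<lambda>N. of_int N ^ r) = 0" for p q r
    unfolding T_def ex by (rule serre1[OF assms(1)])
  note lins = lin_onD[OF e_lin] lin_onD[OF e'_lin] br_linear csc_linear
  have l1: "lin_on (qp n) (\<lambda>F. T F G H)" and l2: "lin_on (qp n) (\<lambda>F. T G F H)" and l3: "lin_on (qp n) (\<lambda>F. T G H F)" if "G \<in> qp n" "H \<in> qp n" for G H
    unfolding lin_on_def T_def by (simp_all add: lins that algebra_simps)
  have mq: "(\<lambda>N. of_int N ^ k) \<in> qp n" for k by (intro qpI)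
  have T0: "T F G H = 0" if "F \<in> qp n" "G \<in> qp n" "H \<in> qp n" for F G H
    using lin_on_monomials[OF assms(1) l1[OF that(2,3)] _ that(1)]
      lin_on_monomials[OF assms(1) l2[OF mq that(3)] _ that(2)]
      lin_on_monomials[OF assms(1) l3[OF mq mq] _ that(3)] mono by blast
  have pure: "be 2 F (\<lambda>w. G w * H (w - 1) * of_int (w - 1) - H w * of_int w * G (w - 1)) = br (e F) (br (e G) (e' H))"
    if "F \<in> qp n" "G \<in> qp n" "H \<in> qp n" for F G H
  proof -
    have "(\<lambda>N. of_int N * H N) \<in> qp n" by (intro qpI that)
    then have "br (e G) (e' H) = ed 2 (\<lambda>w. G w * (of_int (w - 1) * H (w - 1)) - (of_int w * H w) * G (w - 1))"
      unfolding e'_def using mult_ok_1 that by (auto simp: mult_ok_def numeral_2_eq_2)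
    then show ?thesis unfolding be_def by (simp add: mult_ac)
  qed
  have q: "(\<lambda>w. G w * H (w - 1) * of_int (w - 1) - H w * of_int w * G (w - 1)) \<in> qp n" if "G \<in> qp n" "H \<in> qp n" for G H
    by (intro qp_diff qp_mult that qp_shift' qp_id)
  have q2: "(\<lambda>z w. sym6 f z w (w - 1)) \<in> qp2 n" if "f \<in> qp3 n" for f
    unfolding sym6_def by (intro qp2_add qp3_subst_qp2[OF that] qps)
  show ?thesis using assms(2)
  proof (induction f rule: qp3.induct)
    case qp3_zero
    then show ?case by (simp add: sym6_def ext_zero[OF be_bilin])
  next
    case (qp3_step P F G H)
    define A where "A F G H = (\<lambda>z w. F z * (G w * H (w - 1) * of_int (w - 1) - H w * of_int w * G (w - 1)))" for F G H :: "int \<Rightarrow> complex"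
    have Aq: "A F G H \<in> qp2 n" if "F \<in> qp n" "G \<in> qp n" "H \<in> qp n" for F G H
      unfolding A_def by (intro qp2_pure that q)
    have A\<Phi>: "\<Phi> 2 (A F G H) = br (e F) (br (e G) (e' H))" if "F \<in> qp n" "G \<in> qp n" "H \<in> qp n" for F G H
      unfolding A_def pure[OF that, symmetric] by (intro ext_pure be_bilin that q)
    note F = qp3_step(2) and G = qp3_step(3) and H = qp3_step(4)
    have split: "sym6 (\<lambda>x y z. P x y z + F x * G y * H z) z w (w - 1)
      = sym6 P z w (w - 1) - (A F G H z w + A F H G z w + A G F H z w + A G H F z w + A H F G z w + A H G F z w)" for z w
      by (simp add: sym6_def A_def algebra_simps)
    have "\<Phi> 2 (\<lambda>z w. A F G H z w + A F H G z w + A G F H z w + A G H F z w + A H F G z w + A H G F z w) = T F G H"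
      by (simp only: ext_add[OF be_bilin] Aq qp2_add F G H A\<Phi> T_def)
    moreover have "(\<lambda>z w. A F G H z w + A F H G z w + A G F H z w + A G H F z w + A H F G z w + A H G F z w) \<in> qp2 n"
      by (intro qp2_add Aq F G H)
    ultimately show ?case unfolding split
      using ext_diff[OF be_bilin q2[OF qp3_step(1)], of _ 2] qp3_step.IH T0[OF F G H] by simp
  qed
qed

text \<open>Among the functions killed by the Serre relation there is one that agrees with \<open>R\<close> on \<open>t = 0\<close> and \<open>t = -1\<close> and
  vanishes on \<open>t = 1\<close> and \<open>t = -2\<close>. The three arguments \<open>z\<close>, \<open>w\<close>, \<open>w - 1\<close> are for \<open>t = 0\<close> a repeated point with its
  lower neighbour, and for \<open>t = -1\<close> a repeated point with its upper neighbour; \<open>\<alpha>\<close> separates these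
  configurations.\<close>

lemma support_three_1:
  assumes "n = 1" "R \<in> qp2 n" "\<And>w. R (w + 1) w = 0" "\<And>w. R (w - 2) w = 0"
  shows "\<Phi> 2 R = 0"
proof -
  define \<alpha> :: "complex \<Rightarrow> complex \<Rightarrow> complex" where "\<alpha> a b = (1 - a\<^sup>2) * (4 - a\<^sup>2) * b * (b + 1) / 16" for a b
  define f where "f = (\<lambda>x y u. R x x * \<alpha> (of_int x - of_int y) (of_int x - of_int u)
    + R x (x + 1) * \<alpha> (of_int x - of_int y) (of_int u - of_int x))"
  have f: "f \<in> qp3 n" unfolding f_def \<alpha>_def
    by (intro qp3_add qp3_mult qp3_divide qp2_subst_qp3[OF assms(2)] qp3_1 shift_3; (assumption | intro qpI))
  define S where "S = (\<lambda>z w. sym6 f z w (w - 1))"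
  have S: "S \<in> qp2 n" unfolding S_def sym6_def by (intro qp2_add qp3_subst_qp2[OF f] qps)
  have "\<Phi> (Suc (Suc 0)) (\<lambda>z w. R z w - S z w) = 0"
  proof (rule support_near[of 0 1])
    show "mult_ok (Suc 0)" using mult_ok_1 by simp
    show "(\<lambda>z w. R z w - S z w) \<in> qp2 n" by (intro qp2_diff assms S)
    show "R (w + 1) w - S (w + 1) w = 0" for w
      using assms(3)[of w] by (simp add: S_def sym6_def f_def \<alpha>_def)
    show "R (w - 1) w - S (w - 1) w = 0" for w
      by (simp add: S_def sym6_def f_def \<alpha>_def)
    show "R w w - S w w = 0" for w
      by (simp add: S_def sym6_def f_def \<alpha>_def)
    show "R (w - 1 - 1) w - S (w - 1 - 1) w = 0" for w
      using assms(4)[of w] by (simp add: S_def sym6_def f_def \<alpha>_def)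
  qed simp
  moreover have "\<Phi> 2 S = 0" unfolding S_def by (rule serre_sym[OF assms(1) f])
  ultimately show ?thesis by (simp add: ext_diff[OF be_bilin assms(2) S] numeral_2_eq_2)
qed

lemma string_ok_2: "string_ok 2"
proof -
  have prev: "mult_ok (Suc 0)" using mult_ok_1 by simp
  have "string_ok (Suc (Suc 0))"
    unfolding string_ok_def
  proof (intro ballI impI)
    fix R assume R: "R \<in> qp2 n" and eq: "\<forall>N. R N (N - 1) = R (N - int (Suc (Suc 0))) N"
    show "\<Phi> (Suc (Suc 0)) R = 0"
    proof (rule exchange_ends[OF prev, of 1])
      show "R N (N - 1) = R (N - 1 - 1) N" for N using eq by simp
      fix R assume R: "R \<in> qp2 n" "\<And>w. R (w + 1) w = 0" "\<And>w. R (w - 1 - 1) w = 0"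
      then have "\<And>w. R (w - 2) w = 0" by simp
      then have "\<Phi> 2 R = 0"
        using support_three_n[OF _ R(1,2)] support_three_2[OF _ R(1,2)] support_three_1[OF _ R(1,2)] n1
        by (cases "n = 1"; cases "n = 2") auto
      then show "\<Phi> (Suc (Suc 0)) R = 0" by (simp add: numeral_2_eq_2)
    qed (use R in simp_all)
  qed
  then show ?thesis by (simp add: numeral_2_eq_2)
qed

text \<open>The two exceptional degrees come first; from then on the induction runs by itself.\<close>

theorem mult_ok_all: "mult_ok (Suc d)"
proof (induction d)
  case 0
  then show ?case using mult_ok_1 by simp
next
  case (Suc d)
  consider "d = 0" | "d = 1" | "d \<ge> 2" by linarith
  then have "string_ok (Suc (Suc d))"
  proof cases
    case 1
    then show ?thesis using string_ok_2 by (simp add: numeral_2_eq_2)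
  next
    case 2
    then show ?thesis using string_ok_3 Suc by (simp add: numeral_2_eq_2 numeral_3_eq_3)
  next
    case 3
    then show ?thesis using string_ok_far[OF Suc] by simp
  qed
  then show ?case by (rule mult_okI)
qed

end


section \<open>Gluing the two halves\<close>

text \<open>The sign and the shift in \<open>tm\<close> are such that both satisfy the same bracket rule \<open>tp_br\<close>, \<open>tm_br\<close>; the results
  on one half then apply to \<open>x\<^sup>+\<close> and to \<open>x\<^sup>-\<close>.\<close>

definition tp :: "nat \<Rightarrow> (int \<Rightarrow> complex) \<Rightarrow> clop" where
  "tp d F = Ext (FT F (int d)) 0"

definition tm :: "nat \<Rightarrow> (int \<Rightarrow> complex) \<Rightarrow> clop" where
  "tm d F = (-1) ^ Suc d *\<^sub>C Ext (FT (\<lambda>N. F (N + int d)) (- int d)) 0"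

lemma clop_eqI: "op u = op v \<Longrightarrow> ctr u = ctr v \<Longrightarrow> u = v"
  by (rule clop.expand) simp

lemma ent_FT_nz: "ent (FT F a) N M \<noteq> 0 \<Longrightarrow> M = N - a"
  by (rule ccontr) simp

lemma alpha_FT_zero: assumes "a + b \<noteq> 0 \<or> a \<le> 0" shows "alpha (FT F a) (FT G b) = 0"
proof -
  have "ent (FT F a) N M = 0 \<or> ent (FT G b) M N = 0" if "N \<ge> 0" "M < 0" for N M
  proof (rule ccontr)
    assume "\<not> (ent (FT F a) N M = 0 \<or> ent (FT G b) M N = 0)"
    then have "M = N - a" "N = M - b" using ent_FT_nz by (blast, blast)
    then have "a + b = 0" "a > 0" using that by linarith+
    with assms show False by linarith
  qed
  then show ?thesis unfolding alpha_def
    by (intro sum.neutral ballI) (auto simp del: ent_simps split: prod.splits)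
qed

lemma phi_FT: "a + b \<noteq> 0 \<Longrightarrow> phi (FT F a) (FT G b) = 0"
  by (simp add: phi_def alpha_FT_zero add.commute)

lemma alpha_FT_one: "alpha (FT F 1) (FT G (-1)) = F 0 * G (-1)"
proof -
  have "alpha (FT F 1) (FT G (-1)) = (\<Sum>(N, M)\<in>{(0, -1)}. ent (FT F 1) N M * ent (FT G (-1)) M N)"
    unfolding alpha_def
  proof (rule sum.mono_neutral_left)
    show "{(N, M). N \<ge> 0 \<and> M < 0 \<and> ent (FT F 1) N M \<noteq> 0 \<and> ent (FT G (-1)) M N \<noteq> 0} \<subseteq> {(0, -1)}"
    proof clarify
      fix N M :: int assume "N \<ge> 0" "M < 0" "ent (FT F 1) N M \<noteq> 0"
      then show "N = 0 \<and> M = -1" using ent_FT_nz[of F 1 N M] by linarith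
    qed
    show "\<forall>p\<in>{(0, -1)} - {(N, M). N \<ge> 0 \<and> M < 0 \<and> ent (FT F 1) N M \<noteq> 0 \<and> ent (FT G (-1)) M N \<noteq> 0}.
        (case p of (N, M) \<Rightarrow> ent (FT F 1) N M * ent (FT G (-1)) M N) = 0" by auto
  qed simp
  then show ?thesis by simp
qed

lemma tp_lin: "lin_on UNIV (tp d)"
  unfolding lin_on_def tp_def by (auto simp: FT_linear intro!: clop_eqI)

lemma tm_lin: "lin_on UNIV (tm d)"
  unfolding lin_on_def tm_def by (auto simp: FT_linear scl_simps mult.commute intro!: clop_eqI)

lemma FT_zero_iff: "FT F d = 0 \<longleftrightarrow> F = (\<lambda>N. 0)"
proof
  assume h: "FT F d = 0"
  show "F = (\<lambda>N. 0)"
  proof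
    fix N show "F N = 0" using arg_cong[OF h, of "\<lambda>A. ent A N (N - d)"] by simp
  qed
qed (simp add: FT_linear)

lemma tp_inj: "tp d F = 0 \<Longrightarrow> F = (\<lambda>N. 0)"
  using FT_zero_iff unfolding tp_def by (metis clop.sel(1) clop_simps(4))

lemma tm_inj: assumes "tm d F = 0" shows "F = (\<lambda>N. 0)"
proof -
  have "Ext (FT (\<lambda>N. F (N + int d)) (- int d)) 0 = 0" using assms unfolding tm_def clie.scale_eq_0_iff by simp
  then have "FT (\<lambda>N. F (N + int d)) (- int d) = 0" by (metis clop.sel(1) clop_simps(4))
  then have "F (N + int d) = 0" for N using FT_zero_iff by metis
  then show ?thesis by (metis diff_add_cancel)
qed

lemma tp_br: "d \<ge> 1 \<Longrightarrow> br (tp 1 F) (tp d G) = tp (Suc d) (\<lambda>N. F N * G (N - 1) - G N * F (N - int d))"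
  by (rule clop_eqI) (simp_all add: tp_def FT_times FT_linear phi_FT add.commute)

lemma tm_br: "d \<ge> 1 \<Longrightarrow> br (tm 1 F) (tm d G) = tm (Suc d) (\<lambda>N. F N * G (N - 1) - G N * F (N - int d))"
proof -
  have 1: "FT (\<lambda>N. F (N + int 1)) (- int 1) * FT (\<lambda>N. G (N + int d)) (- int d) = FT (\<lambda>N. G (N + int (Suc d)) * F (N + int (Suc d) - int d)) (- int (Suc d))"
    unfolding FT_times by (rule arg_cong2[where f = FT]) (auto simp: algebra_simps)
  have 2: "FT (\<lambda>N. G (N + int d)) (- int d) * FT (\<lambda>N. F (N + int 1)) (- int 1) = FT (\<lambda>N. F (N + int (Suc d)) * G (N + int (Suc d) - 1)) (- int (Suc d))"
    unfolding FT_times by (rule arg_cong2[where f = FT]) (auto simp: algebra_simps)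
  have "br (tm 1 F) (tm d G) = (-1) ^ Suc d *\<^sub>C Ext (FT (\<lambda>N. F (N + int 1)) (- int 1) * FT (\<lambda>N. G (N + int d)) (- int d)
     - FT (\<lambda>N. G (N + int d)) (- int d) * FT (\<lambda>N. F (N + int 1)) (- int 1)) 0"
    unfolding tm_def br_csc_left br_csc_right csc_csc
    by (rule clop_eqI) (simp_all add: phi_FT)
  also have "\<dots> = tm (Suc d) (\<lambda>N. F N * G (N - 1) - G N * F (N - int d))"
    unfolding 1 2 tm_def by (rule clop_eqI) (simp_all add: FT_linear scl_simps)
  finally show ?thesis .
qed

locale two_halves = P: half n x y h \<Theta> tp + M: half n y x "\<lambda>i r. - h i r" \<Theta> tm
  for n :: nat and x y h :: "nat \<Rightarrow> nat \<Rightarrow> 'v::clie" and \<Theta> :: "'v \<Rightarrow> clop"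
begin

lemmas n1 = P.n1

lemma Hs_eq: "M.Hs = P.Hs"
proof -
  have "- h i r \<in> P.Hs" "h i r \<in> M.Hs" if "i < n" for i r
  proof -
    have "h i r \<in> clie.span {h i r | i r. i < n}" using that by (intro clie.span_base) blast
    then show "- h i r \<in> P.Hs" unfolding P.Hs_def by (rule clie.span_neg)
    have "- h i r \<in> clie.span {- h i r | i r. i < n}" using that by (intro clie.span_base) blast
    then have "- (- h i r) \<in> clie.span {- h i r | i r. i < n}" by (rule clie.span_neg)
    then show "h i r \<in> M.Hs" unfolding M.Hs_def by simp
  qed
  then have sub: "{- h i r | i r. i < n} \<subseteq> P.Hs" "{h i r | i r. i < n} \<subseteq> M.Hs" by auto
  have "M.Hs \<subseteq> P.Hs" unfolding M.Hs_def
    by (rule clie.span_minimal[OF sub(1)]) (simp add: P.Hs_def clie.subspace_span)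
  moreover have "P.Hs \<subseteq> M.Hs" unfolding P.Hs_def
    by (rule clie.span_minimal[OF sub(2)]) (simp add: M.Hs_def clie.subspace_span)
  ultimately show ?thesis by simp
qed

text \<open>The candidate for the whole algebra. It is stable under \<open>x\<close> and \<open>y\<close>, because each of them raises the degree on
  its own side, lowers it on the opposite side, and maps degree one of the opposite side into \<open>Hs\<close>.\<close>

definition U :: "'v set" where
  "U = clie.span (P.Hs \<union> (\<Union>d. P.Ed (Suc d)) \<union> (\<Union>d. M.Ed (Suc d)))"

lemma U_subspace: "clie.subspace U" unfolding U_def by (rule clie.subspace_span)

lemma U_Hs: "a \<in> P.Hs \<Longrightarrow> a \<in> U" and U_P: "a \<in> P.Ed (Suc d) \<Longrightarrow> a \<in> U" and U_M: "a \<in> M.Ed (Suc d) \<Longrightarrow> a \<in> U"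
  unfolding U_def by (auto intro!: clie.span_base)

lemma span_br:
  assumes "u \<in> clie.span A" "\<And>a. a \<in> A \<Longrightarrow> br v a \<in> S" "clie.subspace S" shows "br v u \<in> S"
proof (rule clie.span_induct[OF assms(1)])
  show "br v a \<in> S" if "a \<in> A" for a using assms(2) that .
  show "clie.subspace {u. br v u \<in> S}"
    by (rule clie.subspaceI) (auto simp: br_linear clie.subspace_add[OF assms(3)] clie.subspace_scale[OF assms(3)] clie.subspace_0[OF assms(3)])
qed

lemma P_x: "i < n \<Longrightarrow> x i r \<in> P.Ed (Suc 0)" and M_y: "i < n \<Longrightarrow> y i r \<in> M.Ed (Suc 0)"
  using P.px_Ed[of i "monom 1 r"] M.px_Ed[of i "monom 1 r"] by (simp_all add: px_monom)

lemma U_x: assumes "j < n" "u \<in> U" shows "br (x j s) u \<in> U"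
  using assms(2) unfolding U_def
proof (rule span_br, fold U_def)
  fix a assume "a \<in> P.Hs \<union> (\<Union>d. P.Ed (Suc d)) \<union> (\<Union>d. M.Ed (Suc d))"
  then consider "a \<in> P.Hs" | d where "a \<in> P.Ed (Suc d)" | d where "a \<in> M.Ed (Suc d)" by blast
  then show "br (x j s) a \<in> U"
  proof cases
    case 1
    obtain F where F: "F \<in> qp n" "x j s = P.ed (Suc 0) F" using P_x[OF assms(1), of s] unfolding P.Ed_def by blast
    have "br a (x j s) \<in> P.Ed (Suc 0)" using P.h_e[OF 1 F(1)] F(2) by simp
    then have "br (x j s) a \<in> P.Ed (Suc 0)" using br_anti[of "x j s" a] by (simp add: P.Ed_closed)
    then show ?thesis by (rule U_P)
  next
    case (2 d)
    show ?thesis by (rule U_P[OF P.Ed1_Ed[OF P.mult_ok_all P_x[OF assms(1)] 2]])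
  next
    case (3 d)
    then obtain G where G: "G \<in> qp n" "a = M.ed (Suc d) G" unfolding M.Ed_def by blast
    show ?thesis
    proof (cases d)
      case 0
      then show ?thesis using M.y_x[OF assms(1) G(1), of s] G(2) U_Hs Hs_eq by simp
    next
      case (Suc c)
      have "br (x j s) (M.ed (Suc (Suc c)) G) \<in> M.Ed (Suc c)"
        by (rule M.y_Ed[OF assms(1) M.mult_ok_all G(1)])
      then show ?thesis using G(2) Suc U_M by simp
    qed
  qed
qed (rule U_subspace)

lemma U_y: assumes "j < n" "u \<in> U" shows "br (y j s) u \<in> U"
  using assms(2) unfolding U_def
proof (rule span_br, fold U_def)
  fix a assume "a \<in> P.Hs \<union> (\<Union>d. P.Ed (Suc d)) \<union> (\<Union>d. M.Ed (Suc d))"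
  then consider "a \<in> M.Hs" | d where "a \<in> P.Ed (Suc d)" | d where "a \<in> M.Ed (Suc d)" using Hs_eq by blast
  then show "br (y j s) a \<in> U"
  proof cases
    case 1
    obtain F where F: "F \<in> qp n" "y j s = M.ed (Suc 0) F" using M_y[OF assms(1), of s] unfolding M.Ed_def by blast
    have "br a (y j s) \<in> M.Ed (Suc 0)" using M.h_e[OF 1 F(1)] F(2) by simp
    then have "br (y j s) a \<in> M.Ed (Suc 0)" using br_anti[of "y j s" a] by (simp add: M.Ed_closed)
    then show ?thesis by (rule U_M)
  next
    case (3 d)
    show ?thesis by (rule U_M[OF M.Ed1_Ed[OF M.mult_ok_all M_y[OF assms(1)] 3]])
  next
    case (2 d)
    then obtain G where G: "G \<in> qp n" "a = P.ed (Suc d) G" unfolding P.Ed_def by blast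
    show ?thesis
    proof (cases d)
      case 0
      then show ?thesis using P.y_x[OF assms(1) G(1), of s] G(2) U_Hs by simp
    next
      case (Suc c)
      have "br (y j s) (P.ed (Suc (Suc c)) G) \<in> P.Ed (Suc c)"
        by (rule P.y_Ed[OF assms(1) P.mult_ok_all G(1)])
      then show ?thesis using G(2) Suc U_P by simp
    qed
  qed
qed (rule U_subspace)

inductive_set sub :: "'v set" where
  sub_x: "i < n \<Longrightarrow> x i r \<in> sub"
| sub_y: "i < n \<Longrightarrow> y i r \<in> sub"
| sub_h: "i < n \<Longrightarrow> h i r \<in> sub"
| sub_zero: "0 \<in> sub"
| sub_add: "u \<in> sub \<Longrightarrow> v \<in> sub \<Longrightarrow> u + v \<in> sub"
| sub_csc: "u \<in> sub \<Longrightarrow> c *\<^sub>C u \<in> sub"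
| sub_br: "u \<in> sub \<Longrightarrow> v \<in> sub \<Longrightarrow> br u v \<in> sub"

lemma h_eq: "i < n \<Longrightarrow> h i r = br (x i r) (y i 0)"
  using P.xy[of i i r 0] by simp

text \<open>Stability under \<open>x\<close> and \<open>y\<close> extends to all brackets by the Jacobi identity.\<close>

lemma sub_U: "u \<in> sub \<Longrightarrow> u \<in> U \<and> (\<forall>v\<in>U. br u v \<in> U)"
proof (induction u rule: sub.induct)
  case (sub_x i r)
  then show ?case using U_x U_P P_x by blast
next
  case (sub_y i r)
  then show ?case using U_y U_M M_y by blast
next
  case (sub_h i r)
  have "h i r \<in> P.Hs" unfolding P.Hs_def by (rule clie.span_base) (use sub_h in blast)
  moreover have "br (h i r) v \<in> U" if "v \<in> U" for v
    unfolding h_eq[OF sub_h] jacobi_left by (intro clie.subspace_diff[OF U_subspace] U_x U_y sub_h that)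
  ultimately show ?case using U_Hs by blast
next
  case (sub_br u v)
  then show ?case unfolding jacobi_left by (auto intro!: clie.subspace_diff[OF U_subspace])
qed (auto simp: br_linear intro!: clie.subspace_add[OF U_subspace] clie.subspace_scale[OF U_subspace] clie.subspace_0[OF U_subspace])

subsection \<open>Injectivity on the generated subalgebra\<close>

lemma \<Theta>_px_h:
  assumes "i < n" shows "\<Theta> (px h i p) = Ext (FT (\<lambda>N. ch n i N * poly p (of_int N) - ch n i (N + 1) * poly p (of_int (N + 1))) 0) (ch n i 0 * poly p 0)"
proof -
  have "px h i p = br (px x i p) (y i 0)" by (simp add: px_def br_linear h_eq[OF assms])
  then have "\<Theta> (px h i p) = br (tp 1 (\<lambda>N. ch n i N * poly p (of_int N))) (tm 1 (\<lambda>N. ch n i N))"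
    using P.\<Theta>_px[OF assms] M.\<Theta>_x[OF assms, of 0] by (simp add: P.\<Theta>_lin)
  also have "\<dots> = Ext (FT (\<lambda>N. ch n i N * poly p (of_int N) - ch n i (N + 1) * poly p (of_int (N + 1))) 0) (ch n i 0 * poly p 0)"
  proof (rule clop_eqI)
    have ch2: "ch n i N * ch n i N = ch n i N" for N by (simp add: ch_def)
    have ch3: "ch n i N * c * ch n i N = ch n i N * c" "ch n i N * (ch n i N * c) = ch n i N * c" for N c by (simp_all add: ch_def)
    let ?F = "\<lambda>N. ch n i N * poly p (of_int N)"
    show "op (br (tp 1 ?F) (tm 1 (\<lambda>N. ch n i N))) = op (Ext (FT (\<lambda>N. ch n i N * poly p (of_int N) - ch n i (N + 1) * poly p (of_int (N + 1))) 0) (ch n i 0 * poly p 0))"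
      by (simp add: tp_def tm_def FT_times FT_linear(3) scl_simps ch3)
    have 1: "alpha (FT ?F 1) (FT (\<lambda>N. ch n i (N + 1)) (-1)) = ch n i 0 * poly p 0"
      unfolding alpha_FT_one by (simp add: ch_def)
    have 2: "alpha (FT (\<lambda>N. ch n i (N + 1)) (-1)) (FT ?F 1) = 0"
      by (rule alpha_FT_zero) simp
    show "ctr (br (tp 1 ?F) (tm 1 (\<lambda>N. ch n i N))) = ctr (Ext (FT (\<lambda>N. ch n i N * poly p (of_int N) - ch n i (N + 1) * poly p (of_int (N + 1))) 0) (ch n i 0 * poly p 0))"
      by (simp add: tp_def tm_def scl_simps phi_def 1 2)
  qed
  finally show ?thesis .
qed

lemma Ext_linear: "Ext A a + Ext B b = Ext (A + B) (a + b)" "c *\<^sub>C Ext A a = Ext (scl c A) (c * a)" "Ext 0 0 = 0"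
  by (auto intro!: clop_eqI)

lemma \<Theta>_gen_h:
  assumes "F \<in> qp n" shows "\<Theta> (gen n h F) = Ext (FT (\<lambda>N. F N - F (N + 1)) 0) (F 0)"
proof -
  have "\<Theta> (\<Sum>i<m. px h i (cpoly n F i)) = Ext (FT (\<lambda>N. (\<Sum>i<m. ch n i N * F N) - (\<Sum>i<m. ch n i (N + 1) * F (N + 1))) 0) (\<Sum>i<m. ch n i 0 * F 0)" if "m \<le> n" for m
    using that
  proof (induction m)
    case 0
    then show ?case by (simp add: FT_linear Ext_linear P.\<Theta>_lin)
  next
    case (Suc m)
    have c: "ch n m N * poly (cpoly n F m) (of_int N) = ch n m N * F N" for N by (rule ch_cpoly[OF n1 assms, symmetric])
    have c0: "ch n m 0 * poly (cpoly n F m) 0 = ch n m 0 * F 0" using c[of 0] by simp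
    have "\<Theta> (px h m (cpoly n F m)) = Ext (FT (\<lambda>N. ch n m N * F N - ch n m (N + 1) * F (N + 1)) 0) (ch n m 0 * F 0)"
      using \<Theta>_px_h[of m "cpoly n F m"] Suc.prems unfolding c c0 by simp
    then show ?case using Suc by (simp add: P.\<Theta>_lin Ext_linear FT_linear(1)[symmetric] algebra_simps)
  qed
  from this[of n] show ?thesis
    unfolding gen_def sum_distrib_right[symmetric] sum_ch[OF n1] by simp
qed

lemma Hs_gen: assumes "a \<in> P.Hs" obtains F where "F \<in> qp n" "a = gen n h F"
proof -
  have "a \<in> gen n h ` qp n"
    using assms unfolding P.Hs_def
  proof (rule clie.span_induct)
    show "b \<in> gen n h ` qp n" if bh: "b \<in> {h i r | i r. i < n}" for b
    proof -
      obtain i r where b: "b = h i r" "i < n" using bh by blast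
      have "gen n h (\<lambda>N. ch n i N * poly (monom 1 r) (of_int N)) = b" using gen_ch_poly[OF n1 b(2), of h "monom 1 r"] b(1) by (simp add: px_monom)
      moreover have "(\<lambda>N. ch n i N * poly (monom 1 r) (of_int N)) \<in> qp n" by (intro qp_mult qp_ch qp_poly)
      ultimately show ?thesis by blast
    qed
    note l = lin_onD[OF gen_lin[OF n1]]
    show "clie.subspace {b. b \<in> gen n h ` qp n}"
    proof (rule clie.subspaceI)
      show "0 \<in> {b. b \<in> gen n h ` qp n}" using l(3)[OF qp_const, of h] qp_const[of 0 n] by force
      fix u v assume "u \<in> {b. b \<in> gen n h ` qp n}" "v \<in> {b. b \<in> gen n h ` qp n}"
      then obtain F G where FG: "F \<in> qp n" "G \<in> qp n" "u = gen n h F" "v = gen n h G" by auto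
      then have "u + v = gen n h (\<lambda>N. F N + G N)" by (simp add: l)
      then show "u + v \<in> {b. b \<in> gen n h ` qp n}" using qp_add[OF FG(1,2)] by auto
    next
      fix u c assume "u \<in> {b. b \<in> gen n h ` qp n}"
      then obtain F where F: "F \<in> qp n" "u = gen n h F" by auto
      then have "c *\<^sub>C u = gen n h (\<lambda>N. c * F N)" by (simp add: l)
      then show "c *\<^sub>C u \<in> {b. b \<in> gen n h ` qp n}" using qp_mult[OF qp_const F(1)] by auto
    qed
  qed
  then show ?thesis using that by blast
qed

text \<open>The operator part determines \<open>F\<close> up to a constant, and the central part \<open>F 0\<close> determines the constant: this is
  where the model must be the central extension.\<close>

lemma Hs_\<Theta>_zero: assumes "a \<in> P.Hs" "\<Theta> a = 0" shows "a = 0"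
proof -
  obtain F where F: "F \<in> qp n" "a = gen n h F" using Hs_gen[OF assms(1)] .
  have e: "Ext (FT (\<lambda>N. F N - F (N + 1)) 0) (F 0) = 0" using assms(2) \<Theta>_gen_h[OF F(1)] F(2) by simp
  then have "F 0 = 0" "FT (\<lambda>N. F N - F (N + 1)) 0 = 0" by (metis clop.sel clop_simps(10), metis clop.sel clop_simps(4))
  then have step: "F N = F (N + 1)" and F0: "F 0 = 0" for N using FT_zero_iff[of _ 0] by (auto dest: fun_cong[where x = N])
  have "F N = 0" for N
    by (induction N rule: int_induct[where k = 0]) (use step F0 in \<open>auto simp: step[of "_ - 1", simplified]\<close>)
  then have "F = (\<lambda>N. 0)" by auto
  then show ?thesis using F lin_onD(3)[OF gen_lin[OF n1] F(1)] by simp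
qed

text \<open>Every vector of \<open>U\<close> is a finite sum of components of the various degrees.\<close>

definition graded :: "nat \<Rightarrow> 'v \<Rightarrow> (nat \<Rightarrow> int \<Rightarrow> complex) \<Rightarrow> (nat \<Rightarrow> int \<Rightarrow> complex) \<Rightarrow> 'v" where
  "graded m a F G = a + (\<Sum>d<m. P.ed (Suc d) (F d)) + (\<Sum>d<m. M.ed (Suc d) (G d))"

definition is_graded :: "'v \<Rightarrow> bool" where
  "is_graded u \<longleftrightarrow> (\<exists>m a F G. a \<in> P.Hs \<and> (\<forall>d. F d \<in> qp n \<and> G d \<in> qp n) \<and>
     (\<forall>d\<ge>m. F d = (\<lambda>N. 0) \<and> G d = (\<lambda>N. 0)) \<and> u = graded m a F G)"

lemma ed_zero [simp]: "P.ed d (\<lambda>N. 0) = 0" "M.ed d (\<lambda>N. 0) = 0"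
  using lin_onD(3)[OF P.ed_lin qp_const] lin_onD(3)[OF M.ed_lin qp_const] by auto

lemma graded_extend:
  assumes "m \<le> k" "\<forall>d\<ge>m. F d = (\<lambda>N. 0) \<and> G d = (\<lambda>N. 0)"
  shows "graded m a F G = graded k a F G"
proof -
  have "(\<Sum>d<m. P.ed (Suc d) (F d)) = (\<Sum>d<k. P.ed (Suc d) (F d))" "(\<Sum>d<m. M.ed (Suc d) (G d)) = (\<Sum>d<k. M.ed (Suc d) (G d))"
    by (rule sum.mono_neutral_left; use assms in auto)+
  then show ?thesis by (simp add: graded_def)
qed

lemma Hs_subspace: "clie.subspace P.Hs" unfolding P.Hs_def by (rule clie.subspace_span)

lemma is_gradedE:
  assumes "is_graded u"
  obtains m a F G where "a \<in> P.Hs" "\<And>d. F d \<in> qp n" "\<And>d. G d \<in> qp n" "\<forall>d\<ge>m. F d = (\<lambda>N. 0) \<and> G d = (\<lambda>N. 0)" "u = graded m a F G"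
  using assms unfolding is_graded_def by blast

lemma is_gradedI:
  "a \<in> P.Hs \<Longrightarrow> (\<And>d. F d \<in> qp n) \<Longrightarrow> (\<And>d. G d \<in> qp n) \<Longrightarrow> (\<And>d. d \<ge> m \<Longrightarrow> F d = (\<lambda>N. 0) \<and> G d = (\<lambda>N. 0)) \<Longrightarrow>
    u = graded m a F G \<Longrightarrow> is_graded u"
  unfolding is_graded_def by blast

lemma is_graded_subspace: "clie.subspace {u. is_graded u}"
proof (rule clie.subspaceI)
  show "0 \<in> {u. is_graded u}"
    unfolding mem_Collect_eq is_graded_def
    by (rule exI[of _ 0], rule exI[of _ 0], rule exI[of _ "\<lambda>_ _. 0"], rule exI[of _ "\<lambda>_ _. 0"])
      (auto simp: graded_def qp_const clie.subspace_0[OF Hs_subspace])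
next
  fix u v assume "u \<in> {u. is_graded u}" "v \<in> {u. is_graded u}"
  then have uv: "is_graded u" "is_graded v" by simp_all
  obtain m a F G where
    1: "a \<in> P.Hs" "\<And>d. F d \<in> qp n" "\<And>d. G d \<in> qp n" "\<forall>d\<ge>m. F d = (\<lambda>N. 0) \<and> G d = (\<lambda>N. 0)" "u = graded m a F G"
    using uv(1) by (rule is_gradedE) blast
  obtain m' a' F' G' where
    2: "a' \<in> P.Hs" "\<And>d. F' d \<in> qp n" "\<And>d. G' d \<in> qp n" "\<forall>d\<ge>m'. F' d = (\<lambda>N. 0) \<and> G' d = (\<lambda>N. 0)" "v = graded m' a' F' G'"
    using uv(2) by (rule is_gradedE) blast
  let ?m = "max m m'"
  have "u + v = graded ?m a F G + graded ?m a' F' G'"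
    unfolding 1(5) 2(5) using graded_extend[OF _ 1(4), of ?m a] graded_extend[OF _ 2(4), of ?m a'] by simp
  also have "\<dots> = graded ?m (a + a') (\<lambda>d N. F d N + F' d N) (\<lambda>d N. G d N + G' d N)"
    unfolding graded_def lin_onD(1)[OF P.ed_lin 1(2) 2(2)] lin_onD(1)[OF M.ed_lin 1(3) 2(3)] by (simp only: sum.distrib add_ac)
  finally have eq: "u + v = \<dots>" .
  show "u + v \<in> {u. is_graded u}"
    unfolding mem_Collect_eq
    by (rule is_gradedI[where m = ?m and a = "a + a'" and F = "\<lambda>d N. F d N + F' d N" and G = "\<lambda>d N. G d N + G' d N", OF _ _ _ _ eq])
      (use 1(1-4) 2(1-4) in \<open>auto intro: qp_add clie.subspace_add[OF Hs_subspace]\<close>)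
next
  fix u c assume "u \<in> {u. is_graded u}"
  then have "is_graded u" by simp
  then obtain m a F G where
    1: "a \<in> P.Hs" "\<And>d. F d \<in> qp n" "\<And>d. G d \<in> qp n" "\<forall>d\<ge>m. F d = (\<lambda>N. 0) \<and> G d = (\<lambda>N. 0)" "u = graded m a F G"
    by (rule is_gradedE) blast
  have "c *\<^sub>C u = graded m (c *\<^sub>C a) (\<lambda>d N. c * F d N) (\<lambda>d N. c * G d N)"
    unfolding 1(5) graded_def lin_onD(2)[OF P.ed_lin 1(2)] lin_onD(2)[OF M.ed_lin 1(3)] by (simp only: csc_linear)
  note eq = this
  show "c *\<^sub>C u \<in> {u. is_graded u}"
    unfolding mem_Collect_eq
    by (rule is_gradedI[where m = m and a = "c *\<^sub>C a" and F = "\<lambda>d N. c * F d N" and G = "\<lambda>d N. c * G d N", OF _ _ _ _ eq])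
      (use 1(1-4) in \<open>auto intro: qp_mult qp_const clie.subspace_scale[OF Hs_subspace]\<close>)
qed

lemma U_graded: assumes "u \<in> U" shows "is_graded u"
  using assms unfolding U_def
proof (rule clie.span_induct)
  show "clie.subspace {u. is_graded u}" by (rule is_graded_subspace)
  fix b assume "b \<in> P.Hs \<union> (\<Union>d. P.Ed (Suc d)) \<union> (\<Union>d. M.Ed (Suc d))"
  then consider "b \<in> P.Hs" | d where "b \<in> P.Ed (Suc d)" | d where "b \<in> M.Ed (Suc d)" by blast
  then show "is_graded b"
  proof cases
    case 1
    then show ?thesis unfolding is_graded_def
      by (intro exI[of _ 0] exI[of _ b] exI[of _ "\<lambda>_ _. 0"]) (auto simp: graded_def qp_const)
  next
    case (2 d)
    then obtain F where F: "F \<in> qp n" "b = P.ed (Suc d) F" unfolding P.Ed_def by blast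
    have "(\<Sum>c<Suc d. P.ed (Suc c) (if c = d then F else (\<lambda>N. 0))) = b"
      using F(2) by (simp add: if_distrib[of "P.ed _"] del: P.ed.simps cong: if_cong)
    then show ?thesis unfolding is_graded_def using F(1)
      by (intro exI[of _ "Suc d"] exI[of _ 0] exI[of _ "\<lambda>c. if c = d then F else (\<lambda>N. 0)"] exI[of _ "\<lambda>_ _. 0"])
        (auto simp: graded_def qp_const clie.subspace_0[OF Hs_subspace] simp del: P.ed.simps)
  next
    case (3 d)
    then obtain F where F: "F \<in> qp n" "b = M.ed (Suc d) F" unfolding M.Ed_def by blast
    have "(\<Sum>c<Suc d. M.ed (Suc c) (if c = d then F else (\<lambda>N. 0))) = b"
      using F(2) by (simp add: if_distrib[of "M.ed _"] del: M.ed.simps cong: if_cong)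
    then show ?thesis unfolding is_graded_def using F(1)
      by (intro exI[of _ "Suc d"] exI[of _ 0] exI[of _ "\<lambda>_ _. 0"] exI[of _ "\<lambda>c. if c = d then F else (\<lambda>N. 0)"])
        (auto simp: graded_def qp_const clie.subspace_0[OF Hs_subspace] simp del: M.ed.simps)
  qed
qed

lemma ent_sum: "ent (\<Sum>i\<in>I. f i) N K = (\<Sum>i\<in>I. ent (f i) N K)"
  by (induction I rule: infinite_finite_induct) auto

lemma op_sum: "op (\<Sum>i\<in>I. f i) = (\<Sum>i\<in>I. op (f i))"
  by (induction I rule: infinite_finite_induct) auto

text \<open>The components of different degrees have their matrix entries on different diagonals.\<close>

lemma sub_\<Theta>_zero: assumes "u \<in> sub" "\<Theta> u = 0" shows "u = 0"
proof -
  have "is_graded u" using sub_U[OF assms(1)] U_graded by blast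
  then obtain m a F G where
    1: "a \<in> P.Hs" "\<And>d. F d \<in> qp n" "\<And>d. G d \<in> qp n" "\<forall>d\<ge>m. F d = (\<lambda>N. 0) \<and> G d = (\<lambda>N. 0)" "u = graded m a F G"
    by (rule is_gradedE) blast
  obtain A where A: "A \<in> qp n" "a = gen n h A" using Hs_gen[OF 1(1)] .
  have \<Theta>u: "\<Theta> u = \<Theta> a + (\<Sum>d<m. tp (Suc d) (F d)) + (\<Sum>d<m. tm (Suc d) (G d))"
    unfolding 1(5) graded_def P.\<Theta>_lin P.\<Theta>_sum P.\<Theta>_ed[OF 1(2)] M.\<Theta>_ed[OF 1(3)] ..
  \<comment> \<open>the matrix entries of the image\<close>
  define B where "B N K = (A N - A (N + 1)) * of_bool (K = N) + (\<Sum>d<m. F d N * of_bool (K = N - int (Suc d)))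
      + (\<Sum>d<m. (-1) ^ Suc (Suc d) * (G d (N + int (Suc d)) * of_bool (K = N + int (Suc d))))" for N K
  have "B N K = ent (op (\<Theta> u)) N K" for N K
    unfolding \<Theta>u B_def A(2) \<Theta>_gen_h[OF A(1)]
    by (simp add: ent_sum op_sum tp_def tm_def algebra_simps)
  then have B: "B N K = 0" for N K using assms(2) by simp
  have "F d N = 0" if "d < m" for d N
  proof -
    have "(\<Sum>c<m. F c N * of_bool (N - int (Suc d) = N - int (Suc c))) = (\<Sum>c<m. if c = d then F d N else 0)"
      by (intro sum.cong) auto
    moreover have "(\<Sum>c<m. (-1) ^ Suc (Suc c) * (G c (N + int (Suc c)) * of_bool (N - int (Suc d) = N + int (Suc c)))) = 0"
      by (intro sum.neutral) auto
    ultimately show ?thesis using B[of N "N - int (Suc d)"] that by (simp add: B_def)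
  qed
  moreover have "G d N = 0" if "d < m" for d N
  proof -
    have "(\<Sum>c<m. (-1) ^ Suc (Suc c) * (G c (N - int (Suc d) + int (Suc c)) * of_bool (N - int (Suc d) + int (Suc d) = N - int (Suc d) + int (Suc c)))) = (\<Sum>c<m. if c = d then (-1) ^ Suc (Suc d) * G d N else 0)"
      by (intro sum.cong) auto
    moreover have "(\<Sum>c<m. F c (N - int (Suc d)) * of_bool (N - int (Suc d) + int (Suc d) = N - int (Suc d) - int (Suc c))) = 0"
      by (intro sum.neutral) auto
    ultimately show ?thesis using B[of "N - int (Suc d)" "N - int (Suc d) + int (Suc d)"] that by (simp add: B_def)
  qed
  ultimately have "F d = (\<lambda>N. 0)" "G d = (\<lambda>N. 0)" for d using 1(4) by (cases "d < m"; auto)+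
  then have u: "u = a" using 1(5) by (simp add: graded_def del: P.ed.simps M.ed.simps)
  then show ?thesis using Hs_\<Theta>_zero[OF 1(1)] assms(2) by simp
qed

subsection \<open>The image of the generated subalgebra\<close>

lemma sub_sum: "(\<And>i. i \<in> I \<Longrightarrow> f i \<in> sub) \<Longrightarrow> (\<Sum>i\<in>I. f i) \<in> sub"
  by (induction I rule: infinite_finite_induct) (auto intro: sub.intros)

lemma sub_diff: "u \<in> sub \<Longrightarrow> v \<in> sub \<Longrightarrow> u - v \<in> sub"
  using sub_add[OF _ sub_csc[of v "-1"], of u] by simp

lemma sub_ed: "P.ed d F \<in> sub" "M.ed d F \<in> sub" "gen n h F \<in> sub"
proof -
  have e: "P.e F \<in> sub" "M.e F \<in> sub" "gen n h F \<in> sub" for F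
    unfolding gen_def px_def by (auto intro!: sub_sum sub.intros)
  show "gen n h F \<in> sub" by (rule e)
  show "P.ed d F \<in> sub"
  proof (induction d F rule: P.ed.induct)
    case (3 d H)
    then show ?case unfolding P.ed.simps by (intro sub_csc sub_diff sub_br e)
  qed (auto intro: e sub.intros)
  show "M.ed d F \<in> sub"
  proof (induction d F rule: M.ed.induct)
    case (3 d H)
    then show ?case unfolding M.ed.simps by (intro sub_csc sub_diff sub_br e)
  qed (auto intro: e sub.intros)
qed

text \<open>Expanding \<open>(z + c)\<^sup>k\<^sup>+\<^sup>1\<close> expresses \<open>z\<^sup>k\<close> by a difference and lower powers.\<close>

lemma antidifference_power: assumes "c \<noteq> 0" shows "\<exists>p. \<forall>z. poly p z - poly p (z + c) = (z :: complex) ^ k"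
proof (induction k rule: less_induct)
  case (less k)
  then obtain p where p: "\<And>j z. j < k \<Longrightarrow> poly (p j) z - poly (p j) (z + c) = z ^ j" by metis
  define b where "b = - inverse (of_nat (Suc k) * c)"
  have "of_nat (Suc k) * c \<noteq> 0" using assms of_nat_neq_0[of k, where 'a = complex] by (simp del: of_nat_Suc)
  then have "inverse (of_nat (Suc k) * c) * (of_nat (Suc k) * c) = 1" by (rule Fields.field_class.field_inverse)
  then have b: "b * (of_nat (Suc k) * c) = -1" unfolding b_def mult_minus_left by (rule arg_cong)
  define q where "q = Polynomial.smult b (monom 1 (Suc k) + (\<Sum>j<k. Polynomial.smult (of_nat (Suc k choose j) * c ^ (Suc k - j)) (p j)))"
  have "poly q z - poly q (z + c) = z ^ k" for z
  proof -
    have alg: "b * (A - (A + K * t + S) + S) = - (b * K) * t" for A K t S :: complex by (simp add: algebra_simps)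
    have "(z + c) ^ Suc k = (\<Sum>j\<le>Suc k. of_nat (Suc k choose j) * z ^ j * c ^ (Suc k - j))" by (rule binomial_ring)
    also have "{..Suc k} = insert (Suc k) (insert k {..<k})" by auto
    finally have bin: "(z + c) ^ Suc k = z ^ Suc k + of_nat (Suc k) * c * z ^ k + (\<Sum>j<k. of_nat (Suc k choose j) * z ^ j * c ^ (Suc k - j))"
      by (simp add: algebra_simps)
    have "poly q z - poly q (z + c) = b * (z ^ Suc k - (z + c) ^ Suc k
       + (\<Sum>j<k. of_nat (Suc k choose j) * c ^ (Suc k - j) * (poly (p j) z - poly (p j) (z + c))))"
      by (simp add: q_def poly_monom poly_sum algebra_simps sum_subtractf)
    also have "(\<Sum>j<k. of_nat (Suc k choose j) * c ^ (Suc k - j) * (poly (p j) z - poly (p j) (z + c))) = (\<Sum>j<k. of_nat (Suc k choose j) * z ^ j * c ^ (Suc k - j))"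
      by (intro sum.cong) (simp_all add: p)
    also have "b * (z ^ Suc k - (z + c) ^ Suc k + (\<Sum>j<k. of_nat (Suc k choose j) * z ^ j * c ^ (Suc k - j))) = - (b * (of_nat (Suc k) * c)) * z ^ k"
      unfolding bin by (rule alg)
    finally show ?thesis unfolding b by simp
  qed
  then show ?case by blast
qed

lemma antidifference_poly: assumes "c \<noteq> 0" shows "\<exists>p. \<forall>z. poly p z - poly p (z + c) = poly q (z :: complex)"
proof -
  obtain p where p: "\<And>k z. poly (p k) z - poly (p k) (z + c) = z ^ k" using antidifference_power[OF assms] by metis
  have "poly (\<Sum>k\<le>degree q. Polynomial.smult (poly.coeff q k) (p k)) z - poly (\<Sum>k\<le>degree q. Polynomial.smult (poly.coeff q k) (p k)) (z + c) = poly q z" for z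
    by (simp add: poly_sum sum_subtractf[symmetric] right_diff_distrib[symmetric] p poly_altdef[of q])
  then show ?thesis by blast
qed

text \<open>Solve \<open>K N - K (N + n) = G N\<close> on every class and sum \<open>K\<close> over \<open>n\<close> consecutive points.\<close>

lemma antidifference: assumes "G \<in> qp n" obtains F where "F \<in> qp n" "\<And>N. F N - F (N + 1) = G N"
proof -
  obtain q where q: "\<And>N. G N = poly (q (N mod int n)) (of_int N)" using assms unfolding qp_def by auto
  have "of_nat n \<noteq> (0::complex)" using n1 by simp
  then have "\<forall>r. \<exists>p. \<forall>z. poly p z - poly p (z + of_nat n) = poly (q r) z" using antidifference_poly by blast
  then obtain p where p: "\<forall>r. \<forall>z. poly (p r) z - poly (p r) (z + of_nat n) = poly (q r) z" by (rule choice[THEN exE])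
  define K where "K N = poly (p (N mod int n)) (of_int N)" for N
  have K: "K \<in> qp n" unfolding K_def qp_def by blast
  have KG: "K N - K (N + int n) = G N" for N using p[rule_format, of "N mod int n" "of_int N"] by (simp add: K_def q)
  define F where "F N = (\<Sum>k<n. K (N + int k))" for N
  have "(\<lambda>N. \<Sum>k<m. K (N + int k)) \<in> qp n" for m
    by (induction m) (auto intro!: qp_const qp_add qp_shift K)
  then have "F \<in> qp n" unfolding F_def .
  moreover have "F N - F (N + 1) = G N" for N
  proof -
    have "(\<Sum>k<m. K (N + int k)) - (\<Sum>k<m. K (N + 1 + int k)) = K N - K (N + int m)" for m
      by (induction m) (auto simp: algebra_simps)
    then show ?thesis unfolding F_def KG[symmetric] .
  qed
  ultimately show ?thesis using that by blast
qed

text \<open>Degree zero together with the centre is reached by antidifferences; constant functions give the centre.\<close>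

lemma sub_surj:
  assumes "F \<in> qp n" shows "\<exists>u\<in>sub. \<exists>c. \<Theta> u = Ext (FT F d) c" "\<exists>u\<in>sub. \<Theta> u = Ext 0 c"
proof -
  have "(\<lambda>N. c) \<in> qp n" by (rule qp_const)
  then have "\<Theta> (gen n h (\<lambda>N. c)) = Ext 0 c" by (simp add: \<Theta>_gen_h FT_linear)
  then show "\<exists>u\<in>sub. \<Theta> u = Ext 0 c" using sub_ed(3) by blast
  consider "d = 0" | k where "d = int (Suc k)" | k where "d = - int (Suc k)"
    by (metis int_cases3 not0_implies_Suc of_nat_0_less_iff less_numeral_extra(3))
  then show "\<exists>u\<in>sub. \<exists>c. \<Theta> u = Ext (FT F d) c"
  proof cases
    case 1
    obtain A where "A \<in> qp n" "\<And>N. A N - A (N + 1) = F N" using antidifference[OF assms] by blast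
    then have "\<Theta> (gen n h A) = Ext (FT F d) (A 0)" using \<Theta>_gen_h 1 by simp
    then show ?thesis using sub_ed(3) by blast
  next
    case (2 k)
    have "\<Theta> (P.ed (Suc k) F) = Ext (FT F d) 0" using P.\<Theta>_ed[OF assms] by (simp add: tp_def 2)
    then show ?thesis using sub_ed(1) by blast
  next
    case (3 k)
    define G where "G N = (-1) ^ Suc (Suc k) * F (N - int (Suc k))" for N
    have G: "G \<in> qp n" unfolding G_def by (intro qp_mult qp_const qp_shift' assms)
    have "\<Theta> (M.ed (Suc k) G) = Ext (FT F d) 0"
      unfolding M.\<Theta>_ed[OF G] tm_def
      by (rule clop_eqI) (simp_all add: 3 G_def FT_linear scl_simps power_add[symmetric] power_mult_distrib[symmetric])
    then show ?thesis using sub_ed(2) by blast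
  qed
qed

end


section \<open>From the defining relations to one half of the algebra\<close>

text \<open>The defining relations that involve the generators of one sign \<open>\<sigma>\<close>, for arbitrary \<open>\<beta>\<close>. The aim is to
  derive from them, for the generators rescaled to \<open>\<beta> = 1\<close>, the uniform relations of \<^locale>\<open>half\<close>.\<close>

locale hrel =
  fixes n :: nat and \<beta> \<sigma> :: complex and x h :: "nat \<Rightarrow> nat \<Rightarrow> 'v::clie"
  assumes n1: "n \<ge> 1" and \<beta>: "\<beta> \<noteq> 0"
    and x_x: "\<lbrakk>n > 2; i < n; j < n\<rbrakk> \<Longrightarrow>
      br (x i (r + 1)) (x j s) - br (x i r) (x j (s + 1)) = (- m_mat n i j * \<beta>) *\<^sub>C br (x i r) (x j s)"
    and h_x: "\<lbrakk>n > 2; i < n; j < n\<rbrakk> \<Longrightarrow>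
      br (h i (r + 1)) (x j s) - br (h i r) (x j (s + 1)) = (- m_mat n i j * \<beta>) *\<^sub>C br (h i r) (x j s)"
    and h0_x: "\<lbrakk>n \<ge> 2; i < n; j < n\<rbrakk> \<Longrightarrow> br (h i 0) (x j s) = (\<sigma> * a_mat n i j) *\<^sub>C x j s"
    and adjacent: "\<lbrakk>n > 2; i < n; j < n; [int j = int i + 1] (mod int n) \<or> [int j = int i - 1] (mod int n)\<rbrakk> \<Longrightarrow>
      br (x i p) (br (x i q) (x j s)) + br (x i q) (br (x i p) (x j s)) = 0"
    and distant: "\<lbrakk>n > 2; i < n; j < n; j \<noteq> i; \<not> [int j = int i + 1] (mod int n); \<not> [int j = int i - 1] (mod int n)\<rbrakk> \<Longrightarrow>
      br (x i r) (x j s) = 0"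
    and x_x_same_2: "\<lbrakk>n = 2; i < n\<rbrakk> \<Longrightarrow> br (x i (r + 1)) (x i s) = br (x i r) (x i (s + 1))"
    and x_x_2: "\<lbrakk>n = 2; i < n; j = (i + 1) mod n\<rbrakk> \<Longrightarrow>
      br (x i (r + 2)) (x j s) - 2 *\<^sub>C br (x i (r + 1)) (x j (s + 1)) + br (x i r) (x j (s + 2)) = \<beta>\<^sup>2 *\<^sub>C br (x i r) (x j s)"
    and h_x_same_2: "\<lbrakk>n = 2; i < n\<rbrakk> \<Longrightarrow> br (h i (r + 1)) (x i s) = br (h i r) (x i (s + 1))"
    and h_x_2: "\<lbrakk>n = 2; i < n; j = (i + 1) mod n\<rbrakk> \<Longrightarrow>
      br (h i (r + 2)) (x j s) - 2 *\<^sub>C br (h i (r + 1)) (x j (s + 1)) + br (h i r) (x j (s + 2)) = \<beta>\<^sup>2 *\<^sub>C br (h i r) (x j s)"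
    and h1_x_2: "\<lbrakk>n = 2; i < n; j = (i + 1) mod n\<rbrakk> \<Longrightarrow> br (h i 1) (x j s) = (- \<sigma> * 2) *\<^sub>C x j (s + 1)"
    and serre_2: "\<lbrakk>n = 2; i < n; j = (i + 1) mod n\<rbrakk> \<Longrightarrow>
      br (x i p) (br (x i q) (br (x i r) (x j s))) + br (x i p) (br (x i r) (br (x i q) (x j s)))
      + br (x i q) (br (x i p) (br (x i r) (x j s))) + br (x i q) (br (x i r) (br (x i p) (x j s)))
      + br (x i r) (br (x i p) (br (x i q) (x j s))) + br (x i r) (br (x i q) (br (x i p) (x j s))) = 0"
    and x_x_1: "n = 1 \<Longrightarrow>
      br (x 0 (r + 3)) (x 0 s) - 3 *\<^sub>C br (x 0 (r + 2)) (x 0 (s + 1)) + 3 *\<^sub>C br (x 0 (r + 1)) (x 0 (s + 2)) - br (x 0 r) (x 0 (s + 3))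
      = \<beta>\<^sup>2 *\<^sub>C (br (x 0 (r + 1)) (x 0 s) - br (x 0 r) (x 0 (s + 1)))"
    and h_x_1: "n = 1 \<Longrightarrow>
      br (h 0 (r + 3)) (x 0 s) - 3 *\<^sub>C br (h 0 (r + 2)) (x 0 (s + 1)) + 3 *\<^sub>C br (h 0 (r + 1)) (x 0 (s + 2)) - br (h 0 r) (x 0 (s + 3))
      = \<beta>\<^sup>2 *\<^sub>C (br (h 0 (r + 1)) (x 0 s) - br (h 0 r) (x 0 (s + 1)))"
    and h0_x_1: "n = 1 \<Longrightarrow> br (h 0 0) (x 0 s) = 0"
    and h1_x_1: "n = 1 \<Longrightarrow> br (h 0 1) (x 0 s) = 0"
    and h2_x_1: "n = 1 \<Longrightarrow> br (h 0 2) (x 0 s) = (- \<sigma> * 2 * \<beta>\<^sup>2) *\<^sub>C x 0 s"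
    and serre_1: "n = 1 \<Longrightarrow>
      br (x 0 p) (br (x 0 q) (x 0 (r + 1))) + br (x 0 p) (br (x 0 r) (x 0 (q + 1)))
      + br (x 0 q) (br (x 0 p) (x 0 (r + 1))) + br (x 0 q) (br (x 0 r) (x 0 (p + 1)))
      + br (x 0 r) (br (x 0 p) (x 0 (q + 1))) + br (x 0 r) (br (x 0 q) (x 0 (p + 1))) = 0"
begin

definition xs :: "nat \<Rightarrow> nat \<Rightarrow> 'v" where "xs i r = (inverse \<beta> ^ r) *\<^sub>C x i r"
definition hs :: "nat \<Rightarrow> nat \<Rightarrow> 'v" where "hs i r = (inverse \<beta> ^ r) *\<^sub>C h i r"

lemma two_cancel: "u + u = 0 \<Longrightarrow> u = (0::'v)"
proof -
  assume "u + u = 0"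
  then have "2 *\<^sub>C u = 0" using csc_add_left[of 1 1 u] by simp
  then show "u = 0" by (simp add: clie.scale_eq_0_iff)
qed

text \<open>Such a family depends on \<open>r + s\<close> only, hence is symmetric as well.\<close>

lemma antisymmetric_shift:
  fixes c :: "nat \<Rightarrow> nat \<Rightarrow> 'v"
  assumes "\<And>r s. c (r + 1) s = c r (s + 1)" "\<And>r s. c r s = - c s r"
  shows "c r s = 0"
proof -
  have shift: "c r s = c 0 (r + s)" for r s
    by (induction r arbitrary: s) (use assms(1) in \<open>auto\<close>)
  have "c r s = c s r" using shift[of r s] shift[of s r] by (simp add: add.commute)
  then have e: "c r s = - c r s" using assms(2)[of r s] by simp
  have "c r s + c r s = 0" by (subst (2) e) simp
  then show ?thesis by (rule two_cancel)
qed

lemma cong_self_n: "n \<ge> 2 \<Longrightarrow> \<not> [int i = int i + 1] (mod int n)" "n \<ge> 2 \<Longrightarrow> \<not> [int i = int i - 1] (mod int n)"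
  by (auto simp: cong_iff_dvd_diff dest: zdvd_imp_le)

lemma cong_pm_n: "n > 2 \<Longrightarrow> \<not> ([int j = int i + 1] (mod int n) \<and> [int j = int i - 1] (mod int n))"
proof
  assume n: "n > 2" and h: "[int j = int i + 1] (mod int n) \<and> [int j = int i - 1] (mod int n)"
  then have "[int i + 1 = int i - 1] (mod int n)" by (meson cong_sym cong_trans)
  then have "int n dvd 2" by (simp add: cong_iff_dvd_diff)
  then show False using n by (auto dest: zdvd_imp_le)
qed

lemma cong_flip: "[int i = int j + 1] (mod int n) \<longleftrightarrow> [int j = int i - 1] (mod int n)"
  "[int i = int j - 1] (mod int n) \<longleftrightarrow> [int j = int i + 1] (mod int n)"
proof -
  have e: "int j - (int i - 1) = - (int i - (int j + 1))" "int j - (int i + 1) = - (int i - (int j - 1))" by simp_all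
  show "[int i = int j + 1] (mod int n) \<longleftrightarrow> [int j = int i - 1] (mod int n)"
    "[int i = int j - 1] (mod int n) \<longleftrightarrow> [int j = int i + 1] (mod int n)"
    unfolding cong_iff_dvd_diff e dvd_minus_iff by simp_all
qed

lemma m_mat_eq:
  assumes "n > 2" shows "m_mat n i j = (if [int j = int i + 1] (mod int n) then -1 else if [int j = int i - 1] (mod int n) then 1 else 0)"
  using cong_pm_n[OF assms, of j i] unfolding m_mat_def kdelta_def cong_flip[of i j] by simp

lemma same_zero: assumes "n \<ge> 2" "i < n" shows "br (x i r) (x i s) = 0"
proof (rule antisymmetric_shift[where c = "\<lambda>r s. br (x i r) (x i s)"])
  show "br (x i (r + 1)) (x i s) = br (x i r) (x i (s + 1))" for r s
  proof (cases "n = 2")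
    case True
    then show ?thesis using x_x_same_2 assms by simp
  next
    case False
    then have n: "n > 2" using assms by simp
    show ?thesis using x_x[OF n assms(2,2), of r s] cong_self_n[OF assms(1), of i] by (simp add: m_mat_eq[OF n])
  qed
qed (rule br_anti)

lemma same_zero_s: "n \<ge> 2 \<Longrightarrow> i < n \<Longrightarrow> br (xs i r) (xs i s) = 0"
  by (simp add: xs_def br_linear same_zero)

lemma xs_xs:
  assumes "n > 2" "i < n" "j < n"
  shows "br (xs i (r + 1)) (xs j s) - br (xs i r) (xs j (s + 1)) = (- m_mat n i j) *\<^sub>C br (xs i r) (xs j s)"
proof -
  have "br (xs i (r + 1)) (xs j s) - br (xs i r) (xs j (s + 1)) = (inverse \<beta> ^ (r + s + 1)) *\<^sub>C (br (x i (r + 1)) (x j s) - br (x i r) (x j (s + 1)))"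
    by (simp add: xs_def br_linear csc_linear power_add mult_ac)
  also have "\<dots> = (- m_mat n i j) *\<^sub>C br (xs i r) (xs j s)"
    unfolding x_x[OF assms] using \<beta> by (simp add: xs_def br_linear power_add mult_ac)
  finally show ?thesis .
qed

text \<open>For \<open>n > 2\<close> the linear relation implies the quadratic one; for \<open>n = 2\<close> it is a defining relation. For
  \<open>n = 1\<close> the cubic relation says that the defect \<open>D\<close> of the quadratic one is invariant under moving a
  shift from one argument to the other, and \<open>D\<close> is antisymmetric.\<close>

lemma quad_s:
  assumes "i < n" "j < n"
  shows "br (xs i (r + 2)) (xs j s) - 2 *\<^sub>C br (xs i (r + 1)) (xs j (s + 1)) + br (xs i r) (xs j (s + 2)) = br (xs i r) (xs j s)"
proof -
  have two: "2 *\<^sub>C u = u + u" for u :: 'v using csc_add_left[of 1 1 u] by simp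
  consider "n = 1" | "n = 2" | "n > 2" using n1 by linarith
  then show ?thesis
  proof cases
    case 1
    define D where "D r s = br (xs 0 (r + 2)) (xs 0 s) - 2 *\<^sub>C br (xs 0 (r + 1)) (xs 0 (s + 1)) + br (xs 0 r) (xs 0 (s + 2)) - br (xs 0 r) (xs 0 s)" for r s
    have "D (r + 1) s - D r (s + 1) = 0" for r s
    proof -
      have "D (r + 1) s - D r (s + 1) = (inverse \<beta> ^ (r + s + 3)) *\<^sub>C
         (br (x 0 (r + 3)) (x 0 s) - 3 *\<^sub>C br (x 0 (r + 2)) (x 0 (s + 1)) + 3 *\<^sub>C br (x 0 (r + 1)) (x 0 (s + 2)) - br (x 0 r) (x 0 (s + 3)))
         - (br (xs 0 (r + 1)) (xs 0 s) - br (xs 0 r) (xs 0 (s + 1)))"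
      proof -
        have three: "3 *\<^sub>C u = u + u + u" for u :: 'v using csc_add_left[of 1 2 u] by (simp add: two)
        have "(inverse \<beta> ^ (r + s + 3)) *\<^sub>C
         (br (x 0 (r + 3)) (x 0 s) - 3 *\<^sub>C br (x 0 (r + 2)) (x 0 (s + 1)) + 3 *\<^sub>C br (x 0 (r + 1)) (x 0 (s + 2)) - br (x 0 r) (x 0 (s + 3)))
          = br (xs 0 (r + 3)) (xs 0 s) - 3 *\<^sub>C br (xs 0 (r + 2)) (xs 0 (s + 1)) + 3 *\<^sub>C br (xs 0 (r + 1)) (xs 0 (s + 2)) - br (xs 0 r) (xs 0 (s + 3))"
          by (simp add: xs_def br_linear csc_linear power_add mult_ac numeral_eq_Suc)
        then show ?thesis unfolding D_def three two by (simp add: numeral_eq_Suc)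
      qed
      also have "\<dots> = 0"
      proof -
        have c: "inverse \<beta> ^ (r + s + 3) * \<beta>\<^sup>2 = inverse \<beta> ^ (r + s + 1)" using \<beta> by (simp add: power_add power2_eq_square power3_eq_cube field_simps)
        show ?thesis unfolding x_x_1[OF 1] csc_csc c by (simp add: xs_def br_linear csc_linear power_add mult_ac)
      qed
      finally show ?thesis .
    qed
    then have Dshift: "D (r + 1) s = D r (s + 1)" for r s by (metis right_minus_eq)
    have "D r s = 0"
    proof (rule antisymmetric_shift[where c = D])
      show "D (r + 1) s = D r (s + 1)" for r s by (rule Dshift)
      show "D r s = - D s r" for r s
        unfolding D_def using br_anti[of "xs 0 (r + 2)" "xs 0 s"] br_anti[of "xs 0 (r + 1)" "xs 0 (s + 1)"]
          br_anti[of "xs 0 r" "xs 0 (s + 2)"] br_anti[of "xs 0 r" "xs 0 s"] by (simp add: csc_linear)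
    qed
    then show ?thesis using 1 assms by (simp add: D_def)
  next
    case 2
    show ?thesis
    proof (cases "i = j")
      case True
      then show ?thesis using same_zero_s[of j] 2 assms by simp
    next
      case False
      then have j: "j = (i + 1) mod n" using assms 2 by (auto simp: less_2_cases_iff)
      have "br (xs i (r + 2)) (xs j s) - 2 *\<^sub>C br (xs i (r + 1)) (xs j (s + 1)) + br (xs i r) (xs j (s + 2))
        = (inverse \<beta> ^ (r + s + 2)) *\<^sub>C (br (x i (r + 2)) (x j s) - 2 *\<^sub>C br (x i (r + 1)) (x j (s + 1)) + br (x i r) (x j (s + 2)))"
        by (simp add: xs_def br_linear csc_linear power_add mult_ac power2_eq_square)
      also have "\<dots> = br (xs i r) (xs j s)"
      proof -
        have c: "inverse \<beta> ^ (r + s + 2) * \<beta>\<^sup>2 = inverse \<beta> ^ r * inverse \<beta> ^ s" using \<beta> by (simp add: power_add power2_eq_square field_simps)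
        show ?thesis unfolding x_x_2[OF 2 assms(1) j] csc_csc c by (simp add: xs_def br_linear)
      qed
      finally show ?thesis .
    qed
  next
    case 3
    note e = xs_xs[OF 3 assms, of "r + 1" s] xs_xs[OF 3 assms, of r "s + 1"] xs_xs[OF 3 assms, of r s]
    consider "i = j" | "i \<noteq> j" "\<not> [int j = int i + 1] (mod int n)" "\<not> [int j = int i - 1] (mod int n)"
      | "[int j = int i + 1] (mod int n)" | "\<not> [int j = int i + 1] (mod int n)" "[int j = int i - 1] (mod int n)" by blast
    then show ?thesis
    proof cases
      case 1
      then show ?thesis using same_zero_s[of j] 3 assms by simp
    next
      case 2
      then have "br (xs i r) (xs j s) = 0" for r s using distant[OF 3 assms] by (simp add: xs_def br_linear)
      then show ?thesis by simp
    next
      case a: 3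
      show ?thesis using e a by (simp add: m_mat_eq[OF 3] two algebra_simps)
    next
      case 4
      have "br (xs i (r + 2)) (xs j s) = br (xs i (r + 1)) (xs j (s + 1)) - br (xs i (r + 1)) (xs j s)"
        "br (xs i r) (xs j (s + 2)) = br (xs i (r + 1)) (xs j (s + 1)) + br (xs i r) (xs j (s + 1))"
        "br (xs i r) (xs j (s + 1)) = br (xs i (r + 1)) (xs j s) + br (xs i r) (xs j s)"
        using e 4 by (simp_all add: m_mat_eq[OF 3] algebra_simps)
      then show ?thesis by (simp add: two algebra_simps)
    qed
  qed
qed

lemma above_s:
  assumes "i < n" "j < n" "\<not> [int j = int i + 1] (mod int n)"
  shows "br (xs i (r + 1)) (xs j s) - br (xs i r) (xs j (s + 1)) + br (xs i r) (xs j s) = 0"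
proof -
  consider "n = 1" | "n = 2" | "n > 2" using n1 by linarith
  then show ?thesis
  proof cases
    case 1
    then show ?thesis using assms by (simp add: cong_def)
  next
    case 2
    then have "i = j" using assms by (cases "i = 0"; cases "j = 0") (auto simp: cong_def less_2_cases_iff)
    then show ?thesis using same_zero_s[of j] 2 assms by simp
  next
    case 3
    show ?thesis
    proof (cases "[int j = int i - 1] (mod int n)")
      case True
      then show ?thesis using xs_xs[OF 3 assms(1,2), of r s] assms(3) by (simp add: m_mat_eq[OF 3])
    next
      case False
      have "br (xs i r) (xs j s) = 0" for r s
        using distant[OF 3 assms(1,2) _ assms(3) False] same_zero[of j] 3 assms by (cases "j = i") (auto simp add: xs_def br_linear)
      then show ?thesis by simp
    qed
  qed
qed

lemma below_s:
  assumes "i < n" "j < n" "\<not> [int j = int i - 1] (mod int n)"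
  shows "br (xs i (r + 1)) (xs j s) - br (xs i r) (xs j (s + 1)) - br (xs i r) (xs j s) = 0"
proof -
  consider "n = 1" | "n = 2" | "n > 2" using n1 by linarith
  then show ?thesis
  proof cases
    case 1
    then show ?thesis using assms by (simp add: cong_def)
  next
    case 2
    then have "i = j" using assms by (cases "i = 0"; cases "j = 0") (auto simp: cong_def less_2_cases_iff)
    then show ?thesis using same_zero_s[of j] 2 assms by simp
  next
    case 3
    show ?thesis
    proof (cases "[int j = int i + 1] (mod int n)")
      case True
      then show ?thesis using xs_xs[OF 3 assms(1,2), of r s] by (simp add: m_mat_eq[OF 3])
    next
      case False
      have "br (xs i r) (xs j s) = 0" for r s
        using distant[OF 3 assms(1,2) _ False assms(3)] same_zero[of j] 3 assms by (cases "j = i") (auto simp add: xs_def br_linear)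
      then show ?thesis by simp
    qed
  qed
qed

lemma commute: "n \<ge> 2 \<Longrightarrow> i < n \<Longrightarrow> br (x i p) (br (x i q) v) = br (x i q) (br (x i p) v)"
  using jacobi_right[of "x i p" "x i q" v] same_zero[of i p q] by simp

lemma serre_n_s:
  assumes "n > 2" "i < n" "j < n" "[int j = int i + 1] (mod int n) \<or> [int j = int i - 1] (mod int n)"
  shows "br (xs i p) (br (xs i q) (xs j s)) = 0"
proof -
  have "br (x i p) (br (x i q) (x j s)) = 0"
    using adjacent[OF assms, of p q s] commute[of i q p] assms by (auto intro: two_cancel)
  then show ?thesis by (simp add: xs_def br_linear)
qed

text \<open>The generators of one class commute, so the six terms of the symmetrised relation are equal.\<close>

lemma serre2_s:
  assumes "n = 2" "i < n" "j < n" "i \<noteq> j"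
  shows "br (xs i p) (br (xs i q) (br (xs i r) (xs j s))) = 0"
proof -
  have j: "j = (i + 1) mod n" using assms by (auto simp: less_2_cases_iff)
  have n: "n \<ge> 2" using assms by simp
  note c = commute[OF n assms(2)]
  let ?u = "br (x i p) (br (x i q) (br (x i r) (x j s)))"
  have "br (x i p) (br (x i r) (br (x i q) (x j s))) = ?u" "br (x i q) (br (x i p) (br (x i r) (x j s))) = ?u"
    "br (x i q) (br (x i r) (br (x i p) (x j s))) = ?u" "br (x i r) (br (x i p) (br (x i q) (x j s))) = ?u"
    "br (x i r) (br (x i q) (br (x i p) (x j s))) = ?u"
    using c[of p q] c[of p r] c[of q r] by metis+
  then have "?u + ?u + ?u + ?u + ?u + ?u = 0" using serre_2[OF assms(1,2) j, of p q r s] by simp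
  moreover have "6 *\<^sub>C ?u = ?u + ?u + ?u + ?u + ?u + ?u"
    by (simp add: csc_add_left[of _ 1, simplified, symmetric] csc_add_left[of 1 1, simplified, symmetric])
  ultimately have "6 *\<^sub>C ?u = 0" by simp
  then have "?u = 0" by (simp add: clie.scale_eq_0_iff)
  then show ?thesis by (simp add: xs_def br_linear)
qed

lemma serre1_s:
  assumes "n = 1"
  shows "br (xs 0 p) (br (xs 0 q) (xs 0 (r + 1))) + br (xs 0 p) (br (xs 0 r) (xs 0 (q + 1)))
      + br (xs 0 q) (br (xs 0 p) (xs 0 (r + 1))) + br (xs 0 q) (br (xs 0 r) (xs 0 (p + 1)))
      + br (xs 0 r) (br (xs 0 p) (xs 0 (q + 1))) + br (xs 0 r) (br (xs 0 q) (xs 0 (p + 1))) = 0"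
proof -
  have "br (xs 0 p) (br (xs 0 q) (xs 0 (r + 1))) + br (xs 0 p) (br (xs 0 r) (xs 0 (q + 1)))
      + br (xs 0 q) (br (xs 0 p) (xs 0 (r + 1))) + br (xs 0 q) (br (xs 0 r) (xs 0 (p + 1)))
      + br (xs 0 r) (br (xs 0 p) (xs 0 (q + 1))) + br (xs 0 r) (br (xs 0 q) (xs 0 (p + 1)))
    = (inverse \<beta> ^ (p + q + r + 1)) *\<^sub>C (br (x 0 p) (br (x 0 q) (x 0 (r + 1))) + br (x 0 p) (br (x 0 r) (x 0 (q + 1)))
      + br (x 0 q) (br (x 0 p) (x 0 (r + 1))) + br (x 0 q) (br (x 0 r) (x 0 (p + 1)))
      + br (x 0 r) (br (x 0 p) (x 0 (q + 1))) + br (x 0 r) (br (x 0 q) (x 0 (p + 1))))"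
    by (simp add: xs_def br_linear csc_linear power_add mult_ac)
  then show ?thesis unfolding serre_1[OF assms] by simp
qed

text \<open>The relations determine the bracket recursively in \<open>r\<close> from the first few, and keep it in the span of
  the \<open>x j s\<close>.\<close>

lemma hx_s: assumes "i < n" "j < n" shows "\<exists>p. br (hs i r) (xs j s) = px xs j p"
proof -
  define S where "S = {v. \<exists>p. v = px xs j p}"
  have S: "clie.subspace S"
  proof (rule clie.subspaceI)
    show "0 \<in> S" unfolding S_def by (auto intro: exI[of _ 0])
    show "u + v \<in> S" if uv: "u \<in> S" "v \<in> S" for u v
    proof -
      obtain p q where "u = px xs j p" "v = px xs j q" using uv by (auto simp: S_def)
      then have "u + v = px xs j (p + q)" by (simp add: px_add)
      then show ?thesis unfolding S_def by blast
    qed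
    show "c *\<^sub>C u \<in> S" if u: "u \<in> S" for u c
    proof -
      obtain p where "u = px xs j p" using u by (auto simp: S_def)
      then have "c *\<^sub>C u = px xs j (Polynomial.smult c p)" by (simp add: px_smult)
      then show ?thesis unfolding S_def by blast
    qed
  qed
  note Sc = clie.subspace_add[OF S] clie.subspace_diff[OF S] clie.subspace_scale[OF S] clie.subspace_0[OF S] clie.subspace_neg[OF S]
  have xS: "x j s \<in> S" for s
  proof -
    have "px xs j (monom (\<beta> ^ s) s) = x j s" using \<beta> by (simp add: px_monom xs_def power_mult_distrib[symmetric])
    then show ?thesis unfolding S_def mem_Collect_eq by (intro exI) (rule HOL.sym)
  qed
  have "br (h i r) (x j s) \<in> S" for r s
  proof -
    consider "n = 1" | "n = 2" | "n > 2" using n1 by linarith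
    then show ?thesis
    proof cases
      case 1
      then have ij: "i = 0" "j = 0" using assms by auto
      have "\<forall>s. br (h 0 r) (x 0 s) \<in> S \<and> br (h 0 (r + 1)) (x 0 s) \<in> S \<and> br (h 0 (r + 2)) (x 0 s) \<in> S"
      proof (induction r)
        case 0
        show ?case using h0_x_1[OF 1] h1_x_1[OF 1] h2_x_1[OF 1] xS by (simp add: Sc ij numeral_2_eq_2)
      next
        case (Suc r)
        have "br (h 0 (r + 3)) (x 0 s) = \<beta>\<^sup>2 *\<^sub>C (br (h 0 (r + 1)) (x 0 s) - br (h 0 r) (x 0 (s + 1)))
           + 3 *\<^sub>C br (h 0 (r + 2)) (x 0 (s + 1)) - 3 *\<^sub>C br (h 0 (r + 1)) (x 0 (s + 2)) + br (h 0 r) (x 0 (s + 3))" for s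
          unfolding h_x_1[OF 1, symmetric] by simp
        moreover have "\<dots> s \<in> S" for s using Suc by (intro Sc) auto
        ultimately have "br (h 0 (r + 3)) (x 0 s) \<in> S" for s by simp
        then show ?case using Suc by (simp add: numeral_eq_Suc)
      qed
      then show ?thesis using ij by blast
    next
      case 2
      show ?thesis
      proof (cases "i = j")
        case True
        have "\<forall>s. br (h i r) (x i s) \<in> S"
          by (induction r) (use h0_x[of i i] h_x_same_2[OF 2 assms(1)] 2 assms xS True Sc in auto)
        then show ?thesis using True by blast
      next
        case False
        then have j: "j = (i + 1) mod n" using assms 2 by (auto simp: less_2_cases_iff)
        have "\<forall>s. br (h i r) (x j s) \<in> S \<and> br (h i (r + 1)) (x j s) \<in> S"
        proof (induction r)
          case 0
          show ?case using h0_x[of i j] h1_x_2[OF 2 assms(1) j] 2 assms xS by (simp add: Sc)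
        next
          case (Suc r)
          have "br (h i (r + 2)) (x j s) = \<beta>\<^sup>2 *\<^sub>C br (h i r) (x j s) + 2 *\<^sub>C br (h i (r + 1)) (x j (s + 1)) - br (h i r) (x j (s + 2))" for s
            unfolding h_x_2[OF 2 assms(1) j, symmetric] by simp
          moreover have "\<dots> s \<in> S" for s using Suc by (intro Sc) auto
          ultimately have "br (h i (r + 2)) (x j s) \<in> S" for s by simp
          then show ?case using Suc by simp
        qed
        then show ?thesis by blast
      qed
    next
      case 3
      have "\<forall>s. br (h i r) (x j s) \<in> S"
      proof (induction r)
        case 0
        show ?case using h0_x[of i j] 3 assms xS by (simp add: Sc)
      next
        case (Suc r)
        have "br (h i (r + 1)) (x j s) = (- m_mat n i j * \<beta>) *\<^sub>C br (h i r) (x j s) + br (h i r) (x j (s + 1))" for s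
          unfolding h_x[OF 3 assms, symmetric] by simp
        moreover have "\<dots> s \<in> S" for s using Suc by (intro Sc) auto
        ultimately have "br (h i (r + 1)) (x j s) \<in> S" for s by simp
        then show ?case by simp
      qed
      then show ?thesis by blast
    qed
  qed
  then have "br (hs i r) (xs j s) \<in> S" unfolding hs_def xs_def br_linear by (intro Sc)
  then show ?thesis by (simp add: S_def)
qed

lemma hx2_s: assumes "n = 2" "i < n" "j < n" shows "br (hs i 0) (xs j s) = (\<sigma> * (if i = j then 2 else -2)) *\<^sub>C xs j s"
proof -
  have "a_mat n i j = (if i = j then 2 else -2)"
    using assms by (auto simp: a_mat_def kdelta_def cong_def less_2_cases_iff)
  then show ?thesis using h0_x[of i j s] assms by (simp add: hs_def xs_def br_linear mult_ac)
qed

end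


section \<open>The relations hold for the matrix model\<close>

definition xf :: "nat \<Rightarrow> complex \<Rightarrow> nat \<Rightarrow> nat \<Rightarrow> int \<Rightarrow> complex" where
  "xf n \<beta> i r N = ch n i N * (of_int N * \<beta>) ^ r"

text \<open>The brackets of \<open>tp 1\<close> with \<open>tm 1\<close> have this form (\<open>tp_tm_br\<close>).\<close>

definition hm :: "(int \<Rightarrow> complex) \<Rightarrow> clop" where
  "hm H = Ext (FT (\<lambda>N. H N - H (N + 1)) 0) (H 0)"

lemma ch_shift: "ch n i (N + k) * ch n j N = of_bool [int j = int i + k] (mod int n) * ch n j N"
proof (cases "(N + int j) mod int n = 0")
  case True
  then have j: "[N + int j = 0] (mod int n)" by (simp add: cong_def)
  have "[N + k + int i = 0] (mod int n) \<longleftrightarrow> [int j = int i + k] (mod int n)"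
  proof -
    have "[N + k + int i = 0] (mod int n) \<longleftrightarrow> [N + k + int i = N + int j] (mod int n)"
      using j by (meson cong_sym cong_trans)
    also have "\<dots> \<longleftrightarrow> [N + (int i + k) = N + int j] (mod int n)" by (simp add: add_ac)
    also have "\<dots> \<longleftrightarrow> [int j = int i + k] (mod int n)" by (simp only: cong_add_lcancel cong_sym_eq)
    finally show ?thesis .
  qed
  then show ?thesis by (simp add: ch_def cong_def)
next
  case False
  then show ?thesis by (simp add: ch_def)
qed

lemma ch_shift_m: "ch n i (N - 1) * ch n j N = of_bool [int i = int j + 1] (mod int n) * ch n j N"
proof -
  have "[int j = int i + (-1)] (mod int n) \<longleftrightarrow> [int i = int j + 1] (mod int n)"
  proof -
    have "int j - (int i + (-1)) = - (int i - (int j + 1))" by simp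
    then show ?thesis unfolding cong_iff_dvd_diff by (metis dvd_minus_iff)
  qed
  then show ?thesis using ch_shift[of n i N "-1" j] by simp
qed

text \<open>The bracket rules that \<open>tp\<close> (with \<open>\<sigma> = 1\<close>) and \<open>tm\<close> (with \<open>\<sigma> = -1\<close>) have in common suffice to verify the
  relations of each sign.\<close>

locale tmodel =
  fixes n :: nat and \<beta> \<sigma> :: complex and t :: "nat \<Rightarrow> (int \<Rightarrow> complex) \<Rightarrow> clop"
  assumes n1: "n \<ge> 1" and \<beta>: "\<beta> \<noteq> 0"
    and t_lin: "lin_on UNIV (t d)"
    and t_br: "d \<ge> 1 \<Longrightarrow> br (t 1 F) (t d G) = t (Suc d) (\<lambda>N. F N * G (N - 1) - G N * F (N - int d))"
    and t_hm: "br (hm H) (t 1 G) = t 1 (\<lambda>N. \<sigma> * ((2 * H N - H (N + 1) - H (N - 1)) * G N))"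
begin

lemma t_lin': "t d F + t d G = t d (\<lambda>N. F N + G N)" "c *\<^sub>C t d F = t d (\<lambda>N. c * F N)" "0 = t d (\<lambda>N. 0)"
  "t d F - t d G = t d (\<lambda>N. F N - G N)"
proof -
  show 1: "t d F + t d G = t d (\<lambda>N. F N + G N)" "c *\<^sub>C t d F = t d (\<lambda>N. c * F N)" "0 = t d (\<lambda>N. 0)" for F G c
    using lin_onD[OF t_lin] by auto
  have "t d F - t d G = t d F + (-1) *\<^sub>C t d G" by simp
  also have "\<dots> = t d (\<lambda>N. F N + (-1) * G N)" by (simp only: 1)
  finally show "t d F - t d G = t d (\<lambda>N. F N - G N)" by simp
qed

abbreviation "X0 i r \<equiv> t 1 (xf n \<beta> i r)"
abbreviation "H0 i r \<equiv> hm (xf n \<beta> i r)"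

lemma bxx: "br (X0 i r) (X0 j s) = t 2 (\<lambda>N. (ch n i N * ch n j (N - 1)) * ((of_int N * \<beta>) ^ r * (of_int N * \<beta> - \<beta>) ^ s)
    - (ch n j N * ch n i (N - 1)) * ((of_int N * \<beta>) ^ s * (of_int N * \<beta> - \<beta>) ^ r))"
proof -
  have "br (X0 i r) (X0 j s) = t (Suc 1) (\<lambda>N. xf n \<beta> i r N * xf n \<beta> j s (N - 1) - xf n \<beta> j s N * xf n \<beta> i r (N - int 1))"
    by (rule t_br) simp
  also have "(\<lambda>N. xf n \<beta> i r N * xf n \<beta> j s (N - 1) - xf n \<beta> j s N * xf n \<beta> i r (N - int 1))
    = (\<lambda>N. (ch n i N * ch n j (N - 1)) * ((of_int N * \<beta>) ^ r * (of_int N * \<beta> - \<beta>) ^ s)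
    - (ch n j N * ch n i (N - 1)) * ((of_int N * \<beta>) ^ s * (of_int N * \<beta> - \<beta>) ^ r))"
  proof (rule HOL.ext)
    fix N
    have w: "of_int (N - 1) * \<beta> = of_int N * \<beta> - \<beta>" by (simp add: algebra_simps)
    show "xf n \<beta> i r N * xf n \<beta> j s (N - 1) - xf n \<beta> j s N * xf n \<beta> i r (N - int 1)
      = (ch n i N * ch n j (N - 1)) * ((of_int N * \<beta>) ^ r * (of_int N * \<beta> - \<beta>) ^ s)
        - (ch n j N * ch n i (N - 1)) * ((of_int N * \<beta>) ^ s * (of_int N * \<beta> - \<beta>) ^ r)"
      unfolding xf_def of_nat_1 w by (simp add: mult_ac)
  qed
  finally show ?thesis by (simp add: numeral_2_eq_2)
qed

lemma bhx: "br (H0 i r) (X0 j s) = t 1 (\<lambda>N. \<sigma> * (2 * (ch n i N * ch n j N) * ((of_int N * \<beta>) ^ r * (of_int N * \<beta>) ^ s)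
    - (ch n i (N + 1) * ch n j N) * ((of_int N * \<beta> + \<beta>) ^ r * (of_int N * \<beta>) ^ s)
    - (ch n i (N - 1) * ch n j N) * ((of_int N * \<beta> - \<beta>) ^ r * (of_int N * \<beta>) ^ s)))"
  unfolding t_hm
  by (rule arg_cong[where f = "t 1"], rule HOL.ext) (simp add: xf_def left_diff_distrib distrib_right algebra_simps)

lemma cong_self: "n \<ge> 2 \<Longrightarrow> \<not> [int i = int i + 1] (mod int n)"
  by (auto simp: cong_iff_dvd_diff dest: zdvd_imp_le)

lemma cong_two: "n = 2 \<Longrightarrow> i < n \<Longrightarrow> j = (i + 1) mod n \<Longrightarrow> [int j = int i + 1] (mod int n) \<and> [int i = int j + 1] (mod int n) \<and> \<not> [int j = int i] (mod int n)"
  by (auto simp: less_2_cases_iff cong_def)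

lemma cong_opp: "n > 2 \<Longrightarrow> \<not> ([int j = int i + 1] (mod int n) \<and> [int i = int j + 1] (mod int n))"
proof
  assume n: "n > 2" and h: "[int j = int i + 1] (mod int n) \<and> [int i = int j + 1] (mod int n)"
  then have "[int j + int i = (int i + 1) + (int j + 1)] (mod int n)" by (intro Cong.cong_add) auto
  then have "int n dvd -2" by (simp add: cong_iff_dvd_diff)
  then show False using n by (auto dest: zdvd_imp_le)
qed

lemma cong_eq: "i < n \<Longrightarrow> j < n \<Longrightarrow> [int j = int i] (mod int n) \<longleftrightarrow> i = j"
  by (auto simp: cong_def)

lemma ch_pairs:
  "ch n i N * ch n j N = of_bool [int j = int i] (mod int n) * ch n j N"
  "ch n i (N + 1) * ch n j N = of_bool [int j = int i + 1] (mod int n) * ch n j N"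
  "ch n i (N - 1) * ch n j N = of_bool [int i = int j + 1] (mod int n) * ch n j N"
  "ch n i N * ch n j (N - 1) = of_bool [int j = int i + 1] (mod int n) * ch n j (N - 1)"
  "ch n j N * ch n i (N - 1) = of_bool [int i = int j + 1] (mod int n) * ch n j N"
  using ch_shift[of n i N 0 j] ch_shift[of n i N 1 j] ch_shift_m[of n i N j] ch_shift[of n i "N - 1" 1 j] ch_shift_m[of n i N j]
  by (simp_all add: mult.commute)

lemma m_mat': "m_mat n i j = of_bool [int i = int j + 1] (mod int n) - of_bool [int j = int i + 1] (mod int n)"
  "a_mat n i j = 2 * of_bool [int j = int i] (mod int n) - of_bool [int i = int j + 1] (mod int n) - of_bool [int j = int i + 1] (mod int n)"
proof -
  have "[int i = int j - 1] (mod int n) \<longleftrightarrow> [int j = int i + 1] (mod int n)"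
  proof -
    have "int j - (int i + 1) = - (int i - (int j - 1))" by simp
    then show ?thesis unfolding cong_iff_dvd_diff by (metis dvd_minus_iff)
  qed
  moreover have "[int i = int j] (mod int n) \<longleftrightarrow> [int j = int i] (mod int n)" by (rule cong_sym_eq)
  ultimately show "m_mat n i j = of_bool [int i = int j + 1] (mod int n) - of_bool [int j = int i + 1] (mod int n)"
    "a_mat n i j = 2 * of_bool [int j = int i] (mod int n) - of_bool [int i = int j + 1] (mod int n) - of_bool [int j = int i + 1] (mod int n)"
    by (simp_all only: m_mat_def a_mat_def kdelta_def)
qed

lemma bbxx:
  "br (X0 k p) (br (X0 i r) (X0 j s)) = t 3 (\<lambda>N. xf n \<beta> k p N * (xf n \<beta> i r (N - 1) * xf n \<beta> j s (N - 2) - xf n \<beta> j s (N - 1) * xf n \<beta> i r (N - 2))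
     - (xf n \<beta> i r N * xf n \<beta> j s (N - 1) - xf n \<beta> j s N * xf n \<beta> i r (N - 1)) * xf n \<beta> k p (N - 2))"
  using t_br[of 1 "xf n \<beta> i r" "xf n \<beta> j s"] t_br[of 2 "xf n \<beta> k p"] by (simp add: numeral_2_eq_2 numeral_3_eq_3)

lemma xf_same: "n \<ge> 2 \<Longrightarrow> xf n \<beta> i r N * xf n \<beta> i s (N - 1) = 0"
  using ch_pairs(4)[of i N i] cong_self[of i] by (auto simp: xf_def)

lemma model: "hrel n \<beta> \<sigma> X0 H0"
proof
  show "n \<ge> 1" "\<beta> \<noteq> 0" by (rule n1 \<beta>)+
  show "br (X0 i (r + 1)) (X0 j s) - br (X0 i r) (X0 j (s + 1)) = (- m_mat n i j * \<beta>) *\<^sub>C br (X0 i r) (X0 j s)"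
    if "n > 2" "i < n" "j < n" for i j r s
    unfolding bxx t_lin' ch_pairs m_mat' using cong_opp[OF that(1), of j i]
    by (intro arg_cong[where f = "t 2"] HOL.ext) (auto simp: algebra_simps)
  show "br (H0 i (r + 1)) (X0 j s) - br (H0 i r) (X0 j (s + 1)) = (- m_mat n i j * \<beta>) *\<^sub>C br (H0 i r) (X0 j s)"
    if "n > 2" "i < n" "j < n" for i j r s
    unfolding bhx t_lin' ch_pairs m_mat' using cong_opp[OF that(1), of j i] cong_self[of i] cong_eq[OF that(2,3)] that(1)
    by (intro arg_cong[where f = "t 1"] HOL.ext) (auto simp: algebra_simps)
  show "br (H0 i 0) (X0 j s) = (\<sigma> * a_mat n i j) *\<^sub>C X0 j s"
    if "n \<ge> 2" "i < n" "j < n" for i j s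
    unfolding bhx t_lin' ch_pairs m_mat'
    by (intro arg_cong[where f = "t 1"] HOL.ext) (simp add: xf_def algebra_simps)
  show "br (X0 i p) (br (X0 i q) (X0 j s)) + br (X0 i q) (br (X0 i p) (X0 j s)) = 0"
    if "n > 2" "i < n" "j < n" "[int j = int i + 1] (mod int n) \<or> [int j = int i - 1] (mod int n)" for i j p q s
  proof -
    have z: "xf n \<beta> i p N * xf n \<beta> j s (N - 1) * xf n \<beta> i q (N - 2) = 0" for p q N
    proof -
      have "ch n i N * ch n j (N - 1) * ch n i (N - 2) = 0"
        using ch_pairs(4)[of i N j] ch_pairs(4)[of j "N - 1" i] cong_opp[OF that(1), of j i] by auto
      then show ?thesis by (auto simp: xf_def)
    qed
    have e: "br (X0 i p) (br (X0 i q) (X0 j s)) = 0" for p q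
    proof -
      have "xf n \<beta> i p N * (xf n \<beta> i q (N - 1) * xf n \<beta> j s (N - 2) - xf n \<beta> j s (N - 1) * xf n \<beta> i q (N - 2))
       - (xf n \<beta> i q N * xf n \<beta> j s (N - 1) - xf n \<beta> j s N * xf n \<beta> i q (N - 1)) * xf n \<beta> i p (N - 2) = 0" for N
        using z[of p N q] z[of q N p] xf_same[of i p N q] xf_same[of i q "N - 1" p] that(1) by (auto simp: algebra_simps)
      then show ?thesis unfolding bbxx using t_lin'(3)[of 3] by simp
    qed
    show ?thesis unfolding e by simp
  qed
  show "br (X0 i r) (X0 j s) = 0"
    if "n > 2" "i < n" "j < n" "j \<noteq> i" "\<not> [int j = int i + 1] (mod int n)" "\<not> [int j = int i - 1] (mod int n)" for i j r s
  proof -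
    have "\<not> [int i = int j + 1] (mod int n)"
    proof -
      have "int j - (int i - 1) = - (int i - (int j + 1))" by simp
      then show ?thesis using that(6) unfolding cong_iff_dvd_diff by (metis dvd_minus_iff)
    qed
    then show ?thesis unfolding bxx ch_pairs using that t_lin'(3)[of 2] by simp
  qed
  show "br (X0 i (r + 1)) (X0 i s) = br (X0 i r) (X0 i (s + 1))" if "n = 2" "i < n" for i r s
    unfolding bxx ch_pairs using cong_self[of i] that by simp
  show "br (X0 i (r + 2)) (X0 j s) - 2 *\<^sub>C br (X0 i (r + 1)) (X0 j (s + 1)) + br (X0 i r) (X0 j (s + 2)) = \<beta>\<^sup>2 *\<^sub>C br (X0 i r) (X0 j s)"
    if "n = 2" "i < n" "j = (i + 1) mod n" for i j r s
    unfolding bxx t_lin' by (intro arg_cong[where f = "t 2"] HOL.ext) (simp add: algebra_simps power2_eq_square)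
  show "br (H0 i (r + 1)) (X0 i s) = br (H0 i r) (X0 i (s + 1))" if "n = 2" "i < n" for i r s
    unfolding bhx ch_pairs using cong_self[of i] that by (simp add: mult_ac)
  show "br (H0 i (r + 2)) (X0 j s) - 2 *\<^sub>C br (H0 i (r + 1)) (X0 j (s + 1)) + br (H0 i r) (X0 j (s + 2)) = \<beta>\<^sup>2 *\<^sub>C br (H0 i r) (X0 j s)"
    if "n = 2" "i < n" "j = (i + 1) mod n" for i j r s
    unfolding bhx t_lin' ch_pairs using cong_two[OF that]
    by (intro arg_cong[where f = "t 1"] HOL.ext) (simp add: algebra_simps power2_eq_square)
  show "br (H0 i 1) (X0 j s) = (- \<sigma> * 2) *\<^sub>C X0 j (s + 1)" if "n = 2" "i < n" "j = (i + 1) mod n" for i j s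
    unfolding bhx t_lin' ch_pairs using cong_two[OF that]
    by (intro arg_cong[where f = "t 1"] HOL.ext) (simp add: xf_def algebra_simps)
  show "br (X0 i p) (br (X0 i q) (br (X0 i r) (X0 j s))) + br (X0 i p) (br (X0 i r) (br (X0 i q) (X0 j s)))
      + br (X0 i q) (br (X0 i p) (br (X0 i r) (X0 j s))) + br (X0 i q) (br (X0 i r) (br (X0 i p) (X0 j s)))
      + br (X0 i r) (br (X0 i p) (br (X0 i q) (X0 j s))) + br (X0 i r) (br (X0 i q) (br (X0 i p) (X0 j s))) = 0"
    if "n = 2" "i < n" "j = (i + 1) mod n" for i j p q r s
  proof -
    have z: "xf n \<beta> i p N * xf n \<beta> i q (N - 1) = 0" for p q N using xf_same that(1) by simp
    have e: "br (X0 i p) (br (X0 i q) (br (X0 i r) (X0 j s))) = 0" for p q r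
    proof -
      have b: "br (X0 i p) (t 3 G) = t (Suc 3) (\<lambda>N. xf n \<beta> i p N * G (N - 1) - G N * xf n \<beta> i p (N - int 3))" for G
        by (rule t_br) simp
      have z1: "xf n \<beta> i p N * (xf n \<beta> i q (N - 1) * (xf n \<beta> i r (N - 1 - 1) * xf n \<beta> j s (N - 1 - 2) - xf n \<beta> j s (N - 1 - 1) * xf n \<beta> i r (N - 1 - 2))
     - (xf n \<beta> i r (N - 1) * xf n \<beta> j s (N - 1 - 1) - xf n \<beta> j s (N - 1) * xf n \<beta> i r (N - 1 - 1)) * xf n \<beta> i q (N - 1 - 2)) = 0" for N
        using z[of p N q] z[of p N r] z[of r "N - 1 - 1" q] by (auto simp: algebra_simps)
      have z2: "(xf n \<beta> i q N * (xf n \<beta> i r (N - 1) * xf n \<beta> j s (N - 2) - xf n \<beta> j s (N - 1) * xf n \<beta> i r (N - 2))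
     - (xf n \<beta> i r N * xf n \<beta> j s (N - 1) - xf n \<beta> j s N * xf n \<beta> i r (N - 1)) * xf n \<beta> i q (N - 2)) * xf n \<beta> i p (N - int 3) = 0" for N
        using z[of q N r] z[of r "N - 2" p] z[of q "N - 2" p] by (auto simp: algebra_simps)
      show ?thesis unfolding bbxx b z1 z2 using t_lin'(3)[of "Suc 3"] by simp
    qed
    show ?thesis unfolding e by simp
  qed
  have ch1: "ch n i N = 1" if "n = 1" for i N using that by (simp add: ch_def)
  show "br (X0 0 (r + 3)) (X0 0 s) - 3 *\<^sub>C br (X0 0 (r + 2)) (X0 0 (s + 1)) + 3 *\<^sub>C br (X0 0 (r + 1)) (X0 0 (s + 2)) - br (X0 0 r) (X0 0 (s + 3))
      = \<beta>\<^sup>2 *\<^sub>C (br (X0 0 (r + 1)) (X0 0 s) - br (X0 0 r) (X0 0 (s + 1)))" if "n = 1" for r s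
    unfolding bxx t_lin' ch1[OF that]
    by (intro arg_cong[where f = "t 2"] HOL.ext) (simp add: algebra_simps power_add power2_eq_square power3_eq_cube)
  show "br (H0 0 (r + 3)) (X0 0 s) - 3 *\<^sub>C br (H0 0 (r + 2)) (X0 0 (s + 1)) + 3 *\<^sub>C br (H0 0 (r + 1)) (X0 0 (s + 2)) - br (H0 0 r) (X0 0 (s + 3))
      = \<beta>\<^sup>2 *\<^sub>C (br (H0 0 (r + 1)) (X0 0 s) - br (H0 0 r) (X0 0 (s + 1)))" if "n = 1" for r s
    unfolding bhx t_lin' ch1[OF that]
    by (intro arg_cong[where f = "t 1"] HOL.ext) (simp add: algebra_simps power_add power2_eq_square power3_eq_cube)
  show "br (H0 0 0) (X0 0 s) = 0" if "n = 1" for s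
    unfolding bhx t_lin'(3)[of 1] ch1[OF that]
    by (intro arg_cong[where f = "t 1"] HOL.ext) (simp add: algebra_simps)
  show "br (H0 0 1) (X0 0 s) = 0" if "n = 1" for s
    unfolding bhx t_lin'(3)[of 1] ch1[OF that]
    by (intro arg_cong[where f = "t 1"] HOL.ext) (simp add: algebra_simps)
  show "br (H0 0 2) (X0 0 s) = (- \<sigma> * 2 * \<beta>\<^sup>2) *\<^sub>C X0 0 s" if "n = 1" for s
    unfolding bhx t_lin' ch1[OF that]
    by (intro arg_cong[where f = "t 1"] HOL.ext) (simp add: xf_def ch1[OF that] algebra_simps power2_eq_square)
  show "br (X0 0 p) (br (X0 0 q) (X0 0 (r + 1))) + br (X0 0 p) (br (X0 0 r) (X0 0 (q + 1)))
      + br (X0 0 q) (br (X0 0 p) (X0 0 (r + 1))) + br (X0 0 q) (br (X0 0 r) (X0 0 (p + 1)))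
      + br (X0 0 r) (br (X0 0 p) (X0 0 (q + 1))) + br (X0 0 r) (br (X0 0 q) (X0 0 (p + 1))) = 0"
    if "n = 1" for p q r
    unfolding bbxx t_lin'(1) t_lin'(3)[of 3]
  proof (intro arg_cong[where f = "t 3"] HOL.ext)
    fix N
    define a b c where "a = of_int N * \<beta>" and "b = of_int (N - 1) * \<beta>" and "c = of_int (N - 2) * \<beta>"
    have f: "xf n \<beta> 0 k N = a ^ k" "xf n \<beta> 0 k (N - 1) = b ^ k" "xf n \<beta> 0 k (N - 2) = c ^ k" for k
      by (simp_all add: xf_def ch1[OF that] a_def b_def c_def)
    define S where "S = a^p * b^q * c^r + a^p * b^r * c^q + a^q * b^p * c^r + a^q * b^r * c^p + a^r * b^p * c^q + a^r * b^q * c^p"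
    have "S * (c - 2 * b + a) = 0" by (simp add: a_def b_def c_def algebra_simps)
    then show "xf n \<beta> 0 p N * (xf n \<beta> 0 q (N - 1) * xf n \<beta> 0 (r + 1) (N - 2) - xf n \<beta> 0 (r + 1) (N - 1) * xf n \<beta> 0 q (N - 2)) -
         (xf n \<beta> 0 q N * xf n \<beta> 0 (r + 1) (N - 1) - xf n \<beta> 0 (r + 1) N * xf n \<beta> 0 q (N - 1)) * xf n \<beta> 0 p (N - 2) +
         (xf n \<beta> 0 p N * (xf n \<beta> 0 r (N - 1) * xf n \<beta> 0 (q + 1) (N - 2) - xf n \<beta> 0 (q + 1) (N - 1) * xf n \<beta> 0 r (N - 2)) -
          (xf n \<beta> 0 r N * xf n \<beta> 0 (q + 1) (N - 1) - xf n \<beta> 0 (q + 1) N * xf n \<beta> 0 r (N - 1)) * xf n \<beta> 0 p (N - 2)) +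
         (xf n \<beta> 0 q N * (xf n \<beta> 0 p (N - 1) * xf n \<beta> 0 (r + 1) (N - 2) - xf n \<beta> 0 (r + 1) (N - 1) * xf n \<beta> 0 p (N - 2)) -
          (xf n \<beta> 0 p N * xf n \<beta> 0 (r + 1) (N - 1) - xf n \<beta> 0 (r + 1) N * xf n \<beta> 0 p (N - 1)) * xf n \<beta> 0 q (N - 2)) +
         (xf n \<beta> 0 q N * (xf n \<beta> 0 r (N - 1) * xf n \<beta> 0 (p + 1) (N - 2) - xf n \<beta> 0 (p + 1) (N - 1) * xf n \<beta> 0 r (N - 2)) -
          (xf n \<beta> 0 r N * xf n \<beta> 0 (p + 1) (N - 1) - xf n \<beta> 0 (p + 1) N * xf n \<beta> 0 r (N - 1)) * xf n \<beta> 0 q (N - 2)) +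
         (xf n \<beta> 0 r N * (xf n \<beta> 0 p (N - 1) * xf n \<beta> 0 (q + 1) (N - 2) - xf n \<beta> 0 (q + 1) (N - 1) * xf n \<beta> 0 p (N - 2)) -
          (xf n \<beta> 0 p N * xf n \<beta> 0 (q + 1) (N - 1) - xf n \<beta> 0 (q + 1) N * xf n \<beta> 0 p (N - 1)) * xf n \<beta> 0 r (N - 2)) +
         (xf n \<beta> 0 r N * (xf n \<beta> 0 q (N - 1) * xf n \<beta> 0 (p + 1) (N - 2) - xf n \<beta> 0 (p + 1) (N - 1) * xf n \<beta> 0 q (N - 2)) -
          (xf n \<beta> 0 q N * xf n \<beta> 0 (p + 1) (N - 1) - xf n \<beta> 0 (p + 1) N * xf n \<beta> 0 q (N - 1)) * xf n \<beta> 0 r (N - 2)) = 0"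
      unfolding f S_def by (simp add: algebra_simps)
  qed
qed

end

lemma tmodel_tp: "n \<ge> 1 \<Longrightarrow> \<beta> \<noteq> 0 \<Longrightarrow> tmodel n \<beta> 1 tp"
proof (unfold_locales, assumption, assumption, rule tp_lin, erule tp_br, rule clop_eqI)
  show "op (br (hm H) (tp 1 G)) = op (tp 1 (\<lambda>N. 1 * ((2 * H N - H (N + 1) - H (N - 1)) * G N)))" for H G
    unfolding hm_def tp_def by (simp add: FT_times FT_linear(3)[symmetric] algebra_simps)
  show "ctr (br (hm H) (tp 1 G)) = ctr (tp 1 (\<lambda>N. 1 * ((2 * H N - H (N + 1) - H (N - 1)) * G N)))" for H G
    by (simp add: hm_def tp_def phi_FT)
qed

lemma tmodel_tm: "n \<ge> 1 \<Longrightarrow> \<beta> \<noteq> 0 \<Longrightarrow> tmodel n \<beta> (-1) tm"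
proof (unfold_locales, assumption, assumption, rule tm_lin, erule tm_br, rule clop_eqI)
  show "op (br (hm H) (tm 1 G)) = op (tm 1 (\<lambda>N. (-1) * ((2 * H N - H (N + 1) - H (N - 1)) * G N)))" for H G
    unfolding hm_def tm_def by (simp add: FT_times FT_linear(3)[symmetric] scl_simps algebra_simps)
  show "ctr (br (hm H) (tm 1 G)) = ctr (tm 1 (\<lambda>N. (-1) * ((2 * H N - H (N + 1) - H (N - 1)) * G N)))" for H G
    by (simp add: hm_def tm_def phi_FT scl_simps)
qed


section \<open>Evaluation of Lie terms\<close>

fun lev :: "('g \<Rightarrow> 'a::clie) \<Rightarrow> 'g lie_term \<Rightarrow> 'a" where
  "lev \<gamma> (LGen g) = \<gamma> g"
| "lev \<gamma> LZero = 0"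
| "lev \<gamma> (u \<oplus>\<^sub>L v) = lev \<gamma> u + lev \<gamma> v"
| "lev \<gamma> (c \<cdot>\<^sub>L u) = c *\<^sub>C lev \<gamma> u"
| "lev \<gamma> \<langle>u, v\<rangle> = br (lev \<gamma> u) (lev \<gamma> v)"

lemma lev_sound:
  assumes "lie_cong G R u v" "\<And>a b. (a, b) \<in> R \<Longrightarrow> lev \<gamma> a = lev \<gamma> b"
  shows "lev \<gamma> u = lev \<gamma> v"
  using assms(1)
proof induction
  case (br_alternating u)
  then show ?case by (simp add: br_self)
next
  case (br_jacobi u v w)
  then show ?case using br_cyclic[of "lev \<gamma> u" "lev \<gamma> v" "lev \<gamma> w"] by simp
qed (simp_all add: assms(2) br_linear csc_add_left csc_linear add.assoc add.commute)

text \<open>A family of elements satisfying the relations of \<open>y\<close>, in terms of \<^locale>\<open>hrel\<close>.\<close>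

definition rel_family :: "nat \<Rightarrow> complex \<Rightarrow> (y_gen \<Rightarrow> 'a::clie) \<Rightarrow> bool" where
  "rel_family n \<beta> \<gamma> \<longleftrightarrow>
    (\<forall>e. hrel n \<beta> (sgn_pm e) (\<lambda>i r. \<gamma> (YX e i r)) (\<lambda>i r. \<gamma> (YXi i r))) \<and>
    (\<forall>i j r s. i < n \<longrightarrow> j < n \<longrightarrow> br (\<gamma> (YXi i r)) (\<gamma> (YXi j s)) = 0) \<and>
    (\<forall>i j r s. i < n \<longrightarrow> j < n \<longrightarrow> br (\<gamma> (YX Plus i r)) (\<gamma> (YX Minus j s)) = (if i = j then \<gamma> (YXi i (r + s)) else 0))"

lemma rel_family_sound:
  assumes f: "rel_family n \<beta> \<gamma>" and uv: "(u, v) \<in> y_rels n \<beta>"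
  shows "lev \<gamma> u = lev \<gamma> v"
proof -
  have h: "hrel n \<beta> (sgn_pm e) (\<lambda>i r. \<gamma> (YX e i r)) (\<lambda>i r. \<gamma> (YXi i r))" for e
    using f by (auto simp: rel_family_def)
  show ?thesis using uv
  proof cases
    case (x_x i j e r s)
    then show ?thesis using hrel.x_x[OF h, of i j e r s] by simp
  next
    case (xi_x i j r e s)
    then show ?thesis using hrel.h_x[OF h, of i j r e s] by simp
  next
    case (xi0_x i j e s)
    then show ?thesis using hrel.h0_x[OF h, of i j e s] by simp
  next
    case (serre_adjacent i j e s r1 r2)
    then show ?thesis using hrel.adjacent[OF h, of i j e] by (simp add: sym2_def)
  next
    case (serre_distant i j e r s)
    then show ?thesis using hrel.distant[OF h, of i j e r s] by simp
  next
    case (x_x_same_2 i e r s)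
    then show ?thesis using hrel.x_x_same_2[OF h, of i e r s] by simp
  next
    case (x_x_2 i j e r s)
    then show ?thesis using hrel.x_x_2[OF h, of i j e r s] by simp
  next
    case (xi_x_same_2 i r e s)
    then show ?thesis using hrel.h_x_same_2[OF h, of i r e s] by simp
  next
    case (xi_x_2 i j r e s)
    then show ?thesis using hrel.h_x_2[OF h, of i j r e s] by simp
  next
    case (xi0_x_2 i j e s)
    then show ?thesis using hrel.h0_x[OF h, of i j e s] by simp
  next
    case (xi1_x_2 i j e s)
    then show ?thesis using hrel.h1_x_2[OF h, of i j e s] by simp
  next
    case (serre_2 i j e s r1 r2 r3)
    then show ?thesis using hrel.serre_2[OF h, of i j e] by (simp add: sym3_def)
  next
    case (x_x_1 e r s)
    then show ?thesis using hrel.x_x_1[OF h, of e r s] by (simp add: csc_linear)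
  next
    case (xi_x_1 r e s)
    then show ?thesis using hrel.h_x_1[OF h, of r e s] by (simp add: csc_linear)
  next
    case (xi0_x_1 e s)
    then show ?thesis using hrel.h0_x_1[OF h, of e s] by simp
  next
    case (xi1_x_1 e s)
    then show ?thesis using hrel.h1_x_1[OF h, of e s] by simp
  next
    case (xi2_x_1 e s)
    then show ?thesis using hrel.h2_x_1[OF h, of e s] by simp
  next
    case (serre_1 e r1 r2 r3)
    then show ?thesis using hrel.serre_1[OF h, of e] by (simp add: sym3_def)
  qed (use f in \<open>auto simp: rel_family_def\<close>)
qed

text \<open>The case distinction on \<open>n\<close> in the defining relations is matched with the one in \<^locale>\<open>hrel\<close>.\<close>

lemma rel_familyI:
  assumes n: "n \<ge> 1" and \<beta>: "\<beta> \<noteq> 0"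
    and rels: "\<And>u v. (u, v) \<in> y_rels n \<beta> \<Longrightarrow> lev \<gamma> u = lev \<gamma> v"
  shows "rel_family n \<beta> \<gamma>"
  unfolding rel_family_def
proof (intro conjI allI impI)
  show "br (\<gamma> (YXi i r)) (\<gamma> (YXi j s)) = 0" if "i < n" "j < n" for i j r s
    using rels[OF y_rels.xi_xi[OF that]] by simp
  show "br (\<gamma> (YX Plus i r)) (\<gamma> (YX Minus j s)) = (if i = j then \<gamma> (YXi i (r + s)) else 0)" if "i < n" "j < n" for i j r s
    using rels[OF y_rels.x_plus_minus[OF that]] by (simp split: if_splits)
  fix e
  show "hrel n \<beta> (sgn_pm e) (\<lambda>i r. \<gamma> (YX e i r)) (\<lambda>i r. \<gamma> (YXi i r))"
  proof (unfold_locales, goal_cases)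
    case (3 i j r s) from rels[OF y_rels.x_x[OF this, of e r s]] show ?case by simp
  next
    case (4 i j r s) from rels[OF y_rels.xi_x[OF this, of r e s]] show ?case by simp
  next
    case (5 i j s)
    show ?case
    proof (cases "n = 2")
      case True
      from rels[OF y_rels.xi0_x_2[OF True 5(2,3), of e s]] show ?thesis by simp
    next
      case False
      then have "n > 2" using 5(1) by simp
      from rels[OF y_rels.xi0_x[OF this 5(2,3), of e s]] show ?thesis by simp
    qed
  next
    case (6 i j p q s) from rels[OF y_rels.serre_adjacent[OF this, of e s]] show ?case by (simp add: sym2_def)
  next
    case (7 i j r s) from rels[OF y_rels.serre_distant[OF this, of e r s]] show ?case by simp
  next
    case (8 i r s) from rels[OF y_rels.x_x_same_2[OF this, of e r s]] show ?case by simp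
  next
    case (9 i j r s) from rels[OF y_rels.x_x_2[OF this, of e r s]] show ?case by simp
  next
    case (10 i r s) from rels[OF y_rels.xi_x_same_2[OF this, of r e s]] show ?case by simp
  next
    case (11 i j r s) from rels[OF y_rels.xi_x_2[OF this, of r e s]] show ?case by simp
  next
    case (12 i j s) from rels[OF y_rels.xi1_x_2[OF this, of e s]] show ?case by simp
  next
    case (13 i j p q r s) from rels[OF y_rels.serre_2[OF this, of e s p q r]] show ?case by (simp add: sym3_def)
  next
    case (14 r s) from rels[OF y_rels.x_x_1[OF this, of e r s]] show ?case by (simp add: csc_linear)
  next
    case (15 r s) from rels[OF y_rels.xi_x_1[OF this, of r e s]] show ?case by (simp add: csc_linear)
  next
    case (16 s) from rels[OF y_rels.xi0_x_1[OF this, of e s]] show ?case by simp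
  next
    case (17 s) from rels[OF y_rels.xi1_x_1[OF this, of e s]] show ?case by simp
  next
    case (18 s) from rels[OF y_rels.xi2_x_1[OF this, of e s]] show ?case by simp
  next
    case (19 p q r) from rels[OF y_rels.serre_1[OF this, of e p q r]] show ?case by (simp add: sym3_def)
  qed (rule n \<beta>)+
qed

fun model_gen :: "nat \<Rightarrow> complex \<Rightarrow> y_gen \<Rightarrow> clop" where
  "model_gen n \<beta> (YX Plus i r) = tp 1 (xf n \<beta> i r)"
| "model_gen n \<beta> (YX Minus i r) = tm 1 (xf n \<beta> i r)"
| "model_gen n \<beta> (YXi i r) = hm (xf n \<beta> i r)"

lemma tp_tm_br: "br (tp 1 F) (tm 1 G) = hm (\<lambda>N. F N * G N)"
proof (rule clop_eqI)
  show "op (br (tp 1 F) (tm 1 G)) = op (hm (\<lambda>N. F N * G N))"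
    by (simp add: tp_def tm_def hm_def FT_times FT_linear(3) scl_simps mult.commute)
  have "alpha (FT (\<lambda>N. G (N + 1)) (-1)) (FT F 1) = 0" by (rule alpha_FT_zero) simp
  then show "ctr (br (tp 1 F) (tm 1 G)) = ctr (hm (\<lambda>N. F N * G N))"
    by (simp add: tp_def tm_def hm_def scl_simps phi_def alpha_FT_one)
qed

lemma model_gen_rel_family: assumes n: "n \<ge> 1" and \<beta>: "\<beta> \<noteq> 0" shows "rel_family n \<beta> (model_gen n \<beta>)"
  unfolding rel_family_def
proof (intro conjI allI impI)
  fix e show "hrel n \<beta> (sgn_pm e) (\<lambda>i r. model_gen n \<beta> (YX e i r)) (\<lambda>i r. model_gen n \<beta> (YXi i r))"
    using tmodel.model[OF tmodel_tp[OF n \<beta>]] tmodel.model[OF tmodel_tm[OF n \<beta>]] by (cases e) simp_all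
next
  fix i j r s
  show "br (model_gen n \<beta> (YXi i r)) (model_gen n \<beta> (YXi j s)) = 0"
  proof (rule clop_eqI)
    show "op (br (model_gen n \<beta> (YXi i r)) (model_gen n \<beta> (YXi j s))) = op 0"
      by (simp add: hm_def FT_times mult.commute)
    show "ctr (br (model_gen n \<beta> (YXi i r)) (model_gen n \<beta> (YXi j s))) = ctr 0"
      by (simp add: hm_def phi_def alpha_FT_zero)
  qed
  assume ij: "i < n" "j < n"
  show "br (model_gen n \<beta> (YX Plus i r)) (model_gen n \<beta> (YX Minus j s)) = (if i = j then model_gen n \<beta> (YXi i (r + s)) else 0)"
  proof -
    have "xf n \<beta> i r N * xf n \<beta> j s N = (if i = j then xf n \<beta> i (r + s) N else 0)" for N
      using ch_ch[OF ij, of N] by (auto simp: xf_def power_add ch_def)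
    moreover have "hm (\<lambda>N. 0) = 0" by (rule clop_eqI) (simp_all add: hm_def FT_linear)
    ultimately show ?thesis by (simp add: tp_tm_br[unfolded One_nat_def])
  qed
qed


section \<open>The presented Lie algebras as a single type\<close>

text \<open>The algebra \<open>y\<close> depends on \<open>n\<close> and \<open>\<beta>\<close>, while a type does not. The product over all \<open>n\<close> and \<open>\<beta>\<close> is a
  type, and each algebra embeds into it as a factor.\<close>

abbreviation Y :: "nat \<times> complex \<Rightarrow> (complex, y_gen lie_term set) module" where
  "Y p \<equiv> y_algebra (fst p) (snd p)"

lemma lie_algebra_Y: "lie_algebra (Y p)"
  unfolding y_algebra_def by (rule lie_algebra_presented)

typedef yfam = "{u :: nat \<times> complex \<Rightarrow> y_gen lie_term set. \<forall>p. u p \<in> carrier (Y p)}"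
  morphisms comp Yfam
proof -
  have "\<zero>\<^bsub>Y p\<^esub> \<in> carrier (Y p)" for p
    by (simp add: y_algebra_def presented_lie_algebra_simps)
  then have "(\<lambda>p. \<zero>\<^bsub>Y p\<^esub>) \<in> {u. \<forall>p. u p \<in> carrier (Y p)}" by blast
  then show ?thesis by (rule exI[of "\<lambda>x. x \<in> {u. \<forall>p. u p \<in> carrier (Y p)}" "\<lambda>p. \<zero>\<^bsub>Y p\<^esub>"])
qed

setup_lifting type_definition_yfam

context
  fixes p :: "nat \<times> complex"
begin

interpretation L: lie_algebra "Y p" by (rule lie_algebra_Y)

lemma Y_closed:
  "\<zero>\<^bsub>Y p\<^esub> \<in> carrier (Y p)" "u \<in> carrier (Y p) \<Longrightarrow> v \<in> carrier (Y p) \<Longrightarrow> u \<oplus>\<^bsub>Y p\<^esub> v \<in> carrier (Y p)"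
  "u \<in> carrier (Y p) \<Longrightarrow> c \<odot>\<^bsub>Y p\<^esub> u \<in> carrier (Y p)" "u \<in> carrier (Y p) \<Longrightarrow> v \<in> carrier (Y p) \<Longrightarrow> u \<otimes>\<^bsub>Y p\<^esub> v \<in> carrier (Y p)"
  by (simp_all add: L.bracket_closed complex_ring_def L.smult_closed[unfolded complex_ring_def, simplified])

lemma Y_axioms:
  assumes "u \<in> carrier (Y p)" "v \<in> carrier (Y p)" "w \<in> carrier (Y p)"
  shows "u \<oplus>\<^bsub>Y p\<^esub> v \<oplus>\<^bsub>Y p\<^esub> w = u \<oplus>\<^bsub>Y p\<^esub> (v \<oplus>\<^bsub>Y p\<^esub> w)"
    "u \<oplus>\<^bsub>Y p\<^esub> v = v \<oplus>\<^bsub>Y p\<^esub> u" "\<zero>\<^bsub>Y p\<^esub> \<oplus>\<^bsub>Y p\<^esub> u = u" "((-1) \<odot>\<^bsub>Y p\<^esub> u) \<oplus>\<^bsub>Y p\<^esub> u = \<zero>\<^bsub>Y p\<^esub>"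
    "c \<odot>\<^bsub>Y p\<^esub> (u \<oplus>\<^bsub>Y p\<^esub> v) = c \<odot>\<^bsub>Y p\<^esub> u \<oplus>\<^bsub>Y p\<^esub> c \<odot>\<^bsub>Y p\<^esub> v" "(c + d) \<odot>\<^bsub>Y p\<^esub> u = c \<odot>\<^bsub>Y p\<^esub> u \<oplus>\<^bsub>Y p\<^esub> d \<odot>\<^bsub>Y p\<^esub> u"
    "c \<odot>\<^bsub>Y p\<^esub> (d \<odot>\<^bsub>Y p\<^esub> u) = (c * d) \<odot>\<^bsub>Y p\<^esub> u" "1 \<odot>\<^bsub>Y p\<^esub> u = u"
    "(u \<oplus>\<^bsub>Y p\<^esub> v) \<otimes>\<^bsub>Y p\<^esub> w = u \<otimes>\<^bsub>Y p\<^esub> w \<oplus>\<^bsub>Y p\<^esub> v \<otimes>\<^bsub>Y p\<^esub> w" "w \<otimes>\<^bsub>Y p\<^esub> (u \<oplus>\<^bsub>Y p\<^esub> v) = w \<otimes>\<^bsub>Y p\<^esub> u \<oplus>\<^bsub>Y p\<^esub> w \<otimes>\<^bsub>Y p\<^esub> v"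
    "(c \<odot>\<^bsub>Y p\<^esub> u) \<otimes>\<^bsub>Y p\<^esub> v = c \<odot>\<^bsub>Y p\<^esub> (u \<otimes>\<^bsub>Y p\<^esub> v)" "u \<otimes>\<^bsub>Y p\<^esub> (c \<odot>\<^bsub>Y p\<^esub> v) = c \<odot>\<^bsub>Y p\<^esub> (u \<otimes>\<^bsub>Y p\<^esub> v)"
    "u \<otimes>\<^bsub>Y p\<^esub> u = \<zero>\<^bsub>Y p\<^esub>"
    "(u \<otimes>\<^bsub>Y p\<^esub> (v \<otimes>\<^bsub>Y p\<^esub> w)) \<oplus>\<^bsub>Y p\<^esub> (v \<otimes>\<^bsub>Y p\<^esub> (w \<otimes>\<^bsub>Y p\<^esub> u)) \<oplus>\<^bsub>Y p\<^esub> (w \<otimes>\<^bsub>Y p\<^esub> (u \<otimes>\<^bsub>Y p\<^esub> v)) = \<zero>\<^bsub>Y p\<^esub>"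
proof -
  show distr: "(c + d) \<odot>\<^bsub>Y p\<^esub> u = c \<odot>\<^bsub>Y p\<^esub> u \<oplus>\<^bsub>Y p\<^esub> d \<odot>\<^bsub>Y p\<^esub> u" for c d
    using L.smult_l_distr[of c d u] assms by (simp add: complex_ring_def)
  show one: "1 \<odot>\<^bsub>Y p\<^esub> u = u" using L.smult_one[of u] assms by (simp add: complex_ring_def)
  have zero: "0 \<odot>\<^bsub>Y p\<^esub> u = \<zero>\<^bsub>Y p\<^esub>" using L.smult_l_null[of u] assms by (simp add: complex_ring_def)
  show "((-1) \<odot>\<^bsub>Y p\<^esub> u) \<oplus>\<^bsub>Y p\<^esub> u = \<zero>\<^bsub>Y p\<^esub>" using distr[of "-1" 1] one zero by simp
  show "c \<odot>\<^bsub>Y p\<^esub> (u \<oplus>\<^bsub>Y p\<^esub> v) = c \<odot>\<^bsub>Y p\<^esub> u \<oplus>\<^bsub>Y p\<^esub> c \<odot>\<^bsub>Y p\<^esub> v"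
    using L.smult_r_distr[of c u v] assms by (simp add: complex_ring_def)
  show "c \<odot>\<^bsub>Y p\<^esub> (d \<odot>\<^bsub>Y p\<^esub> u) = (c * d) \<odot>\<^bsub>Y p\<^esub> u"
    using L.smult_assoc1[of c d u] assms by (simp add: complex_ring_def)
  show "u \<oplus>\<^bsub>Y p\<^esub> v \<oplus>\<^bsub>Y p\<^esub> w = u \<oplus>\<^bsub>Y p\<^esub> (v \<oplus>\<^bsub>Y p\<^esub> w)" by (rule L.a_assoc[OF assms])
  show "u \<oplus>\<^bsub>Y p\<^esub> v = v \<oplus>\<^bsub>Y p\<^esub> u" by (rule L.a_comm[OF assms(1,2)])
qed (use assms in \<open>simp_all add: L.bracket_add_left L.bracket_add_right L.bracket_smult_left
  L.bracket_smult_right L.bracket_alternating L.jacobi\<close>)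

end

instantiation yfam :: clie
begin
lift_definition zero_yfam :: yfam is "\<lambda>p. \<zero>\<^bsub>Y p\<^esub>" by (rule Y_closed)
lift_definition plus_yfam :: "yfam \<Rightarrow> yfam \<Rightarrow> yfam" is "\<lambda>u v p. u p \<oplus>\<^bsub>Y p\<^esub> v p" by (simp add: Y_closed)
lift_definition csc_yfam :: "complex \<Rightarrow> yfam \<Rightarrow> yfam" is "\<lambda>c u p. c \<odot>\<^bsub>Y p\<^esub> u p" by (simp add: Y_closed)
lift_definition br_yfam :: "yfam \<Rightarrow> yfam \<Rightarrow> yfam" is "\<lambda>u v p. u p \<otimes>\<^bsub>Y p\<^esub> v p" by (simp add: Y_closed)
definition uminus_yfam :: "yfam \<Rightarrow> yfam" where "uminus_yfam u = (-1) *\<^sub>C u"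
definition minus_yfam :: "yfam \<Rightarrow> yfam \<Rightarrow> yfam" where "minus_yfam u v = u + - v"
instance
proof
  fix u v w :: yfam and c d :: complex
  show "u + v + w = u + (v + w)" by transfer (rule HOL.ext, rule Y_axioms, auto)
  show "u + v = v + u" by transfer (rule HOL.ext, rule Y_axioms, auto)
  show "0 + u = u" by transfer (rule HOL.ext, rule Y_axioms, auto)
  show "- u + u = 0" unfolding uminus_yfam_def by transfer (rule HOL.ext, rule Y_axioms, auto)
  show "u - v = u + - v" by (rule minus_yfam_def)
  show "c *\<^sub>C (u + v) = c *\<^sub>C u + c *\<^sub>C v" by transfer (rule HOL.ext, rule Y_axioms, auto)
  show "(c + d) *\<^sub>C u = c *\<^sub>C u + d *\<^sub>C u" by transfer (rule HOL.ext, rule Y_axioms, auto)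
  show "c *\<^sub>C d *\<^sub>C u = (c * d) *\<^sub>C u" by transfer (rule HOL.ext, rule Y_axioms, auto)
  show "1 *\<^sub>C u = u" by transfer (rule HOL.ext, rule Y_axioms, auto)
  show "br (u + v) w = br u w + br v w" by transfer (rule HOL.ext, rule Y_axioms, auto)
  show "br w (u + v) = br w u + br w v" by transfer (rule HOL.ext, rule Y_axioms, auto)
  show "br (c *\<^sub>C u) v = c *\<^sub>C br u v" by transfer (rule HOL.ext, rule Y_axioms, auto)
  show "br u (c *\<^sub>C v) = c *\<^sub>C br u v" by transfer (rule HOL.ext, rule Y_axioms, auto)
  show "br u u = 0" by transfer (rule HOL.ext, rule Y_axioms, auto)
  show "br u (br v w) + br v (br w u) + br w (br u v) = 0" by transfer (rule HOL.ext, rule Y_axioms, auto)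
qed
end

definition single :: "nat \<times> complex \<Rightarrow> y_gen lie_term \<Rightarrow> yfam" where
  "single p u = Yfam (\<lambda>q. if q = p then lie_class (y_gens (fst p)) (y_rels (fst p) (snd p)) u else \<zero>\<^bsub>Y q\<^esub>)"

lemma lie_class_carrier: "u \<in> lie_terms (y_gens (fst p)) \<Longrightarrow> lie_class (y_gens (fst p)) (y_rels (fst p) (snd p)) u \<in> carrier (Y p)"
  by (simp add: y_algebra_def presented_lie_algebra_simps)

lemma comp_single:
  assumes "u \<in> lie_terms (y_gens (fst p))"
  shows "comp (single p u) q = (if q = p then lie_class (y_gens (fst p)) (y_rels (fst p) (snd p)) u else \<zero>\<^bsub>Y q\<^esub>)"
proof -
  have "(\<lambda>q. if q = p then lie_class (y_gens (fst p)) (y_rels (fst p) (snd p)) u else \<zero>\<^bsub>Y q\<^esub>) \<in> {u. \<forall>p. u p \<in> carrier (Y p)}"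
    by (intro CollectI allI) (simp add: lie_class_carrier[OF assms] Y_closed)
  then show ?thesis unfolding single_def by (simp add: Yfam_inverse)
qed

lemma yfam_eqI: "(\<And>q. comp u q = comp v q) \<Longrightarrow> u = v"
  by (simp add: comp_inject[symmetric] HOL.ext)

lemma Y_zero: "\<zero>\<^bsub>Y q\<^esub> \<oplus>\<^bsub>Y q\<^esub> \<zero>\<^bsub>Y q\<^esub> = \<zero>\<^bsub>Y q\<^esub>" "c \<odot>\<^bsub>Y q\<^esub> \<zero>\<^bsub>Y q\<^esub> = \<zero>\<^bsub>Y q\<^esub>" "\<zero>\<^bsub>Y q\<^esub> \<otimes>\<^bsub>Y q\<^esub> \<zero>\<^bsub>Y q\<^esub> = \<zero>\<^bsub>Y q\<^esub>"
proof -
  interpret L: lie_algebra "Y q" by (rule lie_algebra_Y)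
  show "\<zero>\<^bsub>Y q\<^esub> \<oplus>\<^bsub>Y q\<^esub> \<zero>\<^bsub>Y q\<^esub> = \<zero>\<^bsub>Y q\<^esub>" by simp
  show "c \<odot>\<^bsub>Y q\<^esub> \<zero>\<^bsub>Y q\<^esub> = \<zero>\<^bsub>Y q\<^esub>" by (rule L.smult_r_null) (simp add: complex_ring_def)
  show "\<zero>\<^bsub>Y q\<^esub> \<otimes>\<^bsub>Y q\<^esub> \<zero>\<^bsub>Y q\<^esub> = \<zero>\<^bsub>Y q\<^esub>" by (rule L.bracket_alternating) simp
qed

lemma single_simps:
  assumes "u \<in> lie_terms (y_gens (fst p))" "v \<in> lie_terms (y_gens (fst p))"
  shows "single p (u \<oplus>\<^sub>L v) = single p u + single p v" "single p (c \<cdot>\<^sub>L u) = c *\<^sub>C single p u"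
    "single p \<langle>u, v\<rangle> = br (single p u) (single p v)"
  by (rule yfam_eqI; simp add: comp_single assms plus_yfam.rep_eq csc_yfam.rep_eq br_yfam.rep_eq zero_yfam.rep_eq Y_zero;
      simp add: y_algebra_def presented_lie_algebra_simps assms)+

lemma single_scale: "u \<in> lie_terms (y_gens (fst p)) \<Longrightarrow> single p (c \<cdot>\<^sub>L u) = c *\<^sub>C single p u"
  by (rule single_simps(2)[of u p u])

lemma single_zero: "single p LZero = 0"
  by (rule yfam_eqI) (simp add: comp_single zero_yfam.rep_eq, simp add: y_algebra_def presented_lie_algebra_simps)

text \<open>The embedding of the factor is injective, so equality in the product means derivability from the
  relations.\<close>

lemma single_eq_iff:
  assumes "u \<in> lie_terms (y_gens (fst p))" "v \<in> lie_terms (y_gens (fst p))"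
  shows "single p u = single p v \<longleftrightarrow> lie_cong (y_gens (fst p)) (y_rels (fst p) (snd p)) u v"
proof
  assume "single p u = single p v"
  then have "comp (single p u) p = comp (single p v) p" by simp
  then have "lie_class (y_gens (fst p)) (y_rels (fst p) (snd p)) u = lie_class (y_gens (fst p)) (y_rels (fst p) (snd p)) v"
    by (simp add: comp_single assms)
  then have "v \<in> lie_class (y_gens (fst p)) (y_rels (fst p) (snd p)) u" using lie_class_refl[OF assms(2)] by simp
  then show "lie_cong (y_gens (fst p)) (y_rels (fst p) (snd p)) u v" by (simp add: lie_class_def)
next
  assume "lie_cong (y_gens (fst p)) (y_rels (fst p) (snd p)) u v"
  then show "single p u = single p v" unfolding single_def using lie_class_eqI by metis
qed

definition class_lev :: "('g \<Rightarrow> 'a::clie) \<Rightarrow> 'g lie_term set \<Rightarrow> 'a" where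
  "class_lev \<gamma> U = lev \<gamma> (SOME u. u \<in> U)"

lemma class_lev:
  assumes "\<And>a b. (a, b) \<in> R \<Longrightarrow> lev \<gamma> a = lev \<gamma> b" "u \<in> lie_terms G"
  shows "class_lev \<gamma> (lie_class G R u) = lev \<gamma> u"
proof -
  have "(SOME v. v \<in> lie_class G R u) \<in> lie_class G R u" using lie_class_refl[OF assms(2)] by (rule someI)
  then have "lie_cong G R u (SOME v. v \<in> lie_class G R u)" by (simp add: lie_class_def)
  then show ?thesis unfolding class_lev_def using lev_sound[OF _ assms(1)] by metis
qed

context
  fixes n :: nat and \<beta> :: complex
  assumes n1: "n \<ge> 1" and \<beta>: "\<beta> \<noteq> 0"
begin

text \<open>The projection to the factor, followed by evaluation in the model.\<close>

definition proj :: "yfam \<Rightarrow> clop" where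
  "proj u = class_lev (model_gen n \<beta>) (comp u (n, \<beta>))"

lemma model_gen_sound: "(a, b) \<in> y_rels n \<beta> \<Longrightarrow> lev (model_gen n \<beta>) a = lev (model_gen n \<beta>) b"
  by (rule rel_family_sound[OF model_gen_rel_family[OF n1 \<beta>]])

lemma comp_rep: obtains t where "t \<in> lie_terms (y_gens n)" "comp u (n, \<beta>) = lie_class (y_gens n) (y_rels n \<beta>) t"
proof -
  have "comp u (n, \<beta>) \<in> carrier (Y (n, \<beta>))" using comp[of u] by blast
  then show ?thesis using that by (auto simp: y_algebra_def presented_lie_algebra_simps)
qed

lemma proj_hom: "clie_hom proj"
  unfolding clie_hom_def
proof (intro conjI allI)
  fix u v :: yfam and c :: complex
  obtain s where s: "s \<in> lie_terms (y_gens n)" "comp u (n, \<beta>) = lie_class (y_gens n) (y_rels n \<beta>) s" by (rule comp_rep)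
  obtain t where t: "t \<in> lie_terms (y_gens n)" "comp v (n, \<beta>) = lie_class (y_gens n) (y_rels n \<beta>) t" by (rule comp_rep)
  show "proj (u + v) = proj u + proj v" "proj (c *\<^sub>C u) = c *\<^sub>C proj u" "proj (br u v) = br (proj u) (proj v)"
    unfolding proj_def plus_yfam.rep_eq csc_yfam.rep_eq br_yfam.rep_eq s(2) t(2)
    by (simp_all add: y_algebra_def presented_lie_algebra_simps s(1) t(1) class_lev[OF model_gen_sound])
qed

lemma proj_single: "t \<in> lie_terms (y_gens n) \<Longrightarrow> proj (single (n, \<beta>) t) = lev (model_gen n \<beta>) t"
  unfolding proj_def by (simp add: comp_single class_lev[OF model_gen_sound])

definition gy :: "y_gen \<Rightarrow> yfam" where
  "gy g = (if g \<in> y_gens n then single (n, \<beta>) (LGen g) else 0)"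

lemma gy_lev: "t \<in> lie_terms (y_gens n) \<Longrightarrow> lev gy t = single (n, \<beta>) t"
  by (induction t) (simp_all add: gy_def single_simps single_scale single_zero)

lemma y_rels_terms: "(u, v) \<in> y_rels n \<beta> \<Longrightarrow> u \<in> lie_terms (y_gens n) \<and> v \<in> lie_terms (y_gens n)"
  by (induction rule: y_rels.induct) (auto simp: y_gens_def sym2_def sym3_def)

lemma gy_rel_family: "rel_family n \<beta> gy"
proof (rule rel_familyI[OF n1 \<beta>])
  fix u v assume uv: "(u, v) \<in> y_rels n \<beta>"
  then have t: "u \<in> lie_terms (y_gens n)" "v \<in> lie_terms (y_gens n)" using y_rels_terms by auto
  then have "lie_cong (y_gens n) (y_rels n \<beta>) u v" using uv by (intro lie_cong.relation)
  then show "lev gy u = lev gy v" using t by (simp add: gy_lev single_eq_iff)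
qed

abbreviation "xs \<equiv> hrel.xs \<beta> (\<lambda>i r. gy (YX Plus i r))"
abbreviation "ys \<equiv> hrel.xs \<beta> (\<lambda>i r. gy (YX Minus i r))"
abbreviation "hs \<equiv> hrel.hs \<beta> (\<lambda>i r. gy (YXi i r))"

lemma hrel_plus: "hrel n \<beta> 1 (\<lambda>i r. gy (YX Plus i r)) (\<lambda>i r. gy (YXi i r))"
  and hrel_minus: "hrel n \<beta> (-1) (\<lambda>i r. gy (YX Minus i r)) (\<lambda>i r. gy (YXi i r))"
proof -
  have "hrel n \<beta> (sgn_pm e) (\<lambda>i r. gy (YX e i r)) (\<lambda>i r. gy (YXi i r))" for e
    using gy_rel_family by (auto simp: rel_family_def)
  from this[of Plus] this[of Minus] show "hrel n \<beta> 1 (\<lambda>i r. gy (YX Plus i r)) (\<lambda>i r. gy (YXi i r))"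
    "hrel n \<beta> (-1) (\<lambda>i r. gy (YX Minus i r)) (\<lambda>i r. gy (YXi i r))" by simp_all
qed

lemma gy_plus_minus: "i < n \<Longrightarrow> j < n \<Longrightarrow> br (gy (YX Plus i r)) (gy (YX Minus j s)) = (if i = j then gy (YXi i (r + s)) else 0)"
  using gy_rel_family by (simp add: rel_family_def)

lemma xs_ys: "i < n \<Longrightarrow> j < n \<Longrightarrow> br (xs i r) (ys j s) = (if i = j then hs i (r + s) else 0)"
  by (simp add: hrel.xs_def[OF hrel_plus] hrel.xs_def[OF hrel_minus] hrel.hs_def[OF hrel_plus] br_linear gy_plus_minus power_add mult.commute)

lemma proj_gy: "g \<in> y_gens n \<Longrightarrow> proj (gy g) = model_gen n \<beta> g"
  by (simp add: gy_def proj_single)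

lemma scale_xf: "(\<lambda>N. inverse \<beta> ^ r * xf n \<beta> i r N) = (\<lambda>N. ch n i N * of_int N ^ r)"
  using \<beta> by (auto simp: xf_def power_mult_distrib power_inverse)

lemma proj_xs: "i < n \<Longrightarrow> proj (xs i r) = tp 1 (\<lambda>N. ch n i N * of_int N ^ r)"
  using lin_onD(2)[OF tp_lin, of "xf n \<beta> i r" 1 "inverse \<beta> ^ r"] proj_gy[of "YX Plus i r"]
  by (simp add: hrel.xs_def[OF hrel_plus] clie_homD[OF proj_hom] y_gens_def scale_xf)

lemma proj_ys: "i < n \<Longrightarrow> proj (ys i r) = tm 1 (\<lambda>N. ch n i N * of_int N ^ r)"
  using lin_onD(2)[OF tm_lin, of "xf n \<beta> i r" 1 "inverse \<beta> ^ r"] proj_gy[of "YX Minus i r"]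
  by (simp add: hrel.xs_def[OF hrel_minus] clie_homD[OF proj_hom] y_gens_def scale_xf)

lemma two_halves_y: "two_halves n xs ys hs proj"
proof (intro two_halves.intro)
  note P = hrel.quad_s[OF hrel_plus] hrel.above_s[OF hrel_plus] hrel.below_s[OF hrel_plus] hrel.serre_n_s[OF hrel_plus]
    hrel.serre2_s[OF hrel_plus] hrel.serre1_s[OF hrel_plus]
  note M = hrel.quad_s[OF hrel_minus] hrel.above_s[OF hrel_minus] hrel.below_s[OF hrel_minus] hrel.serre_n_s[OF hrel_minus]
    hrel.serre2_s[OF hrel_minus] hrel.serre1_s[OF hrel_minus]
  show "half n xs ys hs proj tp"
  proof (unfold_locales, goal_cases)
    case 1 show ?case by (rule n1)
  next
    case 2 then show ?case by (rule P(1))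
  next
    case 3 then show ?case by (rule P(2))
  next
    case 4 then show ?case by (rule P(3))
  next
    case 5 then show ?case by (rule P(4))
  next
    case 6 then show ?case by (rule P(5))
  next
    case 7 then show ?case by (rule P(6))
  next
    case 8 then show ?case by (rule xs_ys)
  next
    case 9 then show ?case by (rule hrel.hx_s[OF hrel_plus])
  next
    case (10 i j s) then show ?case using hrel.hx2_s[OF hrel_plus 10, of s] by simp
  next
    case 11 show ?case by (rule proj_hom)
  next
    case 12 then show ?case by (rule proj_xs)
  next
    case 13 show ?case by (rule tp_lin)
  next
    case 14 then show ?case by (rule tp_inj)
  next
    case 15 then show ?case by (rule tp_br)
  qed
  show "half n ys xs (\<lambda>i r. - hs i r) proj tm"
  proof (unfold_locales, goal_cases)
    case 1 show ?case by (rule n1)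
  next
    case 2 then show ?case by (rule M(1))
  next
    case 3 then show ?case by (rule M(2))
  next
    case 4 then show ?case by (rule M(3))
  next
    case 5 then show ?case by (rule M(4))
  next
    case 6 then show ?case by (rule M(5))
  next
    case 7 then show ?case by (rule M(6))
  next
    case (8 i j r s)
    then show ?case using br_anti[of "ys i r" "xs j s"] xs_ys[of j i s r] by (auto simp: add.commute)
  next
    case (9 i j r s)
    have "hs i r = hrel.hs \<beta> (\<lambda>i r. gy (YXi i r)) i r" ..
    obtain p where "br (hs i r) (ys j s) = px ys j p"
      using hrel.hx_s[OF hrel_minus 9, of r s] by (auto simp: hrel.hs_def[OF hrel_plus] hrel.hs_def[OF hrel_minus])
    then have "br (- hs i r) (ys j s) = px ys j (Polynomial.smult (-1) p)" by (simp add: br_linear px_smult del: smult_minus_left)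
    then show ?case by blast
  next
    case (10 i j s)
    then show ?case using hrel.hx2_s[OF hrel_minus 10, of s] by (simp add: br_linear hrel.hs_def[OF hrel_plus] hrel.hs_def[OF hrel_minus])
  next
    case 11 show ?case by (rule proj_hom)
  next
    case 12 then show ?case by (rule proj_ys)
  next
    case 13 show ?case by (rule tm_lin)
  next
    case 14 then show ?case by (rule tm_inj)
  next
    case 15 then show ?case by (rule tm_br)
  qed
qed

interpretation B: two_halves n xs ys hs proj by (rule two_halves_y)

lemma gy_sub: "g \<in> y_gens n \<Longrightarrow> gy g \<in> B.sub"
proof -
  have s: "(\<beta> ^ r) *\<^sub>C (inverse \<beta> ^ r) *\<^sub>C v = v" for r and v :: yfam
    using \<beta> by (simp add: power_mult_distrib[symmetric])
  have P: "gy (YX Plus i r) \<in> B.sub" if "i < n" for i r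
    using B.sub_csc[OF B.sub_x[OF that, of r], of "\<beta> ^ r"] unfolding hrel.xs_def[OF hrel_plus] s .
  have M: "gy (YX Minus i r) \<in> B.sub" if "i < n" for i r
    using B.sub_csc[OF B.sub_y[OF that, of r], of "\<beta> ^ r"] unfolding hrel.xs_def[OF hrel_minus] s .
  have H: "gy (YXi i r) \<in> B.sub" if "i < n" for i r
    using B.sub_csc[OF B.sub_h[OF that, of r], of "\<beta> ^ r"] unfolding hrel.hs_def[OF hrel_plus] s .
  have "gy (YX e i r) \<in> B.sub" if "i < n" for e i r
    using P[OF that] M[OF that] by (cases e) simp_all
  moreover assume "g \<in> y_gens n"
  ultimately show ?thesis using H unfolding y_gens_def by blast
qed

lemma single_sub: "t \<in> lie_terms (y_gens n) \<Longrightarrow> single (n, \<beta>) t \<in> B.sub"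
proof (induction t)
  case (LGen g)
  then show ?case using gy_sub[of g] by (simp add: gy_def)
qed (auto simp: single_simps single_scale single_zero intro: B.sub.intros)

text \<open>The subalgebra of the product that the generators generate is the factor.\<close>

lemma sub_single: "u \<in> B.sub \<Longrightarrow> \<exists>t\<in>lie_terms (y_gens n). u = single (n, \<beta>) t"
proof -
  have g: "\<exists>t\<in>lie_terms (y_gens n). c *\<^sub>C gy g = single (n, \<beta>) t" if "g \<in> y_gens n" for g c
    using that by (intro bexI[of _ "c \<cdot>\<^sub>L LGen g"]) (auto simp: gy_def single_scale)
  show "u \<in> B.sub \<Longrightarrow> ?thesis"
  proof (induction rule: B.sub.induct)
    case (sub_x i r) then show ?case unfolding hrel.xs_def[OF hrel_plus] by (intro g) (simp add: y_gens_def)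
  next
    case (sub_y i r) then show ?case unfolding hrel.xs_def[OF hrel_minus] by (intro g) (simp add: y_gens_def)
  next
    case (sub_h i r) then show ?case unfolding hrel.hs_def[OF hrel_plus] by (intro g) (simp add: y_gens_def)
  next
    case sub_zero show ?case by (intro bexI[of _ LZero]) (simp_all add: single_zero)
  next
    case (sub_add u v)
    then obtain s t where "s \<in> lie_terms (y_gens n)" "u = single (n, \<beta>) s" "t \<in> lie_terms (y_gens n)" "v = single (n, \<beta>) t" by blast
    then show ?case by (intro bexI[of _ "s \<oplus>\<^sub>L t"]) (simp_all add: single_simps single_scale)
  next
    case (sub_csc u c)
    then obtain s where "s \<in> lie_terms (y_gens n)" "u = single (n, \<beta>) s" by blast
    then show ?case by (intro bexI[of _ "c \<cdot>\<^sub>L s"]) (simp_all add: single_simps single_scale)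
  next
    case (sub_br u v)
    then obtain s t where "s \<in> lie_terms (y_gens n)" "u = single (n, \<beta>) s" "t \<in> lie_terms (y_gens n)" "v = single (n, \<beta>) t" by blast
    then show ?case by (intro bexI[of _ "\<langle>s, t\<rangle>"]) (simp_all add: single_simps single_scale)
  qed
qed

text \<open>The two halves of the isomorphism, in terms of the model: an identity that holds there follows from the
  relations, and everything homogeneous is the value of a term.\<close>

theorem model_complete:
  assumes "u \<in> lie_terms (y_gens n)" "v \<in> lie_terms (y_gens n)"
  shows "lev (model_gen n \<beta>) u = lev (model_gen n \<beta>) v \<longleftrightarrow> lie_cong (y_gens n) (y_rels n \<beta>) u v"
proof
  assume eq: "lev (model_gen n \<beta>) u = lev (model_gen n \<beta>) v"
  have "single (n, \<beta>) u - single (n, \<beta>) v = 0"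
  proof (rule B.sub_\<Theta>_zero)
    show "single (n, \<beta>) u - single (n, \<beta>) v \<in> B.sub" by (intro B.sub_diff single_sub assms)
    show "proj (single (n, \<beta>) u - single (n, \<beta>) v) = 0"
      by (simp add: clie_homD[OF proj_hom] proj_single assms eq)
  qed
  then show "lie_cong (y_gens n) (y_rels n \<beta>) u v" using single_eq_iff[of u "(n, \<beta>)" v] assms by simp
next
  assume "lie_cong (y_gens n) (y_rels n \<beta>) u v"
  then show "lev (model_gen n \<beta>) u = lev (model_gen n \<beta>) v" by (rule lev_sound[OF _ model_gen_sound])
qed

theorem model_onto:
  assumes "F \<in> qp n"
  shows "\<exists>u\<in>lie_terms (y_gens n). lev (model_gen n \<beta>) u = Ext (FT F d) c"
proof -
  obtain u b where u: "u \<in> B.sub" "proj u = Ext (FT F d) b" using B.sub_surj(1)[OF assms] by blast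
  obtain v where v: "v \<in> B.sub" "proj v = Ext 0 (c - b)" using B.sub_surj(2)[OF assms] by blast
  obtain s where s: "s \<in> lie_terms (y_gens n)" "u = single (n, \<beta>) s" using sub_single[OF u(1)] by blast
  obtain t where t: "t \<in> lie_terms (y_gens n)" "v = single (n, \<beta>) t" using sub_single[OF v(1)] by blast
  have "lev (model_gen n \<beta>) (s \<oplus>\<^sub>L t) = Ext (FT F d) b + Ext 0 (c - b)"
    using u(2) v(2) s t by (simp add: proj_single)
  then show ?thesis using s t by (intro bexI[of _ "s \<oplus>\<^sub>L t"]) (auto intro!: clop_eqI)
qed

end


section \<open>A faithful representation of \<open>D\<close>\<close>

text \<open>Functions of \<open>k\<close> as a representation: \<open>\<partial>\<close> multiplies by \<open>k s\<close> and \<open>x\<close> shifts by one.\<close>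

fun aev :: "complex \<Rightarrow> d_gen alg_term \<Rightarrow> lop" where
  "aev s (AGen GPartial) = FT (\<lambda>k. of_int k * s) 0"
| "aev s (AGen GX) = FT (\<lambda>k. 1) 1"
| "aev s (AGen GXinv) = FT (\<lambda>k. 1) (-1)"
| "aev s AZero = 0"
| "aev s AOne = 1"
| "aev s (u \<oplus>\<^sub>A v) = aev s u + aev s v"
| "aev s (c \<cdot>\<^sub>A u) = scl c (aev s u)"
| "aev s (u \<otimes>\<^sub>A v) = aev s u * aev s v"

lemma FT_one: "FT (\<lambda>k. 1) 0 = 1" by (rule lop_eqI) simp

lemma aev_sound: "alg_cong (d_rels s) u v \<Longrightarrow> aev s u = aev s v"
proof (induction rule: alg_cong.induct)
  case (relation u v)
  have "FT (\<lambda>k. of_int k * s) 1 = FT (\<lambda>k. 1) 1 * (FT (\<lambda>k. of_int k * s) 0 + scl s 1)"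
    by (rule lop_eqI) (simp add: app_linear algebra_simps)
  with relation show ?case by (auto simp: d_rels_def FT_times FT_one)
next
  case (add_neg u)
  show ?case by (rule lop_eqI) simp
qed (simp_all add: scl_simps algebra_simps)

definition dev :: "complex \<Rightarrow> d_gen alg_term set \<Rightarrow> lop" where
  "dev s U = aev s (SOME u. u \<in> U)"

lemma dev_class: "dev s (alg_class (d_rels s) u) = aev s u"
proof -
  have "(SOME v. v \<in> alg_class (d_rels s) u) \<in> alg_class (d_rels s) u"
    by (rule someI[of _ u]) (simp add: alg_class_def alg_cong.refl)
  then show ?thesis unfolding dev_def using aev_sound by (metis alg_class_def mem_Collect_eq)
qed

lemma D_carrier: "U \<in> carrier (D s) \<longleftrightarrow> (\<exists>u. U = alg_class (d_rels s) u)"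
  by (auto simp: D_def presented_algebra_simps)

lemma ring_D: "ring (D s)" unfolding D_def by (rule ring_presented_algebra)
lemma module_D: "module complex_ring (D s)" unfolding D_def by (rule module_presented_algebra)

lemma D_gens: "\<partial> s \<in> carrier (D s)" "d_x s \<in> carrier (D s)" "d_xinv s \<in> carrier (D s)"
  by (auto simp: D_carrier d_partial_def d_x_def d_xinv_def)

lemma dev_simps:
  "U \<in> carrier (D s) \<Longrightarrow> V \<in> carrier (D s) \<Longrightarrow> dev s (U \<oplus>\<^bsub>D s\<^esub> V) = dev s U + dev s V"
  "U \<in> carrier (D s) \<Longrightarrow> V \<in> carrier (D s) \<Longrightarrow> dev s (U \<otimes>\<^bsub>D s\<^esub> V) = dev s U * dev s V"
  "U \<in> carrier (D s) \<Longrightarrow> dev s (c \<odot>\<^bsub>D s\<^esub> U) = scl c (dev s U)"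
  "dev s \<zero>\<^bsub>D s\<^esub> = 0" "dev s \<one>\<^bsub>D s\<^esub> = 1"
  "dev s (\<partial> s) = FT (\<lambda>k. of_int k * s) 0" "dev s (d_x s) = FT (\<lambda>k. 1) 1" "dev s (d_xinv s) = FT (\<lambda>k. 1) (-1)"
proof -
  show "U \<in> carrier (D s) \<Longrightarrow> V \<in> carrier (D s) \<Longrightarrow> dev s (U \<oplus>\<^bsub>D s\<^esub> V) = dev s U + dev s V"
    "U \<in> carrier (D s) \<Longrightarrow> V \<in> carrier (D s) \<Longrightarrow> dev s (U \<otimes>\<^bsub>D s\<^esub> V) = dev s U * dev s V"
    "U \<in> carrier (D s) \<Longrightarrow> dev s (c \<odot>\<^bsub>D s\<^esub> U) = scl c (dev s U)"
    by (auto simp: D_carrier) (auto simp: D_def presented_algebra_simps dev_class)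
  show "dev s \<zero>\<^bsub>D s\<^esub> = 0" "dev s \<one>\<^bsub>D s\<^esub> = 1"
    by (simp_all add: D_def presented_algebra_simps dev_class)
  show "dev s (\<partial> s) = FT (\<lambda>k. of_int k * s) 0" "dev s (d_x s) = FT (\<lambda>k. 1) 1" "dev s (d_xinv s) = FT (\<lambda>k. 1) (-1)"
    by (simp_all add: d_partial_def d_x_def d_xinv_def dev_class)
qed

lemma D_relations:
  "d_x s \<otimes>\<^bsub>D s\<^esub> d_xinv s = \<one>\<^bsub>D s\<^esub>" "d_xinv s \<otimes>\<^bsub>D s\<^esub> d_x s = \<one>\<^bsub>D s\<^esub>"
  "\<partial> s \<otimes>\<^bsub>D s\<^esub> d_x s = d_x s \<otimes>\<^bsub>D s\<^esub> (\<partial> s \<oplus>\<^bsub>D s\<^esub> s \<odot>\<^bsub>D s\<^esub> \<one>\<^bsub>D s\<^esub>)"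
  unfolding d_x_def d_xinv_def d_partial_def D_def presented_algebra_simps
  by (rule alg_class_eqI, rule alg_cong.relation, simp add: d_rels_def)+

locale D_rep =
  fixes s :: complex
begin

sublocale R: ring "D s" by (rule ring_D)
sublocale M: module complex_ring "D s" by (rule module_D)

lemma smult_closed: "U \<in> carrier (D s) \<Longrightarrow> c \<odot>\<^bsub>D s\<^esub> U \<in> carrier (D s)"
  using M.smult_closed[of c U] by (simp add: complex_ring_def)

lemma smult_simps:
  "U \<in> carrier (D s) \<Longrightarrow> V \<in> carrier (D s) \<Longrightarrow> c \<odot>\<^bsub>D s\<^esub> (U \<oplus>\<^bsub>D s\<^esub> V) = c \<odot>\<^bsub>D s\<^esub> U \<oplus>\<^bsub>D s\<^esub> c \<odot>\<^bsub>D s\<^esub> V"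
  "U \<in> carrier (D s) \<Longrightarrow> (c + d) \<odot>\<^bsub>D s\<^esub> U = c \<odot>\<^bsub>D s\<^esub> U \<oplus>\<^bsub>D s\<^esub> d \<odot>\<^bsub>D s\<^esub> U"
  "U \<in> carrier (D s) \<Longrightarrow> c \<odot>\<^bsub>D s\<^esub> (d \<odot>\<^bsub>D s\<^esub> U) = (c * d) \<odot>\<^bsub>D s\<^esub> U"
  "U \<in> carrier (D s) \<Longrightarrow> 1 \<odot>\<^bsub>D s\<^esub> U = U" "U \<in> carrier (D s) \<Longrightarrow> 0 \<odot>\<^bsub>D s\<^esub> U = \<zero>\<^bsub>D s\<^esub>"
  "U \<in> carrier (D s) \<Longrightarrow> V \<in> carrier (D s) \<Longrightarrow> (c \<odot>\<^bsub>D s\<^esub> U) \<otimes>\<^bsub>D s\<^esub> V = c \<odot>\<^bsub>D s\<^esub> (U \<otimes>\<^bsub>D s\<^esub> V)"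
  "U \<in> carrier (D s) \<Longrightarrow> V \<in> carrier (D s) \<Longrightarrow> U \<otimes>\<^bsub>D s\<^esub> (c \<odot>\<^bsub>D s\<^esub> V) = c \<odot>\<^bsub>D s\<^esub> (U \<otimes>\<^bsub>D s\<^esub> V)"
  "c \<odot>\<^bsub>D s\<^esub> \<zero>\<^bsub>D s\<^esub> = \<zero>\<^bsub>D s\<^esub>"
  using M.smult_r_distr[of c U V] M.smult_l_distr[of c d U] M.smult_assoc1[of c d U] M.smult_one[of U] M.smult_l_null[of U] M.smult_r_null[of c]
  by (simp_all add: complex_ring_def)
    (auto simp: D_carrier D_def presented_algebra_simps intro!: alg_class_eqI alg_cong.mult_scale_left alg_cong.mult_scale_right del: equalityI)

lemma gens [simp]: "\<partial> s \<in> carrier (D s)" "d_x s \<in> carrier (D s)" "d_xinv s \<in> carrier (D s)"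
  by (fact D_gens)+

lemma xpow_eq: "d_xpow s (int k) = d_x s [^]\<^bsub>D s\<^esub> k" "d_xpow s (- int k) = d_xinv s [^]\<^bsub>D s\<^esub> k"
proof -
  show "d_xpow s (int k) = d_x s [^]\<^bsub>D s\<^esub> k" unfolding d_xpow_def by (simp only: nat_int of_nat_0_le_iff if_True)
  show "d_xpow s (- int k) = d_xinv s [^]\<^bsub>D s\<^esub> k"
  proof (cases "k = 0")
    case True
    then show ?thesis unfolding d_xpow_def by simp
  next
    case False
    then have "\<not> 0 \<le> - int k" by simp
    then show ?thesis unfolding d_xpow_def minus_minus nat_int by (rule if_not_P)
  qed
qed

lemma xpow_closed [simp]: "d_xpow s l \<in> carrier (D s)"
  by (cases l rule: int_cases2) (simp_all add: xpow_eq)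

definition mon :: "nat \<times> int \<Rightarrow> d_gen alg_term set" where
  "mon \<kappa> = \<partial> s [^]\<^bsub>D s\<^esub> fst \<kappa> \<otimes>\<^bsub>D s\<^esub> d_xpow s (snd \<kappa>)"

lemma mon_closed [simp]: "mon \<kappa> \<in> carrier (D s)"
  by (simp add: mon_def)

lemma dev_pow: "U \<in> carrier (D s) \<Longrightarrow> dev s (U [^]\<^bsub>D s\<^esub> (k::nat)) = dev s U ^ k"
proof (induction k)
  case (Suc k)
  then show ?case by (simp add: dev_simps power_commutes)
qed (simp add: dev_simps)

lemma FT_power: "FT F 0 ^ k = FT (\<lambda>N. F N ^ k) 0" "FT (\<lambda>N. 1) d ^ k = FT (\<lambda>N. 1) (int k * d)"
  by (induction k) (auto simp: FT_one FT_times algebra_simps)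

lemma dev_xpow: "dev s (d_xpow s l) = FT (\<lambda>k. 1) l"
  by (cases l rule: int_cases2) (simp_all add: xpow_eq dev_pow dev_simps FT_power)

lemma dev_mon: "dev s (mon (k, l)) = FT (\<lambda>N. (of_int N * s) ^ k) l"
  by (simp add: mon_def dev_simps dev_pow dev_xpow FT_power FT_times)

fun lsum :: "((nat \<times> int) \<times> complex) list \<Rightarrow> d_gen alg_term set" where
  "lsum [] = \<zero>\<^bsub>D s\<^esub>"
| "lsum ((\<kappa>, c) # L) = c \<odot>\<^bsub>D s\<^esub> mon \<kappa> \<oplus>\<^bsub>D s\<^esub> lsum L"

lemma lsum_closed [simp]: "lsum L \<in> carrier (D s)"
  by (induction L rule: lsum.induct) (simp_all add: smult_closed)

text \<open>The combinations of distinct monomials \<open>\<partial>\<^sup>k x\<^sup>l\<close>. They are stable under left multiplication by the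
  generators, since \<open>x \<partial> = (\<partial> - s) x\<close>, and contain \<open>1\<close>, so they are everything.\<close>

definition NF :: "d_gen alg_term set set" where
  "NF = {lsum L | L. distinct (map fst L)}"

lemma lsum_insert:
  "distinct (map fst L) \<Longrightarrow> \<exists>L'. distinct (map fst L') \<and> fst ` set L' \<subseteq> insert \<kappa> (fst ` set L) \<and> c \<odot>\<^bsub>D s\<^esub> mon \<kappa> \<oplus>\<^bsub>D s\<^esub> lsum L = lsum L'"
proof (induction L)
  case Nil
  show ?case by (rule exI[of _ "[(\<kappa>, c)]"]) simp
next
  case (Cons p L)
  obtain \<kappa>' c' where p: "p = (\<kappa>', c')" by (cases p)
  show ?case
  proof (cases "\<kappa>' = \<kappa>")
    case True
    have "c \<odot>\<^bsub>D s\<^esub> mon \<kappa> \<oplus>\<^bsub>D s\<^esub> lsum (p # L) = lsum ((\<kappa>, c + c') # L)"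
      by (simp add: p True smult_simps(2) R.a_assoc smult_closed)
    then show ?thesis using Cons.prems p True by (intro exI[of _ "(\<kappa>, c + c') # L"]) auto
  next
    case False
    obtain L' where L': "distinct (map fst L')" "fst ` set L' \<subseteq> insert \<kappa> (fst ` set L)" "c \<odot>\<^bsub>D s\<^esub> mon \<kappa> \<oplus>\<^bsub>D s\<^esub> lsum L = lsum L'"
      using Cons by auto
    have "c \<odot>\<^bsub>D s\<^esub> mon \<kappa> \<oplus>\<^bsub>D s\<^esub> lsum (p # L) = c' \<odot>\<^bsub>D s\<^esub> mon \<kappa>' \<oplus>\<^bsub>D s\<^esub> (c \<odot>\<^bsub>D s\<^esub> mon \<kappa> \<oplus>\<^bsub>D s\<^esub> lsum L)"
      by (simp add: p R.a_lcomm smult_closed)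
    also have "\<dots> = lsum ((\<kappa>', c') # L')" by (simp add: L'(3))
    finally show ?thesis using L' False Cons.prems p
      by (intro exI[of _ "(\<kappa>', c') # L'"]) auto
  qed
qed

lemma NF_closed: "v \<in> NF \<Longrightarrow> v \<in> carrier (D s)" by (auto simp: NF_def)

lemma NF_zero: "\<zero>\<^bsub>D s\<^esub> \<in> NF" unfolding NF_def by (auto intro!: exI[of _ "[]"])

lemma NF_insert: "v \<in> NF \<Longrightarrow> c \<odot>\<^bsub>D s\<^esub> mon \<kappa> \<oplus>\<^bsub>D s\<^esub> v \<in> NF"
proof -
  assume "v \<in> NF"
  then obtain L where "distinct (map fst L)" "v = lsum L" by (auto simp: NF_def)
  with lsum_insert[of L \<kappa> c] show ?thesis by (auto simp: NF_def)
qed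

lemma NF_mon: "mon \<kappa> \<in> NF"
  using NF_insert[OF NF_zero, of 1 \<kappa>] by (simp add: smult_simps(4))

lemma NF_add: "u \<in> NF \<Longrightarrow> v \<in> NF \<Longrightarrow> u \<oplus>\<^bsub>D s\<^esub> v \<in> NF"
proof -
  assume v: "v \<in> NF"
  have "lsum L \<oplus>\<^bsub>D s\<^esub> v \<in> NF" for L
    by (induction L rule: lsum.induct) (auto simp: v NF_closed R.a_assoc smult_closed intro: NF_insert)
  moreover assume "u \<in> NF"
  ultimately show ?thesis by (auto simp: NF_def)
qed

lemma NF_smult: "u \<in> NF \<Longrightarrow> c \<odot>\<^bsub>D s\<^esub> u \<in> NF"
proof -
  have "c \<odot>\<^bsub>D s\<^esub> lsum L \<in> NF" for L
    by (induction L rule: lsum.induct)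
      (auto simp: smult_simps(8) smult_simps(1) smult_simps(3) smult_closed intro: NF_insert NF_zero)
  moreover assume "u \<in> NF"
  ultimately show ?thesis by (auto simp: NF_def)
qed

lemma NF_mult_left:
  assumes g: "g \<in> carrier (D s)" and mon: "\<And>\<kappa>. g \<otimes>\<^bsub>D s\<^esub> mon \<kappa> \<in> NF" and v: "v \<in> NF"
  shows "g \<otimes>\<^bsub>D s\<^esub> v \<in> NF"
proof -
  have "g \<otimes>\<^bsub>D s\<^esub> lsum L \<in> NF" for L
    by (induction L rule: lsum.induct)
      (auto simp: g NF_zero R.r_distr smult_closed smult_simps(7) intro!: NF_add NF_smult mon)
  then show ?thesis using v by (auto simp: NF_def)
qed

lemma partial_mon: "\<partial> s \<otimes>\<^bsub>D s\<^esub> mon (k, l) = mon (Suc k, l)"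
  unfolding mon_def fst_conv snd_conv R.nat_pow_Suc2[OF gens(1)] by (simp add: R.m_assoc)

lemma x_partial: "d_x s \<otimes>\<^bsub>D s\<^esub> \<partial> s = \<partial> s \<otimes>\<^bsub>D s\<^esub> d_x s \<oplus>\<^bsub>D s\<^esub> (- s) \<odot>\<^bsub>D s\<^esub> d_x s"
proof -
  have "\<partial> s \<otimes>\<^bsub>D s\<^esub> d_x s \<oplus>\<^bsub>D s\<^esub> (- s) \<odot>\<^bsub>D s\<^esub> d_x s = d_x s \<otimes>\<^bsub>D s\<^esub> \<partial> s \<oplus>\<^bsub>D s\<^esub> (s \<odot>\<^bsub>D s\<^esub> d_x s \<oplus>\<^bsub>D s\<^esub> (- s) \<odot>\<^bsub>D s\<^esub> d_x s)"
    by (simp add: D_relations(3) R.r_distr smult_closed smult_simps(7) R.a_assoc)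
  also have "s \<odot>\<^bsub>D s\<^esub> d_x s \<oplus>\<^bsub>D s\<^esub> (- s) \<odot>\<^bsub>D s\<^esub> d_x s = \<zero>\<^bsub>D s\<^esub>"
    using smult_simps(2)[of "d_x s" s "- s"] smult_simps(5)[of "d_x s"] by simp
  finally show ?thesis by simp
qed

lemma xinv_partial: "d_xinv s \<otimes>\<^bsub>D s\<^esub> \<partial> s = \<partial> s \<otimes>\<^bsub>D s\<^esub> d_xinv s \<oplus>\<^bsub>D s\<^esub> s \<odot>\<^bsub>D s\<^esub> d_xinv s"
proof -
  have "d_xinv s \<otimes>\<^bsub>D s\<^esub> \<partial> s = d_xinv s \<otimes>\<^bsub>D s\<^esub> (\<partial> s \<otimes>\<^bsub>D s\<^esub> (d_x s \<otimes>\<^bsub>D s\<^esub> d_xinv s))" by (simp add: D_relations(1))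
  also have "\<dots> = d_xinv s \<otimes>\<^bsub>D s\<^esub> ((\<partial> s \<otimes>\<^bsub>D s\<^esub> d_x s) \<otimes>\<^bsub>D s\<^esub> d_xinv s)" by (simp add: R.m_assoc)
  also have "\<dots> = (d_xinv s \<otimes>\<^bsub>D s\<^esub> d_x s) \<otimes>\<^bsub>D s\<^esub> ((\<partial> s \<oplus>\<^bsub>D s\<^esub> s \<odot>\<^bsub>D s\<^esub> \<one>\<^bsub>D s\<^esub>) \<otimes>\<^bsub>D s\<^esub> d_xinv s)"
    unfolding D_relations(3) by (simp add: R.m_assoc smult_closed)
  also have "\<dots> = \<partial> s \<otimes>\<^bsub>D s\<^esub> d_xinv s \<oplus>\<^bsub>D s\<^esub> s \<odot>\<^bsub>D s\<^esub> d_xinv s"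
    by (simp add: D_relations(2) R.l_distr smult_closed smult_simps(6))
  finally show ?thesis .
qed

lemma x_xpow: "d_x s \<otimes>\<^bsub>D s\<^esub> d_xpow s l = d_xpow s (l + 1)"
proof (cases l rule: int_cases2)
  case (nonneg k)
  have "d_xpow s (l + 1) = d_xpow s (int (Suc k))" by (rule arg_cong[of _ _ "d_xpow s"]) (simp add: nonneg)
  then show ?thesis unfolding nonneg xpow_eq R.nat_pow_Suc2[OF gens(2)] by simp
next
  case (nonpos k)
  show ?thesis
  proof (cases k)
    case 0
    then show ?thesis using xpow_eq(1)[of 1] xpow_eq(1)[of 0] by (simp add: nonpos)
  next
    case (Suc m)
    have "d_x s \<otimes>\<^bsub>D s\<^esub> d_xinv s [^]\<^bsub>D s\<^esub> Suc m = d_xinv s [^]\<^bsub>D s\<^esub> m"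
      unfolding R.nat_pow_Suc2[OF gens(3)] by (simp add: R.m_assoc[symmetric] D_relations(1))
    moreover have "d_xpow s (l + 1) = d_xpow s (- int m)" by (simp add: nonpos Suc)
    ultimately show ?thesis unfolding nonpos xpow_eq Suc by simp
  qed
qed

lemma xinv_xpow: "d_xinv s \<otimes>\<^bsub>D s\<^esub> d_xpow s l = d_xpow s (l - 1)"
proof -
  have "d_xpow s l = d_x s \<otimes>\<^bsub>D s\<^esub> d_xpow s (l - 1)" by (simp add: x_xpow)
  then show ?thesis by (simp add: R.m_assoc[symmetric] D_relations(2))
qed

lemma NF_gen: "v \<in> NF \<Longrightarrow> \<partial> s \<otimes>\<^bsub>D s\<^esub> v \<in> NF" "v \<in> NF \<Longrightarrow> d_x s \<otimes>\<^bsub>D s\<^esub> v \<in> NF" "v \<in> NF \<Longrightarrow> d_xinv s \<otimes>\<^bsub>D s\<^esub> v \<in> NF"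
proof -
  have p: "\<partial> s \<otimes>\<^bsub>D s\<^esub> v \<in> NF" if "v \<in> NF" for v
    by (rule NF_mult_left[OF gens(1) _ that]) (metis NF_mon partial_mon prod.collapse)
  then show "v \<in> NF \<Longrightarrow> \<partial> s \<otimes>\<^bsub>D s\<^esub> v \<in> NF" .
  have twist: "g \<otimes>\<^bsub>D s\<^esub> mon (k, l) \<in> NF"
    if g: "g \<in> carrier (D s)" "\<And>l. \<exists>l'. g \<otimes>\<^bsub>D s\<^esub> d_xpow s l = d_xpow s l'" "g \<otimes>\<^bsub>D s\<^esub> \<partial> s = \<partial> s \<otimes>\<^bsub>D s\<^esub> g \<oplus>\<^bsub>D s\<^esub> a \<odot>\<^bsub>D s\<^esub> g" for g a k l
  proof (induction k)
    case 0
    obtain l' where "g \<otimes>\<^bsub>D s\<^esub> d_xpow s l = d_xpow s l'" using g(2) by blast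
    then have "g \<otimes>\<^bsub>D s\<^esub> mon (0, l) = mon (0, l')" using g(1) by (simp add: mon_def)
    then show ?case using NF_mon by simp
  next
    case (Suc k)
    have "g \<otimes>\<^bsub>D s\<^esub> mon (Suc k, l) = (g \<otimes>\<^bsub>D s\<^esub> \<partial> s) \<otimes>\<^bsub>D s\<^esub> mon (k, l)"
      using g(1) by (simp add: partial_mon[symmetric] R.m_assoc)
    also have "\<dots> = \<partial> s \<otimes>\<^bsub>D s\<^esub> (g \<otimes>\<^bsub>D s\<^esub> mon (k, l)) \<oplus>\<^bsub>D s\<^esub> a \<odot>\<^bsub>D s\<^esub> (g \<otimes>\<^bsub>D s\<^esub> mon (k, l))"
      unfolding g(3) using g(1) by (simp add: R.l_distr R.m_assoc smult_closed smult_simps(6))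
    also have "\<dots> \<in> NF" by (intro NF_add NF_smult p Suc)
    finally show ?case .
  qed
  show "v \<in> NF \<Longrightarrow> d_x s \<otimes>\<^bsub>D s\<^esub> v \<in> NF"
    by (rule NF_mult_left[OF gens(2)]) (use twist[OF gens(2) _ x_partial] x_xpow in \<open>metis prod.collapse\<close>, assumption)
  show "v \<in> NF \<Longrightarrow> d_xinv s \<otimes>\<^bsub>D s\<^esub> v \<in> NF"
    by (rule NF_mult_left[OF gens(3)]) (use twist[OF gens(3) _ xinv_partial] xinv_xpow in \<open>metis prod.collapse\<close>, assumption)
qed

lemma NF_all: assumes "v \<in> carrier (D s)" shows "v \<in> NF"
proof -
  have "\<forall>v\<in>NF. alg_class (d_rels s) u \<otimes>\<^bsub>D s\<^esub> v \<in> NF" for u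
  proof (induction u)
    case (AGen g)
    then show ?case using NF_gen by (cases g) (auto simp: d_x_def d_xinv_def d_partial_def)
  next
    case AZero
    have "alg_class (d_rels s) AZero = \<zero>\<^bsub>D s\<^esub>" by (simp add: D_def presented_algebra_simps)
    then show ?case using NF_zero NF_closed by simp
  next
    case AOne
    have "alg_class (d_rels s) AOne = \<one>\<^bsub>D s\<^esub>" by (simp add: D_def presented_algebra_simps)
    then show ?case using NF_closed by simp
  next
    case (AAdd u v)
    have "alg_class (d_rels s) (u \<oplus>\<^sub>A v) = alg_class (d_rels s) u \<oplus>\<^bsub>D s\<^esub> alg_class (d_rels s) v" by (simp add: D_def presented_algebra_simps)
    moreover have "alg_class (d_rels s) w \<in> carrier (D s)" for w by (auto simp: D_carrier)
    ultimately show ?case using AAdd NF_closed NF_add by (simp add: R.l_distr)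
  next
    case (AScale c u)
    have "alg_class (d_rels s) (c \<cdot>\<^sub>A u) = c \<odot>\<^bsub>D s\<^esub> alg_class (d_rels s) u" by (simp add: D_def presented_algebra_simps)
    moreover have "alg_class (d_rels s) w \<in> carrier (D s)" for w by (auto simp: D_carrier)
    ultimately show ?case using AScale NF_closed NF_smult by (simp add: smult_simps(6))
  next
    case (AMult u v)
    have "alg_class (d_rels s) (u \<otimes>\<^sub>A v) = alg_class (d_rels s) u \<otimes>\<^bsub>D s\<^esub> alg_class (d_rels s) v" by (simp add: D_def presented_algebra_simps)
    moreover have "alg_class (d_rels s) w \<in> carrier (D s)" for w by (auto simp: D_carrier)
    ultimately show ?case using AMult NF_closed by (simp add: R.m_assoc)
  qed
  moreover have "\<one>\<^bsub>D s\<^esub> \<in> NF" using NF_mon[of "(0, 0)"] by (simp add: mon_def d_xpow_def)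
  moreover obtain u where "v = alg_class (d_rels s) u" using assms by (auto simp: D_carrier)
  ultimately have "v \<otimes>\<^bsub>D s\<^esub> \<one>\<^bsub>D s\<^esub> \<in> NF" by blast
  then show ?thesis using assms by simp
qed

text \<open>The monomials span \<open>D\<close>.\<close>

lemma D_induct [consumes 1, case_names zero add]:
  assumes "v \<in> carrier (D s)" "P \<zero>\<^bsub>D s\<^esub>" "\<And>c \<kappa> v. v \<in> carrier (D s) \<Longrightarrow> P v \<Longrightarrow> P (c \<odot>\<^bsub>D s\<^esub> mon \<kappa> \<oplus>\<^bsub>D s\<^esub> v)"
  shows "P v"
proof -
  have "P (lsum L)" for L by (induction L rule: lsum.induct) (auto intro: assms)
  then show ?thesis using NF_all[OF assms(1)] by (auto simp: NF_def)
qed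

text \<open>The entries of a combination of monomials on the diagonal \<open>l\<close> are the values at \<open>k s\<close> of the polynomial
  formed by the coefficients of \<open>x\<^sup>l\<close>. For \<open>s \<noteq> 0\<close> these are infinitely many points.\<close>

lemma dev_faithful:
  assumes "s \<noteq> 0" "v \<in> carrier (D s)" "dev s v = 0"
  shows "v = \<zero>\<^bsub>D s\<^esub>"
proof -
  obtain L where L: "distinct (map fst L)" "v = lsum L" using NF_all[OF assms(2)] by (auto simp: NF_def)
  have ents: "ent (dev s (lsum L)) N (N - l) = (\<Sum>p\<leftarrow>L. if snd (fst p) = l then snd p * (of_int N * s) ^ fst (fst p) else 0)" for N l L
  proof (induction L rule: lsum.induct)
    case (2 \<kappa> c L)
    obtain k l' where "\<kappa> = (k, l')" by (cases \<kappa>)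
    then show ?case using 2 by (simp add: dev_simps smult_closed dev_mon)
  qed (simp add: dev_simps)
  have "c = 0" if mem: "((k, l), c) \<in> set L" for k l c
  proof -
    define q where "q = (\<Sum>p\<leftarrow>L. if snd (fst p) = l then monom (snd p) (fst (fst p)) else 0)"
    have qp: "poly q z = (\<Sum>p\<leftarrow>L. if snd (fst p) = l then snd p * z ^ fst (fst p) else 0)" for z
      unfolding q_def by (induction L) (auto simp: poly_monom)
    have "poly q (of_int N * s) = 0" for N
      using ents[of L N l] assms(3) L(2) by (simp add: qp)
    then have "(\<lambda>N. of_int N * s) ` (UNIV :: int set) \<subseteq> {z. poly q z = 0}" by auto
    moreover have "infinite ((\<lambda>N. of_int N * s) ` (UNIV :: int set))"
      using assms(1) finite_imageD[of "\<lambda>N. of_int N * s" "UNIV :: int set"] infinite_UNIV_int by (auto simp: inj_on_def)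
    ultimately have "q = 0" using poly_roots_finite[of q] finite_subset by blast
    moreover have "poly.coeff q k = c"
      unfolding q_def using L(1) mem
    proof (induction L)
      case (Cons p L)
      have notin: "poly.coeff (\<Sum>p\<leftarrow>L. if snd (fst p) = l then monom (snd p) (fst (fst p)) else 0) k = 0" if "(k, l) \<notin> fst ` set L" for L
        using that by (induction L) (auto simp: image_iff)
      show ?case
      proof (cases "p = ((k, l), c)")
        case True
        then show ?thesis using notin[of L] Cons.prems by simp
      next
        case False
        then have "((k, l), c) \<in> set L" using Cons.prems by auto
        then have "fst p \<noteq> (k, l)" using Cons.prems by (auto simp: image_iff)
        then show ?thesis using Cons \<open>((k, l), c) \<in> set L\<close> by (auto simp: prod_eq_iff)
      qed
    qed simp
    ultimately show ?thesis by simp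
  qed
  then have "lsum L = \<zero>\<^bsub>D s\<^esub>"
  proof (induction L rule: lsum.induct)
    case (2 \<kappa> c L)
    have "c = 0" using 2(2)[of "fst \<kappa>" "snd \<kappa>" c] by simp
    moreover have "lsum L = \<zero>\<^bsub>D s\<^esub>" using 2(2) by (intro 2(1)) auto
    ultimately show ?case by (simp add: smult_simps(5))
  qed simp
  then show ?thesis using L by simp
qed

lemma dev_inj:
  assumes "s \<noteq> 0" "u \<in> carrier (D s)" "v \<in> carrier (D s)" "dev s u = dev s v"
  shows "u = v"
proof -
  have "dev s (u \<oplus>\<^bsub>D s\<^esub> (-1) \<odot>\<^bsub>D s\<^esub> v) = 0"
    using assms by (simp add: dev_simps smult_closed) (rule lop_eqI, simp)
  then have "u \<oplus>\<^bsub>D s\<^esub> (-1) \<odot>\<^bsub>D s\<^esub> v = \<zero>\<^bsub>D s\<^esub>" using assms by (intro dev_faithful) (simp_all add: smult_closed)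
  then have "u \<oplus>\<^bsub>D s\<^esub> ((-1) \<odot>\<^bsub>D s\<^esub> v \<oplus>\<^bsub>D s\<^esub> v) = v" using assms by (simp add: R.a_assoc[symmetric] smult_closed)
  moreover have "(-1) \<odot>\<^bsub>D s\<^esub> v \<oplus>\<^bsub>D s\<^esub> v = \<zero>\<^bsub>D s\<^esub>"
    using smult_simps(2)[of v "-1" 1] smult_simps(4,5)[of v] assms by simp
  ultimately show ?thesis using assms by simp
qed

lemma dev_dpoly: "dev s (d_poly s f) = FT (\<lambda>k. poly f (of_int k * s)) 0" and d_poly_closed: "d_poly s f \<in> carrier (D s)"
proof -
  define g where "g k = poly.coeff f k \<odot>\<^bsub>D s\<^esub> (\<partial> s [^]\<^bsub>D s\<^esub> k)" for k
  have g: "g k \<in> carrier (D s)" "dev s (g k) = FT (\<lambda>N. poly.coeff f k * (of_int N * s) ^ k) 0" for k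
    by (simp_all add: g_def smult_closed dev_simps dev_pow FT_power FT_linear)
  have "(\<Oplus>\<^bsub>D s\<^esub>k\<in>{..m}. g k) \<in> carrier (D s) \<and> dev s (\<Oplus>\<^bsub>D s\<^esub>k\<in>{..m}. g k) = FT (\<lambda>N. \<Sum>k\<le>m. poly.coeff f k * (of_int N * s) ^ k) 0" for m
  proof (induction m)
    case 0
    have "(\<Oplus>\<^bsub>D s\<^esub>k\<in>{..0::nat}. g k) = g 0" using g R.finsum_insert[of "{}" 0 g] by (simp add: Pi_def)
    then show ?case using g by simp
  next
    case (Suc m)
    have "(\<Oplus>\<^bsub>D s\<^esub>k\<in>{..Suc m}. g k) = g (Suc m) \<oplus>\<^bsub>D s\<^esub> (\<Oplus>\<^bsub>D s\<^esub>k\<in>{..m}. g k)"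
      unfolding atMost_Suc by (rule R.finsum_insert) (auto simp: g)
    then show ?case using Suc g by (simp add: dev_simps FT_linear(1) add.commute)
  qed
  from this[of "degree f"] show "dev s (d_poly s f) = FT (\<lambda>k. poly f (of_int k * s)) 0" "d_poly s f \<in> carrier (D s)"
    unfolding d_poly_def g_def[symmetric] by (simp_all add: poly_altdef)
qed

end


section \<open>Block matrices of local operators\<close>

text \<open>The position of \<open>N = k n + (n - i)\<close>: the row \<open>i\<close> and the site of \<open>k\<close> in it.\<close>

definition row :: "nat \<Rightarrow> int \<Rightarrow> nat" where
  "row n N = n - nat (N mod int n)"

definition site :: "nat \<Rightarrow> int \<Rightarrow> nat \<Rightarrow> int" where
  "site n k j = k * int n + int n - int j"

lemma site_simps:
  assumes "j \<in> {1..n}"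
  shows "site n k j div int n = k" "row n (site n k j) = j"
proof -
  have e: "site n k j = (int n - int j) + k * int n" by (simp add: site_def)
  show "site n k j div int n = k" unfolding e using assms by simp
  have "site n k j mod int n = int n - int j" unfolding e mod_mult_self1 using assms by (intro mod_pos_pos_trivial) auto
  then show "row n (site n k j) = j" using assms by (simp add: row_def nat_diff_distrib)
qed

lemma site_eq:
  assumes "n \<ge> 1" shows "row n N \<in> {1..n}" "site n (N div int n) (row n N) = N"
proof -
  have m: "0 \<le> N mod int n" "N mod int n < int n" using assms by simp_all
  then show "row n N \<in> {1..n}" by (auto simp: row_def nat_less_iff)
  have "int (row n N) = int n - N mod int n" using m by (simp add: row_def of_nat_diff nat_le_iff)
  then show "site n (N div int n) (row n N) = N" by (simp add: site_def)
qed

lemma site_inj: "j \<in> {1..n} \<Longrightarrow> j' \<in> {1..n} \<Longrightarrow> site n k j = site n k' j' \<longleftrightarrow> k = k' \<and> j = j'"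
  using site_simps by metis

lemma site_cases:
  assumes "n \<ge> 1" obtains k j where "j \<in> {1..n}" "N = site n k j"
  using site_eq[OF assms, of N] by metis

lemma ch_row: assumes "n \<ge> 1" "i \<in> {1..n}" shows "ch n i N = of_bool (row n N = i)"
proof -
  obtain k j where N: "j \<in> {1..n}" "N = site n k j" using site_cases[OF assms(1)] by blast
  have e: "N + int i = (int i - int j) + (k + 1) * int n" by (simp add: N site_def algebra_simps)
  have "(N + int i) mod int n = (int i - int j) mod int n" unfolding e by simp
  also have "\<dots> = 0 \<longleftrightarrow> int n dvd int i - int j" by (simp add: dvd_eq_mod_eq_0)
  also have "\<dots> \<longleftrightarrow> int i - int j = 0"
  proof
    assume d: "int n dvd int i - int j"
    show "int i - int j = 0"
      using N(1) assms(2) zdvd_imp_le[OF d] zdvd_imp_le[of "int n" "int j - int i"] d dvd_minus_iff[of "int n" "int i - int j"] by fastforce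
  qed simp
  finally show ?thesis using N site_simps(2)[OF N(1)] by (auto simp: ch_def)
qed

lemma local_op_family:
  assumes "finite S" obtains b where "b \<ge> 0" "\<And>x. x \<in> S \<Longrightarrow> local_op b (app (a x))"
proof -
  have "\<exists>b\<ge>0. \<forall>x\<in>S. local_op b (app (a x))"
    using assms
  proof (induction S)
    case (insert x S)
    obtain b where b: "b \<ge> 0" "\<forall>x\<in>S. local_op b (app (a x))" using insert by blast
    obtain c where c: "c \<ge> 0" "local_op c (app (a x))" by (rule app_local)
    show ?case using b c by (intro exI[of _ "b + c"]) (auto intro: local_op_mono)
  qed auto
  then show ?thesis using that by blast
qed

text \<open>A matrix of operators on functions of \<open>k\<close> acts on functions of \<open>N\<close>, which are regarded as columns by means of
  \<open>N = site n k i\<close>.\<close>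

definition mat_op :: "nat \<Rightarrow> (nat \<times> nat \<Rightarrow> lop) \<Rightarrow> lop" where
  "mat_op n a = Lop (\<lambda>v N. \<Sum>j = 1..n. app (a (row n N, j)) (\<lambda>k. v (site n k j)) (N div int n))"

lemma app_mat_op:
  assumes n: "n \<ge> 1"
  shows "app (mat_op n a) v N = (\<Sum>j = 1..n. app (a (row n N, j)) (\<lambda>k. v (site n k j)) (N div int n))"
proof -
  let ?A = "\<lambda>v N. \<Sum>j = 1..n. app (a (row n N, j)) (\<lambda>k. v (site n k j)) (N div int n)"
  obtain b where b: "b \<ge> 0" "\<And>p. p \<in> {1..n} \<times> {1..n} \<Longrightarrow> local_op b (app (a p))"
    using local_op_family[of "{1..n} \<times> {1..n}" a] by auto
  have "local_op ((b + 1) * int n) ?A"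
    unfolding local_op_def
  proof (intro allI impI sum.cong HOL.refl)
    fix u v :: "int \<Rightarrow> complex" and N j
    assume eq: "\<forall>M\<in>{N - (b + 1) * int n..N + (b + 1) * int n}. u M = v M" and j: "j \<in> {1..n}"
    have "u (site n k j) = v (site n k j)" if "k \<in> {N div int n - b..N div int n + b}" for k
    proof (rule eq[rule_format])
      have N: "N = (N div int n) * int n + int n - int (row n N)" using site_eq(2)[OF n, of N] by (simp add: site_def)
      have r: "int (row n N) \<le> int n" "int (row n N) \<ge> 1" "int j \<le> int n" "int j \<ge> 1" using site_eq(1)[OF n, of N] j by auto
      \<comment> \<open>a distance of at most \<open>b\<close> in \<open>k\<close> becomes one of less than \<open>(b + 1) n\<close> in \<open>N\<close>\<close>
      have e: "site n k j - N = (k - N div int n) * int n + (int (row n N) - int j)"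
        using N by (simp add: site_def algebra_simps)
      have "(k - N div int n) * int n \<le> b * int n" "(- b) * int n \<le> (k - N div int n) * int n"
        using that by (intro mult_right_mono; simp)+
      then have "site n k j - N \<le> (b + 1) * int n" "- ((b + 1) * int n) \<le> site n k j - N"
        unfolding e distrib_right using r by linarith+
      then show "site n k j \<in> {N - (b + 1) * int n..N + (b + 1) * int n}" by simp
    qed
    moreover have "local_op b (app (a (row n N, j)))" using j site_eq(1)[OF n, of N] by (intro b(2)) simp
    ultimately show "app (a (row n N, j)) (\<lambda>k. u (site n k j)) (N div int n) = app (a (row n N, j)) (\<lambda>k. v (site n k j)) (N div int n)"
      unfolding local_op_def by metis
  qed
  then have "?A \<in> {A. (\<forall>u v. A (\<lambda>k. u k + v k) = (\<lambda>k. A u k + A v k)) \<and> (\<forall>c u. A (\<lambda>k. c * u k) = (\<lambda>k. c * A u k)) \<and> (\<exists>b. local_op b A)}"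
    by (auto simp: app_linear sum.distrib sum_distrib_left)
  from Lop_inverse[OF this] show ?thesis by (simp add: mat_op_def)
qed

lemma mat_op_cong:
  assumes "n \<ge> 1" "\<And>i j. i \<in> {1..n} \<Longrightarrow> j \<in> {1..n} \<Longrightarrow> a (i, j) = b (i, j)"
  shows "mat_op n a = mat_op n b"
  by (rule lop_eqI) (use assms site_eq(1)[OF assms(1)] in \<open>auto simp: app_mat_op intro!: sum.cong\<close>)

lemma app_sum_lop: "app (\<Sum>k\<in>K. A k) u N = (\<Sum>k\<in>K. app (A k) u N)"
  by (induction K rule: infinite_finite_induct) simp_all

lemma mat_op_linear:
  assumes "n \<ge> 1"
  shows "mat_op n (\<lambda>p. a p + b p) = mat_op n a + mat_op n b" "mat_op n (\<lambda>p. a p - b p) = mat_op n a - mat_op n b"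
    "mat_op n (\<lambda>p. scl c (a p)) = scl c (mat_op n a)" "mat_op n (\<lambda>p. 0) = 0"
  by (rule lop_eqI; simp add: app_mat_op[OF assms] sum.distrib sum_subtractf sum_distrib_left)+

lemma mat_op_times:
  assumes n: "n \<ge> 1"
  shows "mat_op n a * mat_op n b = mat_op n (\<lambda>(i, j). \<Sum>k = 1..n. a (i, k) * b (k, j))"
proof (rule lop_eqI)
  fix u N
  have "app (mat_op n a * mat_op n b) u N = (\<Sum>k = 1..n. app (a (row n N, k)) (\<lambda>l. app (mat_op n b) u (site n l k)) (N div int n))"
    by (simp add: app_mat_op[OF n])
  also have "\<dots> = (\<Sum>k = 1..n. \<Sum>j = 1..n. app (a (row n N, k)) (app (b (k, j)) (\<lambda>m. u (site n m j))) (N div int n))"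
    by (intro sum.cong HOL.refl) (simp add: app_mat_op[OF n] site_simps app_sum)
  also have "\<dots> = app (mat_op n (\<lambda>(i, j). \<Sum>k = 1..n. a (i, k) * b (k, j))) u N"
    unfolding app_mat_op[OF n] by (subst sum.swap) (simp add: app_sum_lop)
  finally show "app (mat_op n a * mat_op n b) u N = app (mat_op n (\<lambda>(i, j). \<Sum>k = 1..n. a (i, k) * b (k, j))) u N" .
qed

lemma ent_mat_op:
  assumes n: "n \<ge> 1" and i: "i \<in> {1..n}" and j: "j \<in> {1..n}"
  shows "ent (mat_op n a) (site n k i) (site n l j) = ent (a (i, j)) k l"
proof -
  have "ent (mat_op n a) (site n k i) (site n l j) = (\<Sum>j' = 1..n. app (a (i, j')) (\<lambda>m. of_bool (j' = j) * of_bool (m = l)) k)"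
    unfolding ent_def app_mat_op[OF n] site_simps[OF i]
    by (intro sum.cong HOL.refl arg_cong2[where f = "\<lambda>x. app x _"] arg_cong[where f = "\<lambda>x. app _ x k"] HOL.ext) (auto simp: site_inj[OF _ j])
  also have "\<dots> = (\<Sum>j' = 1..n. of_bool (j' = j) * ent (a (i, j')) k l)"
    by (simp only: app_linear(2) ent_def)
  also have "\<dots> = (\<Sum>j' = 1..n. if j' = j then ent (a (i, j')) k l else 0)"
    by (intro sum.cong HOL.refl) simp
  also have "\<dots> = ent (a (i, j)) k l" using j by (simp add: sum.delta)
  finally show ?thesis .
qed

lemma mat_op_inj:
  assumes "n \<ge> 1" "mat_op n a = mat_op n b" "i \<in> {1..n}" "j \<in> {1..n}"
  shows "a (i, j) = b (i, j)"
  using ent_mat_op[OF assms(1,3,4)] assms(2) by (intro ent_eqI) metis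

lemma mat_op_unit:
  assumes n: "n \<ge> 1" and i: "i \<in> {1..n}" and j: "j \<in> {1..n}"
  shows "mat_op n (\<lambda>(p, q). scl (E i j p q) (FT G l)) = FT (\<lambda>N. ch n i N * G (N div int n)) (l * int n + int j - int i)"
proof (rule lop_eqI)
  fix u N
  have "app (mat_op n (\<lambda>(p, q). scl (E i j p q) (FT G l))) u N = (\<Sum>j' = 1..n. if j' = j then of_bool (row n N = i) * G (N div int n) * u (site n (N div int n - l) j) else 0)"
    unfolding app_mat_op[OF n] by (intro sum.cong) (auto simp: unit_mat_def)
  also have "\<dots> = ch n i N * G (N div int n) * u (N - (l * int n + int j - int i))"
  proof (cases "row n N = i")
    case True
    have "site n (N div int n - l) j = N - (l * int n + int j - int i)"
      using site_eq(2)[OF n, of N] unfolding True by (simp add: site_def algebra_simps)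
    then show ?thesis using j by (simp add: ch_row[OF n i] sum.delta)
  next
    case False
    then show ?thesis by (simp add: ch_row[OF n i])
  qed
  finally show "app (mat_op n (\<lambda>(p, q). scl (E i j p q) (FT G l))) u N = app (FT (\<lambda>N. ch n i N * G (N div int n)) (l * int n + int j - int i)) u N"
    by simp
qed

text \<open>The sum defining the cocycle may be taken over any box around the cut that the operators
  do not leave.\<close>

lemma alpha_box:
  assumes "local_op b (app A)" "b \<le> L"
  shows "alpha A B = (\<Sum>N\<in>{0..<L}. \<Sum>M\<in>{- L..<0}. ent A N M * ent B M N)"
proof -
  have "alpha A B = (\<Sum>(N, M) \<in> {0..<L} \<times> {- L..<0}. ent A N M * ent B M N)"
    unfolding alpha_def
  proof (rule sum.mono_neutral_left)
    show "{(N, M). N \<ge> 0 \<and> M < 0 \<and> ent A N M \<noteq> 0 \<and> ent B M N \<noteq> 0} \<subseteq> {0..<L} \<times> {- L..<0}"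
    proof (clarsimp)
      fix N M :: int assume h: "0 \<le> N" "M < 0" "ent A N M \<noteq> 0"
      have "\<not> \<bar>N - M\<bar> > b" using ent_outside[OF assms(1), of N M] h by auto
      then show "N < L \<and> - L \<le> M" using h assms(2) by linarith
    qed
  qed auto
  then show ?thesis by (simp add: sum.cartesian_product)
qed

lemma sum_sites:
  assumes n: "n \<ge> 1"
  shows "(\<Sum>N\<in>{p * int n..<q * int n}. f N) = (\<Sum>j = 1..n. \<Sum>k\<in>{p..<q}. f (site n k j))"
  unfolding sum.cartesian_product
proof (rule sum.reindex_bij_witness[of _ "\<lambda>(j, k). site n k j" "\<lambda>N. (row n N, N div int n)"])
  fix N assume N: "N \<in> {p * int n..<q * int n}"
  have "p * int n div int n \<le> N div int n" using N n by (intro zdiv_mono1) auto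
  moreover have "N div int n < q" proof (rule ccontr)
    assume "\<not> N div int n < q"
    then have "q * int n \<le> (N div int n) * int n" by (intro mult_right_mono) auto
    also have "\<dots> \<le> N" using n div_mult_mod_eq[of N "int n"] pos_mod_sign[of "int n" N] by linarith
    finally show False using N by simp
  qed
  ultimately show "(row n N, N div int n) \<in> {1..n} \<times> {p..<q}" using site_eq(1)[OF n, of N] n by simp
next
  fix x assume "x \<in> {1..n} \<times> {p..<q}"
  then obtain j k where x: "x = (j, k)" "j \<in> {1..n}" "p \<le> k" "k + 1 \<le> q" by auto
  have "p * int n \<le> k * int n" "(k + 1) * int n \<le> q * int n" using x by (intro mult_right_mono; simp)+
  moreover have "int j \<le> int n" "int j > 0" using x(2) by auto
  ultimately have "p * int n \<le> site n k j" "site n k j < q * int n" unfolding site_def distrib_right by linarith+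
  then show "(case x of (j, k) \<Rightarrow> site n k j) \<in> {p * int n..<q * int n}" by (simp add: x(1))
qed (auto simp: site_eq[OF n] site_simps simp del: atLeastAtMost_iff)

text \<open>The cut between \<open>-1\<close> and \<open>0\<close> is the same for \<open>N\<close> and for \<open>k\<close>, because \<open>N = k n + (n - i)\<close> is nonnegative
  exactly when \<open>k\<close> is.\<close>

lemma alpha_mat_op:
  assumes n: "n \<ge> 1"
  shows "alpha (mat_op n a) (mat_op n b) = (\<Sum>i = 1..n. \<Sum>j = 1..n. alpha (a (i, j)) (b (j, i)))"
proof -
  obtain c where c: "c \<ge> 0" "local_op c (app (mat_op n a))" by (rule app_local)
  obtain d where d: "d \<ge> 0" "\<And>p. p \<in> {1..n} \<times> {1..n} \<Longrightarrow> local_op d (app (a p))"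
    using local_op_family[of "{1..n} \<times> {1..n}" a] by auto
  define L where "L = c + d"
  have "c \<le> L * 1" "L * 1 \<le> L * int n" using c d n unfolding L_def by (simp, intro mult_left_mono) auto
  then have L: "c \<le> L * int n" "d \<le> L" using c d by (auto simp: L_def)
  have s: "(\<Sum>N\<in>{0..<L * int n}. f N) = (\<Sum>i = 1..n. \<Sum>k\<in>{0..<L}. f (site n k i))"
    "(\<Sum>N\<in>{- (L * int n)..<0}. f N) = (\<Sum>i = 1..n. \<Sum>k\<in>{- L..<0}. f (site n k i))" for f :: "int \<Rightarrow> complex"
    using sum_sites[OF n, of f 0 L] sum_sites[OF n, of f "- L" 0] by simp_all
  have "alpha (mat_op n a) (mat_op n b) = (\<Sum>i = 1..n. \<Sum>k\<in>{0..<L}. \<Sum>j = 1..n. \<Sum>l\<in>{- L..<0}. ent (a (i, j)) k l * ent (b (j, i)) l k)"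
    unfolding alpha_box[OF c(2) L(1)] s by (intro sum.cong HOL.refl) (simp add: ent_mat_op[OF n])
  also have "\<dots> = (\<Sum>i = 1..n. \<Sum>j = 1..n. \<Sum>k\<in>{0..<L}. \<Sum>l\<in>{- L..<0}. ent (a (i, j)) k l * ent (b (j, i)) l k)"
    by (rule sum.cong[OF HOL.refl], rule sum.swap)
  also have "\<dots> = (\<Sum>i = 1..n. \<Sum>j = 1..n. alpha (a (i, j)) (b (j, i)))"
    using alpha_box[OF d(2) L(2)] by (intro sum.cong HOL.refl) auto
  finally show ?thesis .
qed

lemma alpha_FT_pos:
  assumes "l > 0" shows "alpha (FT F l) (FT G (- l)) = (\<Sum>a = 0..l - 1. F a * G (a - l))"
proof -
  have loc: "local_op l (app (FT F l))" using assms unfolding local_op_def by auto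
  have "alpha (FT F l) (FT G (- l)) = (\<Sum>a\<in>{0..<l}. \<Sum>M\<in>{- l..<0}. if M = a - l then F a * G (a - l) else 0)"
    unfolding alpha_box[OF loc order.refl] by (intro sum.cong HOL.refl) auto
  also have "\<dots> = (\<Sum>a\<in>{0..<l}. F a * G (a - l))"
    by (intro sum.cong HOL.refl) (simp add: sum.delta)
  also have "{0..<l} = {0..l - 1}" by auto
  finally show ?thesis .
qed


section \<open>The Lie algebra \<open>Dbar\<close> inside the extended operators\<close>

text \<open>The representation of matrices over \<open>D\<close>; it is injective for \<open>s \<noteq> 0\<close>, and the algebraic laws of the target
  are inherited.\<close>

definition mev :: "nat \<Rightarrow> complex \<Rightarrow> d_elem \<Rightarrow> lop" where
  "mev n s M = mat_op n (\<lambda>p. dev s (M p))"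

locale Dmat_rep = D_rep s for s +
  fixes n :: nat
  assumes n1: "n \<ge> 1" and s0: "s \<noteq> 0"
begin

abbreviation Q where "Q \<equiv> Dmat n s"

lemma carrier_Q: "carrier Q = {1..n} \<times> {1..n} \<rightarrow>\<^sub>E carrier (D s)"
  by (simp add: Dmat_def mat_algebra_def)

lemma entry: "M \<in> carrier Q \<Longrightarrow> i \<in> {1..n} \<Longrightarrow> j \<in> {1..n} \<Longrightarrow> M (i, j) \<in> carrier (D s)"
  unfolding carrier_Q by (rule PiE_mem) auto

lemma Q_closed:
  "M \<in> carrier Q \<Longrightarrow> N \<in> carrier Q \<Longrightarrow> M \<oplus>\<^bsub>Q\<^esub> N \<in> carrier Q"
  "M \<in> carrier Q \<Longrightarrow> N \<in> carrier Q \<Longrightarrow> M \<otimes>\<^bsub>Q\<^esub> N \<in> carrier Q"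
  "M \<in> carrier Q \<Longrightarrow> c \<odot>\<^bsub>Q\<^esub> M \<in> carrier Q" "\<zero>\<^bsub>Q\<^esub> \<in> carrier Q"
  "d \<in> carrier (D s) \<Longrightarrow> tensor n (D s) A d \<in> carrier Q"
proof -
  have restr: "(\<lambda>(i, j)\<in>{1..n} \<times> {1..n}. f i j) \<in> carrier Q" if "\<And>i j. i \<in> {1..n} \<Longrightarrow> j \<in> {1..n} \<Longrightarrow> f i j \<in> carrier (D s)" for f
    unfolding carrier_Q restrict_PiE_iff
  proof
    fix p assume "p \<in> {1..n} \<times> {1..n}"
    then show "(case p of (i, j) \<Rightarrow> f i j) \<in> carrier (D s)" by (cases p) (simp add: that)
  qed
  show "M \<in> carrier Q \<Longrightarrow> N \<in> carrier Q \<Longrightarrow> M \<oplus>\<^bsub>Q\<^esub> N \<in> carrier Q"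
    using restr[of "\<lambda>i j. M (i, j) \<oplus>\<^bsub>D s\<^esub> N (i, j)"] entry by (simp add: Dmat_def mat_algebra_def)
  show "M \<in> carrier Q \<Longrightarrow> N \<in> carrier Q \<Longrightarrow> M \<otimes>\<^bsub>Q\<^esub> N \<in> carrier Q"
    using restr[of "\<lambda>i j. \<Oplus>\<^bsub>D s\<^esub>k\<in>{1..n}. M (i, k) \<otimes>\<^bsub>D s\<^esub> N (k, j)"] entry by (simp add: Dmat_def mat_algebra_def R.finsum_closed Pi_def)
  show "M \<in> carrier Q \<Longrightarrow> c \<odot>\<^bsub>Q\<^esub> M \<in> carrier Q"
    using restr[of "\<lambda>i j. c \<odot>\<^bsub>D s\<^esub> M (i, j)"] entry by (simp add: Dmat_def mat_algebra_def smult_closed)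
  show "\<zero>\<^bsub>Q\<^esub> \<in> carrier Q"
    using restr[of "\<lambda>i j. \<zero>\<^bsub>D s\<^esub>"] by (simp add: Dmat_def mat_algebra_def)
  show "d \<in> carrier (D s) \<Longrightarrow> tensor n (D s) A d \<in> carrier Q"
    using restr[of "\<lambda>i j. A i j \<odot>\<^bsub>D s\<^esub> d"] by (simp add: tensor_def smult_closed)
qed

lemma Q_entries:
  assumes "i \<in> {1..n}" "j \<in> {1..n}"
  shows "(M \<oplus>\<^bsub>Q\<^esub> N) (i, j) = M (i, j) \<oplus>\<^bsub>D s\<^esub> N (i, j)"
    "(M \<otimes>\<^bsub>Q\<^esub> N) (i, j) = (\<Oplus>\<^bsub>D s\<^esub>k\<in>{1..n}. M (i, k) \<otimes>\<^bsub>D s\<^esub> N (k, j))"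
    "(c \<odot>\<^bsub>Q\<^esub> M) (i, j) = c \<odot>\<^bsub>D s\<^esub> M (i, j)" "\<zero>\<^bsub>Q\<^esub> (i, j) = \<zero>\<^bsub>D s\<^esub>"
    "tensor n (D s) A d (i, j) = A i j \<odot>\<^bsub>D s\<^esub> d"
  using assms by (simp_all add: Dmat_def mat_algebra_def tensor_def)

lemma Q_eqI:
  assumes "M \<in> carrier Q" "N \<in> carrier Q" "\<And>i j. i \<in> {1..n} \<Longrightarrow> j \<in> {1..n} \<Longrightarrow> M (i, j) = N (i, j)"
  shows "M = N"
  using assms unfolding carrier_Q by (intro PiE_ext) auto

lemma dev_finsum:
  assumes "finite K" "\<And>k. k \<in> K \<Longrightarrow> f k \<in> carrier (D s)"
  shows "dev s (\<Oplus>\<^bsub>D s\<^esub>k\<in>K. f k) = (\<Sum>k\<in>K. dev s (f k))"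
  using assms
proof (induction K)
  case (insert k K)
  then show ?case by (simp add: R.finsum_insert Pi_def R.finsum_closed dev_simps)
qed (simp add: dev_simps)

lemma mev_simps:
  assumes M: "M \<in> carrier Q" and N: "N \<in> carrier Q"
  shows "mev n s (M \<oplus>\<^bsub>Q\<^esub> N) = mev n s M + mev n s N" "mev n s (M \<otimes>\<^bsub>Q\<^esub> N) = mev n s M * mev n s N"
  unfolding mev_def mat_op_linear(1)[OF n1, symmetric] mat_op_times[OF n1]
  by (rule mat_op_cong[OF n1]; simp add: Q_entries dev_simps entry M N dev_finsum del: atLeastAtMost_iff One_nat_def)+

lemma mev_zero: "mev n s \<zero>\<^bsub>Q\<^esub> = 0"
proof -
  have "mev n s \<zero>\<^bsub>Q\<^esub> = mat_op n (\<lambda>p. 0)"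
    unfolding mev_def by (rule mat_op_cong[OF n1]) (simp add: Q_entries dev_simps del: atLeastAtMost_iff)
  then show ?thesis by (simp add: mat_op_linear(4)[OF n1])
qed

lemma mev_smult: "M \<in> carrier Q \<Longrightarrow> mev n s (c \<odot>\<^bsub>Q\<^esub> M) = scl c (mev n s M)"
  unfolding mev_def mat_op_linear(3)[OF n1, symmetric]
  by (rule mat_op_cong[OF n1]) (simp add: Q_entries dev_simps entry del: atLeastAtMost_iff One_nat_def)

lemma mev_tensor:
  assumes "d \<in> carrier (D s)"
  shows "mev n s (tensor n (D s) A d) = mat_op n (\<lambda>(i, j). scl (A i j) (dev s d))"
  unfolding mev_def by (rule mat_op_cong[OF n1]) (simp add: Q_entries dev_simps assms del: atLeastAtMost_iff)

lemma mev_inj: "M \<in> carrier Q \<Longrightarrow> N \<in> carrier Q \<Longrightarrow> mev n s M = mev n s N \<Longrightarrow> M = N"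
proof (rule Q_eqI)
  fix i j assume M: "M \<in> carrier Q" "N \<in> carrier Q" "mev n s M = mev n s N" and ij: "i \<in> {1..n}" "j \<in> {1..n}"
  have "dev s (M (i, j)) = dev s (N (i, j))" by (rule mat_op_inj[OF n1 M(3)[unfolded mev_def] ij])
  then show "M (i, j) = N (i, j)" by (rule dev_inj[OF s0 entry[OF M(1) ij] entry[OF M(2) ij]])
qed

sublocale Q: abelian_group Q
proof (rule abelian_groupI)
  fix M assume M: "M \<in> carrier Q"
  show "\<exists>N\<in>carrier Q. N \<oplus>\<^bsub>Q\<^esub> M = \<zero>\<^bsub>Q\<^esub>"
  proof (rule bexI[of _ "(-1) \<odot>\<^bsub>Q\<^esub> M"], rule mev_inj)
    show "mev n s ((-1) \<odot>\<^bsub>Q\<^esub> M \<oplus>\<^bsub>Q\<^esub> M) = mev n s \<zero>\<^bsub>Q\<^esub>"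
      by (rule lop_eqI) (simp add: mev_simps mev_smult mev_zero Q_closed M)
  qed (simp_all add: Q_closed M)
qed (auto intro!: mev_inj simp: Q_closed mev_simps mev_zero add_ac)

lemma mev_minus:
  assumes M: "M \<in> carrier Q" and N: "N \<in> carrier Q"
  shows "mev n s (M \<ominus>\<^bsub>Q\<^esub> N) = mev n s M - mev n s N"
proof -
  have "(M \<ominus>\<^bsub>Q\<^esub> N) \<oplus>\<^bsub>Q\<^esub> N = M" using M N by (simp add: Q.minus_eq Q.a_assoc Q.l_neg)
  then have "mev n s (M \<ominus>\<^bsub>Q\<^esub> N) + mev n s N = mev n s M" using mev_simps(1)[of "M \<ominus>\<^bsub>Q\<^esub> N" N] M N by simp
  then show ?thesis by (simp add: eq_diff_eq)
qed

text \<open>The multiples of \<open>E i j \<otimes> \<partial>\<^sup>k x\<^sup>l\<close> span.\<close>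

lemma Q_induct [consumes 1, case_names zero add monomial]:
  assumes M: "M \<in> carrier Q" and zero: "P \<zero>\<^bsub>Q\<^esub>"
    and add: "\<And>M N. M \<in> carrier Q \<Longrightarrow> N \<in> carrier Q \<Longrightarrow> P M \<Longrightarrow> P N \<Longrightarrow> P (M \<oplus>\<^bsub>Q\<^esub> N)"
    and monomial: "\<And>c i j \<kappa>. i \<in> {1..n} \<Longrightarrow> j \<in> {1..n} \<Longrightarrow> P (c \<odot>\<^bsub>Q\<^esub> tensor n (D s) (E i j) (mon \<kappa>))"
  shows "P M"
proof -
  have single: "P (tensor n (D s) (E i j) d)" if ij: "i \<in> {1..n}" "j \<in> {1..n}" and d: "d \<in> carrier (D s)" for i j d
    using d
  proof (induction rule: D_induct)
    case zero
    have "tensor n (D s) (E i j) \<zero>\<^bsub>D s\<^esub> = \<zero>\<^bsub>Q\<^esub>"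
      by (rule Q_eqI) (simp_all add: Q_closed Q_entries smult_simps)
    then show ?case using assms(2) by simp
  next
    case (add c \<kappa> v)
    have "tensor n (D s) (E i j) (c \<odot>\<^bsub>D s\<^esub> mon \<kappa> \<oplus>\<^bsub>D s\<^esub> v)
      = c \<odot>\<^bsub>Q\<^esub> tensor n (D s) (E i j) (mon \<kappa>) \<oplus>\<^bsub>Q\<^esub> tensor n (D s) (E i j) v"
      by (rule Q_eqI) (simp_all add: Q_closed Q_entries smult_simps smult_closed add mult.commute)
    then show ?case using assms(3)[OF _ _ monomial[OF ij, of c \<kappa>] add(2)] add(1) by (simp add: Q_closed)
  qed
  define cut where "cut S = (\<lambda>p\<in>{1..n} \<times> {1..n}. if p \<in> S then M p else \<zero>\<^bsub>D s\<^esub>)" for S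
  have cut_closed: "cut S \<in> carrier Q" for S
    using entry[OF M] unfolding carrier_Q by (auto simp: cut_def simp del: atLeastAtMost_iff)
  have "P (cut S)" if "finite S" "S \<subseteq> {1..n} \<times> {1..n}" for S
    using that
  proof (induction S)
    case empty
    have "cut {} = \<zero>\<^bsub>Q\<^esub>" by (rule Q_eqI) (simp_all add: cut_closed Q_closed Q_entries, simp add: cut_def)
    then show ?case using zero by simp
  next
    case (insert p S)
    obtain i j where p: "p = (i, j)" "i \<in> {1..n}" "j \<in> {1..n}" using insert.prems by (cases p) auto
    have "cut (insert p S) = tensor n (D s) (E i j) (M (i, j)) \<oplus>\<^bsub>Q\<^esub> cut S"
    proof (rule Q_eqI)
      fix a b assume ab: "a \<in> {1..n}" "b \<in> {1..n}"
      show "cut (insert p S) (a, b) = (tensor n (D s) (E i j) (M (i, j)) \<oplus>\<^bsub>Q\<^esub> cut S) (a, b)"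
        using ab insert.hyps(2) entry[OF M p(2,3)] entry[OF M ab]
        by (auto simp: Q_entries cut_def p(1) unit_mat_def smult_simps simp del: atLeastAtMost_iff)
    qed (simp_all add: cut_closed Q_closed entry[OF M p(2,3)])
    then show ?case using add[OF _ cut_closed single[OF p(2,3)]] insert entry[OF M p(2,3)] by (simp add: Q_closed)
  qed
  from this[of "{1..n} \<times> {1..n}"] have "P (cut ({1..n} \<times> {1..n}))" by simp
  also have "cut ({1..n} \<times> {1..n}) = M"
    by (rule Q_eqI[OF cut_closed M]) (simp add: cut_def)
  finally show ?thesis .
qed

text \<open>The block structure contributes the trace of the product of the two complex matrices. The pairing
  \<open>alpha\<close> of two shifts is nonzero only if the first is positive and they are opposite; this gives the case
  distinction in the definition of the cocycle.\<close>

lemma phi_tensor: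
  "phi (mev n s (tensor n (D s) M1 (d_poly s f1 \<otimes>\<^bsub>D s\<^esub> d_xpow s l1))) (mev n s (tensor n (D s) M2 (d_poly s f2 \<otimes>\<^bsub>D s\<^esub> d_xpow s l2)))
    = cocycle_value n s M1 f1 l1 M2 f2 l2"
proof -
  let ?A = "FT (\<lambda>k. poly f1 (of_int k * s)) l1" and ?B = "FT (\<lambda>k. poly f2 (of_int k * s)) l2"
  have d: "dev s (d_poly s f \<otimes>\<^bsub>D s\<^esub> d_xpow s l) = FT (\<lambda>k. poly f (of_int k * s)) l" for f l
    by (simp add: dev_simps d_poly_closed dev_dpoly dev_xpow FT_times)
  have m: "mev n s (tensor n (D s) M (d_poly s f \<otimes>\<^bsub>D s\<^esub> d_xpow s l)) = mat_op n (\<lambda>(i, j). scl (M i j) (FT (\<lambda>k. poly f (of_int k * s)) l))" for M f l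
    by (simp add: mev_tensor d_poly_closed d)
  have "(\<Sum>i = 1..n. \<Sum>j = 1..n. alpha (scl (M2 i j) ?B) (scl (M1 j i) ?A)) = (\<Sum>j = 1..n. \<Sum>i = 1..n. alpha (scl (M2 i j) ?B) (scl (M1 j i) ?A))"
    by (rule sum.swap)
  then have "phi (mev n s (tensor n (D s) M1 (d_poly s f1 \<otimes>\<^bsub>D s\<^esub> d_xpow s l1))) (mev n s (tensor n (D s) M2 (d_poly s f2 \<otimes>\<^bsub>D s\<^esub> d_xpow s l2)))
    = trace_mult n M1 M2 * alpha ?A ?B - trace_mult n M1 M2 * alpha ?B ?A"
    unfolding m phi_def alpha_mat_op[OF n1] by (simp add: alpha_scl trace_mult_def sum_distrib_right mult_ac)
  also have "\<dots> = cocycle_value n s M1 f1 l1 M2 f2 l2"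
  proof (cases "l1 + l2 = 0")
    case False
    then have "alpha ?A ?B = 0" "alpha ?B ?A = 0" using alpha_FT_zero[of l1 l2] alpha_FT_zero[of l2 l1] by auto
    then show ?thesis using False by (auto simp: cocycle_value_def)
  next
    case True
    consider "l1 > 0" | "l1 = 0" | "l1 < 0" by linarith
    then show ?thesis
    proof cases
      case 1
      then have "l2 = - l1" "alpha ?B ?A = 0" using True alpha_FT_zero[of l2 l1] by auto
      then show ?thesis using 1 alpha_FT_pos[of l1 "\<lambda>k. poly f1 (of_int k * s)" "\<lambda>k. poly f2 (of_int k * s)"]
        by (simp add: cocycle_value_def)
    next
      case 2
      then show ?thesis using True alpha_FT_zero[of l1 l2] alpha_FT_zero[of l2 l1] by (simp add: cocycle_value_def)
    next
      case 3
      then have l: "l1 = - l2" "l2 > 0" "alpha ?A ?B = 0" using True alpha_FT_zero[of l1 l2] by auto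
      then show ?thesis using alpha_FT_pos[OF l(2), of "\<lambda>k. poly f2 (of_int k * s)" "\<lambda>k. poly f1 (of_int k * s)"]
        by (simp add: cocycle_value_def)
    qed
  qed
  finally show ?thesis .
qed

lemma mon_dpoly: "mon (k, l) = d_poly s (monom 1 k) \<otimes>\<^bsub>D s\<^esub> d_xpow s l"
proof -
  have "\<partial> s [^]\<^bsub>D s\<^esub> k = d_poly s (monom 1 k)"
    by (rule dev_inj[OF s0]) (simp_all add: d_poly_closed dev_dpoly dev_pow dev_simps FT_power poly_monom)
  then show ?thesis by (simp add: mon_def)
qed

text \<open>A form with the prescribed values is determined on monomials, which span.\<close>

lemma cocycle_unique:
  assumes "is_cocycle n s \<phi>" "is_cocycle n s \<psi>" shows "\<phi> = \<psi>"
proof -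
  have add1: "\<chi> (u \<oplus>\<^bsub>Q\<^esub> v) w = \<chi> u w + \<chi> v w" and add2: "\<chi> w (u \<oplus>\<^bsub>Q\<^esub> v) = \<chi> w u + \<chi> w v"
    if "is_cocycle n s \<chi>" "u \<in> carrier Q" "v \<in> carrier Q" "w \<in> carrier Q" for \<chi> u v w
    using that unfolding is_cocycle_def by blast+
  have ext: "\<chi> \<in> carrier Q \<rightarrow>\<^sub>E (carrier Q \<rightarrow>\<^sub>E UNIV)" if "is_cocycle n s \<chi>" for \<chi>
    using that unfolding is_cocycle_def by (rule conjunct1)
  have z: "\<chi> \<zero>\<^bsub>Q\<^esub> v = 0" "\<chi> v \<zero>\<^bsub>Q\<^esub> = 0" if "is_cocycle n s \<chi>" "v \<in> carrier Q" for \<chi> v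
  proof -
    have "\<chi> (\<zero>\<^bsub>Q\<^esub> \<oplus>\<^bsub>Q\<^esub> \<zero>\<^bsub>Q\<^esub>) v = \<chi> \<zero>\<^bsub>Q\<^esub> v + \<chi> \<zero>\<^bsub>Q\<^esub> v" "\<chi> v (\<zero>\<^bsub>Q\<^esub> \<oplus>\<^bsub>Q\<^esub> \<zero>\<^bsub>Q\<^esub>) = \<chi> v \<zero>\<^bsub>Q\<^esub> + \<chi> v \<zero>\<^bsub>Q\<^esub>"
      using that by (simp_all only: add1 add2 Q_closed(4))
    then show "\<chi> \<zero>\<^bsub>Q\<^esub> v = 0" "\<chi> v \<zero>\<^bsub>Q\<^esub> = 0" by simp_all
  qed
  have mm: "\<chi> (a \<odot>\<^bsub>Q\<^esub> tensor n (D s) (E i j) (mon \<kappa>)) (b \<odot>\<^bsub>Q\<^esub> tensor n (D s) (E p q) (mon \<mu>))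
      = a * (b * cocycle_value n s (E i j) (monom 1 (fst \<kappa>)) (snd \<kappa>) (E p q) (monom 1 (fst \<mu>)) (snd \<mu>))"
    if \<chi>: "is_cocycle n s \<chi>" for \<chi> a b i j p q \<kappa> \<mu>
  proof -
    have t: "tensor n (D s) A (mon \<kappa>) \<in> carrier Q" for A \<kappa> by (simp add: Q_closed)
    have "\<chi> (a \<odot>\<^bsub>Q\<^esub> tensor n (D s) (E i j) (mon \<kappa>)) (b \<odot>\<^bsub>Q\<^esub> tensor n (D s) (E p q) (mon \<mu>))
      = a * (b * \<chi> (tensor n (D s) (E i j) (mon \<kappa>)) (tensor n (D s) (E p q) (mon \<mu>)))"
      using \<chi> t Q_closed(3)[OF t] unfolding is_cocycle_def by simp
    also have "\<chi> (tensor n (D s) (E i j) (mon \<kappa>)) (tensor n (D s) (E p q) (mon \<mu>))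
      = cocycle_value n s (E i j) (monom 1 (fst \<kappa>)) (snd \<kappa>) (E p q) (monom 1 (fst \<mu>)) (snd \<mu>)"
      using \<chi> mon_dpoly[of "fst \<kappa>" "snd \<kappa>"] mon_dpoly[of "fst \<mu>" "snd \<mu>"] unfolding is_cocycle_def by simp
    finally show ?thesis .
  qed
  have eq: "\<phi> u v = \<psi> u v" if u: "u \<in> carrier Q" and v: "v \<in> carrier Q" for u v
    using u
  proof (induction u rule: Q_induct)
    case zero
    show ?case using z(1)[OF assms(1) v] z(1)[OF assms(2) v] by simp
  next
    case (add M N)
    then show ?case by (simp only: add1[OF assms(1) _ _ v] add1[OF assms(2) _ _ v])
  next
    case (monomial a i j \<kappa>)
    let ?m = "a \<odot>\<^bsub>Q\<^esub> tensor n (D s) (E i j) (mon \<kappa>)"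
    have m: "?m \<in> carrier Q" by (simp add: Q_closed)
    show ?case using v
    proof (induction v rule: Q_induct)
      case zero
      show ?case using z(2)[OF assms(1) m] z(2)[OF assms(2) m] by simp
    next
      case (add M N)
      then show ?case by (simp only: add2[OF assms(1) _ _ m] add2[OF assms(2) _ _ m])
    next
      case (monomial b p q \<mu>)
      show ?case unfolding mm[OF assms(1)] mm[OF assms(2)] by (rule HOL.refl)
    qed
  qed
  show ?thesis
  proof (rule PiE_ext[of _ "carrier Q" "\<lambda>_. carrier Q \<rightarrow>\<^sub>E UNIV"])
    show "\<phi> \<in> carrier Q \<rightarrow>\<^sub>E (carrier Q \<rightarrow>\<^sub>E UNIV)" "\<psi> \<in> carrier Q \<rightarrow>\<^sub>E (carrier Q \<rightarrow>\<^sub>E UNIV)" by (rule ext[OF assms(1)], rule ext[OF assms(2)])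
    fix u assume u: "u \<in> carrier Q"
    show "\<phi> u = \<psi> u"
    proof (rule PiE_ext[of _ "carrier Q" "\<lambda>_. UNIV"])
      show "\<phi> u \<in> carrier Q \<rightarrow>\<^sub>E UNIV" "\<psi> u \<in> carrier Q \<rightarrow>\<^sub>E UNIV" by (rule PiE_mem[OF ext[OF assms(1)] u], rule PiE_mem[OF ext[OF assms(2)] u])
    qed (rule eq[OF u])
  qed
qed

text \<open>The given cocycle exists and is the restriction of the standard one.\<close>

lemma cocycle_eq:
  assumes "u \<in> carrier Q" "v \<in> carrier Q"
  shows "cocycle n s u v = phi (mev n s u) (mev n s v)"
proof -
  let ?\<phi> = "\<lambda>u\<in>carrier Q. \<lambda>v\<in>carrier Q. phi (mev n s u) (mev n s v)"
  have "is_cocycle n s ?\<phi>"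
    unfolding is_cocycle_def
    by (auto simp: Q_closed mev_simps mev_smult phi_bilinear d_poly_closed phi_tensor simp del: Q.a_comm)
  then have "cocycle n s = ?\<phi>" unfolding cocycle_def using cocycle_unique by blast
  then show ?thesis using assms by simp
qed

definition rho :: "d_elem \<times> complex \<Rightarrow> clop" where
  "rho x = Ext (mev n s (fst x)) (snd x)"

lemma rho_inj: "inj_on rho (carrier (Dbar n s))"
  by (rule inj_onI) (auto simp: rho_def Dbar_def dest: mev_inj)

lemma rho_simps:
  assumes "x \<in> carrier (Dbar n s)" "y \<in> carrier (Dbar n s)"
  shows "rho (x \<oplus>\<^bsub>Dbar n s\<^esub> y) = rho x + rho y" "rho (x \<otimes>\<^bsub>Dbar n s\<^esub> y) = br (rho x) (rho y)"
  using assms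
  by (auto simp: rho_def Dbar_def mev_simps mev_smult mev_minus mev_zero Q_closed cocycle_eq intro!: clop_eqI split: prod.splits)

lemma Dbar_closed:
  assumes "x \<in> carrier (Dbar n s)" "y \<in> carrier (Dbar n s)"
  shows "x \<oplus>\<^bsub>Dbar n s\<^esub> y \<in> carrier (Dbar n s)" "x \<otimes>\<^bsub>Dbar n s\<^esub> y \<in> carrier (Dbar n s)"
  using assms by (auto simp: Dbar_def Q_closed)

lemma Dbar_smult:
  assumes "x \<in> carrier (Dbar n s)"
  shows "c \<odot>\<^bsub>Dbar n s\<^esub> x \<in> carrier (Dbar n s)" "rho (c \<odot>\<^bsub>Dbar n s\<^esub> x) = c *\<^sub>C rho x"
  using assms by (auto simp: rho_def Dbar_def mev_smult Q_closed intro!: clop_eqI split: prod.splits)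

lemma Dbar_zero: "\<zero>\<^bsub>Dbar n s\<^esub> \<in> carrier (Dbar n s)" "rho \<zero>\<^bsub>Dbar n s\<^esub> = 0"
  by (auto simp: rho_def Dbar_def mev_zero Q_closed intro!: clop_eqI)

end

lemma lie_algebra_transport:
  fixes L :: "(complex, 'b) module" and \<rho> :: "'b \<Rightarrow> 'a::clie"
  assumes inj: "inj_on \<rho> (carrier L)"
    and closed: "\<And>x y. x \<in> carrier L \<Longrightarrow> y \<in> carrier L \<Longrightarrow> x \<oplus>\<^bsub>L\<^esub> y \<in> carrier L"
      "\<And>x y. x \<in> carrier L \<Longrightarrow> y \<in> carrier L \<Longrightarrow> x \<otimes>\<^bsub>L\<^esub> y \<in> carrier L"
      "\<And>c x. x \<in> carrier L \<Longrightarrow> c \<odot>\<^bsub>L\<^esub> x \<in> carrier L" "\<zero>\<^bsub>L\<^esub> \<in> carrier L"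
    and hom: "\<And>x y. x \<in> carrier L \<Longrightarrow> y \<in> carrier L \<Longrightarrow> \<rho> (x \<oplus>\<^bsub>L\<^esub> y) = \<rho> x + \<rho> y"
      "\<And>x y. x \<in> carrier L \<Longrightarrow> y \<in> carrier L \<Longrightarrow> \<rho> (x \<otimes>\<^bsub>L\<^esub> y) = br (\<rho> x) (\<rho> y)"
      "\<And>c x. x \<in> carrier L \<Longrightarrow> \<rho> (c \<odot>\<^bsub>L\<^esub> x) = c *\<^sub>C \<rho> x" "\<rho> \<zero>\<^bsub>L\<^esub> = 0"
  shows "lie_algebra L"
proof -
  note i = inj_onD[OF inj]
  have "abelian_group L"
  proof (rule abelian_groupI)
    fix x assume x: "x \<in> carrier L"
    show "\<exists>y\<in>carrier L. y \<oplus>\<^bsub>L\<^esub> x = \<zero>\<^bsub>L\<^esub>"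
    proof (rule bexI[of _ "(-1) \<odot>\<^bsub>L\<^esub> x"], rule i)
      show "\<rho> ((-1) \<odot>\<^bsub>L\<^esub> x \<oplus>\<^bsub>L\<^esub> x) = \<rho> \<zero>\<^bsub>L\<^esub>" using x by (simp add: closed hom)
    qed (simp_all add: closed x)
  qed (auto intro!: i simp: closed hom add_ac)
  then have "module complex_ring L"
    by (intro moduleI cring_complex_ring) (auto intro!: i simp: complex_ring_def closed hom csc_add_left csc_add_right)
  then show ?thesis
    by (intro lie_algebra.intro lie_algebra_axioms.intro)
      (auto intro!: i simp: closed hom br_add_left br_add_right br_csc_left br_csc_right br_self br_cyclic)
qed

context Dmat_rep
begin

lemma lie_algebra_Dbar: "lie_algebra (Dbar n s)"
  by (rule lie_algebra_transport[OF rho_inj]) (auto simp: Dbar_closed rho_simps Dbar_smult Dbar_zero)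

lemma mev_unit:
  assumes "i \<in> {1..n}" "j \<in> {1..n}" "d \<in> carrier (D s)" "dev s d = FT G l"
  shows "mev n s (tensor n (D s) (E i j) d) = FT (\<lambda>N. ch n i N * G (N div int n)) (l * int n + int j - int i)"
  unfolding mev_tensor[OF assms(3)] assms(4) by (rule mat_op_unit[OF n1 assms(1,2)])

lemma mev_tensor_diff:
  assumes "d \<in> carrier (D s)"
  shows "mev n s (tensor n (D s) (\<lambda>a b. A a b - B a b) d) = mev n s (tensor n (D s) A d) - mev n s (tensor n (D s) B d)"
proof -
  have "scl (a - b) X = scl a X - scl b X" for a b X by (rule lop_eqI) (simp add: algebra_simps)
  then show ?thesis
    unfolding mev_tensor[OF assms] mat_op_linear(2)[OF n1, symmetric] by (intro mat_op_cong[OF n1]) simp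
qed

lemma dev_shift: "dev s (shift_pow s c r) = FT (\<lambda>k. (of_int k * s + c) ^ r) 0" and shift_closed: "shift_pow s c r \<in> carrier (D s)"
proof -
  have m: "\<partial> s \<oplus>\<^bsub>D s\<^esub> c \<odot>\<^bsub>D s\<^esub> \<one>\<^bsub>D s\<^esub> \<in> carrier (D s)" by (simp add: smult_closed)
  then show "shift_pow s c r \<in> carrier (D s)" by (simp add: shift_pow_def)
  have "dev s (\<partial> s \<oplus>\<^bsub>D s\<^esub> c \<odot>\<^bsub>D s\<^esub> \<one>\<^bsub>D s\<^esub>) = FT (\<lambda>k. of_int k * s + c) 0"
    by (rule lop_eqI) (simp add: dev_simps smult_closed algebra_simps)
  then show "dev s (shift_pow s c r) = FT (\<lambda>k. (of_int k * s + c) ^ r) 0"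
    unfolding shift_pow_def by (simp add: dev_pow[OF m] FT_power)
qed

lemma dev_affine_gens: "dev s (\<partial> s [^]\<^bsub>D s\<^esub> r \<otimes>\<^bsub>D s\<^esub> d_x s) = FT (\<lambda>k. (of_int k * s) ^ r) 1"
    "dev s (d_xinv s \<otimes>\<^bsub>D s\<^esub> \<partial> s [^]\<^bsub>D s\<^esub> r) = FT (\<lambda>k. (of_int k * s + s) ^ r) (-1)"
    "dev s (\<partial> s [^]\<^bsub>D s\<^esub> r) = FT (\<lambda>k. (of_int k * s) ^ r) 0"
  by (simp_all add: dev_simps dev_pow FT_power FT_times distrib_right)

end

text \<open>On the class \<open>i\<close> one has \<open>(N div n) n = N + i - n\<close>: for \<open>s = n \<beta>\<close>, polynomials in \<open>k s\<close> become
  polynomials in \<open>N\<close>.\<close>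

lemma ch_site:
  assumes "n \<ge> 1" "i \<in> {1..n}"
  shows "ch n i N * f (of_int (N div int n) * (of_nat n * \<beta>)) = ch n i N * f ((of_int N + of_nat i - of_nat n) * (\<beta>::complex))"
proof (cases "row n N = i")
  case True
  then have "(N div int n) * int n = N + int i - int n" using site_eq(2)[OF assms(1), of N] by (simp add: site_def)
  from arg_cong[OF this, of "of_int :: int \<Rightarrow> complex"] have "of_int (N div int n) * of_nat n = (of_int N + of_nat i - of_nat n :: complex)" by simp
  then show ?thesis by (metis mult.assoc)
qed (simp add: ch_row[OF assms])

lemma ch_wrap: "ch n n N = ch n 0 N" "ch n i (N + 1) = ch n (i + 1) N"
proof -
  have "N + 1 + int i = N + int (i + 1)" by simp
  then show "ch n i (N + 1) = ch n (i + 1) N" unfolding ch_def by (simp only:)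
qed (simp add: ch_def)

context
  fixes n :: nat and \<beta> :: complex
  assumes n1: "n \<ge> 1" and \<beta>: "\<beta> \<noteq> 0"
begin

abbreviation (input) "s \<equiv> of_nat n * \<beta>"

interpretation A: Dmat_rep "of_nat n * \<beta>" n
  by unfold_locales (use n1 \<beta> in auto)

lemma mev_unit:
  assumes "i \<in> {1..n}" "j \<in> {1..n}" "d \<in> carrier (D s)" "dev s d = FT (\<lambda>k. f (of_int k * s)) l" "e = l * int n + int j - int i"
  shows "mev n s (tensor n (D s) (E i j) d) = FT (\<lambda>N. ch n i N * f ((of_int N + of_nat i - of_nat n) * \<beta>)) e"
  unfolding A.mev_unit[OF assms(1-4)] assms(5) ch_site[OF n1 assms(1)] ..

text \<open>The assignment of the theorem is the model of the previous sections.\<close>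

lemma rho_theta_gen:
  assumes "g \<in> y_gens n"
  shows "theta_gen n \<beta> g \<in> carrier (Dbar n s)" "A.rho (theta_gen n \<beta> g) = model_gen n \<beta> g"
proof -
  have Dbar: "(M, c) \<in> carrier (Dbar n s) \<longleftrightarrow> M \<in> carrier A.Q" for M c by (simp add: Dbar_def)
  note cl = Dbar A.Q_closed A.shift_closed
  note dx = A.dev_affine_gens
  have bnd: "1 \<in> {1..n}" "n \<in> {1..n}" "\<And>i. i < n \<Longrightarrow> i \<noteq> 0 \<Longrightarrow> i \<in> {1..n}" "\<And>i. i < n \<Longrightarrow> i + 1 \<in> {1..n}"
    using n1 by auto
  \<comment> \<open>the shifts of \<open>\<partial>\<close> turn \<open>k s\<close> into \<open>N \<beta>\<close> on row \<open>i\<close> and into \<open>(N + 1) \<beta>\<close> on row \<open>i + 1\<close>\<close>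
  define sh where "sh i = (of_nat n - of_nat i) * \<beta>" for i
  have shN: "(of_int N + of_nat i - of_nat n) * \<beta> + sh i = of_int N * \<beta>"
     "(of_int N + of_nat (i + 1) - of_nat n) * \<beta> + sh i = of_int (N + 1) * \<beta>" for i N by (simp_all add: sh_def algebra_simps)
  have s1: "(of_int N + of_nat 1 - of_nat n) * \<beta> + s = of_int (N + 1) * \<beta>" for N by (simp add: algebra_simps)
  show "theta_gen n \<beta> g \<in> carrier (Dbar n s)"
    by (cases "(n, \<beta>, g)" rule: theta_gen.cases) (simp_all add: cl Let_def)
  consider i r where "g = YX Plus i r" "i < n" | i r where "g = YX Minus i r" "i < n" | i r where "g = YXi i r" "i < n"
  proof (cases g)
    case (YX e i r)
    then show ?thesis using that assms by (cases e) (auto simp: y_gens_def)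
  next
    case (YXi i r)
    then show ?thesis using that assms by (auto simp: y_gens_def)
  qed
  then show "A.rho (theta_gen n \<beta> g) = model_gen n \<beta> g"
  proof cases
    case (1 i r)
    show ?thesis
    proof (cases "i = 0")
      case True
      have "mev n s (tensor n (D s) (E n 1) (\<partial> s [^]\<^bsub>D s\<^esub> r \<otimes>\<^bsub>D s\<^esub> d_x s)) = FT (xf n \<beta> 0 r) 1"
        by (subst mev_unit[where f = "\<lambda>z. z ^ r" and e = "1", OF bnd(2,1) _ dx(1)]) (simp_all add: ch_wrap xf_def[abs_def])
      then show ?thesis using True by (simp add: 1 Let_def A.rho_def tp_def)
    next
      case False
      have "mev n s (tensor n (D s) (E i (i + 1)) (shift_pow s (sh i) r)) = FT (xf n \<beta> i r) 1"
        by (subst mev_unit[where f = "\<lambda>z. (z + sh i) ^ r" and e = "1", OF bnd(3)[OF 1(2) False] bnd(4)[OF 1(2)] A.shift_closed A.dev_shift]) (simp, simp only: shN xf_def[abs_def])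
      then show ?thesis using False by (simp add: 1 Let_def A.rho_def tp_def sh_def)
    qed
  next
    case (2 i r)
    show ?thesis
    proof (cases "i = 0")
      case True
      have "mev n s (tensor n (D s) (E 1 n) (d_xinv s \<otimes>\<^bsub>D s\<^esub> \<partial> s [^]\<^bsub>D s\<^esub> r)) = FT (\<lambda>N. xf n \<beta> 0 r (N + 1)) (-1)"
        by (subst mev_unit[where f = "\<lambda>z. (z + s) ^ r" and e = "-1", OF bnd(1,2) _ dx(2)]) (simp, simp, unfold s1 ch_wrap xf_def, simp)
      then show ?thesis using True by (simp add: 2 Let_def A.rho_def tm_def)
    next
      case False
      have "mev n s (tensor n (D s) (E (i + 1) i) (shift_pow s (sh i) r)) = FT (\<lambda>N. xf n \<beta> i r (N + 1)) (-1)"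
        by (subst mev_unit[where f = "\<lambda>z. (z + sh i) ^ r" and e = "-1", OF bnd(4)[OF 2(2)] bnd(3)[OF 2(2) False] A.shift_closed A.dev_shift]) (simp, simp only: shN xf_def ch_wrap)
      then show ?thesis using False by (simp add: 2 Let_def A.rho_def tm_def sh_def)
    qed
  next
    case (3 i r)
    show ?thesis
    proof (cases "i = 0")
      case True
      have "mev n s (tensor n (D s) (E n n) (\<partial> s [^]\<^bsub>D s\<^esub> r)) = FT (xf n \<beta> 0 r) 0"
        by (subst mev_unit[where f = "\<lambda>z. z ^ r" and e = "0", OF bnd(2,2) _ dx(3)]) (simp_all add: ch_wrap xf_def[abs_def])
      moreover have "mev n s (tensor n (D s) (E 1 1) (shift_pow s s r)) = FT (\<lambda>N. xf n \<beta> 0 r (N + 1)) 0"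
        by (subst mev_unit[where f = "\<lambda>z. (z + s) ^ r" and e = "0", OF bnd(1,1) A.shift_closed A.dev_shift]) (simp, unfold s1 ch_wrap xf_def, simp)
      moreover have "xf n \<beta> 0 r 0 = of_bool (r = 0)" by (simp add: xf_def ch_def power_0_left)
      ultimately show ?thesis using True
        by (simp add: 3 Let_def A.rho_def hm_def A.mev_minus A.Q_closed A.shift_closed FT_linear(3))
    next
      case False
      have "mev n s (tensor n (D s) (E i i) (shift_pow s (sh i) r)) = FT (xf n \<beta> i r) 0"
        by (subst mev_unit[where f = "\<lambda>z. (z + sh i) ^ r" and e = "0", OF bnd(3,3)[OF 3(2) False] A.shift_closed A.dev_shift]) (simp, simp only: shN xf_def[abs_def])
      moreover have "mev n s (tensor n (D s) (E (i + 1) (i + 1)) (shift_pow s (sh i) r)) = FT (\<lambda>N. xf n \<beta> i r (N + 1)) 0"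
        by (subst mev_unit[where f = "\<lambda>z. (z + sh i) ^ r" and e = "0", OF bnd(4,4)[OF 3(2)] A.shift_closed A.dev_shift]) (simp, simp only: shN xf_def ch_wrap)
      moreover have "xf n \<beta> i r 0 = 0" using False 3(2) by (simp add: xf_def ch_def)
      ultimately show ?thesis using False
        by (simp add: 3 Let_def A.rho_def hm_def A.mev_tensor_diff A.shift_closed FT_linear(3) sh_def)
    qed
  qed
qed

lemma lev_rho: "t \<in> lie_terms (y_gens n) \<Longrightarrow> lev (model_gen n \<beta>) t \<in> A.rho ` carrier (Dbar n s)"
proof (induction t)
  case (LGen g)
  then show ?case using rho_theta_gen[of g] by (metis imageI lev.simps(1) lie_terms_simps(1))
next
  case LZero
  show ?case using A.Dbar_zero by (metis imageI lev.simps(2))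
next
  case (LAdd t u)
  then obtain x y where "x \<in> carrier (Dbar n s)" "y \<in> carrier (Dbar n s)" "lev (model_gen n \<beta>) t = A.rho x" "lev (model_gen n \<beta>) u = A.rho y" by auto
  then show ?case using A.rho_simps(1)[of x y] A.Dbar_closed(1)[of x y] by (intro image_eqI[of _ _ "x \<oplus>\<^bsub>Dbar n s\<^esub> y"]) auto
next
  case (LScale c t)
  then obtain x where "x \<in> carrier (Dbar n s)" "lev (model_gen n \<beta>) t = A.rho x" by auto
  then show ?case using A.Dbar_smult[of x c] by (intro image_eqI[of _ _ "c \<odot>\<^bsub>Dbar n s\<^esub> x"]) auto
next
  case (LBr t u)
  then obtain x y where "x \<in> carrier (Dbar n s)" "y \<in> carrier (Dbar n s)" "lev (model_gen n \<beta>) t = A.rho x" "lev (model_gen n \<beta>) u = A.rho y" by auto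
  then show ?case using A.rho_simps(2)[of x y] A.Dbar_closed(2)[of x y] by (intro image_eqI[of _ _ "x \<otimes>\<^bsub>Dbar n s\<^esub> y"]) auto
qed

text \<open>Every element is a combination of monomials, whose images are homogeneous operators with quasi-polynomial
  coefficients.\<close>

lemma rho_lev:
  assumes "x \<in> carrier (Dbar n s)"
  shows "\<exists>t\<in>lie_terms (y_gens n). lev (model_gen n \<beta>) t = A.rho x"
proof -
  obtain M c where x: "x = (M, c)" "M \<in> carrier A.Q" using assms by (auto simp: Dbar_def)
  have "\<exists>t\<in>lie_terms (y_gens n). lev (model_gen n \<beta>) t = Ext (mev n s M) 0"
    using x(2)
  proof (induction rule: A.Q_induct)
    case zero
    show ?case by (rule bexI[of _ LZero]) (auto simp: A.mev_zero intro!: clop_eqI)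
  next
    case (add M N)
    then obtain t u where "t \<in> lie_terms (y_gens n)" "lev (model_gen n \<beta>) t = Ext (mev n s M) 0" "u \<in> lie_terms (y_gens n)" "lev (model_gen n \<beta>) u = Ext (mev n s N) 0" by blast
    then show ?case using add(1,2) by (intro bexI[of _ "t \<oplus>\<^sub>L u"]) (auto simp: A.mev_simps intro!: clop_eqI)
  next
    case (monomial c i j \<kappa>)
    obtain k l where \<kappa>: "\<kappa> = (k, l)" by (cases \<kappa>)
    have "mev n s (c \<odot>\<^bsub>A.Q\<^esub> tensor n (D s) (E i j) (A.mon \<kappa>))
      = FT (\<lambda>N. c * (ch n i N * (of_int (N div int n) * s) ^ k)) (l * int n + int j - int i)"
      unfolding FT_linear(2) by (simp only: A.mev_smult[OF A.Q_closed(5)[OF A.mon_closed]] \<kappa> A.mev_unit[OF monomial A.mon_closed A.dev_mon])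
    also have "\<dots> = FT (\<lambda>N. c * (ch n i N * ((of_int N + of_nat i - of_nat n) * \<beta>) ^ k)) (l * int n + int j - int i)"
      unfolding ch_site[OF n1 monomial(1), of _ "\<lambda>z. z ^ k"] ..
    finally show ?case
      using model_onto[OF n1 \<beta>, of "\<lambda>N. c * (ch n i N * ((of_int N + of_nat i - of_nat n) * \<beta>) ^ k)" "l * int n + int j - int i" 0]
      by (simp add: qpI)
  qed
  then obtain t where t: "t \<in> lie_terms (y_gens n)" "lev (model_gen n \<beta>) t = Ext (mev n s M) 0" by blast
  obtain u where u: "u \<in> lie_terms (y_gens n)" "lev (model_gen n \<beta>) u = Ext 0 c"
    using model_onto[OF n1 \<beta> qp_const[of 0], of 0 c] by (auto simp: FT_linear(5))
  show ?thesis using t u by (intro bexI[of _ "t \<oplus>\<^sub>L u"]) (auto simp: A.rho_def x intro!: clop_eqI)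
qed

text \<open>Evaluation in the model, read in the Lie algebra \<open>Dbar\<close>, which the model contains.\<close>

definition iso :: "y_gen lie_term set \<Rightarrow> d_elem \<times> complex" where
  "iso U = inv_into (carrier (Dbar n s)) A.rho (class_lev (model_gen n \<beta>) U)"

lemma iso_class:
  assumes "t \<in> lie_terms (y_gens n)"
  shows "iso (lie_class (y_gens n) (y_rels n \<beta>) t) \<in> carrier (Dbar n s)"
    "A.rho (iso (lie_class (y_gens n) (y_rels n \<beta>) t)) = lev (model_gen n \<beta>) t"
proof -
  have c: "class_lev (model_gen n \<beta>) (lie_class (y_gens n) (y_rels n \<beta>) t) = lev (model_gen n \<beta>) t"
    using assms by (intro class_lev model_gen_sound[OF n1 \<beta>])
  show "iso (lie_class (y_gens n) (y_rels n \<beta>) t) \<in> carrier (Dbar n s)"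
    "A.rho (iso (lie_class (y_gens n) (y_rels n \<beta>) t)) = lev (model_gen n \<beta>) t"
    unfolding iso_def c by (rule inv_into_into[OF lev_rho[OF assms]], rule f_inv_into_f[OF lev_rho[OF assms]])
qed

lemma y_algebra_class: "U \<in> carrier (y_algebra n \<beta>) \<Longrightarrow> \<exists>t\<in>lie_terms (y_gens n). U = lie_class (y_gens n) (y_rels n \<beta>) t"
  by (auto simp: y_algebra_def presented_lie_algebra_simps)

lemma iso_lie_iso: "lie_iso (y_algebra n \<beta>) (Dbar n s) iso"
proof -
  note i = inj_onD[OF A.rho_inj]
  have "lie_hom (y_algebra n \<beta>) (Dbar n s) iso"
  proof (intro lie_hom.intro lie_hom_axioms.intro A.lie_algebra_Dbar)
    show "lie_algebra (y_algebra n \<beta>)" unfolding y_algebra_def by (rule lie_algebra_presented)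
    fix U assume "U \<in> carrier (y_algebra n \<beta>)"
    then obtain t where t: "t \<in> lie_terms (y_gens n)" "U = lie_class (y_gens n) (y_rels n \<beta>) t" using y_algebra_class by blast
    show "iso U \<in> carrier (Dbar n s)" unfolding t(2) by (rule iso_class[OF t(1)])
    show "iso (c \<odot>\<^bsub>y_algebra n \<beta>\<^esub> U) = c \<odot>\<^bsub>Dbar n s\<^esub> iso U" for c
      using t(1) unfolding t(2) y_algebra_def presented_lie_algebra_smult[OF t(1)]
      by (intro i) (simp_all add: iso_class A.rho_simps A.Dbar_closed A.Dbar_smult)
    fix V assume "V \<in> carrier (y_algebra n \<beta>)"
    then obtain u where u: "u \<in> lie_terms (y_gens n)" "V = lie_class (y_gens n) (y_rels n \<beta>) u" using y_algebra_class by blast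
    show "iso (U \<oplus>\<^bsub>y_algebra n \<beta>\<^esub> V) = iso U \<oplus>\<^bsub>Dbar n s\<^esub> iso V"
      using t(1) u(1) unfolding t(2) u(2) y_algebra_def presented_lie_algebra_add[OF t(1) u(1)]
      by (intro i) (simp_all add: iso_class A.rho_simps A.Dbar_closed A.Dbar_smult)
    show "iso (U \<otimes>\<^bsub>y_algebra n \<beta>\<^esub> V) = iso U \<otimes>\<^bsub>Dbar n s\<^esub> iso V"
      using t(1) u(1) unfolding t(2) u(2) y_algebra_def presented_lie_algebra_bracket[OF t(1) u(1)]
      by (intro i) (simp_all add: iso_class A.rho_simps A.Dbar_closed A.Dbar_smult)
  qed
  moreover have "bij_betw iso (carrier (y_algebra n \<beta>)) (carrier (Dbar n s))"
  proof (rule bij_betwI')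
    fix U V assume "U \<in> carrier (y_algebra n \<beta>)" "V \<in> carrier (y_algebra n \<beta>)"
    then obtain t u where t: "t \<in> lie_terms (y_gens n)" "U = lie_class (y_gens n) (y_rels n \<beta>) t"
      and u: "u \<in> lie_terms (y_gens n)" "V = lie_class (y_gens n) (y_rels n \<beta>) u" using y_algebra_class by blast
    show "iso U = iso V \<longleftrightarrow> U = V"
    proof
      assume "iso U = iso V"
      then have "lev (model_gen n \<beta>) t = lev (model_gen n \<beta>) u" using iso_class(2)[OF t(1)] iso_class(2)[OF u(1)] t u by simp
      then show "U = V" unfolding t(2) u(2) model_complete[OF n1 \<beta> t(1) u(1)] by (rule lie_class_eqI)
    qed simp
  next
    fix U assume "U \<in> carrier (y_algebra n \<beta>)"
    then show "iso U \<in> carrier (Dbar n s)" using y_algebra_class iso_class(1) by blast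
  next
    fix x assume x: "x \<in> carrier (Dbar n s)"
    then obtain t where t: "t \<in> lie_terms (y_gens n)" "lev (model_gen n \<beta>) t = A.rho x" using rho_lev by blast
    have "x = iso (lie_class (y_gens n) (y_rels n \<beta>) t)" by (rule i) (simp_all add: iso_class t x)
    then show "\<exists>U\<in>carrier (y_algebra n \<beta>). x = iso U" using t(1) by (auto simp: y_algebra_def presented_lie_algebra_simps)
  qed
  ultimately show ?thesis by (intro lie_iso.intro lie_iso_axioms.intro)
qed

lemma iso_gen: "g \<in> y_gens n \<Longrightarrow> iso (y_elem n \<beta> g) = theta_gen n \<beta> g"
  unfolding y_elem_def by (rule inj_onD[OF A.rho_inj]) (simp_all add: iso_class rho_theta_gen)

end

theorem theorem2p2:
  fixes n :: nat and \<beta> :: complex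
  assumes "n \<ge> 1" and "\<beta> \<noteq> 0"
  shows "\<exists>\<theta>. lie_iso (y_algebra n \<beta>) (Dbar n (of_nat n * \<beta>)) \<theta> \<and>
    (\<forall>g\<in>y_gens n. \<theta> (y_elem n \<beta> g) = theta_gen n \<beta> g)"
  using iso_lie_iso[OF assms] iso_gen[OF assms] by blast

end
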